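(* Let $k$ be the field of real or complex numbers, let $f\in k[x_1,\dots,x_n]$ be a non-constant polynomial, let $A=k[x_1,\dots,x_n]/(f)$, and assume $\operatorname{Spec}(A)$ is regular. Let $\Omega^1_A$ be the module of Kähler differentials of $A$ over $k$ and $T_A=\operatorname{Der}_k(A)$. Then $ch_i(\Omega^1_A)=0$ and $ch_i(T_A)=0$ in $\operatorname{H}^{2i}_{DR}(A)$ for all $i\ge1$.
   Context: $\operatorname{H}^*_{DR}(A)$ is the cohomology of the naive algebraic de Rham complex $(\wedge^\bullet_A\Omega^1_A,d)$. For a finitely generated projective $A$-module $E$ choose a connection $\nabla:E\to E\otimes_A\Omega^1_A$ (a $k$-linear map with $\nabla(ae)=a\nabla(e)+e\otimes da$), with curvature $R_\nabla\in\operatorname{End}_A(E)\otimes_A\wedge^2\Omega^1_A$. Then $ch_i(E)\in\operatorname{H}^{2i}_{DR}(A)$ is the class of $\frac1{i!}\operatorname{tr}(R_\nabla^i)$; it does not depend on the choice of $\nabla$. *)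

theory Defs
  imports
    Complex_Main
    "HOL.Hull"
    "HOL-Library.Poly_Mapping"
    "HOL-Library.Extended_Nat"
    "HOL-Library.FuncSet"
    "HOL-Algebra.QuotRing"
    "HOL-Algebra.Module"
    "HOL-Algebra.Generated_Groups"
    "HOL-Algebra.Ring_Divisibility"
begin

section \<open>Polynomial rings and hypersurfaces\<close>

text \<open>
  Polynomials in countably many variables \<open>x\<^sub>0, x\<^sub>1, \<dots>\<close>, as finitely supported functions on
  exponent vectors; the variables of \<open>k[x\<^sub>1, \<dots>, x\<^sub>n]\<close> are the ones with index below \<open>n\<close>.
\<close>

type_synonym 'k mpoly = "(nat \<Rightarrow>\<^sub>0 nat) \<Rightarrow>\<^sub>0 'k"

definition mpoly_const :: "'k::field \<Rightarrow> 'k mpoly" where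
  "mpoly_const c = Poly_Mapping.single 0 c"

definition poly_ring :: "nat \<Rightarrow> 'k::field mpoly ring" where
  "poly_ring n = \<lparr>carrier = {p. \<forall>m\<in>Poly_Mapping.keys p. Poly_Mapping.keys m \<subseteq> {..<n}},
     mult = (*), one = 1, zero = 0, add = (+)\<rparr>"

definition hypersurface_ring :: "nat \<Rightarrow> 'k::field mpoly \<Rightarrow> 'k mpoly set ring" where
  "hypersurface_ring n f = poly_ring n Quot (PIdl\<^bsub>poly_ring n\<^esub> f)"

definition hypersurface_scalar :: "nat \<Rightarrow> 'k::field mpoly \<Rightarrow> 'k \<Rightarrow> 'k mpoly set" where
  "hypersurface_scalar n f c = (PIdl\<^bsub>poly_ring n\<^esub> f) +>\<^bsub>poly_ring n\<^esub> mpoly_const c"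


section \<open>Regularity of the spectrum\<close>

definition krull_dim :: "('a, 'b) ring_scheme \<Rightarrow> enat" where
  "krull_dim R = Sup {enat l | l (P :: nat \<Rightarrow> 'a set).
     (\<forall>i\<le>l. primeideal (P i) R) \<and> (\<forall>i<l. P i \<subset> P (Suc i))}"

text \<open>The fraction \<open>a / s\<close>: the set of all pairs \<open>(b, t)\<close> with \<open>b / t = a / s\<close>.\<close>

definition loc_frac :: "('a, 'b) ring_scheme \<Rightarrow> 'a set \<Rightarrow> 'a \<Rightarrow> 'a \<Rightarrow> ('a \<times> 'a) set" where
  "loc_frac R S a s = {(b, t). b \<in> carrier R \<and> t \<in> S \<and>
     (\<exists>u\<in>S. u \<otimes>\<^bsub>R\<^esub> ((t \<otimes>\<^bsub>R\<^esub> a) \<ominus>\<^bsub>R\<^esub> (s \<otimes>\<^bsub>R\<^esub> b)) = \<zero>\<^bsub>R\<^esub>)}"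

definition localization :: "('a, 'b) ring_scheme \<Rightarrow> 'a set \<Rightarrow> ('a \<times> 'a) set ring" where
  "localization R S = \<lparr>carrier = {loc_frac R S a s | a s. a \<in> carrier R \<and> s \<in> S},
     mult = (\<lambda>X Y. \<Union>(a, s)\<in>X. \<Union>(b, t)\<in>Y. loc_frac R S (a \<otimes>\<^bsub>R\<^esub> b) (s \<otimes>\<^bsub>R\<^esub> t)),
     one = loc_frac R S \<one>\<^bsub>R\<^esub> \<one>\<^bsub>R\<^esub>,
     zero = loc_frac R S \<zero>\<^bsub>R\<^esub> \<one>\<^bsub>R\<^esub>,
     add = (\<lambda>X Y. \<Union>(a, s)\<in>X. \<Union>(b, t)\<in>Y.
       loc_frac R S ((t \<otimes>\<^bsub>R\<^esub> a) \<oplus>\<^bsub>R\<^esub> (s \<otimes>\<^bsub>R\<^esub> b)) (s \<otimes>\<^bsub>R\<^esub> t))\<rparr>"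

definition regular_local_ring :: "('a, 'b) ring_scheme \<Rightarrow> bool" where
  "regular_local_ring R \<longleftrightarrow> cring R \<and> noetherian_ring R \<and> (\<exists>!m. maximalideal m R) \<and>
     (\<forall>m. maximalideal m R \<longrightarrow>
       (\<exists>S. S \<subseteq> m \<and> finite S \<and> Idl\<^bsub>R\<^esub> S = m \<and> enat (card S) = krull_dim R))"

definition regular_spec :: "('a, 'b) ring_scheme \<Rightarrow> bool" where
  "regular_spec R \<longleftrightarrow>
     (\<forall>p. primeideal p R \<longrightarrow> regular_local_ring (localization R (carrier R - p)))"


section \<open>Modules\<close>

text \<open>
  The record type \<^typ>\<open>('a, 'b) module\<close> has fields for a product and a unit, which
  are irrelevant for modules and set to \<^const>\<open>undefined\<close>; they are filled in where the module is an
  algebra.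
\<close>

definition free_module :: "('a, 'r) ring_scheme \<Rightarrow> 'x set \<Rightarrow> ('a, 'x \<Rightarrow> 'a) module" where
  "free_module R X = \<lparr>
     carrier = {g. (\<forall>x\<in>X. g x \<in> carrier R) \<and> (\<forall>x. x \<notin> X \<longrightarrow> g x = \<zero>\<^bsub>R\<^esub>) \<and>
       finite {x. g x \<noteq> \<zero>\<^bsub>R\<^esub>}},
     mult = undefined, one = undefined,
     zero = (\<lambda>x. \<zero>\<^bsub>R\<^esub>), add = (\<lambda>g h x. g x \<oplus>\<^bsub>R\<^esub> h x),
     smult = (\<lambda>a g x. a \<otimes>\<^bsub>R\<^esub> g x)\<rparr>"

definition free_gen :: "('a, 'r) ring_scheme \<Rightarrow> 'x \<Rightarrow> 'x \<Rightarrow> 'a" where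
  "free_gen R x = (\<lambda>y. if y = x then \<one>\<^bsub>R\<^esub> else \<zero>\<^bsub>R\<^esub>)"

definition module_span ::
  "('a, 'r) ring_scheme \<Rightarrow> ('a, 'm, 's) module_scheme \<Rightarrow> 'm set \<Rightarrow> 'm set" where
  "module_span R M S = (\<lambda>N. submodule N R M) hull S"

definition quot_module :: "('a, 'm, 's) module_scheme \<Rightarrow> 'm set \<Rightarrow> ('a, 'm set) module" where
  "quot_module M N = \<lparr>carrier = a_rcosets\<^bsub>M\<^esub> N, mult = undefined, one = undefined,
     zero = N, add = set_add M,
     smult = (\<lambda>a X. \<Union>x\<in>X. N +>\<^bsub>M\<^esub> (a \<odot>\<^bsub>M\<^esub> x))\<rparr>"

definition ring_module :: "('a, 'r) ring_scheme \<Rightarrow> ('a, 'a) module" where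
  "ring_module R = \<lparr>carrier = carrier R, mult = mult R, one = one R,
     zero = zero R, add = add R, smult = mult R\<rparr>"

definition module_hom :: "('a, 'r) ring_scheme \<Rightarrow> ('a, 'm, 's) module_scheme \<Rightarrow>
    ('a, 'n, 't) module_scheme \<Rightarrow> ('m \<Rightarrow> 'n) set" where
  "module_hom R M N = {T \<in> carrier M \<rightarrow>\<^sub>E carrier N.
     (\<forall>x\<in>carrier M. \<forall>y\<in>carrier M. T (x \<oplus>\<^bsub>M\<^esub> y) = T x \<oplus>\<^bsub>N\<^esub> T y) \<and>
     (\<forall>a\<in>carrier R. \<forall>x\<in>carrier M. T (a \<odot>\<^bsub>M\<^esub> x) = a \<odot>\<^bsub>N\<^esub> T x)}"

definition end_module ::
  "('a, 'r) ring_scheme \<Rightarrow> ('a, 'e, 's) module_scheme \<Rightarrow> ('a, 'e \<Rightarrow> 'e) module" where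
  "end_module R E = \<lparr>carrier = module_hom R E E,
     mult = compose (carrier E), one = (\<lambda>x\<in>carrier E. x),
     zero = (\<lambda>x\<in>carrier E. \<zero>\<^bsub>E\<^esub>), add = (\<lambda>S T. \<lambda>x\<in>carrier E. S x \<oplus>\<^bsub>E\<^esub> T x),
     smult = (\<lambda>a T. \<lambda>x\<in>carrier E. a \<odot>\<^bsub>E\<^esub> T x)\<rparr>"


subsection \<open>Tensor products\<close>

definition tensor_rels :: "('a, 'r) ring_scheme \<Rightarrow> ('a, 'm, 's) module_scheme \<Rightarrow>
    ('a, 'n, 't) module_scheme \<Rightarrow> ('m \<times> 'n \<Rightarrow> 'a) set" where
  "tensor_rels R M N = (let F = free_module R (carrier M \<times> carrier N); g = free_gen R in
     {g (x \<oplus>\<^bsub>M\<^esub> x', y) \<ominus>\<^bsub>F\<^esub> (g (x, y) \<oplus>\<^bsub>F\<^esub> g (x', y)) | x x' y.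
        x \<in> carrier M \<and> x' \<in> carrier M \<and> y \<in> carrier N} \<union>
     {g (x, y \<oplus>\<^bsub>N\<^esub> y') \<ominus>\<^bsub>F\<^esub> (g (x, y) \<oplus>\<^bsub>F\<^esub> g (x, y')) | x y y'.
        x \<in> carrier M \<and> y \<in> carrier N \<and> y' \<in> carrier N} \<union>
     {g (a \<odot>\<^bsub>M\<^esub> x, y) \<ominus>\<^bsub>F\<^esub> (a \<odot>\<^bsub>F\<^esub> g (x, y)) | a x y.
        a \<in> carrier R \<and> x \<in> carrier M \<and> y \<in> carrier N} \<union>
     {g (x, a \<odot>\<^bsub>N\<^esub> y) \<ominus>\<^bsub>F\<^esub> (a \<odot>\<^bsub>F\<^esub> g (x, y)) | a x y.
        a \<in> carrier R \<and> x \<in> carrier M \<and> y \<in> carrier N})"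

definition tensor_null :: "('a, 'r) ring_scheme \<Rightarrow> ('a, 'm, 's) module_scheme \<Rightarrow>
    ('a, 'n, 't) module_scheme \<Rightarrow> ('m \<times> 'n \<Rightarrow> 'a) set" where
  "tensor_null R M N =
     module_span R (free_module R (carrier M \<times> carrier N)) (tensor_rels R M N)"

definition tensor :: "('a, 'r) ring_scheme \<Rightarrow> ('a, 'm, 's) module_scheme \<Rightarrow>
    ('a, 'n, 't) module_scheme \<Rightarrow> ('a, ('m \<times> 'n \<Rightarrow> 'a) set) module" where
  "tensor R M N = quot_module (free_module R (carrier M \<times> carrier N)) (tensor_null R M N)"

definition tensor_elem :: "('a, 'r) ring_scheme \<Rightarrow> ('a, 'm, 's) module_scheme \<Rightarrow>
    ('a, 'n, 't) module_scheme \<Rightarrow> 'm \<Rightarrow> 'n \<Rightarrow> ('m \<times> 'n \<Rightarrow> 'a) set" where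
  "tensor_elem R M N x y =
     tensor_null R M N +>\<^bsub>free_module R (carrier M \<times> carrier N)\<^esub> free_gen R (x, y)"

text \<open>
  The additive map \<open>M \<otimes> N \<rightarrow> P\<close>, \<open>x \<otimes> y \<mapsto> \<phi> x y\<close>, induced by a biadditive map \<open>\<phi>\<close> with
  \<open>\<phi> (a x) y = \<phi> x (a y)\<close>. The map \<open>\<phi>\<close> need not be \<open>R\<close>-linear, which is why a formal sum
  \<open>\<Sum> a\<^sub>i (x\<^sub>i, y\<^sub>i)\<close> is evaluated as \<open>\<Sum> \<phi> (a\<^sub>i x\<^sub>i) y\<^sub>i\<close>; for such \<open>\<phi>\<close> all representatives of a class
  give the same value.
\<close>

definition tensor_lift :: "('a, 'r) ring_scheme \<Rightarrow> ('a, 'm, 's) module_scheme \<Rightarrow>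
    ('b, 'p, 't) module_scheme \<Rightarrow> ('m \<Rightarrow> 'n \<Rightarrow> 'p) \<Rightarrow> ('m \<times> 'n \<Rightarrow> 'a) set \<Rightarrow> 'p" where
  "tensor_lift R M P \<phi> X = the_elem
     ((\<lambda>g. \<Oplus>\<^bsub>P\<^esub> z\<in>{z. g z \<noteq> \<zero>\<^bsub>R\<^esub>}. \<phi> (g z \<odot>\<^bsub>M\<^esub> fst z) (snd z)) ` X)"


subsection \<open>Exterior algebras\<close>

text \<open>
  The free associative \<open>R\<close>-algebra on a set \<open>X\<close>, with the words in \<open>X\<close> as basis and concatenation of
  words as product. The exterior algebra of \<open>M\<close> is the free algebra on the set \<open>M\<close> modulo the
  two-sided ideal which makes \<open>x \<mapsto> [x]\<close> linear (this gives the tensor algebra) and kills all squares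
  \<open>[x, x]\<close>.
\<close>

definition free_algebra :: "('a, 'r) ring_scheme \<Rightarrow> 'x set \<Rightarrow> ('a, 'x list \<Rightarrow> 'a) module" where
  "free_algebra R X = (free_module R (lists X))
     \<lparr>mult := (\<lambda>g h w. \<Oplus>\<^bsub>R\<^esub> i\<in>{..length w}. g (take i w) \<otimes>\<^bsub>R\<^esub> h (drop i w)),
      one := free_gen R []\<rparr>"

definition ext_rels ::
  "('a, 'r) ring_scheme \<Rightarrow> ('a, 'm, 's) module_scheme \<Rightarrow> ('m list \<Rightarrow> 'a) set" where
  "ext_rels R M = (let F = free_algebra R (carrier M); g = free_gen R in
     {g [x \<oplus>\<^bsub>M\<^esub> y] \<ominus>\<^bsub>F\<^esub> (g [x] \<oplus>\<^bsub>F\<^esub> g [y]) | x y. x \<in> carrier M \<and> y \<in> carrier M} \<union>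
     {g [a \<odot>\<^bsub>M\<^esub> x] \<ominus>\<^bsub>F\<^esub> (a \<odot>\<^bsub>F\<^esub> g [x]) | a x. a \<in> carrier R \<and> x \<in> carrier M} \<union>
     {g [x, x] | x. x \<in> carrier M})"

definition ext_ideal ::
  "('a, 'r) ring_scheme \<Rightarrow> ('a, 'm, 's) module_scheme \<Rightarrow> ('m list \<Rightarrow> 'a) set" where
  "ext_ideal R M = Idl\<^bsub>free_algebra R (carrier M)\<^esub> (ext_rels R M)"

definition ext_algebra ::
  "('a, 'r) ring_scheme \<Rightarrow> ('a, 'm, 's) module_scheme \<Rightarrow> ('a, ('m list \<Rightarrow> 'a) set) module" where
  "ext_algebra R M = (let F = free_algebra R (carrier M); I = ext_ideal R M in
     (quot_module F I)\<lparr>mult := rcoset_mult F I, one := I +>\<^bsub>F\<^esub> \<one>\<^bsub>F\<^esub>\<rparr>)"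

text \<open>The wedge product \<open>x\<^sub>1 \<and> \<dots> \<and> x\<^sub>p\<close> of a list of elements of \<open>M\<close>.\<close>

definition ext_word ::
  "('a, 'r) ring_scheme \<Rightarrow> ('a, 'm, 's) module_scheme \<Rightarrow> 'm list \<Rightarrow> ('m list \<Rightarrow> 'a) set" where
  "ext_word R M xs = ext_ideal R M +>\<^bsub>free_algebra R (carrier M)\<^esub> free_gen R xs"

definition ext_power :: "('a, 'r) ring_scheme \<Rightarrow> ('a, 'm, 's) module_scheme \<Rightarrow> nat \<Rightarrow>
    ('m list \<Rightarrow> 'a) set set" where
  "ext_power R M p = module_span R (ext_algebra R M)
     {ext_word R M xs | xs. xs \<in> lists (carrier M) \<and> length xs = p}"


section \<open>Differential forms and de Rham cohomology\<close>

text \<open>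
  Throughout, \<open>s :: 'k \<Rightarrow> 'a\<close> is the structure map of the \<open>k\<close>-algebra \<open>R\<close>.
\<close>

definition kahler_rels :: "('a, 'r) ring_scheme \<Rightarrow> ('k \<Rightarrow> 'a) \<Rightarrow> ('a \<Rightarrow> 'a) set" where
  "kahler_rels R s = (let F = free_module R (carrier R); g = free_gen R in
     {g (a \<oplus>\<^bsub>R\<^esub> b) \<ominus>\<^bsub>F\<^esub> (g a \<oplus>\<^bsub>F\<^esub> g b) | a b. a \<in> carrier R \<and> b \<in> carrier R} \<union>
     {g (a \<otimes>\<^bsub>R\<^esub> b) \<ominus>\<^bsub>F\<^esub> ((a \<odot>\<^bsub>F\<^esub> g b) \<oplus>\<^bsub>F\<^esub> (b \<odot>\<^bsub>F\<^esub> g a)) | a b.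
        a \<in> carrier R \<and> b \<in> carrier R} \<union>
     {g (s c) | c. True})"

definition kahler_null :: "('a, 'r) ring_scheme \<Rightarrow> ('k \<Rightarrow> 'a) \<Rightarrow> ('a \<Rightarrow> 'a) set" where
  "kahler_null R s = module_span R (free_module R (carrier R)) (kahler_rels R s)"

definition kahler :: "('a, 'r) ring_scheme \<Rightarrow> ('k \<Rightarrow> 'a) \<Rightarrow> ('a, ('a \<Rightarrow> 'a) set) module" where
  "kahler R s = quot_module (free_module R (carrier R)) (kahler_null R s)"

definition kahler_d :: "('a, 'r) ring_scheme \<Rightarrow> ('k \<Rightarrow> 'a) \<Rightarrow> 'a \<Rightarrow> ('a \<Rightarrow> 'a) set" where
  "kahler_d R s a = kahler_null R s +>\<^bsub>free_module R (carrier R)\<^esub> free_gen R a"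

definition derivations :: "('a, 'r) ring_scheme \<Rightarrow> ('k \<Rightarrow> 'a) \<Rightarrow> ('a, 'a \<Rightarrow> 'a) module" where
  "derivations R s = \<lparr>
     carrier = {D \<in> carrier R \<rightarrow>\<^sub>E carrier R.
       (\<forall>a\<in>carrier R. \<forall>b\<in>carrier R. D (a \<oplus>\<^bsub>R\<^esub> b) = D a \<oplus>\<^bsub>R\<^esub> D b) \<and>
       (\<forall>c. \<forall>a\<in>carrier R. D (s c \<otimes>\<^bsub>R\<^esub> a) = s c \<otimes>\<^bsub>R\<^esub> D a) \<and>
       (\<forall>a\<in>carrier R. \<forall>b\<in>carrier R.
          D (a \<otimes>\<^bsub>R\<^esub> b) = (a \<otimes>\<^bsub>R\<^esub> D b) \<oplus>\<^bsub>R\<^esub> (b \<otimes>\<^bsub>R\<^esub> D a))},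
     mult = undefined, one = undefined,
     zero = (\<lambda>a\<in>carrier R. \<zero>\<^bsub>R\<^esub>), add = (\<lambda>D D'. \<lambda>a\<in>carrier R. D a \<oplus>\<^bsub>R\<^esub> D' a),
     smult = (\<lambda>b D. \<lambda>a\<in>carrier R. b \<otimes>\<^bsub>R\<^esub> D a)\<rparr>"

type_synonym 'a form = "(('a \<Rightarrow> 'a) set list \<Rightarrow> 'a) set"

definition forms :: "('a, 'r) ring_scheme \<Rightarrow> ('k \<Rightarrow> 'a) \<Rightarrow> ('a, 'a form) module" where
  "forms R s = ext_algebra R (kahler R s)"

definition forms_deg :: "('a, 'r) ring_scheme \<Rightarrow> ('k \<Rightarrow> 'a) \<Rightarrow> nat \<Rightarrow> 'a form set" where
  "forms_deg R s p = ext_power R (kahler R s) p"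

text \<open>
  The de Rham differential is the unique graded derivation of square zero extending the universal
  derivation; as the forms \<open>a\<close> and \<open>da\<close> generate the algebra, its values on them determine it.
\<close>

definition deRham_d :: "('a, 'r) ring_scheme \<Rightarrow> ('k \<Rightarrow> 'a) \<Rightarrow> 'a form \<Rightarrow> 'a form" where
  "deRham_d R s = (let L = forms R s in THE d. d \<in> carrier L \<rightarrow>\<^sub>E carrier L \<and>
     (\<forall>x\<in>carrier L. \<forall>y\<in>carrier L. d (x \<oplus>\<^bsub>L\<^esub> y) = d x \<oplus>\<^bsub>L\<^esub> d y) \<and>
     (\<forall>p. \<forall>x\<in>forms_deg R s p. \<forall>y\<in>carrier L. d (x \<otimes>\<^bsub>L\<^esub> y) =
        (d x \<otimes>\<^bsub>L\<^esub> y) \<oplus>\<^bsub>L\<^esub> (((\<ominus>\<^bsub>L\<^esub> \<one>\<^bsub>L\<^esub>) [^]\<^bsub>L\<^esub> p) \<otimes>\<^bsub>L\<^esub> (x \<otimes>\<^bsub>L\<^esub> d y))) \<and>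
     (\<forall>a\<in>carrier R. d (a \<odot>\<^bsub>L\<^esub> \<one>\<^bsub>L\<^esub>) = ext_word R (kahler R s) [kahler_d R s a]) \<and>
     (\<forall>x\<in>carrier L. d (d x) = \<zero>\<^bsub>L\<^esub>))"

definition closed_forms :: "('a, 'r) ring_scheme \<Rightarrow> ('k \<Rightarrow> 'a) \<Rightarrow> nat \<Rightarrow> 'a form set" where
  "closed_forms R s p = {x \<in> forms_deg R s p. deRham_d R s x = \<zero>\<^bsub>forms R s\<^esub>}"

definition exact_forms :: "('a, 'r) ring_scheme \<Rightarrow> ('k \<Rightarrow> 'a) \<Rightarrow> nat \<Rightarrow> 'a form set" where
  "exact_forms R s p =
     (case p of 0 \<Rightarrow> {\<zero>\<^bsub>forms R s\<^esub>} | Suc q \<Rightarrow> deRham_d R s ` forms_deg R s q)"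

definition deRham_cohomology ::
  "('a, 'r) ring_scheme \<Rightarrow> ('k \<Rightarrow> 'a) \<Rightarrow> nat \<Rightarrow> ('k, 'a form set) module" where
  "deRham_cohomology R s p = (let L = forms R s in quot_module
     \<lparr>carrier = closed_forms R s p, mult = undefined, one = undefined,
      zero = zero L, add = add L, smult = (\<lambda>c x. s c \<odot>\<^bsub>L\<^esub> x)\<rparr>
     (exact_forms R s p))"


section \<open>Connections and the Chern character\<close>

definition connection :: "('a, 'r) ring_scheme \<Rightarrow> ('k \<Rightarrow> 'a) \<Rightarrow> ('a, 'e, 't) module_scheme \<Rightarrow>
    ('e \<Rightarrow> ('e \<times> ('a \<Rightarrow> 'a) set \<Rightarrow> 'a) set) \<Rightarrow> bool" where
  "connection R s E D \<longleftrightarrow> (let T = tensor R E (kahler R s) in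
     D \<in> carrier E \<rightarrow> carrier T \<and>
     (\<forall>x\<in>carrier E. \<forall>y\<in>carrier E. D (x \<oplus>\<^bsub>E\<^esub> y) = D x \<oplus>\<^bsub>T\<^esub> D y) \<and>
     (\<forall>c. \<forall>x\<in>carrier E. D (s c \<odot>\<^bsub>E\<^esub> x) = s c \<odot>\<^bsub>T\<^esub> D x) \<and>
     (\<forall>a\<in>carrier R. \<forall>x\<in>carrier E. D (a \<odot>\<^bsub>E\<^esub> x) =
        (a \<odot>\<^bsub>T\<^esub> D x) \<oplus>\<^bsub>T\<^esub> tensor_elem R E (kahler R s) x (kahler_d R s a)))"

definition vforms :: "('a, 'r) ring_scheme \<Rightarrow> ('k \<Rightarrow> 'a) \<Rightarrow> ('a, 'e, 't) module_scheme \<Rightarrow>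
    ('a, ('e \<times> 'a form \<Rightarrow> 'a) set) module" where
  "vforms R s E = tensor R E (forms R s)"

text \<open>
  The extension of a connection to \<open>E\<close>-valued forms,
  \<open>\<nabla> (x \<otimes> \<omega>) = \<nabla> x \<and> \<omega> + x \<otimes> d\<omega>\<close>, where \<open>(x' \<otimes> \<eta>) \<and> \<omega> = x' \<otimes> (\<eta> \<and> \<omega>)\<close>.
\<close>

definition connection_ext :: "('a, 'r) ring_scheme \<Rightarrow> ('k \<Rightarrow> 'a) \<Rightarrow> ('a, 'e, 't) module_scheme \<Rightarrow>
    ('e \<Rightarrow> ('e \<times> ('a \<Rightarrow> 'a) set \<Rightarrow> 'a) set) \<Rightarrow>
    ('e \<times> 'a form \<Rightarrow> 'a) set \<Rightarrow> ('e \<times> 'a form \<Rightarrow> 'a) set" where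
  "connection_ext R s E D = (let L = forms R s; V = vforms R s E in
     tensor_lift R E V (\<lambda>x \<omega>.
       tensor_lift R E V (\<lambda>x' \<eta>.
         tensor_elem R E L x' (ext_word R (kahler R s) [\<eta>] \<otimes>\<^bsub>L\<^esub> \<omega>)) (D x)
       \<oplus>\<^bsub>V\<^esub> tensor_elem R E L x (deRham_d R s \<omega>)))"

text \<open>
  The algebra \<open>End(E) \<otimes> \<Lambda>\<close> with product \<open>(S \<otimes> \<alpha>) (T \<otimes> \<beta>) = S T \<otimes> \<alpha> \<and> \<beta>\<close>. It contains
  \<open>End(E) \<otimes> \<Lambda>\<^sup>p\<close> as a direct summand, because \<open>\<Lambda>\<^sup>p\<close> is a direct summand of \<open>\<Lambda>\<close>.
\<close>

definition end_forms :: "('a, 'r) ring_scheme \<Rightarrow> ('k \<Rightarrow> 'a) \<Rightarrow> ('a, 'e, 't) module_scheme \<Rightarrow>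
    ('a, (('e \<Rightarrow> 'e) \<times> 'a form \<Rightarrow> 'a) set) module" where
  "end_forms R s E = (let N = end_module R E; L = forms R s; T = tensor R N L in
     T\<lparr>mult := (\<lambda>X Y. tensor_lift R N T (\<lambda>S \<alpha>.
          tensor_lift R N T (\<lambda>S' \<beta>. tensor_elem R N L (S \<otimes>\<^bsub>N\<^esub> S') (\<alpha> \<otimes>\<^bsub>L\<^esub> \<beta>)) Y) X),
       one := tensor_elem R N L \<one>\<^bsub>N\<^esub> \<one>\<^bsub>L\<^esub>\<rparr>)"

definition end_forms_deg :: "('a, 'r) ring_scheme \<Rightarrow> ('k \<Rightarrow> 'a) \<Rightarrow> ('a, 'e, 't) module_scheme \<Rightarrow>
    nat \<Rightarrow> (('e \<Rightarrow> 'e) \<times> 'a form \<Rightarrow> 'a) set set" where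
  "end_forms_deg R s E p = module_span R (end_forms R s E)
     {tensor_elem R (end_module R E) (forms R s) S \<omega> | S \<omega>.
        S \<in> carrier (end_module R E) \<and> \<omega> \<in> forms_deg R s p}"

text \<open>The evaluation \<open>(S \<otimes> \<omega>) x = S x \<otimes> \<omega>\<close>.\<close>

definition end_forms_apply :: "('a, 'r) ring_scheme \<Rightarrow> ('k \<Rightarrow> 'a) \<Rightarrow> ('a, 'e, 't) module_scheme \<Rightarrow>
    (('e \<Rightarrow> 'e) \<times> 'a form \<Rightarrow> 'a) set \<Rightarrow> 'e \<Rightarrow> ('e \<times> 'a form \<Rightarrow> 'a) set" where
  "end_forms_apply R s E X x = tensor_lift R (end_module R E) (vforms R s E)
     (\<lambda>S \<omega>. tensor_elem R E (forms R s) (S x) \<omega>) X"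

text \<open>
  The curvature as an element of \<open>End(E) \<otimes> \<Lambda>\<^sup>2\<close>: for finitely generated projective \<open>E\<close>,
  evaluation identifies \<open>End(E) \<otimes> \<Lambda>\<^sup>2\<close> with \<open>Hom(E, E \<otimes> \<Lambda>\<^sup>2)\<close>, which contains \<open>\<nabla> \<circ> \<nabla>\<close>.
\<close>

definition curvature :: "('a, 'r) ring_scheme \<Rightarrow> ('k \<Rightarrow> 'a) \<Rightarrow> ('a, 'e, 't) module_scheme \<Rightarrow>
    ('e \<Rightarrow> ('e \<times> ('a \<Rightarrow> 'a) set \<Rightarrow> 'a) set) \<Rightarrow> (('e \<Rightarrow> 'e) \<times> 'a form \<Rightarrow> 'a) set" where
  "curvature R s E D = (THE X. X \<in> end_forms_deg R s E 2 \<and>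
     (\<forall>x\<in>carrier E. end_forms_apply R s E X x =
        connection_ext R s E D (connection_ext R s E D
          (tensor_elem R E (forms R s) x \<one>\<^bsub>forms R s\<^esub>))))"

text \<open>
  The trace on \<open>End(E) \<cong> E\<^sup>* \<otimes> E\<close> for finitely generated projective \<open>E\<close>: a dual basis consists of
  \<open>e\<^sub>j \<in> E\<close> and \<open>\<phi>\<^sub>j \<in> E\<^sup>*\<close> such that \<open>\<Sum> \<phi>\<^sub>j \<otimes> e\<^sub>j\<close> corresponds to the identity, hence
  \<open>\<Sum> \<phi>\<^sub>j \<otimes> T e\<^sub>j\<close> to \<open>T\<close>. The trace does not depend on the dual basis, and a dual basis exists
  precisely if \<open>E\<close> is finitely generated projective.
\<close>

definition dual_basis :: "('a, 'r) ring_scheme \<Rightarrow> ('a, 'e, 't) module_scheme \<Rightarrow>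
    nat \<Rightarrow> (nat \<Rightarrow> 'e) \<Rightarrow> (nat \<Rightarrow> 'e \<Rightarrow> 'a) \<Rightarrow> bool" where
  "dual_basis R E m e \<phi> \<longleftrightarrow>
     (\<forall>j<m. e j \<in> carrier E \<and> \<phi> j \<in> module_hom R E (ring_module R)) \<and>
     (\<forall>x\<in>carrier E. x = (\<Oplus>\<^bsub>E\<^esub> j\<in>{..<m}. \<phi> j x \<odot>\<^bsub>E\<^esub> e j))"

definition module_trace ::
  "('a, 'r) ring_scheme \<Rightarrow> ('a, 'e, 't) module_scheme \<Rightarrow> ('e \<Rightarrow> 'e) \<Rightarrow> 'a" where
  "module_trace R E T = (case (SOME (m, e, \<phi>). dual_basis R E m e \<phi>) of
     (m, e, \<phi>) \<Rightarrow> \<Oplus>\<^bsub>R\<^esub> j\<in>{..<m}. \<phi> j (T (e j)))"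

definition trace_forms :: "('a, 'r) ring_scheme \<Rightarrow> ('k \<Rightarrow> 'a) \<Rightarrow> ('a, 'e, 't) module_scheme \<Rightarrow>
    (('e \<Rightarrow> 'e) \<times> 'a form \<Rightarrow> 'a) set \<Rightarrow> 'a form" where
  "trace_forms R s E = tensor_lift R (end_module R E) (forms R s)
     (\<lambda>S \<omega>. module_trace R E S \<odot>\<^bsub>forms R s\<^esub> \<omega>)"

definition chern_form :: "('a, 'r) ring_scheme \<Rightarrow> ('k::field_char_0 \<Rightarrow> 'a) \<Rightarrow>
    ('a, 'e, 't) module_scheme \<Rightarrow> ('e \<Rightarrow> ('e \<times> ('a \<Rightarrow> 'a) set \<Rightarrow> 'a) set) \<Rightarrow> nat \<Rightarrow> 'a form" where
  "chern_form R s E D i = s (1 / fact i) \<odot>\<^bsub>forms R s\<^esub>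
     trace_forms R s E (curvature R s E D [^]\<^bsub>end_forms R s E\<^esub> i)"

text \<open>
  The class in \<open>H\<^sup>2\<^sup>i\<close> of the Chern form of some connection. Nothing is known about the chosen
  connection except that it is one (if there is one, as for finitely generated projective \<open>E\<close>).
\<close>

definition chern_character :: "('a, 'r) ring_scheme \<Rightarrow> ('k::field_char_0 \<Rightarrow> 'a) \<Rightarrow>
    ('a, 'e, 't) module_scheme \<Rightarrow> nat \<Rightarrow> 'a form set" where
  "chern_character R s E i =
     exact_forms R s (2 * i) +>\<^bsub>forms R s\<^esub> chern_form R s E (SOME D. connection R s E D) i"

end

theory Submission
  imports Defs
begin

text \<open>
  Regularity makes the gradient unimodular: \<open>\<Sum> g\<^sub>j \<partial>\<^sub>j f = 1\<close> modulo \<open>f\<close> for suitable \<open>g\<^sub>j\<close>. Otherwise some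
  maximal ideal \<open>Q\<close> contains \<open>f\<close> and all \<open>\<partial>\<^sub>j f\<close>. A chain of \<open>d + 1\<close> primes between \<open>(f)\<close> and \<open>Q\<close>, with \<open>d\<close> the
  dimension of the local ring at \<open>Q\<close>, leaves more than \<open>d\<close> polynomials in \<open>Q\<close> with linearly independent
  differentials modulo \<open>Q\<close>, whereas regularity generates \<open>Q\<close> locally by \<open>d\<close> elements and \<open>f\<close>, and \<open>f\<close> has zero
  differential modulo \<open>Q\<close>.

  Hence \<open>\<Omega>\<close> and \<open>T\<close> are direct summands of \<open>A\<^sup>n\<close> with a free complement of rank one, cut out by the
  projection matrix \<open>1 - (\<partial>\<^sub>l f g\<^sub>j)\<close>. The curvature of any connection on such a module \<open>E\<close> becomes the matrix
  \<open>d\<Theta> + \<Theta>\<^sup>2\<close> of a connection on \<open>A\<^sup>n\<close>, and \<open>tr (d\<Theta> + \<Theta>\<^sup>2)\<^sup>i\<close> is exact by the Chern--Simons transgression along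
  \<open>t\<Theta>\<close>. Since the exterior algebra is not assumed to be free over \<open>A\<close>, the transgression is carried out as
  an identity between words in \<open>\<Theta>\<close> and \<open>d\<Theta>\<close>, using only the cyclicity of the trace and \<open>d\<^sup>2 = 0\<close>.
\<close>

section \<open>Modules by generators and relations\<close>

text \<open>The differential, the curvature and the trace are given by \<open>THE\<close> or
  \<open>SOME\<close> on cosets of free modules. Each has to be constructed through the presentation
  and identified with the described object, and since d and a connection are not A-linear, the maps
  out of a presentation can only be assumed additive. Of the chosen connection nothing but the
  defining rules may be used. The free complement of \<Omega> is the image of the gradient in A^n:
  the conormal sequence splits because the gradient is unimodular. The formulas with F and G come
  from the sum of the given connection on E and d on A, whose matrix on A^n is t + F dG. Integration
  along the Chern-Simons path becomes a comparison of coefficients; the factor i/(i + r) is the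
  integral of i t^(i + r - 1) over [0, 1]. Characteristic zero enters there and in the separability
  of minimal equations. Maximal ideals need not be rational points, since k may be the reals.
  Tangent vectors at a point are therefore replaced by partial derivatives in the variables outside
  a maximal independent set.\<close>

lemma (in abelian_group) a_inv_zero [simp]: "\<ominus> \<zero> = \<zero>"
  by (rule minus_equality) auto

lemma (in abelian_group) minus_eq_zero_iff:
  assumes "x \<in> carrier G" "y \<in> carrier G"
  shows "x \<ominus> y = \<zero> \<longleftrightarrow> x = y"
proof
  assume "x \<ominus> y = \<zero>"
  hence "(x \<oplus> \<ominus> y) \<oplus> y = y" using assms by (simp add: a_minus_def)
  thus "x = y" using assms by (simp add: a_assoc l_neg)
qed (use assms in \<open>simp add: a_minus_def r_neg\<close>)

lemmas (in abelian_group) abel_simps =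
  a_minus_def minus_add minus_minus a_ac l_neg r_neg r_neg1 r_neg2

text \<open>Only additivity is asked for, because d and connections are among the maps treated and
  are not linear. Modules extend the ring record, so one predicate covers rings and modules.\<close>

definition addmap :: "('a, 'r) ring_scheme \<Rightarrow> ('b, 's) ring_scheme \<Rightarrow> ('a \<Rightarrow> 'b) \<Rightarrow> bool" where
  "addmap G H h \<longleftrightarrow> h \<in> carrier G \<rightarrow> carrier H \<and>
     (\<forall>x\<in>carrier G. \<forall>y\<in>carrier G. h (x \<oplus>\<^bsub>G\<^esub> y) = h x \<oplus>\<^bsub>H\<^esub> h y)"

lemma addmapI:
  assumes "\<And>x. x \<in> carrier G \<Longrightarrow> h x \<in> carrier H"
    and "\<And>x y. x \<in> carrier G \<Longrightarrow> y \<in> carrier G \<Longrightarrow> h (x \<oplus>\<^bsub>G\<^esub> y) = h x \<oplus>\<^bsub>H\<^esub> h y"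
  shows "addmap G H h"
  using assms by (auto simp: addmap_def)

lemma addmap_closed: "addmap G H h \<Longrightarrow> x \<in> carrier G \<Longrightarrow> h x \<in> carrier H"
  by (auto simp: addmap_def)

lemma addmap_add: "addmap G H h \<Longrightarrow> x \<in> carrier G \<Longrightarrow> y \<in> carrier G \<Longrightarrow>
    h (x \<oplus>\<^bsub>G\<^esub> y) = h x \<oplus>\<^bsub>H\<^esub> h y"
  by (auto simp: addmap_def)

lemma addmap_zero:
  assumes "abelian_group G" "abelian_group H" "addmap G H h"
  shows "h \<zero>\<^bsub>G\<^esub> = \<zero>\<^bsub>H\<^esub>"
proof -
  interpret G: abelian_group G by fact
  interpret H: abelian_group H by fact
  have c: "h \<zero>\<^bsub>G\<^esub> \<in> carrier H" using assms(3) by (simp add: addmap_closed)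
  have "h \<zero>\<^bsub>G\<^esub> \<oplus>\<^bsub>H\<^esub> h \<zero>\<^bsub>G\<^esub> = h \<zero>\<^bsub>G\<^esub>"
    using addmap_add[OF assms(3), of "\<zero>\<^bsub>G\<^esub>" "\<zero>\<^bsub>G\<^esub>"] by simp
  thus ?thesis using c by (metis H.add.l_cancel_one)
qed

lemma addmap_inv:
  assumes "abelian_group G" "abelian_group H" "addmap G H h" "x \<in> carrier G"
  shows "h (\<ominus>\<^bsub>G\<^esub> x) = \<ominus>\<^bsub>H\<^esub> h x"
proof -
  interpret G: abelian_group G by fact
  interpret H: abelian_group H by fact
  have "h (\<ominus>\<^bsub>G\<^esub> x) \<oplus>\<^bsub>H\<^esub> h x = \<zero>\<^bsub>H\<^esub>"
    using addmap_add[OF assms(3), of "\<ominus>\<^bsub>G\<^esub> x" x] assms(4) addmap_zero[OF assms(1-3)]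
    by (simp add: G.l_neg)
  thus ?thesis using assms by (simp add: H.minus_equality addmap_closed)
qed

lemma addmap_minus:
  assumes "abelian_group G" "abelian_group H" "addmap G H h" "x \<in> carrier G" "y \<in> carrier G"
  shows "h (x \<ominus>\<^bsub>G\<^esub> y) = h x \<ominus>\<^bsub>H\<^esub> h y"
proof -
  interpret G: abelian_group G by fact
  show ?thesis
    using assms by (simp add: a_minus_def addmap_add addmap_inv)
qed

lemma addmap_finsum:
  assumes "abelian_group G" "abelian_group H" "addmap G H h" "f \<in> A \<rightarrow> carrier G"
  shows "h (\<Oplus>\<^bsub>G\<^esub> i\<in>A. f i) = (\<Oplus>\<^bsub>H\<^esub> i\<in>A. h (f i))"
proof -
  interpret G: abelian_group G by fact
  interpret H: abelian_group H by fact
  show ?thesis using assms(4)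
  proof (induction A rule: infinite_finite_induct)
    case (insert x A)
    then show ?case
      using assms(3) by (simp add: addmap_add addmap_closed Pi_def)
  qed (simp_all add: addmap_zero[OF assms(1-3)])
qed

lemma (in abelian_monoid) finsum_swap:
  assumes "finite A" "finite B" "\<And>a b. a \<in> A \<Longrightarrow> b \<in> B \<Longrightarrow> f a b \<in> carrier G"
  shows "(\<Oplus>a\<in>A. \<Oplus>b\<in>B. f a b) = (\<Oplus>b\<in>B. \<Oplus>a\<in>A. f a b)"
  using assms(1,3)
proof (induction A)
  case empty
  then show ?case by simp
next
  case (insert x A)
  have "(\<Oplus>b\<in>B. \<Oplus>a\<in>insert x A. f a b) = (\<Oplus>b\<in>B. f x b \<oplus> (\<Oplus>a\<in>A. f a b))"
    using insert by (intro finsum_cong') auto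
  then show ?case using insert
    by (simp add: Pi_def finsum_addf)
qed

subsection \<open>Quotients and spans\<close>

context module
begin

lemma submodule_abelian_subgroup: "submodule N R M \<Longrightarrow> abelian_subgroup N M"
  by (intro abelian_subgroupI2 M.a_comm_group submodule.axioms(1))

lemma coset_eq_iff:
  assumes "submodule N R M" "x \<in> carrier M" "y \<in> carrier M"
  shows "N +>\<^bsub>M\<^esub> x = N +>\<^bsub>M\<^esub> y \<longleftrightarrow> x \<ominus>\<^bsub>M\<^esub> y \<in> N"
proof -
  interpret abelian_subgroup N M by (rule submodule_abelian_subgroup) fact
  have sb: "subgroup N (add_monoid M)" by (rule a_subgroup)
  show ?thesis
  proof
    assume "N +>\<^bsub>M\<^esub> x = N +>\<^bsub>M\<^esub> y"
    hence "x \<in> N +>\<^bsub>M\<^esub> y" using assms(2) a_rcos_self by blast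
    thus "x \<ominus>\<^bsub>M\<^esub> y \<in> N"
      using assms a_rcos_module_imp[of y x] by (simp add: a_minus_def)
  next
    assume "x \<ominus>\<^bsub>M\<^esub> y \<in> N"
    thus "N +>\<^bsub>M\<^esub> x = N +>\<^bsub>M\<^esub> y"
      using assms sb a_subset M.a_coset_join2[of "x \<ominus>\<^bsub>M\<^esub> y" N] M.a_coset_add_inv1[of N x y]
      by (simp add: a_minus_def)
  qed
qed

lemma coset_zero:
  assumes "submodule N R M"
  shows "N +>\<^bsub>M\<^esub> \<zero>\<^bsub>M\<^esub> = N"
  using submoduleE(1)[OF assms] by simp

lemma coset_eq_self_iff:
  assumes "submodule N R M" "x \<in> carrier M"
  shows "N +>\<^bsub>M\<^esub> x = N \<longleftrightarrow> x \<in> N"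
  using coset_eq_iff[OF assms(1,2), of "\<zero>\<^bsub>M\<^esub>"] coset_zero[OF assms(1)] assms(2)
  by (simp add: a_minus_def)

lemma coset_mem_iff:
  assumes "submodule N R M" "x \<in> carrier M"
  shows "y \<in> N +>\<^bsub>M\<^esub> x \<longleftrightarrow> y \<in> carrier M \<and> N +>\<^bsub>M\<^esub> y = N +>\<^bsub>M\<^esub> x"
proof -
  interpret abelian_subgroup N M by (rule submodule_abelian_subgroup) fact
  have sb: "subgroup N (add_monoid M)" by (rule a_subgroup)
  show ?thesis
    using assms sb M.a_repr_independence[of y N x] a_rcos_self M.a_r_coset_subset_G[OF a_subset, of x]
    by blast
qed

lemma quot_carrier: "carrier (quot_module M N) = (\<lambda>x. N +>\<^bsub>M\<^esub> x) ` carrier M"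
  by (auto simp: quot_module_def A_RCOSETS_def')

lemma quot_add:
  assumes "submodule N R M" "x \<in> carrier M" "y \<in> carrier M"
  shows "(N +>\<^bsub>M\<^esub> x) \<oplus>\<^bsub>quot_module M N\<^esub> (N +>\<^bsub>M\<^esub> y) = N +>\<^bsub>M\<^esub> (x \<oplus>\<^bsub>M\<^esub> y)"
proof -
  interpret abelian_subgroup N M by (rule submodule_abelian_subgroup) fact
  show ?thesis using assms by (simp add: quot_module_def a_rcos_sum)
qed

lemma quot_zero: "submodule N R M \<Longrightarrow> \<zero>\<^bsub>quot_module M N\<^esub> = N +>\<^bsub>M\<^esub> \<zero>\<^bsub>M\<^esub>"
  by (simp add: coset_zero) (simp add: quot_module_def)

lemma quot_smult:
  assumes "submodule N R M" "x \<in> carrier M" "a \<in> carrier R"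
  shows "a \<odot>\<^bsub>quot_module M N\<^esub> (N +>\<^bsub>M\<^esub> x) = N +>\<^bsub>M\<^esub> (a \<odot>\<^bsub>M\<^esub> x)"
proof -
  have "N +>\<^bsub>M\<^esub> (a \<odot>\<^bsub>M\<^esub> y) = N +>\<^bsub>M\<^esub> (a \<odot>\<^bsub>M\<^esub> x)" if y: "y \<in> N +>\<^bsub>M\<^esub> x" for y
  proof -
    have yM: "y \<in> carrier M" and "y \<ominus>\<^bsub>M\<^esub> x \<in> N"
      using y assms coset_mem_iff coset_eq_iff by auto
    hence "a \<odot>\<^bsub>M\<^esub> (y \<ominus>\<^bsub>M\<^esub> x) \<in> N" using assms submoduleE(4) by auto
    hence "a \<odot>\<^bsub>M\<^esub> y \<ominus>\<^bsub>M\<^esub> a \<odot>\<^bsub>M\<^esub> x \<in> N" using assms yM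
      by (simp add: a_minus_def smult_r_distr smult_r_minus)
    thus ?thesis using assms yM coset_eq_iff by simp
  qed
  moreover have "x \<in> N +>\<^bsub>M\<^esub> x" using assms coset_mem_iff by simp
  ultimately have "(\<Union>y\<in>N +>\<^bsub>M\<^esub> x. N +>\<^bsub>M\<^esub> (a \<odot>\<^bsub>M\<^esub> y)) = N +>\<^bsub>M\<^esub> (a \<odot>\<^bsub>M\<^esub> x)" by blast
  thus ?thesis by (simp add: quot_module_def)
qed

lemma quot_is_module:
  assumes N: "submodule N R M"
  shows "module R (quot_module M N)"
proof (rule moduleI)
  let ?Q = "quot_module M N"
  note simps = quot_carrier quot_add[OF N] quot_smult[OF N] quot_zero[OF N]
  show "cring R" by (rule R.is_cring)
  show "abelian_group ?Q"
  proof (rule abelian_groupI)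
    fix x assume "x \<in> carrier ?Q"
    then obtain u where u: "u \<in> carrier M" "x = N +>\<^bsub>M\<^esub> u" by (auto simp: simps)
    have "(N +>\<^bsub>M\<^esub> (\<ominus>\<^bsub>M\<^esub> u)) \<oplus>\<^bsub>?Q\<^esub> x = \<zero>\<^bsub>?Q\<^esub>" using u by (simp add: simps M.l_neg)
    thus "\<exists>y\<in>carrier ?Q. y \<oplus>\<^bsub>?Q\<^esub> x = \<zero>\<^bsub>?Q\<^esub>" using u by (auto simp: quot_carrier)
  next
    fix x y assume "x \<in> carrier ?Q" "y \<in> carrier ?Q"
    then obtain u v where "u \<in> carrier M" "v \<in> carrier M" "x = N +>\<^bsub>M\<^esub> u" "y = N +>\<^bsub>M\<^esub> v"
      by (auto simp: quot_carrier)
    thus "x \<oplus>\<^bsub>?Q\<^esub> y = y \<oplus>\<^bsub>?Q\<^esub> x" by (simp add: simps M.a_comm)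
  qed (auto simp: simps M.a_assoc)
qed (auto simp: quot_carrier quot_add[OF N] quot_smult[OF N] smult_l_distr smult_r_distr smult_assoc1)

lemma span_submodule:
  assumes "S \<subseteq> carrier M"
  shows "submodule (module_span R M S) R M"
proof -
  have 1: "H \<subseteq> carrier M" "\<zero>\<^bsub>M\<^esub> \<in> H" if "submodule H R M" for H
    using that submoduleE(1) submodule_abelian_subgroup
    by (auto simp: abelian_subgroup_def additive_subgroup.zero_closed)
  show ?thesis
  proof (rule submoduleI)
    show "module_span R M S \<subseteq> carrier M"
      using assms carrier_is_submodule by (auto simp: module_span_def hull_def)
  qed (use 1(2) submoduleE(3-5) in \<open>auto simp: module_span_def hull_def\<close>)
qed

text \<open>\<open>P\<close> is not assumed closed under scalars; the scalars sit in the generator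
  case instead. This allows \<open>P x\<close> to say that a merely additive map vanishes at
  x.\<close>

lemma span_induct:
  assumes S: "S \<subseteq> carrier M" and x: "x \<in> module_span R M S"
    and gen: "\<And>a s. a \<in> carrier R \<Longrightarrow> s \<in> S \<Longrightarrow> P (a \<odot>\<^bsub>M\<^esub> s)"
    and add: "\<And>x y. x \<in> carrier M \<Longrightarrow> y \<in> carrier M \<Longrightarrow> P x \<Longrightarrow> P y \<Longrightarrow> P (x \<oplus>\<^bsub>M\<^esub> y)"
    and zero: "P \<zero>\<^bsub>M\<^esub>"
  shows "P x"
proof -
  \<comment> \<open>Quantifying over all scalar multiples turns the predicate into a submodule; the
    scalar one recovers \<open>P x\<close> at the end.\<close>
  let ?H = "{x \<in> carrier M. \<forall>a\<in>carrier R. P (a \<odot>\<^bsub>M\<^esub> x)}"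
  have "submodule ?H R M"
  proof (rule submoduleI)
    fix x assume x: "x \<in> ?H"
    have "P (a \<odot>\<^bsub>M\<^esub> (\<ominus>\<^bsub>M\<^esub> x))" if "a \<in> carrier R" for a
    proof -
      have "P ((\<ominus> a) \<odot>\<^bsub>M\<^esub> x)" using that x by blast
      thus ?thesis using that x by (simp add: smult_l_minus smult_r_minus)
    qed
    thus "\<ominus>\<^bsub>M\<^esub> x \<in> ?H" using x by simp
  next
    fix a x assume "a \<in> carrier R" "x \<in> ?H"
    thus "a \<odot>\<^bsub>M\<^esub> x \<in> ?H" by (simp add: smult_assoc1[symmetric])
  next
    fix x y assume "x \<in> ?H" "y \<in> ?H"
    thus "x \<oplus>\<^bsub>M\<^esub> y \<in> ?H" by (simp add: smult_r_distr add)
  qed (use zero in \<open>simp_all add: subset_iff\<close>)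
  moreover have "S \<subseteq> ?H" using S gen by auto
  ultimately have "module_span R M S \<subseteq> ?H"
    unfolding module_span_def by (intro hull_minimal)
  hence "x \<in> ?H" using x by (rule subsetD)
  hence "x \<in> carrier M" "P (\<one> \<odot>\<^bsub>M\<^esub> x)" by blast+
  thus ?thesis by simp
qed

lemma span_subset:
  assumes "S \<subseteq> carrier M"
  shows "module_span R M S \<subseteq> carrier M"
  using submoduleE(1)[OF span_submodule[OF assms]] .

lemma span_superset: "S \<subseteq> module_span R M S"
  unfolding module_span_def by (rule hull_subset)

text \<open>A merely additive map has to be tested on all multiples \<open>a s\<close> of the
  relations, not on the relations alone. The well-definedness proofs for tensor products and Kaehler
  differentials have this shape.\<close>

lemma span_kernel:
  assumes S: "S \<subseteq> carrier M" and G: "abelian_group G" and h: "addmap M G h"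
    and rel: "\<And>a s. a \<in> carrier R \<Longrightarrow> s \<in> S \<Longrightarrow> h (a \<odot>\<^bsub>M\<^esub> s) = \<zero>\<^bsub>G\<^esub>"
    and x: "x \<in> module_span R M S"
  shows "h x = \<zero>\<^bsub>G\<^esub>"
proof -
  interpret G: abelian_group G by fact
  show ?thesis
    by (rule span_induct[OF S x])
      (auto simp: rel addmap_add[OF h] addmap_zero[OF M.abelian_group_axioms G h])
qed

text \<open>\<open>tensor_lift\<close> and the lifts below are defined as the sole value of a map on
  a coset; vanishing on \<open>N\<close> makes that image a singleton.\<close>

lemma the_elem_coset:
  assumes N: "submodule N R M" and G: "abelian_group G" and h: "addmap M G h"
    and ker: "\<And>x. x \<in> N \<Longrightarrow> h x = \<zero>\<^bsub>G\<^esub>" and x: "x \<in> carrier M"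
  shows "the_elem (h ` (N +>\<^bsub>M\<^esub> x)) = h x"
proof -
  interpret G: abelian_group G by fact
  have "h y = h x" if "y \<in> N +>\<^bsub>M\<^esub> x" for y
  proof -
    have y: "y \<in> carrier M" "y \<ominus>\<^bsub>M\<^esub> x \<in> N" using that N x coset_mem_iff coset_eq_iff by auto
    have "h y \<ominus>\<^bsub>G\<^esub> h x = \<zero>\<^bsub>G\<^esub>"
      using ker[OF y(2)] addmap_minus[OF M.abelian_group_axioms G h y(1) x] by simp
    thus ?thesis using addmap_closed[OF h] x y by (simp add: G.minus_eq_zero_iff)
  qed
  moreover have "x \<in> N +>\<^bsub>M\<^esub> x" using N x coset_mem_iff by simp
  ultimately have "h ` (N +>\<^bsub>M\<^esub> x) = {h x}" by blast
  thus ?thesis by simp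
qed

lemma the_elem_addmap:
  assumes N: "submodule N R M" and G: "abelian_group G" and h: "addmap M G h"
    and ker: "\<And>x. x \<in> N \<Longrightarrow> h x = \<zero>\<^bsub>G\<^esub>"
  shows "addmap (quot_module M N) G (\<lambda>X. the_elem (h ` X))"
  by (rule addmapI)
    (auto simp: quot_carrier quot_add[OF N] the_elem_coset[OF assms] addmap_closed[OF h] addmap_add[OF h])

end

subsection \<open>Free modules\<close>

context cring
begin

lemma free_module_module: "module R (free_module R X)"
proof (rule moduleI)
  show "abelian_group (free_module R X)"
  proof (rule abelian_groupI)
    fix g assume g: "g \<in> carrier (free_module R X)"
    let ?h = "\<lambda>x. \<ominus> g x"
    have gR: "g x \<in> carrier R" for x using g by (cases "x \<in> X") (auto simp: free_module_def)
    have "{x. ?h x \<noteq> \<zero>} \<subseteq> {x. g x \<noteq> \<zero>}" by auto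
    hence "finite {x. ?h x \<noteq> \<zero>}" using g by (auto simp: free_module_def intro: finite_subset)
    moreover have "g x = \<zero>" if "x \<notin> X" for x using g that by (simp add: free_module_def)
    ultimately have "?h \<in> carrier (free_module R X)" using gR by (auto simp: free_module_def)
    moreover have "?h \<oplus>\<^bsub>free_module R X\<^esub> g = \<zero>\<^bsub>free_module R X\<^esub>"
      using gR by (auto simp: free_module_def l_neg)
    ultimately show "\<exists>y\<in>carrier (free_module R X). y \<oplus>\<^bsub>free_module R X\<^esub> g = \<zero>\<^bsub>free_module R X\<^esub>" by blast
  next
    fix g h assume gh: "g \<in> carrier (free_module R X)" "h \<in> carrier (free_module R X)"
    have "{x. g x \<oplus> h x \<noteq> \<zero>} \<subseteq> {x. g x \<noteq> \<zero>} \<union> {x. h x \<noteq> \<zero>}" by auto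
    hence "finite {x. g x \<oplus> h x \<noteq> \<zero>}" using gh
      by (auto simp: free_module_def intro: finite_subset)
    thus "g \<oplus>\<^bsub>free_module R X\<^esub> h \<in> carrier (free_module R X)" using gh by (auto simp: free_module_def)
  next
    fix g h k assume gh: "g \<in> carrier (free_module R X)" "h \<in> carrier (free_module R X)"
      "k \<in> carrier (free_module R X)"
    have "g x \<in> carrier R" "h x \<in> carrier R" "k x \<in> carrier R" for x
      using gh by (cases "x \<in> X"; auto simp: free_module_def)+
    thus "g \<oplus>\<^bsub>free_module R X\<^esub> h \<oplus>\<^bsub>free_module R X\<^esub> k = g \<oplus>\<^bsub>free_module R X\<^esub> (h \<oplus>\<^bsub>free_module R X\<^esub> k)"
      by (simp add: free_module_def a_assoc)
  next
    fix g h assume gh: "g \<in> carrier (free_module R X)" "h \<in> carrier (free_module R X)"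
    have "g x \<in> carrier R" "h x \<in> carrier R" for x
      using gh by (cases "x \<in> X"; auto simp: free_module_def)+
    thus "g \<oplus>\<^bsub>free_module R X\<^esub> h = h \<oplus>\<^bsub>free_module R X\<^esub> g"
      by (simp add: free_module_def a_comm)
  next
    fix g assume gh: "g \<in> carrier (free_module R X)"
    have "g x \<in> carrier R" for x
      using gh by (cases "x \<in> X"; auto simp: free_module_def)+
    thus "\<zero>\<^bsub>free_module R X\<^esub> \<oplus>\<^bsub>free_module R X\<^esub> g = g"
      by (simp add: free_module_def)
  qed (simp add: free_module_def)
next
  fix a g assume gh: "a \<in> carrier R" "g \<in> carrier (free_module R X)"
  have "{x. a \<otimes> g x \<noteq> \<zero>} \<subseteq> {x. g x \<noteq> \<zero>}" using gh by auto
  hence "finite {x. a \<otimes> g x \<noteq> \<zero>}" using gh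
      by (auto simp: free_module_def intro: finite_subset)
  thus "a \<odot>\<^bsub>free_module R X\<^esub> g \<in> carrier (free_module R X)" using gh by (auto simp: free_module_def)
next
  fix a b g assume ab: "a \<in> carrier R" "b \<in> carrier R" and gh: "g \<in> carrier (free_module R X)"
  have "g x \<in> carrier R" for x
    using gh by (cases "x \<in> X"; auto simp: free_module_def)+
  thus "(a \<oplus> b) \<odot>\<^bsub>free_module R X\<^esub> g = a \<odot>\<^bsub>free_module R X\<^esub> g \<oplus>\<^bsub>free_module R X\<^esub> b \<odot>\<^bsub>free_module R X\<^esub> g"
    "a \<otimes> b \<odot>\<^bsub>free_module R X\<^esub> g = a \<odot>\<^bsub>free_module R X\<^esub> (b \<odot>\<^bsub>free_module R X\<^esub> g)"
    using ab by (simp_all add: free_module_def l_distr m_assoc)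
next
  fix a g h assume a: "a \<in> carrier R" and gh: "g \<in> carrier (free_module R X)" "h \<in> carrier (free_module R X)"
  have "g x \<in> carrier R" "h x \<in> carrier R" for x
    using gh by (cases "x \<in> X"; auto simp: free_module_def)+
  thus "a \<odot>\<^bsub>free_module R X\<^esub> (g \<oplus>\<^bsub>free_module R X\<^esub> h) = a \<odot>\<^bsub>free_module R X\<^esub> g \<oplus>\<^bsub>free_module R X\<^esub> a \<odot>\<^bsub>free_module R X\<^esub> h"
    using a by (simp add: free_module_def r_distr)
next
  fix g assume gh: "g \<in> carrier (free_module R X)"
  have "g x \<in> carrier R" for x
    using gh by (cases "x \<in> X"; auto simp: free_module_def)+
  thus "\<one> \<odot>\<^bsub>free_module R X\<^esub> g = g" by (simp add: free_module_def)
qed (rule is_cring)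

lemma free_gen_closed: "x \<in> X \<Longrightarrow> free_gen R x \<in> carrier (free_module R X)"
  by (auto simp: free_module_def free_gen_def)

lemma free_module_val: "g \<in> carrier (free_module R X) \<Longrightarrow> g x \<in> carrier R"
  by (cases "x \<in> X") (auto simp: free_module_def)

lemma free_module_induct:
  assumes g: "g \<in> carrier (free_module R X)"
    and zero: "P \<zero>\<^bsub>free_module R X\<^esub>"
    and gen: "\<And>a x. a \<in> carrier R \<Longrightarrow> x \<in> X \<Longrightarrow> P (a \<odot>\<^bsub>free_module R X\<^esub> free_gen R x)"
    and add: "\<And>g h. g \<in> carrier (free_module R X) \<Longrightarrow> h \<in> carrier (free_module R X) \<Longrightarrow> P g \<Longrightarrow> P h \<Longrightarrow>
      P (g \<oplus>\<^bsub>free_module R X\<^esub> h)"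
  shows "P g"
proof -
  have "P g" if "finite S" "g \<in> carrier (free_module R X)" "{x. g x \<noteq> \<zero>} \<subseteq> S" for S g
    using that
  proof (induction S arbitrary: g)
    case empty
    hence "g = \<zero>\<^bsub>free_module R X\<^esub>" by (auto simp: free_module_def)
    thus ?case using zero by simp
  next
    case (insert y S)
    show ?case
    proof (cases "g y = \<zero>")
      case True
      thus ?thesis using insert by (intro insert.IH) auto
    next
      case False
      hence y: "y \<in> X" using insert.prems by (auto simp: free_module_def)
      let ?h = "\<lambda>x. if x = y then \<zero> else g x"
      have "{x. ?h x \<noteq> \<zero>} \<subseteq> {x. g x \<noteq> \<zero>}" by auto
      hence "finite {x. ?h x \<noteq> \<zero>}"
        using insert.prems by (auto simp: free_module_def intro: finite_subset)
      hence h: "?h \<in> carrier (free_module R X)" using insert.prems by (auto simp: free_module_def)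
      have "P ?h" using insert.prems by (intro insert.IH h) auto
      moreover have gy: "g y \<in> carrier R" by (rule free_module_val[OF insert.prems(1)])
      have vals: "g x \<in> carrier R" for x by (rule free_module_val[OF insert.prems(1)])
      have "g = g y \<odot>\<^bsub>free_module R X\<^esub> free_gen R y \<oplus>\<^bsub>free_module R X\<^esub> ?h"
        using gy vals by (auto simp: free_module_def free_gen_def fun_eq_iff)
      moreover have "g y \<odot>\<^bsub>free_module R X\<^esub> free_gen R y \<in> carrier (free_module R X)"
        by (meson free_gen_closed free_module_module gy module.smult_closed y)
      ultimately show ?thesis using gen[OF gy y] add[OF _ h] by metis
    qed
  qed
  thus ?thesis using g by (auto simp: free_module_def)
qed

end

text \<open>One additive map R -> G is prescribed per generator, not one value: without linearity
  the value at \<open>a x\<close> does not follow from the value at x, and the target is just an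
  abelian group.\<close>

definition free_ext :: "('a, 'r) ring_scheme \<Rightarrow> ('b, 's) ring_scheme \<Rightarrow> ('x \<Rightarrow> 'a \<Rightarrow> 'b) \<Rightarrow> ('x \<Rightarrow> 'a) \<Rightarrow> 'b" where
  "free_ext R G \<phi> g = (\<Oplus>\<^bsub>G\<^esub> x\<in>{x. g x \<noteq> \<zero>\<^bsub>R\<^esub>}. \<phi> x (g x))"

lemma free_ext_props:
  assumes R: "cring R" and G: "abelian_group G" and \<phi>: "\<And>x. x \<in> X \<Longrightarrow> addmap R G (\<phi> x)"
  shows free_ext_addmap: "addmap (free_module R X) G (free_ext R G \<phi>)"
    and free_ext_gen: "a \<in> carrier R \<Longrightarrow> x \<in> X \<Longrightarrow>
      free_ext R G \<phi> (a \<odot>\<^bsub>free_module R X\<^esub> free_gen R x) = \<phi> x a"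
proof -
  interpret R: cring R by fact
  interpret G: abelian_group G by fact
  have z: "\<phi> x \<zero>\<^bsub>R\<^esub> = \<zero>\<^bsub>G\<^esub>" if "x \<in> X" for x
    using addmap_zero[OF R.abelian_group_axioms G \<phi>[OF that]] .
  have ext: "free_ext R G \<phi> g = (\<Oplus>\<^bsub>G\<^esub> x\<in>S. \<phi> x (g x))"
    if "finite S" "{x. g x \<noteq> \<zero>\<^bsub>R\<^esub>} \<subseteq> S" "S \<subseteq> X" "g \<in> carrier (free_module R X)" for g S
    unfolding free_ext_def
  proof (rule G.add.finprod_mono_neutral_cong_left)
    show "\<And>i. i \<in> S - {x. g x \<noteq> \<zero>\<^bsub>R\<^esub>} \<Longrightarrow> \<phi> i (g i) = \<zero>\<^bsub>G\<^esub>" using z that by auto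
    show "(\<lambda>x. \<phi> x (g x)) \<in> S \<rightarrow> carrier G"
      using that addmap_closed[OF \<phi>] R.free_module_val[OF that(4)] by auto
  qed (use that in auto)
  have supp: "{x. g x \<noteq> \<zero>\<^bsub>R\<^esub>} \<subseteq> X" "finite {x. g x \<noteq> \<zero>\<^bsub>R\<^esub>}" if "g \<in> carrier (free_module R X)" for g
    using that by (auto simp: free_module_def)
  interpret F: module R "free_module R X" by (rule R.free_module_module)
  show "addmap (free_module R X) G (free_ext R G \<phi>)"
  proof (rule addmapI)
    fix g assume g: "g \<in> carrier (free_module R X)"
    show "free_ext R G \<phi> g \<in> carrier G"
      unfolding free_ext_def using supp[OF g] addmap_closed[OF \<phi>] R.free_module_val[OF g]
      by (intro G.finsum_closed) auto
  next
    fix g h assume gh: "g \<in> carrier (free_module R X)" "h \<in> carrier (free_module R X)"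
    let ?S = "{x. g x \<noteq> \<zero>\<^bsub>R\<^esub>} \<union> {x. h x \<noteq> \<zero>\<^bsub>R\<^esub>}"
    have S: "finite ?S" "?S \<subseteq> X" using supp gh by blast+
    have gh': "g \<oplus>\<^bsub>free_module R X\<^esub> h \<in> carrier (free_module R X)" using gh by (rule F.M.a_closed)
    have "free_ext R G \<phi> (g \<oplus>\<^bsub>free_module R X\<^esub> h) = (\<Oplus>\<^bsub>G\<^esub> x\<in>?S. \<phi> x ((g \<oplus>\<^bsub>free_module R X\<^esub> h) x))"
      by (rule ext[OF S(1) _ S(2) gh']) (auto simp: free_module_def)
    also have "\<dots> = (\<Oplus>\<^bsub>G\<^esub> x\<in>?S. \<phi> x (g x) \<oplus>\<^bsub>G\<^esub> \<phi> x (h x))"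
    proof (rule G.finsum_cong')
      fix x assume "x \<in> ?S"
      hence "x \<in> X" using S by auto
      thus "\<phi> x ((g \<oplus>\<^bsub>free_module R X\<^esub> h) x) = \<phi> x (g x) \<oplus>\<^bsub>G\<^esub> \<phi> x (h x)"
        using addmap_add[OF \<phi>] R.free_module_val[OF gh(1)] R.free_module_val[OF gh(2)]
        by (simp add: free_module_def)
    qed (use S(2) addmap_closed[OF \<phi>] R.free_module_val[OF gh(1)] R.free_module_val[OF gh(2)] in auto)
    also have "\<dots> = (\<Oplus>\<^bsub>G\<^esub> x\<in>?S. \<phi> x (g x)) \<oplus>\<^bsub>G\<^esub> (\<Oplus>\<^bsub>G\<^esub> x\<in>?S. \<phi> x (h x))"
      using S addmap_closed[OF \<phi>] R.free_module_val[OF gh(1)] R.free_module_val[OF gh(2)]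
      by (intro G.finsum_addf) auto
    also have "(\<Oplus>\<^bsub>G\<^esub> x\<in>?S. \<phi> x (g x)) = free_ext R G \<phi> g" by (rule ext[OF S(1) _ S(2) gh(1), symmetric]) auto
    also have "(\<Oplus>\<^bsub>G\<^esub> x\<in>?S. \<phi> x (h x)) = free_ext R G \<phi> h" by (rule ext[OF S(1) _ S(2) gh(2), symmetric]) auto
    finally show "free_ext R G \<phi> (g \<oplus>\<^bsub>free_module R X\<^esub> h) = free_ext R G \<phi> g \<oplus>\<^bsub>G\<^esub> free_ext R G \<phi> h" .
  qed
  show "free_ext R G \<phi> (a \<odot>\<^bsub>free_module R X\<^esub> free_gen R x) = \<phi> x a" if a: "a \<in> carrier R" and x: "x \<in> X"
  proof -
    have c: "a \<odot>\<^bsub>free_module R X\<^esub> free_gen R x \<in> carrier (free_module R X)"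
      by (rule F.smult_closed[OF a R.free_gen_closed[OF x]])
    have "free_ext R G \<phi> (a \<odot>\<^bsub>free_module R X\<^esub> free_gen R x) =
        (\<Oplus>\<^bsub>G\<^esub> y\<in>{x}. \<phi> y ((a \<odot>\<^bsub>free_module R X\<^esub> free_gen R x) y))"
      by (rule ext) (use a x c in \<open>auto simp: free_module_def free_gen_def split: if_splits\<close>)
    also have "\<dots> = \<phi> x a"
      using a addmap_closed[OF \<phi>[OF x] a] by (simp add: free_module_def free_gen_def)
    finally show ?thesis .
  qed
qed

subsection \<open>Tensor products\<close>

lemma (in module) smult_minus_distr:
  "a \<in> carrier R \<Longrightarrow> x \<in> carrier M \<Longrightarrow> y \<in> carrier M \<Longrightarrow>
    a \<odot>\<^bsub>M\<^esub> (x \<ominus>\<^bsub>M\<^esub> y) = a \<odot>\<^bsub>M\<^esub> x \<ominus>\<^bsub>M\<^esub> a \<odot>\<^bsub>M\<^esub> y"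
  by (simp add: a_minus_def smult_r_distr smult_r_minus)

text \<open>Bilinearity is weakened to additivity and the exchange of scalars, so that the extension
  of a connection, (nabla x) w + x dw as a function of x and w, qualifies.\<close>

definition balanced :: "('a, 'r) ring_scheme \<Rightarrow> ('a, 'm, 's) module_scheme \<Rightarrow> ('a, 'n, 't) module_scheme \<Rightarrow>
    ('b, 'p) ring_scheme \<Rightarrow> ('m \<Rightarrow> 'n \<Rightarrow> 'b) \<Rightarrow> bool" where
  "balanced R M N P \<phi> \<longleftrightarrow> (\<forall>x\<in>carrier M. addmap N P (\<phi> x)) \<and> (\<forall>y\<in>carrier N. addmap M P (\<lambda>x. \<phi> x y)) \<and>
     (\<forall>a\<in>carrier R. \<forall>x\<in>carrier M. \<forall>y\<in>carrier N. \<phi> (a \<odot>\<^bsub>M\<^esub> x) y = \<phi> x (a \<odot>\<^bsub>N\<^esub> y))"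

lemma balancedI:
  assumes "\<And>x y. x \<in> carrier M \<Longrightarrow> y \<in> carrier N \<Longrightarrow> \<phi> x y \<in> carrier P"
    and "\<And>x y y'. x \<in> carrier M \<Longrightarrow> y \<in> carrier N \<Longrightarrow> y' \<in> carrier N \<Longrightarrow> \<phi> x (y \<oplus>\<^bsub>N\<^esub> y') = \<phi> x y \<oplus>\<^bsub>P\<^esub> \<phi> x y'"
    and "\<And>x x' y. x \<in> carrier M \<Longrightarrow> x' \<in> carrier M \<Longrightarrow> y \<in> carrier N \<Longrightarrow> \<phi> (x \<oplus>\<^bsub>M\<^esub> x') y = \<phi> x y \<oplus>\<^bsub>P\<^esub> \<phi> x' y"
    and "\<And>a x y. a \<in> carrier R \<Longrightarrow> x \<in> carrier M \<Longrightarrow> y \<in> carrier N \<Longrightarrow> \<phi> (a \<odot>\<^bsub>M\<^esub> x) y = \<phi> x (a \<odot>\<^bsub>N\<^esub> y)"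
  shows "balanced R M N P \<phi>"
  using assms by (auto simp: balanced_def intro!: addmapI)

locale two_modules = M: module R M + N: module R N
  for R :: "('a, 'r) ring_scheme" and M :: "('a, 'm, 's) module_scheme" and N :: "('a, 'n, 't) module_scheme"
begin

abbreviation "FT \<equiv> free_module R (carrier M \<times> carrier N)"
abbreviation "T \<equiv> tensor R M N"
abbreviation "te \<equiv> tensor_elem R M N"
abbreviation "gen \<equiv> free_gen R :: ('m \<times> 'n) \<Rightarrow> ('m \<times> 'n) \<Rightarrow> 'a"

sublocale F: module R FT
  by (rule M.R.free_module_module)

lemma gen_closed: "x \<in> carrier M \<Longrightarrow> y \<in> carrier N \<Longrightarrow> gen (x, y) \<in> carrier FT"
  by (rule M.R.free_gen_closed) auto

lemma tensor_rels_subset: "tensor_rels R M N \<subseteq> carrier FT"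
  unfolding tensor_rels_def Let_def
  by (auto intro!: F.M.minus_closed F.M.a_closed F.smult_closed gen_closed)

lemma tensor_null_submodule: "submodule (tensor_null R M N) R FT"
  unfolding tensor_null_def by (rule F.span_submodule[OF tensor_rels_subset])

sublocale T: module R T
  unfolding tensor_def by (rule F.quot_is_module[OF tensor_null_submodule])

lemma tensor_elem_closed [simp, intro]: "x \<in> carrier M \<Longrightarrow> y \<in> carrier N \<Longrightarrow> te x y \<in> carrier T"
  unfolding tensor_def tensor_elem_def by (simp add: F.quot_carrier gen_closed)

lemma tensor_relD:
  assumes "u \<ominus>\<^bsub>FT\<^esub> v \<in> tensor_rels R M N" "u \<in> carrier FT" "v \<in> carrier FT"
  shows "tensor_null R M N +>\<^bsub>FT\<^esub> u = tensor_null R M N +>\<^bsub>FT\<^esub> v"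
  using assms F.coset_eq_iff[OF tensor_null_submodule] F.span_superset
  unfolding tensor_null_def by blast

lemma tensor_elem_add_left:
  assumes "x \<in> carrier M" "x' \<in> carrier M" "y \<in> carrier N"
  shows "te (x \<oplus>\<^bsub>M\<^esub> x') y = te x y \<oplus>\<^bsub>T\<^esub> te x' y"
proof -
  have "gen (x \<oplus>\<^bsub>M\<^esub> x', y) \<ominus>\<^bsub>FT\<^esub> (gen (x, y) \<oplus>\<^bsub>FT\<^esub> gen (x', y)) \<in> tensor_rels R M N"
    using assms unfolding tensor_rels_def Let_def by blast
  from tensor_relD[OF this] show ?thesis using assms
    by (simp add: tensor_def tensor_elem_def F.quot_add[OF tensor_null_submodule] gen_closed)
qed

lemma tensor_elem_add_right:
  assumes "x \<in> carrier M" "y \<in> carrier N" "y' \<in> carrier N"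
  shows "te x (y \<oplus>\<^bsub>N\<^esub> y') = te x y \<oplus>\<^bsub>T\<^esub> te x y'"
proof -
  have "gen (x, y \<oplus>\<^bsub>N\<^esub> y') \<ominus>\<^bsub>FT\<^esub> (gen (x, y) \<oplus>\<^bsub>FT\<^esub> gen (x, y')) \<in> tensor_rels R M N"
    using assms unfolding tensor_rels_def Let_def by blast
  from tensor_relD[OF this] show ?thesis using assms
    by (simp add: tensor_def tensor_elem_def F.quot_add[OF tensor_null_submodule] gen_closed)
qed

lemma tensor_elem_smult_left:
  assumes "a \<in> carrier R" "x \<in> carrier M" "y \<in> carrier N"
  shows "te (a \<odot>\<^bsub>M\<^esub> x) y = a \<odot>\<^bsub>T\<^esub> te x y"
proof -
  have "gen (a \<odot>\<^bsub>M\<^esub> x, y) \<ominus>\<^bsub>FT\<^esub> (a \<odot>\<^bsub>FT\<^esub> gen (x, y)) \<in> tensor_rels R M N"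
    using assms unfolding tensor_rels_def Let_def by blast
  from tensor_relD[OF this] show ?thesis using assms
    by (simp add: tensor_def tensor_elem_def F.quot_smult[OF tensor_null_submodule] gen_closed)
qed

lemma tensor_elem_smult_right:
  assumes "a \<in> carrier R" "x \<in> carrier M" "y \<in> carrier N"
  shows "te x (a \<odot>\<^bsub>N\<^esub> y) = a \<odot>\<^bsub>T\<^esub> te x y"
proof -
  have "gen (x, a \<odot>\<^bsub>N\<^esub> y) \<ominus>\<^bsub>FT\<^esub> (a \<odot>\<^bsub>FT\<^esub> gen (x, y)) \<in> tensor_rels R M N"
    using assms unfolding tensor_rels_def Let_def by blast
  from tensor_relD[OF this] show ?thesis using assms
    by (simp add: tensor_def tensor_elem_def F.quot_smult[OF tensor_null_submodule] gen_closed)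
qed

lemma tensor_elem_addmap: "x \<in> carrier M \<Longrightarrow> addmap N T (te x)" "y \<in> carrier N \<Longrightarrow> addmap M T (\<lambda>x. te x y)"
  by (auto intro!: addmapI simp: tensor_elem_add_left tensor_elem_add_right)

lemma tensor_elem_zero: "y \<in> carrier N \<Longrightarrow> te \<zero>\<^bsub>M\<^esub> y = \<zero>\<^bsub>T\<^esub>" "x \<in> carrier M \<Longrightarrow> te x \<zero>\<^bsub>N\<^esub> = \<zero>\<^bsub>T\<^esub>"
  using addmap_zero[OF M.M.abelian_group_axioms T.M.abelian_group_axioms tensor_elem_addmap(2)]
    addmap_zero[OF N.M.abelian_group_axioms T.M.abelian_group_axioms tensor_elem_addmap(1)] by auto

text \<open>There is no scalar and no zero case: a scalar is absorbed by the left factor, and zero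
  is the tensor of two zeros.\<close>

lemma tensor_induct [consumes 1, case_names elem add]:
  assumes X: "X \<in> carrier T"
    and elem: "\<And>x y. x \<in> carrier M \<Longrightarrow> y \<in> carrier N \<Longrightarrow> P (te x y)"
    and add: "\<And>X Y. X \<in> carrier T \<Longrightarrow> Y \<in> carrier T \<Longrightarrow> P X \<Longrightarrow> P Y \<Longrightarrow> P (X \<oplus>\<^bsub>T\<^esub> Y)"
  shows "P X"
proof -
  let ?c = "\<lambda>g. tensor_null R M N +>\<^bsub>FT\<^esub> g"
  obtain g where g: "g \<in> carrier FT" "X = ?c g" using X by (auto simp: tensor_def F.quot_carrier)
  have "?c h \<in> carrier T" if "h \<in> carrier FT" for h using that by (auto simp: tensor_def F.quot_carrier)
  moreover have "?c (h \<oplus>\<^bsub>FT\<^esub> h') = ?c h \<oplus>\<^bsub>T\<^esub> ?c h'" if "h \<in> carrier FT" "h' \<in> carrier FT" for h h'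
    using that by (simp add: tensor_def F.quot_add[OF tensor_null_submodule])
  moreover have "P (?c (a \<odot>\<^bsub>FT\<^esub> gen z))" if az: "a \<in> carrier R" "z \<in> carrier M \<times> carrier N" for a z
  proof -
    obtain x y where xy: "z = (x, y)" "x \<in> carrier M" "y \<in> carrier N" using az by auto
    have "?c (a \<odot>\<^bsub>FT\<^esub> gen z) = te (a \<odot>\<^bsub>M\<^esub> x) y"
      using xy az by (simp add: tensor_elem_smult_left)
        (simp add: tensor_def tensor_elem_def F.quot_smult[OF tensor_null_submodule] gen_closed)
    thus ?thesis using elem xy az by simp
  qed
  moreover have "?c \<zero>\<^bsub>FT\<^esub> = te \<zero>\<^bsub>M\<^esub> \<zero>\<^bsub>N\<^esub>"
    by (simp add: tensor_elem_zero) (simp add: tensor_def F.quot_zero[OF tensor_null_submodule])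
  ultimately have "P (?c g)"
    using elem[OF M.M.zero_closed N.M.zero_closed] add
    by (intro M.R.free_module_induct[OF g(1), of "\<lambda>g. P (?c g)"]) metis+
  thus ?thesis using g by simp
qed

lemma tensor_lift_props:
  assumes P: "abelian_group P" and \<phi>: "balanced R M N P \<phi>"
  shows tensor_lift_addmap: "addmap T P (tensor_lift R M P \<phi>)"
    and tensor_lift_elem: "x \<in> carrier M \<Longrightarrow> y \<in> carrier N \<Longrightarrow> tensor_lift R M P \<phi> (te x y) = \<phi> x y"
proof -
  interpret P: abelian_group P by fact
  \<comment> \<open>The scalar moves into the left factor before \<open>\<phi>\<close> is applied,
    exactly as in \<open>tensor_lift\<close>; thus the lift is \<open>the_elem\<close> of the image
    of a coset under \<open>free_ext\<close>.\<close>
  let ?f = "\<lambda>z a. \<phi> (a \<odot>\<^bsub>M\<^esub> fst z) (snd z)"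
  let ?h = "free_ext R P ?f"
  note \<phi>c = addmap_closed[OF \<phi>[unfolded balanced_def, THEN conjunct1, rule_format]]
  note \<phi>r = addmap_add[OF \<phi>[unfolded balanced_def, THEN conjunct1, rule_format]]
  have \<phi>l: "\<phi> (x \<oplus>\<^bsub>M\<^esub> x') y = \<phi> x y \<oplus>\<^bsub>P\<^esub> \<phi> x' y"
    if "x \<in> carrier M" "x' \<in> carrier M" "y \<in> carrier N" for x x' y
    using \<phi> that by (auto simp: balanced_def addmap_def)
  have \<phi>b: "\<phi> (a \<odot>\<^bsub>M\<^esub> x) y = \<phi> x (a \<odot>\<^bsub>N\<^esub> y)" if "a \<in> carrier R" "x \<in> carrier M" "y \<in> carrier N" for a x y
    using \<phi> that by (auto simp: balanced_def)
  have f: "addmap R P (?f z)" if "z \<in> carrier M \<times> carrier N" for z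
    using that by (intro addmapI) (auto simp: M.smult_l_distr \<phi>c \<phi>l)
  note h = free_ext_addmap[where \<phi> = ?f and X = "carrier M \<times> carrier N", OF M.R.is_cring P f]
    and hg = free_ext_gen[where \<phi> = ?f and X = "carrier M \<times> carrier N", OF M.R.is_cring P f]
  have hg': "?h (a \<odot>\<^bsub>FT\<^esub> gen (x, y)) = \<phi> (a \<odot>\<^bsub>M\<^esub> x) y"
    if "a \<in> carrier R" "x \<in> carrier M" "y \<in> carrier N" for a x y using hg[of a "(x, y)"] that by auto
  note hm = addmap_minus[OF F.M.abelian_group_axioms P h]
  have rel: "?h (a \<odot>\<^bsub>FT\<^esub> r) = \<zero>\<^bsub>P\<^esub>" if a: "a \<in> carrier R" and r: "r \<in> tensor_rels R M N" for a r
  proof -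
    note s = F.smult_minus_distr F.smult_r_distr hm addmap_add[OF h] hg' gen_closed
      M.smult_r_distr N.smult_r_distr \<phi>l \<phi>r \<phi>c P.minus_eq_zero_iff \<phi>b F.smult_assoc1[symmetric] N.smult_assoc1[symmetric]
      M.R.m_comm
    from r consider
      (1) x x' y where "r = gen (x \<oplus>\<^bsub>M\<^esub> x', y) \<ominus>\<^bsub>FT\<^esub> (gen (x, y) \<oplus>\<^bsub>FT\<^esub> gen (x', y))"
        "x \<in> carrier M" "x' \<in> carrier M" "y \<in> carrier N"
      | (2) x y y' where "r = gen (x, y \<oplus>\<^bsub>N\<^esub> y') \<ominus>\<^bsub>FT\<^esub> (gen (x, y) \<oplus>\<^bsub>FT\<^esub> gen (x, y'))"
        "x \<in> carrier M" "y \<in> carrier N" "y' \<in> carrier N"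
      | (3) b x y where "r = gen (b \<odot>\<^bsub>M\<^esub> x, y) \<ominus>\<^bsub>FT\<^esub> (b \<odot>\<^bsub>FT\<^esub> gen (x, y))"
        "b \<in> carrier R" "x \<in> carrier M" "y \<in> carrier N"
      | (4) b x y where "r = gen (x, b \<odot>\<^bsub>N\<^esub> y) \<ominus>\<^bsub>FT\<^esub> (b \<odot>\<^bsub>FT\<^esub> gen (x, y))"
        "b \<in> carrier R" "x \<in> carrier M" "y \<in> carrier N"
      unfolding tensor_rels_def Let_def by blast
    thus ?thesis
    proof cases
      case 1
      thus ?thesis using a by (simp add: s)
    next
      case 2
      thus ?thesis using a by (simp add: s)
    next
      case 3
      thus ?thesis using a by (simp add: s)
    next
      case 4
      thus ?thesis using a by (simp add: s)
    qed
  qed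
  have ker: "?h x = \<zero>\<^bsub>P\<^esub>" if "x \<in> tensor_null R M N" for x
    using F.span_kernel[OF tensor_rels_subset P h rel] that by (simp add: tensor_null_def)
  have eq: "tensor_lift R M P \<phi> = (\<lambda>X. the_elem (?h ` X))"
    by (auto simp: tensor_lift_def free_ext_def fun_eq_iff)
  show "addmap T P (tensor_lift R M P \<phi>)"
    using F.the_elem_addmap[OF tensor_null_submodule P h ker] by (simp add: eq tensor_def)
  show "tensor_lift R M P \<phi> (te x y) = \<phi> x y" if "x \<in> carrier M" "y \<in> carrier N"
  proof -
    have "?h (gen (x, y)) = \<phi> x y" using hg'[OF M.R.one_closed that] that gen_closed by simp
    thus ?thesis using F.the_elem_coset[OF tensor_null_submodule P h ker gen_closed[OF that]]
      by (simp add: eq tensor_elem_def)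
  qed
qed

end

section \<open>Differential forms\<close>

locale kalgebra = cring R for R :: "('a, 'r) ring_scheme" (structure) and s :: "'k::field_char_0 \<Rightarrow> 'a" +
  assumes s_closed [simp, intro]: "s c \<in> carrier R"
    and s_add: "s (c + c') = s c \<oplus> s c'"
    and s_mult: "s (c * c') = s c \<otimes> s c'"
    and s_one: "s 1 = \<one>"
begin

abbreviation "FK \<equiv> free_module R (carrier R)"
abbreviation "\<Omega> \<equiv> kahler R s"
abbreviation "dK \<equiv> kahler_d R s"
abbreviation "genK \<equiv> free_gen R :: 'a \<Rightarrow> 'a \<Rightarrow> 'a"

sublocale FK: module R FK
  by (rule free_module_module)

lemma kahler_rels_subset: "kahler_rels R s \<subseteq> carrier FK"
  unfolding kahler_rels_def Let_def
  by (auto intro!: FK.M.minus_closed FK.M.a_closed FK.smult_closed free_gen_closed)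

lemma kahler_null_submodule: "submodule (kahler_null R s) R FK"
  unfolding kahler_null_def by (rule FK.span_submodule[OF kahler_rels_subset])

sublocale \<Omega>: module R \<Omega>
  unfolding kahler_def by (rule FK.quot_is_module[OF kahler_null_submodule])

lemma dK_closed [simp, intro]: "a \<in> carrier R \<Longrightarrow> dK a \<in> carrier \<Omega>"
  unfolding kahler_def kahler_d_def by (simp add: FK.quot_carrier free_gen_closed)

lemma kahler_relD:
  assumes "u \<ominus>\<^bsub>FK\<^esub> v \<in> kahler_rels R s" "u \<in> carrier FK" "v \<in> carrier FK"
  shows "kahler_null R s +>\<^bsub>FK\<^esub> u = kahler_null R s +>\<^bsub>FK\<^esub> v"
  using assms FK.coset_eq_iff[OF kahler_null_submodule] FK.span_superset
  unfolding kahler_null_def by blast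

lemma dK_add:
  assumes "a \<in> carrier R" "b \<in> carrier R"
  shows "dK (a \<oplus> b) = dK a \<oplus>\<^bsub>\<Omega>\<^esub> dK b"
proof -
  have "genK (a \<oplus> b) \<ominus>\<^bsub>FK\<^esub> (genK a \<oplus>\<^bsub>FK\<^esub> genK b) \<in> kahler_rels R s"
    using assms unfolding kahler_rels_def Let_def by blast
  from kahler_relD[OF this] show ?thesis using assms
    by (simp add: kahler_def kahler_d_def FK.quot_add[OF kahler_null_submodule] free_gen_closed)
qed

lemma dK_mult:
  assumes "a \<in> carrier R" "b \<in> carrier R"
  shows "dK (a \<otimes> b) = a \<odot>\<^bsub>\<Omega>\<^esub> dK b \<oplus>\<^bsub>\<Omega>\<^esub> b \<odot>\<^bsub>\<Omega>\<^esub> dK a"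
proof -
  have "genK (a \<otimes> b) \<ominus>\<^bsub>FK\<^esub> ((a \<odot>\<^bsub>FK\<^esub> genK b) \<oplus>\<^bsub>FK\<^esub> (b \<odot>\<^bsub>FK\<^esub> genK a)) \<in> kahler_rels R s"
    using assms unfolding kahler_rels_def Let_def by blast
  from kahler_relD[OF this] show ?thesis using assms
    by (simp add: kahler_def kahler_d_def FK.quot_add[OF kahler_null_submodule]
        FK.quot_smult[OF kahler_null_submodule] free_gen_closed)
qed

lemma dK_scalar: "dK (s c) = \<zero>\<^bsub>\<Omega>\<^esub>"
proof -
  have "genK (s c) \<in> kahler_rels R s"
    unfolding kahler_rels_def Let_def by blast
  hence "genK (s c) \<in> kahler_null R s" using FK.span_superset unfolding kahler_null_def by blast
  thus ?thesis using FK.coset_eq_self_iff[OF kahler_null_submodule free_gen_closed[OF s_closed]]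
    by (simp add: kahler_def kahler_d_def quot_module_def)
qed

lemma dK_one: "dK \<one> = \<zero>\<^bsub>\<Omega>\<^esub>"
  using dK_scalar[of 1] by (simp add: s_one)

lemma kahler_induct [consumes 1, case_names gen add]:
  assumes X: "X \<in> carrier \<Omega>"
    and elem: "\<And>a b. a \<in> carrier R \<Longrightarrow> b \<in> carrier R \<Longrightarrow> P (a \<odot>\<^bsub>\<Omega>\<^esub> dK b)"
    and add: "\<And>X Y. X \<in> carrier \<Omega> \<Longrightarrow> Y \<in> carrier \<Omega> \<Longrightarrow> P X \<Longrightarrow> P Y \<Longrightarrow> P (X \<oplus>\<^bsub>\<Omega>\<^esub> Y)"
  shows "P X"
proof -
  let ?c = "\<lambda>g. kahler_null R s +>\<^bsub>FK\<^esub> g"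
  obtain g where g: "g \<in> carrier FK" "X = ?c g" using X by (auto simp: kahler_def FK.quot_carrier)
  have "?c h \<in> carrier \<Omega>" if "h \<in> carrier FK" for h using that by (auto simp: kahler_def FK.quot_carrier)
  moreover have "?c (h \<oplus>\<^bsub>FK\<^esub> h') = ?c h \<oplus>\<^bsub>\<Omega>\<^esub> ?c h'" if "h \<in> carrier FK" "h' \<in> carrier FK" for h h'
    using that by (simp add: kahler_def FK.quot_add[OF kahler_null_submodule])
  moreover have "P (?c (a \<odot>\<^bsub>FK\<^esub> genK b))" if ab: "a \<in> carrier R" "b \<in> carrier R" for a b
  proof -
    have "?c (a \<odot>\<^bsub>FK\<^esub> genK b) = a \<odot>\<^bsub>\<Omega>\<^esub> dK b"
      using ab by (simp add: kahler_def kahler_d_def FK.quot_smult[OF kahler_null_submodule] free_gen_closed)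
    thus ?thesis using elem ab by simp
  qed
  moreover have "?c \<zero>\<^bsub>FK\<^esub> = \<zero> \<odot>\<^bsub>\<Omega>\<^esub> dK \<zero>"
    by simp (simp add: kahler_def FK.quot_zero[OF kahler_null_submodule])
  ultimately have "P (?c g)"
    using elem[OF zero_closed zero_closed] add
    by (intro free_module_induct[OF g(1), of "\<lambda>g. P (?c g)"]) metis+
  thus ?thesis using g by simp
qed

text \<open>\<open>\<phi> b a\<close> is the prescribed value at a db. The instances are
  \<open>d1\<close>, which is not linear, and the contraction of one-forms with a
  derivation.\<close>

definition kahler_lift :: "('b, 'p) ring_scheme \<Rightarrow> ('a \<Rightarrow> 'a \<Rightarrow> 'b) \<Rightarrow> ('a \<Rightarrow> 'a) set \<Rightarrow> 'b" where
  "kahler_lift G \<phi> X = the_elem (free_ext R G \<phi> ` X)"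

text \<open>The three conditions are the defining relations multiplied by c: the relation for c d(a
  + b), the product rule c d(ab) = ca db + cb da, and the vanishing of c d(s k).\<close>

lemma kahler_lift_props:
  assumes G: "abelian_group G" and \<phi>: "\<And>b. b \<in> carrier R \<Longrightarrow> addmap R G (\<phi> b)"
    and add: "\<And>a b c. a \<in> carrier R \<Longrightarrow> b \<in> carrier R \<Longrightarrow> c \<in> carrier R \<Longrightarrow> \<phi> (a \<oplus> b) c = \<phi> a c \<oplus>\<^bsub>G\<^esub> \<phi> b c"
    and mult: "\<And>a b c. a \<in> carrier R \<Longrightarrow> b \<in> carrier R \<Longrightarrow> c \<in> carrier R \<Longrightarrow>
      \<phi> (a \<otimes> b) c = \<phi> b (c \<otimes> a) \<oplus>\<^bsub>G\<^esub> \<phi> a (c \<otimes> b)"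
    and scal: "\<And>k c. c \<in> carrier R \<Longrightarrow> \<phi> (s k) c = \<zero>\<^bsub>G\<^esub>"
  shows kahler_lift_addmap: "addmap \<Omega> G (kahler_lift G \<phi>)"
    and kahler_lift_gen: "a \<in> carrier R \<Longrightarrow> b \<in> carrier R \<Longrightarrow> kahler_lift G \<phi> (a \<odot>\<^bsub>\<Omega>\<^esub> dK b) = \<phi> b a"
proof -
  interpret G: abelian_group G by fact
  let ?h = "free_ext R G \<phi>"
  note h = free_ext_addmap[OF is_cring G \<phi>] and hg = free_ext_gen[OF is_cring G \<phi>]
  note hm = addmap_minus[OF FK.M.abelian_group_axioms G h]
  have rel: "?h (a \<odot>\<^bsub>FK\<^esub> r) = \<zero>\<^bsub>G\<^esub>" if a: "a \<in> carrier R" and r: "r \<in> kahler_rels R s" for a r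
  proof -
    note s = FK.smult_minus_distr FK.smult_r_distr hm addmap_add[OF h] hg free_gen_closed
      addmap_closed[OF \<phi>] add mult scal G.minus_eq_zero_iff FK.smult_assoc1[symmetric]
    from r consider
      (1) x y where "r = genK (x \<oplus> y) \<ominus>\<^bsub>FK\<^esub> (genK x \<oplus>\<^bsub>FK\<^esub> genK y)" "x \<in> carrier R" "y \<in> carrier R"
      | (2) x y where "r = genK (x \<otimes> y) \<ominus>\<^bsub>FK\<^esub> ((x \<odot>\<^bsub>FK\<^esub> genK y) \<oplus>\<^bsub>FK\<^esub> (y \<odot>\<^bsub>FK\<^esub> genK x))"
         "x \<in> carrier R" "y \<in> carrier R"
      | (3) c where "r = genK (s c)"
      unfolding kahler_rels_def Let_def by blast
    thus ?thesis
    proof cases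
      case 1
      thus ?thesis using a by (simp add: s)
    next
      case 2
      thus ?thesis using a by (simp add: s)
    next
      case 3
      thus ?thesis using a by (simp add: s)
    qed
  qed
  have ker: "?h x = \<zero>\<^bsub>G\<^esub>" if "x \<in> kahler_null R s" for x
    using FK.span_kernel[OF kahler_rels_subset G h rel] that by (simp add: kahler_null_def)
  show "addmap \<Omega> G (kahler_lift G \<phi>)"
    using FK.the_elem_addmap[OF kahler_null_submodule G h ker] by (simp add: kahler_lift_def[abs_def] kahler_def)
  show "kahler_lift G \<phi> (a \<odot>\<^bsub>\<Omega>\<^esub> dK b) = \<phi> b a" if ab: "a \<in> carrier R" "b \<in> carrier R"
  proof -
    have c: "a \<odot>\<^bsub>FK\<^esub> genK b \<in> carrier FK" using ab by (simp add: free_gen_closed)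
    have "a \<odot>\<^bsub>\<Omega>\<^esub> dK b = kahler_null R s +>\<^bsub>FK\<^esub> (a \<odot>\<^bsub>FK\<^esub> genK b)"
      using ab by (simp add: kahler_def kahler_d_def FK.quot_smult[OF kahler_null_submodule] free_gen_closed)
    thus ?thesis using hg ab
      by (simp add: kahler_lift_def FK.the_elem_coset[OF kahler_null_submodule G h ker c])
  qed
qed

end

subsection \<open>The free algebra\<close>

lemma module_update:
  assumes "module R M"
  shows "module R (M\<lparr>mult := m, one := e\<rparr>)"
proof -
  interpret module R M by fact
  show ?thesis
  proof (rule moduleI)
    show "abelian_group (M\<lparr>mult := m, one := e\<rparr>)"
    proof (rule abelian_groupI)
      fix x assume "x \<in> carrier (M\<lparr>mult := m, one := e\<rparr>)"
      thus "\<exists>y\<in>carrier (M\<lparr>mult := m, one := e\<rparr>). y \<oplus>\<^bsub>M\<lparr>mult := m, one := e\<rparr>\<^esub> x = \<zero>\<^bsub>M\<lparr>mult := m, one := e\<rparr>\<^esub>"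
        by (auto intro!: bexI[of _ "\<ominus>\<^bsub>M\<^esub> x"] simp: M.l_neg)
    qed (simp_all add: M.a_ac)
  qed (simp_all add: R.is_cring smult_l_distr smult_r_distr smult_assoc1)
qed

context cring
begin

definition conv :: "('x list \<Rightarrow> 'a) \<Rightarrow> ('x list \<Rightarrow> 'a) \<Rightarrow> 'x list \<Rightarrow> 'a" where
  "conv g h w = (\<Oplus> i\<in>{..length w}. g (take i w) \<otimes> h (drop i w))"

context
  fixes g h :: "'x list \<Rightarrow> 'a"
  assumes g: "\<And>v. g v \<in> carrier R" and h: "\<And>v. h v \<in> carrier R"
begin

lemma conv_closed: "conv g h w \<in> carrier R"
  unfolding conv_def using g h by (intro finsum_closed) auto

lemma conv_Nil: "conv g h [] = g [] \<otimes> h []"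
  unfolding conv_def using g h by simp

text \<open>The split point 0 is separated; the remaining sum is a convolution with \<open>g\<close>
  shifted by the first letter. This recursion replaces manipulations of the sum over split points in
  the proofs that follow.\<close>

lemma conv_Cons: "conv g h (x # w) = g [] \<otimes> h (x # w) \<oplus> conv (\<lambda>v. g (x # v)) h w"
proof -
  have "conv g h (x # w) = (\<Oplus> i\<in>{..length w}. g (take (Suc i) (x # w)) \<otimes> h (drop (Suc i) (x # w)))
      \<oplus> g (take 0 (x # w)) \<otimes> h (drop 0 (x # w))"
    unfolding conv_def length_Cons by (rule finsum_Suc2) (use g h in auto)
  thus ?thesis using g h by (simp add: conv_def a_comm)
qed

end

lemma conv_zero_left: "(\<And>v. h v \<in> carrier R) \<Longrightarrow> conv (\<lambda>v. \<zero>) h w = \<zero>"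
  unfolding conv_def by simp

lemma conv_add_left:
  assumes "\<And>v. g v \<in> carrier R" "\<And>v. h v \<in> carrier R" "\<And>v. k v \<in> carrier R"
  shows "conv (\<lambda>v. g v \<oplus> h v) k w = conv g k w \<oplus> conv h k w"
  unfolding conv_def using assms by (subst finsum_addf[symmetric]) (auto simp: l_distr)

lemma conv_add_right:
  assumes "\<And>v. g v \<in> carrier R" "\<And>v. h v \<in> carrier R" "\<And>v. k v \<in> carrier R"
  shows "conv k (\<lambda>v. g v \<oplus> h v) w = conv k g w \<oplus> conv k h w"
  unfolding conv_def using assms by (subst finsum_addf[symmetric]) (auto simp: r_distr)

lemma conv_smult_left:
  assumes "\<And>v. g v \<in> carrier R" "\<And>v. h v \<in> carrier R" "a \<in> carrier R"
  shows "conv (\<lambda>v. a \<otimes> g v) h w = a \<otimes> conv g h w"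
  unfolding conv_def using assms by (subst finsum_rdistr) (auto simp: m_assoc)

lemma conv_smult_right:
  assumes "\<And>v. g v \<in> carrier R" "\<And>v. h v \<in> carrier R" "a \<in> carrier R"
  shows "conv g (\<lambda>v. a \<otimes> h v) w = a \<otimes> conv g h w"
  unfolding conv_def using assms by (subst finsum_rdistr) (auto simp: m_lcomm)

text \<open>Induction on the word with \<open>g\<close> arbitrary: the shift of
  \<open>conv g h\<close> by a letter is again a combination of convolutions, in which
  \<open>g\<close> is replaced by its own shift.\<close>

lemma conv_assoc:
  assumes "\<And>v. g v \<in> carrier R" "\<And>v. h v \<in> carrier R" "\<And>v. k v \<in> carrier R"
  shows "conv (conv g h) k w = conv g (conv h k) w"
  using assms(1)
proof (induction w arbitrary: g)
  case Nil
  thus ?case using assms by (simp add: conv_Nil conv_closed m_assoc)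
next
  case (Cons x w)
  have gx: "\<And>v. g (x # v) \<in> carrier R" using Cons by simp
  have "conv (conv g h) k (x # w) = conv g h [] \<otimes> k (x # w) \<oplus> conv (\<lambda>v. conv g h (x # v)) k w"
    using assms Cons.prems by (intro conv_Cons conv_closed)
  also have "(\<lambda>v. conv g h (x # v)) = (\<lambda>v. g [] \<otimes> h (x # v) \<oplus> conv (\<lambda>v. g (x # v)) h v)"
    using assms Cons.prems by (simp add: conv_Cons)
  also have "conv \<dots> k w = g [] \<otimes> conv (\<lambda>v. h (x # v)) k w \<oplus> conv (conv (\<lambda>v. g (x # v)) h) k w"
    using assms Cons.prems gx
    by (subst conv_add_left) (auto simp: conv_closed conv_smult_left)
  also have "conv (conv (\<lambda>v. g (x # v)) h) k w = conv (\<lambda>v. g (x # v)) (conv h k) w"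
    using gx by (rule Cons.IH)
  finally show ?case using assms Cons.prems gx
    by (simp add: conv_Cons conv_Nil conv_closed r_distr m_assoc a_assoc)
qed

lemma free_gen_val: "free_gen R x y \<in> carrier R"
  by (simp add: free_gen_def)

lemma conv_one_left:
  assumes "\<And>v. h v \<in> carrier R"
  shows "conv (free_gen R []) h w = h w"
proof (cases w)
  case Nil
  thus ?thesis using assms by (simp add: conv_Nil free_gen_val) (simp add: free_gen_def)
next
  case (Cons x v)
  have "(\<lambda>v. free_gen R [] (x # v)) = (\<lambda>v. \<zero>)" by (simp add: free_gen_def)
  thus ?thesis using Cons assms by (simp add: conv_Cons free_gen_val conv_zero_left) (simp add: free_gen_def)
qed

lemma conv_gen_gen: "conv (free_gen R u) (free_gen R v) w = free_gen R (u @ v) w"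
proof (induction w arbitrary: u)
  case Nil
  thus ?case by (simp add: conv_Nil free_gen_val) (simp add: free_gen_def)
next
  case (Cons y w)
  show ?case
  proof (cases u)
    case Nil
    thus ?thesis by (simp add: conv_one_left free_gen_val)
  next
    case u: (Cons x u')
    have "(\<lambda>v. free_gen R u (y # v)) = (if x = y then free_gen R u' else (\<lambda>v. \<zero>))"
      by (auto simp: u free_gen_def fun_eq_iff)
    thus ?thesis using u Cons.IH[of u']
      by (simp add: conv_Cons free_gen_val conv_zero_left) (auto simp: free_gen_def)
  qed
qed

lemma conv_one_right:
  assumes "\<And>v. h v \<in> carrier R"
  shows "conv h (free_gen R []) w = h w"
  using assms
proof (induction w arbitrary: h)
  case Nil
  thus ?case by (simp add: conv_Nil free_gen_val) (simp add: free_gen_def)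
next
  case (Cons x w)
  thus ?case using Cons.IH[of "\<lambda>v. h (x # v)"] by (simp add: conv_Cons free_gen_val) (simp add: free_gen_def)
qed

lemma free_algebra_simps [simp]:
  "carrier (free_algebra R X) = carrier (free_module R (lists X))"
  "\<zero>\<^bsub>free_algebra R X\<^esub> = \<zero>\<^bsub>free_module R (lists X)\<^esub>"
  "g \<oplus>\<^bsub>free_algebra R X\<^esub> h = g \<oplus>\<^bsub>free_module R (lists X)\<^esub> h"
  "a \<odot>\<^bsub>free_algebra R X\<^esub> h = a \<odot>\<^bsub>free_module R (lists X)\<^esub> h"
  "g \<otimes>\<^bsub>free_algebra R X\<^esub> h = conv g h"
  "\<one>\<^bsub>free_algebra R X\<^esub> = free_gen R []"
  by (auto simp: free_algebra_def conv_def fun_eq_iff)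

lemma free_algebra_module: "module R (free_algebra R X)"
  unfolding free_algebra_def by (rule module_update[OF free_module_module])

text \<open>A word in the support of the product is a concatenation of words from the two supports,
  hence one of finitely many.\<close>

lemma conv_in_free_module:
  assumes g: "g \<in> carrier (free_module R (lists X))" and h: "h \<in> carrier (free_module R (lists X))"
  shows "conv g h \<in> carrier (free_module R (lists X))"
proof -
  let ?S = "(\<lambda>(u, v). u @ v) ` ({u. g u \<noteq> \<zero>} \<times> {v. h v \<noteq> \<zero>})"
  note gv = free_module_val[OF g] and hv = free_module_val[OF h]
  have z: "w \<in> ?S" if "conv g h w \<noteq> \<zero>" for w
  proof (rule ccontr)
    assume w: "w \<notin> ?S"
    have "g (take i w) \<otimes> h (drop i w) = \<zero>" for i
    proof (rule ccontr)
      assume "g (take i w) \<otimes> h (drop i w) \<noteq> \<zero>"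
      hence "g (take i w) \<noteq> \<zero>" "h (drop i w) \<noteq> \<zero>" using gv hv by auto
      hence "(\<lambda>(u, v). u @ v) (take i w, drop i w) \<in> ?S" by blast
      thus False using w by simp
    qed
    hence "conv g h w = \<zero>" unfolding conv_def by simp
    thus False using that by simp
  qed
  have "finite ?S" using g h by (auto simp: free_module_def)
  hence "finite {w. conv g h w \<noteq> \<zero>}" by (rule finite_subset[rotated]) (use z in auto)
  moreover have "?S \<subseteq> lists X"
  proof
    fix w assume "w \<in> ?S"
    then obtain u v where uv: "w = u @ v" "g u \<noteq> \<zero>" "h v \<noteq> \<zero>" by auto
    have "u \<in> lists X" "v \<in> lists X" using uv g h by (auto simp: free_module_def)
    thus "w \<in> lists X" using uv by simp
  qed
  moreover have "conv g h w \<in> carrier R" for w using gv hv by (rule conv_closed)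
  moreover have "conv g h w = \<zero>" if "w \<notin> lists X" for w
    using z[of w] that calculation(2) by blast
  ultimately show ?thesis by (simp add: free_module_def)
qed

lemma free_algebra_ring: "ring (free_algebra R X)"
proof -
  interpret F: module R "free_algebra R X" by (rule free_algebra_module)
  show ?thesis
  proof (rule ringI)
    show "abelian_group (free_algebra R X)" by (rule F.M.abelian_group_axioms)
    show "monoid (free_algebra R X)"
    proof (rule monoidI)
      fix g h k assume "g \<in> carrier (free_algebra R X)" "h \<in> carrier (free_algebra R X)" "k \<in> carrier (free_algebra R X)"
      hence "\<And>v. g v \<in> carrier R" "\<And>v. h v \<in> carrier R" "\<And>v. k v \<in> carrier R"
        by (simp_all add: free_module_val)
      hence "conv (conv g h) k w = conv g (conv h k) w" for w by (rule conv_assoc)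
      thus "g \<otimes>\<^bsub>free_algebra R X\<^esub> h \<otimes>\<^bsub>free_algebra R X\<^esub> k = g \<otimes>\<^bsub>free_algebra R X\<^esub> (h \<otimes>\<^bsub>free_algebra R X\<^esub> k)"
        by (simp add: fun_eq_iff)
    next
      fix g assume "g \<in> carrier (free_algebra R X)"
      hence "\<And>v. g v \<in> carrier R" by (simp add: free_module_val)
      hence "conv (free_gen R []) g w = g w" "conv g (free_gen R []) w = g w" for w
        using conv_one_left[of g] conv_one_right[of g] by auto
      thus "\<one>\<^bsub>free_algebra R X\<^esub> \<otimes>\<^bsub>free_algebra R X\<^esub> g = g" "g \<otimes>\<^bsub>free_algebra R X\<^esub> \<one>\<^bsub>free_algebra R X\<^esub> = g"
        by (simp_all add: fun_eq_iff)
    qed (auto intro: conv_in_free_module free_gen_closed)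
  next
    fix g h k assume "g \<in> carrier (free_algebra R X)" "h \<in> carrier (free_algebra R X)" "k \<in> carrier (free_algebra R X)"
    hence v: "\<And>v. g v \<in> carrier R" "\<And>v. h v \<in> carrier R" "\<And>v. k v \<in> carrier R"
      by (simp_all add: free_module_val)
    hence "conv (\<lambda>v. g v \<oplus> h v) k w = conv g k w \<oplus> conv h k w"
      "conv k (\<lambda>v. g v \<oplus> h v) w = conv k g w \<oplus> conv k h w" for w
      using conv_add_left[of g h k] conv_add_right[of g h k] by auto
    thus "(g \<oplus>\<^bsub>free_algebra R X\<^esub> h) \<otimes>\<^bsub>free_algebra R X\<^esub> k =
        g \<otimes>\<^bsub>free_algebra R X\<^esub> k \<oplus>\<^bsub>free_algebra R X\<^esub> h \<otimes>\<^bsub>free_algebra R X\<^esub> k"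
      "k \<otimes>\<^bsub>free_algebra R X\<^esub> (g \<oplus>\<^bsub>free_algebra R X\<^esub> h) =
        k \<otimes>\<^bsub>free_algebra R X\<^esub> g \<oplus>\<^bsub>free_algebra R X\<^esub> k \<otimes>\<^bsub>free_algebra R X\<^esub> h"
      by (simp_all add: free_module_def fun_eq_iff)
  qed
qed

lemma free_algebra_smult:
  assumes "g \<in> carrier (free_algebra R X)" "h \<in> carrier (free_algebra R X)" "a \<in> carrier R"
  shows "(a \<odot>\<^bsub>free_algebra R X\<^esub> g) \<otimes>\<^bsub>free_algebra R X\<^esub> h = a \<odot>\<^bsub>free_algebra R X\<^esub> (g \<otimes>\<^bsub>free_algebra R X\<^esub> h)"
    and "g \<otimes>\<^bsub>free_algebra R X\<^esub> (a \<odot>\<^bsub>free_algebra R X\<^esub> h) = a \<odot>\<^bsub>free_algebra R X\<^esub> (g \<otimes>\<^bsub>free_algebra R X\<^esub> h)"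
proof -
  have v: "\<And>v. g v \<in> carrier R" "\<And>v. h v \<in> carrier R"
    using assms by (simp_all add: free_module_val)
  show "(a \<odot>\<^bsub>free_algebra R X\<^esub> g) \<otimes>\<^bsub>free_algebra R X\<^esub> h = a \<odot>\<^bsub>free_algebra R X\<^esub> (g \<otimes>\<^bsub>free_algebra R X\<^esub> h)"
    and "g \<otimes>\<^bsub>free_algebra R X\<^esub> (a \<odot>\<^bsub>free_algebra R X\<^esub> h) = a \<odot>\<^bsub>free_algebra R X\<^esub> (g \<otimes>\<^bsub>free_algebra R X\<^esub> h)"
    using conv_smult_left[of g h a] conv_smult_right[of g h a] v assms(3)
    by (simp_all add: free_module_def fun_eq_iff)
qed

end

subsection \<open>Exterior algebras\<close>

text \<open>The sign (-1)^p with the parity as a Boolean: two signs compose to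
  \<open>b \<noteq> c\<close>, so they are settled by simplification or case distinction instead of
  powers of -1.\<close>

definition (in ring) alt_sign :: "bool \<Rightarrow> 'a \<Rightarrow> 'a" where
  "alt_sign b x = (if b then \<ominus> x else x)"

context ring
begin

lemma alt_sign_closed [simp, intro]: "x \<in> carrier R \<Longrightarrow> alt_sign b x \<in> carrier R"
  by (simp add: alt_sign_def)

lemma alt_sign_add: "x \<in> carrier R \<Longrightarrow> y \<in> carrier R \<Longrightarrow> alt_sign b (x \<oplus> y) = alt_sign b x \<oplus> alt_sign b y"
  by (simp add: alt_sign_def minus_add a_comm)

lemma alt_sign_mult_left: "x \<in> carrier R \<Longrightarrow> y \<in> carrier R \<Longrightarrow> alt_sign b x \<otimes> y = alt_sign b (x \<otimes> y)"
  by (simp add: alt_sign_def l_minus)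

lemma alt_sign_mult_right: "x \<in> carrier R \<Longrightarrow> y \<in> carrier R \<Longrightarrow> x \<otimes> alt_sign b y = alt_sign b (x \<otimes> y)"
  by (simp add: alt_sign_def r_minus)

lemma alt_sign_alt_sign [simp]: "x \<in> carrier R \<Longrightarrow> alt_sign b (alt_sign c x) = alt_sign (b \<noteq> c) x"
  by (auto simp: alt_sign_def minus_minus)

lemma alt_sign_False [simp]: "alt_sign False x = x"
  by (simp add: alt_sign_def)

lemma alt_sign_True [simp]: "alt_sign True x = \<ominus> x"
  by (simp add: alt_sign_def)

lemma alt_sign_zero [simp]: "alt_sign b \<zero> = \<zero>"
  by (simp add: alt_sign_def)

end

locale exterior = M: module R M for R :: "('a, 'r) ring_scheme" and M :: "('a, 'm, 's) module_scheme"
begin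

abbreviation "FA \<equiv> free_algebra R (carrier M)"
abbreviation "L \<equiv> ext_algebra R M"
abbreviation "I \<equiv> ext_ideal R M"
abbreviation "genA \<equiv> free_gen R :: 'm list \<Rightarrow> 'm list \<Rightarrow> 'a"
abbreviation "word \<equiv> ext_word R M"
abbreviation "\<pi> \<equiv> \<lambda>g. I +>\<^bsub>FA\<^esub> g"

sublocale FA: module R FA
  by (rule M.R.free_algebra_module)

sublocale FR: ring FA
  by (rule M.R.free_algebra_ring)

lemma genA_closed: "xs \<in> lists (carrier M) \<Longrightarrow> genA xs \<in> carrier FA"
  using M.R.free_gen_closed[of xs "lists (carrier M)"] by simp

lemma genA_closed1 [simp]: "x \<in> carrier M \<Longrightarrow> genA [x] \<in> carrier FA"
  by (rule genA_closed) simp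

lemma ext_rels_subset: "ext_rels R M \<subseteq> carrier FA"
proof -
  have "genA [x, x] \<in> carrier FA" if "x \<in> carrier M" for x using that by (intro genA_closed) simp
  thus ?thesis
    unfolding ext_rels_def Let_def
    by (auto intro!: FA.M.minus_closed FA.M.a_closed FA.smult_closed genA_closed1
        simp del: M.R.free_algebra_simps)
qed

sublocale I: ideal I FA
  unfolding ext_ideal_def by (rule FR.genideal_ideal[OF ext_rels_subset])

lemma ext_ideal_submodule: "submodule I R FA"
proof (intro submodule.intro submodule_axioms.intro)
  show "subgroup I (add_monoid FA)" by (rule I.a_subgroup)
  fix a g assume a: "a \<in> carrier R" and g: "g \<in> I"
  have gF: "g \<in> carrier FA" using g I.Icarr by blast
  have "a \<odot>\<^bsub>FA\<^esub> g = (a \<odot>\<^bsub>FA\<^esub> \<one>\<^bsub>FA\<^esub>) \<otimes>\<^bsub>FA\<^esub> g"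
    using M.R.free_algebra_smult(1)[OF FR.one_closed gF a] FR.l_one[OF gF] by metis
  also have "\<dots> \<in> I" using a g by (intro I.I_l_closed FA.smult_closed FR.one_closed)
  finally show "a \<odot>\<^bsub>FA\<^esub> g \<in> I" .
qed

lemma ext_algebra_simps:
  "carrier L = carrier (quot_module FA I)"
  "\<zero>\<^bsub>L\<^esub> = \<zero>\<^bsub>quot_module FA I\<^esub>"
  "x \<oplus>\<^bsub>L\<^esub> y = x \<oplus>\<^bsub>quot_module FA I\<^esub> y"
  "a \<odot>\<^bsub>L\<^esub> x = a \<odot>\<^bsub>quot_module FA I\<^esub> x"
  "x \<otimes>\<^bsub>L\<^esub> y = rcoset_mult FA I x y"
  "\<one>\<^bsub>L\<^esub> = \<pi> \<one>\<^bsub>FA\<^esub>"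
  unfolding ext_algebra_def Let_def by (simp_all del: M.R.free_algebra_simps)

sublocale L: module R L
  unfolding ext_algebra_def Let_def
  by (rule module_update[OF FA.quot_is_module[OF ext_ideal_submodule]])

lemma pi_carrier: "carrier L = \<pi> ` carrier FA"
  by (simp add: ext_algebra_simps FA.quot_carrier del: M.R.free_algebra_simps)

lemma pi_closed [simp]: "g \<in> carrier FA \<Longrightarrow> \<pi> g \<in> carrier L"
  by (simp only: pi_carrier) (rule imageI)

lemma pi_add: "g \<in> carrier FA \<Longrightarrow> h \<in> carrier FA \<Longrightarrow> \<pi> (g \<oplus>\<^bsub>FA\<^esub> h) = \<pi> g \<oplus>\<^bsub>L\<^esub> \<pi> h"
  by (simp only: ext_algebra_simps FA.quot_add[OF ext_ideal_submodule])

lemma pi_smult: "a \<in> carrier R \<Longrightarrow> g \<in> carrier FA \<Longrightarrow> \<pi> (a \<odot>\<^bsub>FA\<^esub> g) = a \<odot>\<^bsub>L\<^esub> \<pi> g"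
  by (simp only: ext_algebra_simps FA.quot_smult[OF ext_ideal_submodule])

lemma pi_mult: "g \<in> carrier FA \<Longrightarrow> h \<in> carrier FA \<Longrightarrow> \<pi> (g \<otimes>\<^bsub>FA\<^esub> h) = \<pi> g \<otimes>\<^bsub>L\<^esub> \<pi> h"
  by (simp only: ext_algebra_simps I.rcoset_mult_add)

lemma pi_eq_zero_iff: "g \<in> carrier FA \<Longrightarrow> \<pi> g = \<zero>\<^bsub>L\<^esub> \<longleftrightarrow> g \<in> I"
  using FA.coset_eq_self_iff[OF ext_ideal_submodule, of g]
  by (simp only: ext_algebra_simps FA.quot_zero[OF ext_ideal_submodule] FA.coset_zero[OF ext_ideal_submodule])

sublocale LR: ring L
proof (rule ringI)
  show "abelian_group L" by (rule L.M.abelian_group_axioms)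
  show "monoid L"
  proof (rule monoidI)
    fix x y z assume "x \<in> carrier L" "y \<in> carrier L" "z \<in> carrier L"
    then obtain g h k where gh: "g \<in> carrier FA" "h \<in> carrier FA" "k \<in> carrier FA"
      and "x = \<pi> g" "y = \<pi> h" "z = \<pi> k" unfolding pi_carrier by blast
    thus "x \<otimes>\<^bsub>L\<^esub> y \<otimes>\<^bsub>L\<^esub> z = x \<otimes>\<^bsub>L\<^esub> (y \<otimes>\<^bsub>L\<^esub> z)"
      by (simp only: pi_mult[symmetric] FR.m_closed FR.m_assoc)
  next
    fix x y assume "x \<in> carrier L" "y \<in> carrier L"
    then obtain g h where gh: "g \<in> carrier FA" "h \<in> carrier FA"
      and "x = \<pi> g" "y = \<pi> h" unfolding pi_carrier by blast
    thus "x \<otimes>\<^bsub>L\<^esub> y \<in> carrier L"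
      by (simp only: pi_mult[symmetric] FR.m_closed pi_closed)
  next
    fix x assume "x \<in> carrier L"
    then obtain g where gh: "g \<in> carrier FA" and "x = \<pi> g" unfolding pi_carrier by blast
    thus "\<one>\<^bsub>L\<^esub> \<otimes>\<^bsub>L\<^esub> x = x" "x \<otimes>\<^bsub>L\<^esub> \<one>\<^bsub>L\<^esub> = x"
      by (simp_all only: ext_algebra_simps(6) pi_mult[symmetric] FR.one_closed FR.l_one FR.r_one)
  next
    show "\<one>\<^bsub>L\<^esub> \<in> carrier L" by (simp only: ext_algebra_simps(6) pi_closed FR.one_closed)
  qed
next
  fix x y z assume "x \<in> carrier L" "y \<in> carrier L" "z \<in> carrier L"
  then obtain g h k where gh: "g \<in> carrier FA" "h \<in> carrier FA" "k \<in> carrier FA"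
    and "x = \<pi> g" "y = \<pi> h" "z = \<pi> k" unfolding pi_carrier by blast
  thus "(x \<oplus>\<^bsub>L\<^esub> y) \<otimes>\<^bsub>L\<^esub> z = x \<otimes>\<^bsub>L\<^esub> z \<oplus>\<^bsub>L\<^esub> y \<otimes>\<^bsub>L\<^esub> z"
    "z \<otimes>\<^bsub>L\<^esub> (x \<oplus>\<^bsub>L\<^esub> y) = z \<otimes>\<^bsub>L\<^esub> x \<oplus>\<^bsub>L\<^esub> z \<otimes>\<^bsub>L\<^esub> y"
    by (simp_all only: pi_mult[symmetric] pi_add[symmetric] FR.m_closed FA.M.a_closed FR.l_distr FR.r_distr)
qed

lemma smult_mult_left:
  assumes "a \<in> carrier R" "x \<in> carrier L" "y \<in> carrier L"
  shows "(a \<odot>\<^bsub>L\<^esub> x) \<otimes>\<^bsub>L\<^esub> y = a \<odot>\<^bsub>L\<^esub> (x \<otimes>\<^bsub>L\<^esub> y)"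
proof -
  obtain g h where gh: "g \<in> carrier FA" "h \<in> carrier FA"
    and xy: "x = \<pi> g" "y = \<pi> h" using assms unfolding pi_carrier by blast
  show ?thesis unfolding xy using gh assms(1)
    by (simp only: pi_mult[symmetric] pi_smult[symmetric] FR.m_closed FA.smult_closed M.R.free_algebra_smult)
qed

lemma smult_mult_right:
  assumes "a \<in> carrier R" "x \<in> carrier L" "y \<in> carrier L"
  shows "x \<otimes>\<^bsub>L\<^esub> (a \<odot>\<^bsub>L\<^esub> y) = a \<odot>\<^bsub>L\<^esub> (x \<otimes>\<^bsub>L\<^esub> y)"
proof -
  obtain g h where gh: "g \<in> carrier FA" "h \<in> carrier FA"
    and xy: "x = \<pi> g" "y = \<pi> h" using assms unfolding pi_carrier by blast
  show ?thesis unfolding xy using gh assms(1)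
    by (simp only: pi_mult[symmetric] pi_smult[symmetric] FR.m_closed FA.smult_closed M.R.free_algebra_smult)
qed

lemma alt_sign_smult: "a \<in> carrier R \<Longrightarrow> x \<in> carrier L \<Longrightarrow> a \<odot>\<^bsub>L\<^esub> LR.alt_sign b x = LR.alt_sign b (a \<odot>\<^bsub>L\<^esub> x)"
  by (simp add: LR.alt_sign_def L.smult_r_minus)

lemma word_pi: "word xs = \<pi> (genA xs)"
  by (simp add: ext_word_def)

lemma word_closed [simp, intro]: "xs \<in> lists (carrier M) \<Longrightarrow> word xs \<in> carrier L"
  unfolding word_pi by (intro pi_closed genA_closed)

lemma word_Nil: "word [] = \<one>\<^bsub>L\<^esub>"
  by (simp add: word_pi ext_algebra_simps)

lemma word_append:
  assumes "xs \<in> lists (carrier M)" "ys \<in> lists (carrier M)"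
  shows "word (xs @ ys) = word xs \<otimes>\<^bsub>L\<^esub> word ys"
proof -
  have "genA (xs @ ys) = genA xs \<otimes>\<^bsub>FA\<^esub> genA ys" by (simp add: M.R.conv_gen_gen fun_eq_iff)
  thus ?thesis using pi_mult genA_closed assms by (simp only: word_pi)
qed

abbreviation "\<iota> x \<equiv> word [x]"

lemma iota_closed [simp, intro]: "x \<in> carrier M \<Longrightarrow> \<iota> x \<in> carrier L"
  by (rule word_closed) simp

lemma word_Cons: "x \<in> carrier M \<Longrightarrow> xs \<in> lists (carrier M) \<Longrightarrow> word (x # xs) = \<iota> x \<otimes>\<^bsub>L\<^esub> word xs"
  using word_append[of "[x]" xs] by simp

lemma ext_relD:
  assumes "u \<ominus>\<^bsub>FA\<^esub> v \<in> ext_rels R M" "u \<in> carrier FA" "v \<in> carrier FA"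
  shows "\<pi> u = \<pi> v"
  using assms FA.coset_eq_iff[OF ext_ideal_submodule] FR.genideal_self[OF ext_rels_subset]
  unfolding ext_ideal_def by blast

lemma iota_add:
  assumes "x \<in> carrier M" "y \<in> carrier M"
  shows "\<iota> (x \<oplus>\<^bsub>M\<^esub> y) = \<iota> x \<oplus>\<^bsub>L\<^esub> \<iota> y"
proof -
  have "genA [x \<oplus>\<^bsub>M\<^esub> y] \<ominus>\<^bsub>FA\<^esub> (genA [x] \<oplus>\<^bsub>FA\<^esub> genA [y]) \<in> ext_rels R M"
    using assms unfolding ext_rels_def Let_def by blast
  from ext_relD[OF this] show ?thesis using assms unfolding word_pi
    by (simp only: pi_add[symmetric] genA_closed1 M.M.a_closed FA.M.a_closed)
qed

lemma iota_smult:
  assumes "a \<in> carrier R" "x \<in> carrier M"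
  shows "\<iota> (a \<odot>\<^bsub>M\<^esub> x) = a \<odot>\<^bsub>L\<^esub> \<iota> x"
proof -
  have "genA [a \<odot>\<^bsub>M\<^esub> x] \<ominus>\<^bsub>FA\<^esub> (a \<odot>\<^bsub>FA\<^esub> genA [x]) \<in> ext_rels R M"
    using assms unfolding ext_rels_def Let_def by blast
  from ext_relD[OF this] show ?thesis using assms unfolding word_pi
    by (simp only: pi_smult[symmetric] genA_closed1 M.smult_closed FA.smult_closed)
qed

lemma iota_addmap: "addmap M L (\<lambda>x. \<iota> x)"
  by (rule addmapI) (auto simp: iota_add)

lemma iota_square:
  assumes "x \<in> carrier M"
  shows "\<iota> x \<otimes>\<^bsub>L\<^esub> \<iota> x = \<zero>\<^bsub>L\<^esub>"
proof -
  have c: "genA [x, x] \<in> carrier FA" using assms by (intro genA_closed) simp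
  have "genA [x, x] \<in> ext_rels R M"
    using assms unfolding ext_rels_def Let_def by blast
  hence "genA [x, x] \<in> I" using FR.genideal_self[OF ext_rels_subset] unfolding ext_ideal_def by blast
  hence "word [x, x] = \<zero>\<^bsub>L\<^esub>" using pi_eq_zero_iff[OF c] by (simp add: word_pi)
  thus ?thesis using word_Cons[of x "[x]"] assms by simp
qed

text \<open>Polarization of \<open>iota_square\<close> at x + y.\<close>

lemma iota_anticomm:
  assumes "x \<in> carrier M" "y \<in> carrier M"
  shows "\<iota> x \<otimes>\<^bsub>L\<^esub> \<iota> y = \<ominus>\<^bsub>L\<^esub> (\<iota> y \<otimes>\<^bsub>L\<^esub> \<iota> x)"
proof -
  have "(\<iota> x \<oplus>\<^bsub>L\<^esub> \<iota> y) \<otimes>\<^bsub>L\<^esub> (\<iota> x \<oplus>\<^bsub>L\<^esub> \<iota> y) = \<zero>\<^bsub>L\<^esub>"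
    using iota_square[of "x \<oplus>\<^bsub>M\<^esub> y"] assms by (simp add: iota_add)
  hence "\<iota> x \<otimes>\<^bsub>L\<^esub> \<iota> y \<oplus>\<^bsub>L\<^esub> \<iota> y \<otimes>\<^bsub>L\<^esub> \<iota> x = \<zero>\<^bsub>L\<^esub>"
    using assms by (simp add: LR.l_distr LR.r_distr iota_square L.M.a_comm)
  thus ?thesis using assms by (simp add: L.M.minus_equality)
qed

lemma ext_induct [consumes 1, case_names word add]:
  assumes X: "X \<in> carrier L"
    and elem: "\<And>a xs. a \<in> carrier R \<Longrightarrow> xs \<in> lists (carrier M) \<Longrightarrow> P (a \<odot>\<^bsub>L\<^esub> word xs)"
    and add: "\<And>X Y. X \<in> carrier L \<Longrightarrow> Y \<in> carrier L \<Longrightarrow> P X \<Longrightarrow> P Y \<Longrightarrow> P (X \<oplus>\<^bsub>L\<^esub> Y)"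
  shows "P X"
proof -
  obtain g where g: "g \<in> carrier FA" "X = \<pi> g" using X unfolding pi_carrier by blast
  have "\<pi> \<zero>\<^bsub>FA\<^esub> = \<zero>\<^bsub>R\<^esub> \<odot>\<^bsub>L\<^esub> word []"
    using pi_smult[of "\<zero>\<^bsub>R\<^esub>" "genA []"] genA_closed[of "[]"] FA.smult_l_null[of "genA []"] by (metis lists.Nil word_pi M.R.zero_closed)
  hence 0: "P (\<pi> \<zero>\<^bsub>FA\<^esub>)" using elem[OF M.R.zero_closed lists.Nil] by metis
  have 1: "P (\<pi> (a \<odot>\<^bsub>FA\<^esub> genA xs))" if "a \<in> carrier R" "xs \<in> lists (carrier M)" for a xs
    using elem[OF that] pi_smult[OF that(1) genA_closed[OF that(2)]] by (simp only: word_pi)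
  have 2: "P (\<pi> (g \<oplus>\<^bsub>FA\<^esub> h))" if "g \<in> carrier FA" "h \<in> carrier FA" "P (\<pi> g)" "P (\<pi> h)" for g h
    using add[OF pi_closed[OF that(1)] pi_closed[OF that(2)]] that by (simp only: pi_add)
  have "P (\<pi> g)"
    by (rule M.R.free_module_induct[of g "lists (carrier M)" "\<lambda>g. P (\<pi> g)"])
      (use 0 1 2 g in simp_all)
  thus ?thesis using g by simp
qed

subsection \<open>The grading\<close>

abbreviation "\<Lambda> p \<equiv> ext_power R M p"

lemma words_subset: "{word xs | xs. xs \<in> lists (carrier M) \<and> length xs = p} \<subseteq> carrier L"
  by auto

lemma power_submodule: "submodule (\<Lambda> p) R L"
  unfolding ext_power_def by (rule L.span_submodule[OF words_subset])

lemma power_carrier: "X \<in> \<Lambda> p \<Longrightarrow> X \<in> carrier L"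
  using L.submoduleE(1)[OF power_submodule] by blast

lemma power_add: "X \<in> \<Lambda> p \<Longrightarrow> Y \<in> \<Lambda> p \<Longrightarrow> X \<oplus>\<^bsub>L\<^esub> Y \<in> \<Lambda> p"
  using L.submoduleE(5)[OF power_submodule] by blast

lemma power_smult: "a \<in> carrier R \<Longrightarrow> X \<in> \<Lambda> p \<Longrightarrow> a \<odot>\<^bsub>L\<^esub> X \<in> \<Lambda> p"
  using L.submoduleE(4)[OF power_submodule] by blast

lemma power_inv: "X \<in> \<Lambda> p \<Longrightarrow> \<ominus>\<^bsub>L\<^esub> X \<in> \<Lambda> p"
  using L.submoduleE(3)[OF power_submodule] by blast

lemma power_zero: "\<zero>\<^bsub>L\<^esub> \<in> \<Lambda> p"
  by (rule additive_subgroup.zero_closed[OF abelian_subgroup.axioms(1)[OF L.submodule_abelian_subgroup[OF power_submodule]]])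

lemma power_word: "xs \<in> lists (carrier M) \<Longrightarrow> word xs \<in> \<Lambda> (length xs)"
  unfolding ext_power_def by (rule subsetD[OF L.span_superset]) blast

lemma power_word': "xs \<in> lists (carrier M) \<Longrightarrow> length xs = p \<Longrightarrow> word xs \<in> \<Lambda> p"
  using power_word by blast

lemma power_one: "\<one>\<^bsub>L\<^esub> \<in> \<Lambda> 0"
  using power_word[of "[]"] by (simp add: word_Nil)

lemma power_finsum: "(\<And>i. i \<in> A \<Longrightarrow> f i \<in> \<Lambda> p) \<Longrightarrow> (\<Oplus>\<^bsub>L\<^esub> i\<in>A. f i) \<in> \<Lambda> p"
proof (induction A rule: infinite_finite_induct)
  case (insert x A)
  have "f \<in> A \<rightarrow> carrier L" "f x \<in> carrier L" using insert.prems power_carrier by blast+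
  thus ?case using insert by (simp add: power_add)
qed (auto simp: power_zero)

lemma power_induct [consumes 1, case_names word add]:
  assumes X: "X \<in> \<Lambda> p"
    and elem: "\<And>a xs. a \<in> carrier R \<Longrightarrow> xs \<in> lists (carrier M) \<Longrightarrow> length xs = p \<Longrightarrow> P (a \<odot>\<^bsub>L\<^esub> word xs)"
    and add: "\<And>X Y. X \<in> carrier L \<Longrightarrow> Y \<in> carrier L \<Longrightarrow> P X \<Longrightarrow> P Y \<Longrightarrow> P (X \<oplus>\<^bsub>L\<^esub> Y)"
  shows "P X"
proof (rule L.span_induct[OF words_subset X[unfolded ext_power_def]])
  \<comment> \<open>Zero is obtained as the zero multiple of some word of length p, so that the rule
    needs no zero case.\<close>
  have "replicate p \<zero>\<^bsub>M\<^esub> \<in> lists (carrier M)" by (induction p) auto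
  from elem[OF M.R.zero_closed this] this show "P \<zero>\<^bsub>L\<^esub>" by simp
qed (use elem add in auto)

lemma power_mult:
  assumes "X \<in> \<Lambda> p" "Y \<in> \<Lambda> q"
  shows "X \<otimes>\<^bsub>L\<^esub> Y \<in> \<Lambda> (p + q)"
  using assms(1)
proof (induction rule: power_induct)
  case (word a xs)
  from assms(2) have "word xs \<otimes>\<^bsub>L\<^esub> Y \<in> \<Lambda> (p + q)"
  proof (induction rule: power_induct)
    case w: (word b ys)
    have "word xs \<otimes>\<^bsub>L\<^esub> word ys \<in> \<Lambda> (p + q)"
      using power_word'[of "xs @ ys" "p + q"] w word by (simp add: word_append)
    thus ?case using w word by (simp add: smult_mult_right word_closed power_smult)
  next
    case (add X Y)
    thus ?case using word by (simp add: LR.r_distr word_closed power_add)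
  qed
  thus ?case using word power_carrier[OF assms(2)] by (simp add: smult_mult_left word_closed power_smult)
next
  case (add X Y)
  thus ?case using power_carrier[OF assms(2)] by (simp add: LR.l_distr power_add)
qed

lemma iota_power: "x \<in> carrier M \<Longrightarrow> \<iota> x \<in> \<Lambda> 1"
  using power_word[of "[x]"] by simp

lemma iota_word_comm:
  assumes "x \<in> carrier M" "ys \<in> lists (carrier M)"
  shows "\<iota> x \<otimes>\<^bsub>L\<^esub> word ys = LR.alt_sign (odd (length ys)) (word ys \<otimes>\<^bsub>L\<^esub> \<iota> x)"
  using assms(2)
proof (induction ys)
  case Nil
  thus ?case using assms by (simp add: word_Nil)
next
  case (Cons y ys)
  hence y: "y \<in> carrier M" "ys \<in> lists (carrier M)" by auto
  have "\<iota> x \<otimes>\<^bsub>L\<^esub> word (y # ys) = (\<iota> x \<otimes>\<^bsub>L\<^esub> \<iota> y) \<otimes>\<^bsub>L\<^esub> word ys"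
    using y assms by (simp add: word_Cons[OF y] word_closed LR.m_assoc)
  also have "\<dots> = (\<ominus>\<^bsub>L\<^esub> (\<iota> y \<otimes>\<^bsub>L\<^esub> \<iota> x)) \<otimes>\<^bsub>L\<^esub> word ys"
    by (simp only: iota_anticomm[OF assms(1) y(1)])
  also have "\<dots> = \<ominus>\<^bsub>L\<^esub> (\<iota> y \<otimes>\<^bsub>L\<^esub> (\<iota> x \<otimes>\<^bsub>L\<^esub> word ys))"
    using y assms by (simp add: word_closed LR.m_assoc LR.l_minus)
  also have "\<dots> = \<ominus>\<^bsub>L\<^esub> (LR.alt_sign (odd (length ys)) (word (y # ys) \<otimes>\<^bsub>L\<^esub> \<iota> x))"
    using Cons y assms by (simp add: word_closed word_Cons[OF y] LR.m_assoc LR.alt_sign_mult_right)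
  also have "\<dots> = LR.alt_sign (odd (length (y # ys))) (word (y # ys) \<otimes>\<^bsub>L\<^esub> \<iota> x)"
    using y assms by (auto simp: LR.alt_sign_def word_closed)
  finally show ?case .
qed

lemma word_word_comm:
  assumes "xs \<in> lists (carrier M)" "ys \<in> lists (carrier M)"
  shows "word xs \<otimes>\<^bsub>L\<^esub> word ys = LR.alt_sign (odd (length xs) \<and> odd (length ys)) (word ys \<otimes>\<^bsub>L\<^esub> word xs)"
  using assms(1)
proof (induction xs)
  case Nil
  thus ?case using assms by (simp add: word_Nil word_closed)
next
  case (Cons x xs)
  hence x: "x \<in> carrier M" "xs \<in> lists (carrier M)" by auto
  note c = word_closed[OF x(2)] word_closed[OF assms(2)] iota_closed[OF x(1)]
  have "word (x # xs) \<otimes>\<^bsub>L\<^esub> word ys = \<iota> x \<otimes>\<^bsub>L\<^esub> (word xs \<otimes>\<^bsub>L\<^esub> word ys)"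
    using x c by (simp add: word_Cons[OF x] LR.m_assoc)
  also have "\<dots> = LR.alt_sign (odd (length xs) \<and> odd (length ys)) ((\<iota> x \<otimes>\<^bsub>L\<^esub> word ys) \<otimes>\<^bsub>L\<^esub> word xs)"
    using Cons x c by (simp add: LR.m_assoc LR.alt_sign_mult_right)
  also have "\<dots> = LR.alt_sign (odd (length (x # xs)) \<and> odd (length ys)) (word ys \<otimes>\<^bsub>L\<^esub> word (x # xs))"
  proof -
    have wc: "word ys \<otimes>\<^bsub>L\<^esub> word (x # xs) \<in> carrier L" using x assms by simp
    have "(\<iota> x \<otimes>\<^bsub>L\<^esub> word ys) \<otimes>\<^bsub>L\<^esub> word xs = LR.alt_sign (odd (length ys)) (word ys \<otimes>\<^bsub>L\<^esub> \<iota> x) \<otimes>\<^bsub>L\<^esub> word xs"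
      by (simp only: iota_word_comm[OF x(1) assms(2)])
    also have "\<dots> = LR.alt_sign (odd (length ys)) (word ys \<otimes>\<^bsub>L\<^esub> word (x # xs))"
      using x c by (simp add: word_Cons[OF x] LR.m_assoc LR.alt_sign_mult_left)
    finally have e: "(\<iota> x \<otimes>\<^bsub>L\<^esub> word ys) \<otimes>\<^bsub>L\<^esub> word xs = \<dots>" .
    show ?thesis unfolding e using wc
      by (cases "odd (length ys)"; cases "odd (length xs)") (simp_all add: L.M.minus_minus)
  qed
  finally show ?case .
qed

text \<open>Graded commutativity is additive in both factors and so descends from words, where the
  letters are moved across one at a time.\<close>

lemma power_comm:
  assumes "X \<in> \<Lambda> p" "Y \<in> \<Lambda> q"
  shows "X \<otimes>\<^bsub>L\<^esub> Y = LR.alt_sign (odd p \<and> odd q) (Y \<otimes>\<^bsub>L\<^esub> X)"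
  using assms(1)
proof (induction rule: power_induct)
  case (word a xs)
  from assms(2) have "word xs \<otimes>\<^bsub>L\<^esub> Y = LR.alt_sign (odd p \<and> odd q) (Y \<otimes>\<^bsub>L\<^esub> word xs)"
  proof (induction rule: power_induct)
    case w: (word b ys)
    thus ?case using w word word_word_comm[of xs ys]
      by (simp add: smult_mult_right smult_mult_left word_closed alt_sign_smult)
  next
    case (add X Y)
    thus ?case using word by (simp add: LR.r_distr LR.l_distr word_closed LR.alt_sign_add)
  qed
  thus ?case using word power_carrier[OF assms(2)]
    by (simp add: smult_mult_left smult_mult_right word_closed alt_sign_smult)
next
  case (add X Y)
  thus ?case using power_carrier[OF assms(2)] by (simp add: LR.l_distr LR.r_distr LR.alt_sign_add)
qed

end

subsection \<open>The de Rham differential\<close>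

sublocale kalgebra \<subseteq> exterior R "kahler R s"
  by (rule exterior.intro) (rule \<Omega>.module_axioms)

context exterior
begin

lemma word_mid:
  assumes "u \<in> lists (carrier M)" "x \<in> carrier M" "v \<in> lists (carrier M)"
  shows "word (u @ x # v) = word u \<otimes>\<^bsub>L\<^esub> (\<iota> x \<otimes>\<^bsub>L\<^esub> word v)"
  using assms word_append[of u "x # v"] word_Cons[OF assms(2,3)] by simp

lemma genA_append: "genA (u @ v) = genA u \<otimes>\<^bsub>FA\<^esub> genA v"
  by (simp add: M.R.conv_gen_gen fun_eq_iff)

lemma neg_one_pow: "X \<in> carrier L \<Longrightarrow> ((\<ominus>\<^bsub>L\<^esub> \<one>\<^bsub>L\<^esub>) [^]\<^bsub>L\<^esub> (p::nat)) \<otimes>\<^bsub>L\<^esub> X = LR.alt_sign (odd p) X"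
  by (induction p arbitrary: X) (auto simp: LR.m_assoc LR.l_minus LR.r_minus LR.alt_sign_def L.M.minus_minus)

lemma minus_smult: "a \<in> carrier R \<Longrightarrow> x \<in> carrier L \<Longrightarrow> y \<in> carrier L \<Longrightarrow>
    a \<odot>\<^bsub>L\<^esub> (x \<ominus>\<^bsub>L\<^esub> y) = a \<odot>\<^bsub>L\<^esub> x \<ominus>\<^bsub>L\<^esub> a \<odot>\<^bsub>L\<^esub> y"
  by (rule L.smult_minus_distr)

end

section \<open>The differential of one-forms and of words in one-forms\<close>

context kalgebra
begin

lemma iota_dK_anticomm:
  assumes "a \<in> carrier R" "b \<in> carrier R"
  shows "\<iota> (dK a) \<otimes>\<^bsub>L\<^esub> \<iota> (dK b) = \<ominus>\<^bsub>L\<^esub> (\<iota> (dK b) \<otimes>\<^bsub>L\<^esub> \<iota> (dK a))"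
  using assms by (intro iota_anticomm) auto

text \<open>The value on one-forms forced by Leibniz and square zero: d(a db) = da db.\<close>

definition d1 :: "('a \<Rightarrow> 'a) set \<Rightarrow> 'a form" where
  "d1 = kahler_lift L (\<lambda>b a. \<iota> (dK a) \<otimes>\<^bsub>L\<^esub> \<iota> (dK b))"

lemma iota_dK_mult:
  assumes "a \<in> carrier R" "b \<in> carrier R"
  shows "\<iota> (dK (a \<otimes> b)) = a \<odot>\<^bsub>L\<^esub> \<iota> (dK b) \<oplus>\<^bsub>L\<^esub> b \<odot>\<^bsub>L\<^esub> \<iota> (dK a)"
  using assms by (simp add: dK_mult iota_add iota_smult)

lemma iota_dK_add:
  assumes "a \<in> carrier R" "b \<in> carrier R"
  shows "\<iota> (dK (a \<oplus> b)) = \<iota> (dK a) \<oplus>\<^bsub>L\<^esub> \<iota> (dK b)"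
  using assms by (simp add: dK_add iota_add)

lemma iota_zero: "\<iota> \<zero>\<^bsub>\<Omega>\<^esub> = \<zero>\<^bsub>L\<^esub>"
  using addmap_zero[OF \<Omega>.M.abelian_group_axioms L.M.abelian_group_axioms iota_addmap] .

lemma d1_props:
  shows d1_addmap: "addmap \<Omega> L d1"
    and d1_gen: "a \<in> carrier R \<Longrightarrow> b \<in> carrier R \<Longrightarrow> d1 (a \<odot>\<^bsub>\<Omega>\<^esub> dK b) = \<iota> (dK a) \<otimes>\<^bsub>L\<^esub> \<iota> (dK b)"
proof -
  let ?\<phi> = "\<lambda>b a. \<iota> (dK a) \<otimes>\<^bsub>L\<^esub> \<iota> (dK b)"
  have 1: "addmap R L (?\<phi> b)" if "b \<in> carrier R" for b
    using that by (intro addmapI) (auto simp: iota_dK_add LR.l_distr)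
  have 2: "?\<phi> (a \<oplus> b) c = ?\<phi> a c \<oplus>\<^bsub>L\<^esub> ?\<phi> b c" if "a \<in> carrier R" "b \<in> carrier R" "c \<in> carrier R" for a b c
    using that by (simp add: iota_dK_add LR.r_distr)
  have 3: "?\<phi> (a \<otimes> b) c = ?\<phi> b (c \<otimes> a) \<oplus>\<^bsub>L\<^esub> ?\<phi> a (c \<otimes> b)"
    if "a \<in> carrier R" "b \<in> carrier R" "c \<in> carrier R" for a b c
  proof -
    note c = that iota_closed[OF dK_closed[OF that(1)]] iota_closed[OF dK_closed[OF that(2)]] iota_closed[OF dK_closed[OF that(3)]]
    have "?\<phi> b (c \<otimes> a) \<oplus>\<^bsub>L\<^esub> ?\<phi> a (c \<otimes> b) =
      (c \<odot>\<^bsub>L\<^esub> ?\<phi> b a \<oplus>\<^bsub>L\<^esub> a \<odot>\<^bsub>L\<^esub> ?\<phi> b c) \<oplus>\<^bsub>L\<^esub> (c \<odot>\<^bsub>L\<^esub> ?\<phi> a b \<oplus>\<^bsub>L\<^esub> b \<odot>\<^bsub>L\<^esub> ?\<phi> a c)"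
      using c by (simp add: iota_dK_mult LR.l_distr smult_mult_left)
    \<comment> \<open>The two mixed terms c da db and c db da cancel by anticommutativity; what is
      left is the product rule for d(ab) applied in the second factor.\<close>
    also have "\<dots> = a \<odot>\<^bsub>L\<^esub> ?\<phi> b c \<oplus>\<^bsub>L\<^esub> b \<odot>\<^bsub>L\<^esub> ?\<phi> a c"
      unfolding iota_dK_anticomm[OF that(1,2)] using c
      by (simp add: L.smult_r_minus L.M.a_ac L.M.r_neg L.M.r_neg1 L.M.r_neg2)
    also have "\<dots> = ?\<phi> (a \<otimes> b) c"
      using c by (simp add: iota_dK_mult LR.r_distr smult_mult_right)
    finally show ?thesis by simp
  qed
  have 4: "?\<phi> (s k) c = \<zero>\<^bsub>L\<^esub>" if "c \<in> carrier R" for k c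
    using that by (simp add: dK_scalar iota_zero)
  show "addmap \<Omega> L d1"
    unfolding d1_def by (rule kahler_lift_addmap[OF L.M.abelian_group_axioms 1 2 3 4])
  show "d1 (a \<odot>\<^bsub>\<Omega>\<^esub> dK b) = ?\<phi> b a" if "a \<in> carrier R" "b \<in> carrier R"
    unfolding d1_def by (rule kahler_lift_gen[where \<phi> = ?\<phi>, OF L.M.abelian_group_axioms 1 2 3 4 that])
qed

lemma d1_closed [simp, intro]: "x \<in> carrier \<Omega> \<Longrightarrow> d1 x \<in> carrier L"
  by (rule addmap_closed[OF d1_addmap])

lemma d1_add: "x \<in> carrier \<Omega> \<Longrightarrow> y \<in> carrier \<Omega> \<Longrightarrow> d1 (x \<oplus>\<^bsub>\<Omega>\<^esub> y) = d1 x \<oplus>\<^bsub>L\<^esub> d1 y"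
  by (rule addmap_add[OF d1_addmap])

lemma d1_smult:
  assumes "a \<in> carrier R" "x \<in> carrier \<Omega>"
  shows "d1 (a \<odot>\<^bsub>\<Omega>\<^esub> x) = \<iota> (dK a) \<otimes>\<^bsub>L\<^esub> \<iota> x \<oplus>\<^bsub>L\<^esub> a \<odot>\<^bsub>L\<^esub> d1 x"
  using assms(2)
proof (induction rule: kahler_induct)
  case (gen c b)
  have "a \<odot>\<^bsub>\<Omega>\<^esub> (c \<odot>\<^bsub>\<Omega>\<^esub> dK b) = (a \<otimes> c) \<odot>\<^bsub>\<Omega>\<^esub> dK b" using gen assms by (simp add: \<Omega>.smult_assoc1)
  thus ?case using gen assms
    by (simp add: d1_gen iota_dK_mult iota_smult LR.l_distr smult_mult_left smult_mult_right L.M.a_comm)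
next
  case (add x y)
  thus ?case using assms
    by (simp add: \<Omega>.smult_r_distr d1_add iota_add LR.r_distr L.smult_r_distr L.M.a_ac)
qed

lemma d1_power: "x \<in> carrier \<Omega> \<Longrightarrow> d1 x \<in> \<Lambda> 2"
proof (induction rule: kahler_induct)
  case (gen a b)
  have "\<iota> (dK a) \<otimes>\<^bsub>L\<^esub> \<iota> (dK b) \<in> \<Lambda> (1 + 1)" using gen by (intro power_mult iota_power) auto
  thus ?case using gen by (simp add: d1_gen numeral_2_eq_2)
qed (simp add: d1_add power_add)

lemma d1_dK: "a \<in> carrier R \<Longrightarrow> d1 (dK a) = \<zero>\<^bsub>L\<^esub>"
  using d1_gen[OF one_closed, of a] by (simp add: dK_one iota_zero)

text \<open>Graded Leibniz rule at the first factor of a wedge of one-forms; the minus sign is due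
  to that factor having degree one.\<close>

primrec wd :: "('a \<Rightarrow> 'a) set list \<Rightarrow> 'a form" where
  "wd [] = \<zero>\<^bsub>L\<^esub>"
| "wd (x # xs) = d1 x \<otimes>\<^bsub>L\<^esub> word xs \<ominus>\<^bsub>L\<^esub> \<iota> x \<otimes>\<^bsub>L\<^esub> wd xs"

abbreviation "WS \<equiv> lists (carrier \<Omega>)"

lemma wd_closed [simp, intro]: "xs \<in> WS \<Longrightarrow> wd xs \<in> carrier L"
  by (induction xs) (auto intro!: L.M.minus_closed LR.m_closed)

lemma wd_power: "xs \<in> WS \<Longrightarrow> wd xs \<in> \<Lambda> (Suc (length xs))"
proof (induction xs)
  case (Cons x xs)
  hence x: "x \<in> carrier \<Omega>" "xs \<in> WS" by auto
  have "d1 x \<otimes>\<^bsub>L\<^esub> word xs \<in> \<Lambda> (2 + length xs)"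
    by (rule power_mult[OF d1_power[OF x(1)] power_word[OF x(2)]])
  moreover have "\<iota> x \<otimes>\<^bsub>L\<^esub> wd xs \<in> \<Lambda> (1 + Suc (length xs))"
    by (rule power_mult[OF iota_power[OF x(1)] Cons.IH[OF x(2)]])
  ultimately show ?case by (simp add: a_minus_def power_add power_inv)
qed (simp add: power_zero)

lemma wd_append:
  assumes "xs \<in> WS" "ys \<in> WS"
  shows "wd (xs @ ys) = wd xs \<otimes>\<^bsub>L\<^esub> word ys \<oplus>\<^bsub>L\<^esub> LR.alt_sign (odd (length xs)) (word xs \<otimes>\<^bsub>L\<^esub> wd ys)"
  using assms(1)
proof (induction xs)
  case Nil
  thus ?case using assms by (simp add: word_Nil)
next
  case (Cons x xs)
  hence x: "x \<in> carrier \<Omega>" "xs \<in> WS" by auto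
  note c = word_closed[OF x(2)] word_closed[OF assms(2)] iota_closed[OF x(1)] wd_closed[OF x(2)] wd_closed[OF assms(2)]
    d1_closed[OF x(1)]
  let ?b = "odd (length xs)"
  have "wd ((x # xs) @ ys) = d1 x \<otimes>\<^bsub>L\<^esub> (word xs \<otimes>\<^bsub>L\<^esub> word ys) \<oplus>\<^bsub>L\<^esub>
      \<ominus>\<^bsub>L\<^esub> (\<iota> x \<otimes>\<^bsub>L\<^esub> (wd xs \<otimes>\<^bsub>L\<^esub> word ys) \<oplus>\<^bsub>L\<^esub> \<iota> x \<otimes>\<^bsub>L\<^esub> LR.alt_sign ?b (word xs \<otimes>\<^bsub>L\<^esub> wd ys))"
    using Cons.IH x assms c by (simp add: word_append a_minus_def LR.r_distr)
  also have "\<dots> = (d1 x \<otimes>\<^bsub>L\<^esub> (word xs \<otimes>\<^bsub>L\<^esub> word ys) \<oplus>\<^bsub>L\<^esub> \<ominus>\<^bsub>L\<^esub> (\<iota> x \<otimes>\<^bsub>L\<^esub> (wd xs \<otimes>\<^bsub>L\<^esub> word ys))) \<oplus>\<^bsub>L\<^esub>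
      \<ominus>\<^bsub>L\<^esub> (\<iota> x \<otimes>\<^bsub>L\<^esub> LR.alt_sign ?b (word xs \<otimes>\<^bsub>L\<^esub> wd ys))"
    using c by (simp add: L.M.minus_add L.M.a_ac)
  also have "\<ominus>\<^bsub>L\<^esub> (\<iota> x \<otimes>\<^bsub>L\<^esub> LR.alt_sign ?b (word xs \<otimes>\<^bsub>L\<^esub> wd ys)) =
      LR.alt_sign (odd (length (x # xs))) (word (x # xs) \<otimes>\<^bsub>L\<^esub> wd ys)"
    using c by (cases ?b) (simp_all add: word_Cons[OF x] LR.m_assoc LR.r_minus L.M.minus_minus)
  also have "d1 x \<otimes>\<^bsub>L\<^esub> (word xs \<otimes>\<^bsub>L\<^esub> word ys) \<oplus>\<^bsub>L\<^esub> \<ominus>\<^bsub>L\<^esub> (\<iota> x \<otimes>\<^bsub>L\<^esub> (wd xs \<otimes>\<^bsub>L\<^esub> word ys)) = wd (x # xs) \<otimes>\<^bsub>L\<^esub> word ys"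
    using c by (simp add: a_minus_def LR.l_distr LR.l_minus LR.m_assoc)
  finally show ?case .
qed

lemma wd_mid:
  assumes "u \<in> WS" "x \<in> carrier \<Omega>" "v \<in> WS"
  shows "wd (u @ x # v) = wd u \<otimes>\<^bsub>L\<^esub> (\<iota> x \<otimes>\<^bsub>L\<^esub> word v) \<oplus>\<^bsub>L\<^esub>
    LR.alt_sign (odd (length u)) (word u \<otimes>\<^bsub>L\<^esub> (d1 x \<otimes>\<^bsub>L\<^esub> word v \<ominus>\<^bsub>L\<^esub> \<iota> x \<otimes>\<^bsub>L\<^esub> wd v))"
  using assms wd_append[of u "x # v"] by (simp add: word_Cons[OF assms(2,3)])

lemma wd_mid_add:
  assumes "u \<in> WS" "x \<in> carrier \<Omega>" "y \<in> carrier \<Omega>" "v \<in> WS"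
  shows "wd (u @ (x \<oplus>\<^bsub>\<Omega>\<^esub> y) # v) = wd (u @ x # v) \<oplus>\<^bsub>L\<^esub> wd (u @ y # v)"
proof -
  note c = word_closed[OF assms(1)] word_closed[OF assms(4)] iota_closed[OF assms(2)] iota_closed[OF assms(3)]
    wd_closed[OF assms(1)] wd_closed[OF assms(4)] d1_closed[OF assms(2)] d1_closed[OF assms(3)]
  show ?thesis using assms c
    by (simp add: wd_mid d1_add iota_add LR.l_distr LR.r_distr a_minus_def LR.alt_sign_add L.M.minus_add L.M.a_ac)
qed

text \<open>The sign from differentiating past \<open>u\<close> is undone by moving da back across
  \<open>u\<close>. Hence the result does not depend on which factor carries the scalar.\<close>

lemma wd_mid_smult:
  assumes "u \<in> WS" "a \<in> carrier R" "x \<in> carrier \<Omega>" "v \<in> WS"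
  shows "wd (u @ (a \<odot>\<^bsub>\<Omega>\<^esub> x) # v) = \<iota> (dK a) \<otimes>\<^bsub>L\<^esub> word (u @ x # v) \<oplus>\<^bsub>L\<^esub> a \<odot>\<^bsub>L\<^esub> wd (u @ x # v)"
proof -
  have da: "\<iota> (dK a) \<in> carrier L" using assms by simp
  note c = da word_closed[OF assms(1)] word_closed[OF assms(4)] iota_closed[OF assms(3)]
    wd_closed[OF assms(1)] wd_closed[OF assms(4)] d1_closed[OF assms(3)] assms
  let ?b = "odd (length u)"
  have "wd (u @ (a \<odot>\<^bsub>\<Omega>\<^esub> x) # v) = wd u \<otimes>\<^bsub>L\<^esub> (a \<odot>\<^bsub>L\<^esub> (\<iota> x \<otimes>\<^bsub>L\<^esub> word v)) \<oplus>\<^bsub>L\<^esub>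
     LR.alt_sign ?b (word u \<otimes>\<^bsub>L\<^esub> (\<iota> (dK a) \<otimes>\<^bsub>L\<^esub> (\<iota> x \<otimes>\<^bsub>L\<^esub> word v) \<oplus>\<^bsub>L\<^esub>
        a \<odot>\<^bsub>L\<^esub> (d1 x \<otimes>\<^bsub>L\<^esub> word v \<ominus>\<^bsub>L\<^esub> \<iota> x \<otimes>\<^bsub>L\<^esub> wd v)))"
    using c by (simp add: wd_mid d1_smult iota_smult LR.l_distr smult_mult_left LR.m_assoc minus_smult)
      (simp add: a_minus_def L.M.a_assoc)
  also have "\<dots> = LR.alt_sign ?b (word u \<otimes>\<^bsub>L\<^esub> \<iota> (dK a)) \<otimes>\<^bsub>L\<^esub> (\<iota> x \<otimes>\<^bsub>L\<^esub> word v) \<oplus>\<^bsub>L\<^esub> a \<odot>\<^bsub>L\<^esub> wd (u @ x # v)"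
    using c by (simp add: wd_mid LR.r_distr smult_mult_right LR.alt_sign_add L.smult_r_distr alt_sign_smult
        LR.alt_sign_mult_left LR.m_assoc L.M.a_ac)
  also have "LR.alt_sign ?b (word u \<otimes>\<^bsub>L\<^esub> \<iota> (dK a)) = \<iota> (dK a) \<otimes>\<^bsub>L\<^esub> word u"
    using iota_word_comm[of "dK a" u] assms by simp
  finally show ?thesis using c by (simp add: word_mid LR.m_assoc)
qed

text \<open>d(x x) = dx x - x dx vanishes because \<open>d1 x\<close> has even degree and commutes
  with x; where the derivative falls on \<open>u\<close> or \<open>v\<close>, the factor x x
  remains.\<close>

lemma wd_mid_square:
  assumes "u \<in> WS" "x \<in> carrier \<Omega>" "v \<in> WS"
  shows "wd (u @ x # x # v) = \<zero>\<^bsub>L\<^esub>"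
proof -
  note c = word_closed[OF assms(1)] word_closed[OF assms(3)] iota_closed[OF assms(2)]
    wd_closed[OF assms(1)] wd_closed[OF assms(3)] d1_closed[OF assms(2)] assms
  have xx: "\<iota> x \<otimes>\<^bsub>L\<^esub> (\<iota> x \<otimes>\<^bsub>L\<^esub> Y) = \<zero>\<^bsub>L\<^esub>" if "Y \<in> carrier L" for Y
    using LR.m_assoc[of "\<iota> x" "\<iota> x" Y] that c iota_square[OF assms(2)] by simp
  have dx: "\<iota> x \<otimes>\<^bsub>L\<^esub> (d1 x \<otimes>\<^bsub>L\<^esub> word v) = d1 x \<otimes>\<^bsub>L\<^esub> (\<iota> x \<otimes>\<^bsub>L\<^esub> word v)"
    using power_comm[OF iota_power[OF assms(2)] d1_power[OF assms(2)]] c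
      LR.m_assoc[of "\<iota> x" "d1 x" "word v"] LR.m_assoc[of "d1 x" "\<iota> x" "word v"] by simp
  have "wd (x # x # v) = \<zero>\<^bsub>L\<^esub>"
    using c by (simp add: word_Cons[OF assms(2,3)] a_minus_def LR.r_distr LR.r_minus xx dx L.M.r_neg)
  moreover have "word (x # x # v) = \<zero>\<^bsub>L\<^esub>"
    using c word_Cons[of x "x # v"] word_Cons[of x v] by (simp add: xx)
  ultimately show ?thesis using wd_append[of u "x # x # v"] c by (simp del: wd.simps)
qed

text \<open>Defined on the free algebra but with values in the forms, since \<open>d1\<close> takes
  values only there. Coefficient and word are differentiated separately, which is additive in the
  coefficient.\<close>

definition dF :: "(('a \<Rightarrow> 'a) set list \<Rightarrow> 'a) \<Rightarrow> 'a form" where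
  "dF = free_ext R L (\<lambda>xs a. \<iota> (dK a) \<otimes>\<^bsub>L\<^esub> word xs \<oplus>\<^bsub>L\<^esub> a \<odot>\<^bsub>L\<^esub> wd xs)"

lemma dF_props:
  shows dF_addmap: "addmap FA L dF"
    and dF_gen: "a \<in> carrier R \<Longrightarrow> xs \<in> WS \<Longrightarrow>
      dF (a \<odot>\<^bsub>FA\<^esub> genA xs) = \<iota> (dK a) \<otimes>\<^bsub>L\<^esub> word xs \<oplus>\<^bsub>L\<^esub> a \<odot>\<^bsub>L\<^esub> wd xs"
proof -
  let ?\<phi> = "\<lambda>xs a. \<iota> (dK a) \<otimes>\<^bsub>L\<^esub> word xs \<oplus>\<^bsub>L\<^esub> a \<odot>\<^bsub>L\<^esub> wd xs"
  have 1: "addmap R L (?\<phi> xs)" if "xs \<in> WS" for xs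
    using word_closed[OF that] wd_closed[OF that]
    by (intro addmapI) (auto simp: iota_dK_add LR.l_distr L.smult_l_distr L.M.a_ac)
  show "addmap FA L dF" using free_ext_addmap[where \<phi> = ?\<phi> and X = WS, OF is_cring L.M.abelian_group_axioms 1]
    by (simp add: addmap_def dF_def)
  show "dF (a \<odot>\<^bsub>FA\<^esub> genA xs) = ?\<phi> xs a" if "a \<in> carrier R" "xs \<in> WS"
    using free_ext_gen[where \<phi> = ?\<phi> and X = WS, OF is_cring L.M.abelian_group_axioms 1] that by (simp add: dF_def)
qed

text \<open>The two-sided ideal is additively spanned by the products a u r v with words u, v and a
  relation r. The surrounding words are the reason for the \<open>wd_mid\<close> lemmas.\<close>

lemma dF_mid_rel:
  assumes r: "r \<in> ext_rels R \<Omega>" and a: "a \<in> carrier R" and u: "u \<in> WS" and v: "v \<in> WS"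
  shows "dF (a \<odot>\<^bsub>FA\<^esub> (genA u \<otimes>\<^bsub>FA\<^esub> r \<otimes>\<^bsub>FA\<^esub> genA v)) = \<zero>\<^bsub>L\<^esub>"
proof -
  let ?h = "\<lambda>r. a \<odot>\<^bsub>FA\<^esub> (genA u \<otimes>\<^bsub>FA\<^esub> r \<otimes>\<^bsub>FA\<^esub> genA v)"
  note gc = genA_closed[OF u] genA_closed[OF v]
  have hadd: "addmap FA FA ?h"
    using gc a by (intro addmapI) (simp_all only: FR.l_distr FR.r_distr FR.m_closed FA.smult_r_distr FA.smult_closed)
  have hc: "?h r \<in> carrier FA" if "r \<in> carrier FA" for r
    using addmap_closed[OF hadd that] .
  have dh: "addmap FA L (\<lambda>r. dF (?h r))"
    by (intro addmapI) (simp_all only: addmap_closed[OF dF_addmap] addmap_closed[OF hadd] addmap_add[OF dF_addmap] addmap_add[OF hadd])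
  note dhm = addmap_minus[OF FA.M.abelian_group_axioms L.M.abelian_group_axioms dh]
  have hg: "?h (genA w) = a \<odot>\<^bsub>FA\<^esub> genA (u @ w @ v)" if "w \<in> WS" for w
    by (simp only: genA_append FR.m_assoc gc genA_closed[OF that])
  have dg: "dF (?h (genA w)) = \<iota> (dK a) \<otimes>\<^bsub>L\<^esub> word (u @ w @ v) \<oplus>\<^bsub>L\<^esub> a \<odot>\<^bsub>L\<^esub> wd (u @ w @ v)" if "w \<in> WS" for w
    unfolding hg[OF that] using that u v by (intro dF_gen a) simp
  have hs: "?h (b \<odot>\<^bsub>FA\<^esub> genA w) = (a \<otimes> b) \<odot>\<^bsub>FA\<^esub> genA (u @ w @ v)" if b: "b \<in> carrier R" and w: "w \<in> WS" for b w
  proof -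
    have "?h (b \<odot>\<^bsub>FA\<^esub> genA w) = a \<odot>\<^bsub>FA\<^esub> (b \<odot>\<^bsub>FA\<^esub> (genA u \<otimes>\<^bsub>FA\<^esub> genA w \<otimes>\<^bsub>FA\<^esub> genA v))"
      using gc b genA_closed[OF w] by (simp only: free_algebra_smult FR.m_closed FA.smult_closed)
    also have "\<dots> = (a \<otimes> b) \<odot>\<^bsub>FA\<^esub> (genA u \<otimes>\<^bsub>FA\<^esub> genA w \<otimes>\<^bsub>FA\<^esub> genA v)"
      using gc b a genA_closed[OF w] by (simp only: FA.smult_assoc1 FR.m_closed)
    also have "\<dots> = (a \<otimes> b) \<odot>\<^bsub>FA\<^esub> genA (u @ w @ v)"
      by (simp only: genA_append FR.m_assoc gc genA_closed[OF w])
    finally show ?thesis .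
  qed
  have wc: "u @ x # v \<in> WS" if "x \<in> carrier \<Omega>" for x using that u v by simp
  from r consider
    (1) x y where "r = genA [x \<oplus>\<^bsub>\<Omega>\<^esub> y] \<ominus>\<^bsub>FA\<^esub> (genA [x] \<oplus>\<^bsub>FA\<^esub> genA [y])" "x \<in> carrier \<Omega>" "y \<in> carrier \<Omega>"
    | (2) b x where "r = genA [b \<odot>\<^bsub>\<Omega>\<^esub> x] \<ominus>\<^bsub>FA\<^esub> (b \<odot>\<^bsub>FA\<^esub> genA [x])" "b \<in> carrier R" "x \<in> carrier \<Omega>"
    | (3) x where "r = genA [x, x]" "x \<in> carrier \<Omega>"
    unfolding ext_rels_def Let_def by blast
  thus ?thesis
  proof cases
    case 1
    have w: "word (u @ (x \<oplus>\<^bsub>\<Omega>\<^esub> y) # v) = word (u @ x # v) \<oplus>\<^bsub>L\<^esub> word (u @ y # v)"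
      using 1 u v by (simp add: word_mid iota_add LR.l_distr LR.r_distr)
    note c = wc[OF 1(2)] wc[OF 1(3)] word_closed[OF wc[OF 1(2)]] word_closed[OF wc[OF 1(3)]]
      wd_closed[OF wc[OF 1(2)]] wd_closed[OF wc[OF 1(3)]]
    have "dF (?h r) = dF (?h (genA [x \<oplus>\<^bsub>\<Omega>\<^esub> y])) \<ominus>\<^bsub>L\<^esub> (dF (?h (genA [x])) \<oplus>\<^bsub>L\<^esub> dF (?h (genA [y])))"
      using 1 by (simp only: dhm addmap_add[OF dh] genA_closed1 FA.M.a_closed \<Omega>.M.a_closed)
    also have "\<dots> = \<zero>\<^bsub>L\<^esub>"
      using 1 a c u v by (simp add: dg w wd_mid_add LR.r_distr L.smult_r_distr L.M.minus_eq_zero_iff L.M.a_ac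
          del: free_algebra_simps)
    finally show ?thesis .
  next
    case 2
    have w: "word (u @ (b \<odot>\<^bsub>\<Omega>\<^esub> x) # v) = b \<odot>\<^bsub>L\<^esub> word (u @ x # v)"
      using 2 u v by (simp add: word_mid iota_smult smult_mult_left smult_mult_right)
    note c = wc[OF 2(3)] word_closed[OF wc[OF 2(3)]] wd_closed[OF wc[OF 2(3)]]
    have "dF (?h r) = dF (?h (genA [b \<odot>\<^bsub>\<Omega>\<^esub> x])) \<ominus>\<^bsub>L\<^esub> dF (?h (b \<odot>\<^bsub>FA\<^esub> genA [x]))"
      using 2 by (simp only: dhm genA_closed1 FA.smult_closed \<Omega>.smult_closed)
    also have "dF (?h (b \<odot>\<^bsub>FA\<^esub> genA [x])) = \<iota> (dK (a \<otimes> b)) \<otimes>\<^bsub>L\<^esub> word (u @ [x] @ v) \<oplus>\<^bsub>L\<^esub> (a \<otimes> b) \<odot>\<^bsub>L\<^esub> wd (u @ [x] @ v)"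
    proof -
      have "[x] \<in> WS" using 2 by simp
      thus ?thesis unfolding hs[OF 2(2) \<open>[x] \<in> WS\<close>] using a 2 u v by (intro dF_gen) auto
    qed
    also have "dF (?h (genA [b \<odot>\<^bsub>\<Omega>\<^esub> x])) \<ominus>\<^bsub>L\<^esub> \<dots> = \<zero>\<^bsub>L\<^esub>"
      using 2 a c u v by (simp add: dg w wd_mid_smult iota_dK_mult LR.l_distr smult_mult_left smult_mult_right
        L.smult_r_distr L.smult_assoc1 L.M.minus_eq_zero_iff L.M.a_ac del: free_algebra_simps)
    finally show ?thesis .
  next
    case 3
    have w: "word (u @ x # x # v) = \<zero>\<^bsub>L\<^esub>"
      using 3 u v word_mid[of u x "x # v"] word_Cons[of x v] LR.m_assoc[of "\<iota> x" "\<iota> x" "word v", symmetric]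
        iota_square[of x] by simp
    show ?thesis unfolding 3(1) using dg[of "[x, x]"] 3 a u v w by (simp add: wd_mid_square del: free_algebra_simps)
  qed
qed

lemma dF_ideal:
  assumes "g \<in> I"
  shows "dF g = \<zero>\<^bsub>L\<^esub>"
proof -
  note dadd = addmap_add[OF dF_addmap] and dz = addmap_zero[OF FA.M.abelian_group_axioms L.M.abelian_group_axioms dF_addmap]
    and dinv = addmap_inv[OF FA.M.abelian_group_axioms L.M.abelian_group_axioms dF_addmap]
  \<comment> \<open>The elements killed in every two-sided context form an ideal by construction,
    which is not evident for the kernel of \<open>dF\<close> itself; the context 1, 1 gives the
    claim.\<close>
  let ?K = "{g \<in> carrier FA. \<forall>h\<in>carrier FA. \<forall>k\<in>carrier FA. dF (h \<otimes>\<^bsub>FA\<^esub> g \<otimes>\<^bsub>FA\<^esub> k) = \<zero>\<^bsub>L\<^esub>}"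
  have "ideal ?K FA"
  proof (rule idealI)
    show "ring FA" by (rule FR.ring_axioms)
    show "subgroup ?K (add_monoid FA)"
    proof (rule FA.M.add.subgroupI)
      show "?K \<subseteq> carrier FA" by blast
      have "dF (h \<otimes>\<^bsub>FA\<^esub> \<zero>\<^bsub>FA\<^esub> \<otimes>\<^bsub>FA\<^esub> k) = \<zero>\<^bsub>L\<^esub>" if "h \<in> carrier FA" "k \<in> carrier FA" for h k
        using that by (simp only: FR.l_null FR.r_null dz)
      thus "?K \<noteq> {}" using FA.M.zero_closed by blast
    next
      fix g assume g: "g \<in> ?K"
      hence gF: "g \<in> carrier FA" by blast
      have gz: "dF (h \<otimes>\<^bsub>FA\<^esub> g \<otimes>\<^bsub>FA\<^esub> k) = \<zero>\<^bsub>L\<^esub>" if "h \<in> carrier FA" "k \<in> carrier FA" for h k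
        using that g by blast
      have e: "dF (h \<otimes>\<^bsub>FA\<^esub> (\<ominus>\<^bsub>FA\<^esub> g) \<otimes>\<^bsub>FA\<^esub> k) = \<ominus>\<^bsub>L\<^esub> dF (h \<otimes>\<^bsub>FA\<^esub> g \<otimes>\<^bsub>FA\<^esub> k)" if "h \<in> carrier FA" "k \<in> carrier FA" for h k
        using that gF by (simp only: FR.l_minus FR.r_minus dinv FR.m_closed)
      have "dF (h \<otimes>\<^bsub>FA\<^esub> (\<ominus>\<^bsub>FA\<^esub> g) \<otimes>\<^bsub>FA\<^esub> k) = \<zero>\<^bsub>L\<^esub>" if "h \<in> carrier FA" "k \<in> carrier FA" for h k
        unfolding e[OF that] gz[OF that] by (rule L.M.a_inv_zero)
      thus "\<ominus>\<^bsub>FA\<^esub> g \<in> ?K" using FA.M.a_inv_closed[OF gF] by blast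
    next
      fix g g' assume g: "g \<in> ?K" "g' \<in> ?K"
      hence gF: "g \<in> carrier FA" "g' \<in> carrier FA" by blast+
      have gz: "dF (h \<otimes>\<^bsub>FA\<^esub> g \<otimes>\<^bsub>FA\<^esub> k) = \<zero>\<^bsub>L\<^esub>" "dF (h \<otimes>\<^bsub>FA\<^esub> g' \<otimes>\<^bsub>FA\<^esub> k) = \<zero>\<^bsub>L\<^esub>"
        if "h \<in> carrier FA" "k \<in> carrier FA" for h k
        using that g by blast+
      have e: "dF (h \<otimes>\<^bsub>FA\<^esub> (g \<oplus>\<^bsub>FA\<^esub> g') \<otimes>\<^bsub>FA\<^esub> k) = dF (h \<otimes>\<^bsub>FA\<^esub> g \<otimes>\<^bsub>FA\<^esub> k) \<oplus>\<^bsub>L\<^esub> dF (h \<otimes>\<^bsub>FA\<^esub> g' \<otimes>\<^bsub>FA\<^esub> k)"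
        if "h \<in> carrier FA" "k \<in> carrier FA" for h k
        using that gF by (simp only: FR.l_distr FR.r_distr dadd FR.m_closed)
      have "dF (h \<otimes>\<^bsub>FA\<^esub> (g \<oplus>\<^bsub>FA\<^esub> g') \<otimes>\<^bsub>FA\<^esub> k) = \<zero>\<^bsub>L\<^esub>" if "h \<in> carrier FA" "k \<in> carrier FA" for h k
        unfolding e[OF that] gz[OF that] by (rule L.M.l_zero[OF L.M.zero_closed])
      thus "g \<oplus>\<^bsub>FA\<^esub> g' \<in> ?K" using FA.M.a_closed[OF gF] by blast
    qed
  next
    fix g g' assume g: "g \<in> ?K" and g': "g' \<in> carrier FA"
    hence gF: "g \<in> carrier FA" by blast
    have "dF (h \<otimes>\<^bsub>FA\<^esub> (g' \<otimes>\<^bsub>FA\<^esub> g) \<otimes>\<^bsub>FA\<^esub> k) = dF ((h \<otimes>\<^bsub>FA\<^esub> g') \<otimes>\<^bsub>FA\<^esub> g \<otimes>\<^bsub>FA\<^esub> k)"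
      "dF (h \<otimes>\<^bsub>FA\<^esub> (g \<otimes>\<^bsub>FA\<^esub> g') \<otimes>\<^bsub>FA\<^esub> k) = dF (h \<otimes>\<^bsub>FA\<^esub> g \<otimes>\<^bsub>FA\<^esub> (g' \<otimes>\<^bsub>FA\<^esub> k))" if "h \<in> carrier FA" "k \<in> carrier FA" for h k
      using that gF g' by (simp_all only: FR.m_assoc FR.m_closed)
    moreover have "dF ((h \<otimes>\<^bsub>FA\<^esub> g') \<otimes>\<^bsub>FA\<^esub> g \<otimes>\<^bsub>FA\<^esub> k) = \<zero>\<^bsub>L\<^esub>"
      "dF (h \<otimes>\<^bsub>FA\<^esub> g \<otimes>\<^bsub>FA\<^esub> (g' \<otimes>\<^bsub>FA\<^esub> k)) = \<zero>\<^bsub>L\<^esub>" if "h \<in> carrier FA" "k \<in> carrier FA" for h k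
      using that g FR.m_closed[OF that(1) g'] FR.m_closed[OF g' that(2)] by blast+
    ultimately show "g' \<otimes>\<^bsub>FA\<^esub> g \<in> ?K" "g \<otimes>\<^bsub>FA\<^esub> g' \<in> ?K"
      using FR.m_closed[OF gF g'] FR.m_closed[OF g' gF] by simp_all
  qed
  moreover have "ext_rels R \<Omega> \<subseteq> ?K"
  proof
    fix r assume r: "r \<in> ext_rels R \<Omega>"
    hence rF: "r \<in> carrier FA" using ext_rels_subset by blast
    have "dF (h \<otimes>\<^bsub>FA\<^esub> r \<otimes>\<^bsub>FA\<^esub> k) = \<zero>\<^bsub>L\<^esub>" if h: "h \<in> carrier FA" and k: "k \<in> carrier FA" for h k
    proof (rule free_module_induct[of h WS "\<lambda>h. dF (h \<otimes>\<^bsub>FA\<^esub> r \<otimes>\<^bsub>FA\<^esub> k) = \<zero>\<^bsub>L\<^esub>", folded free_algebra_simps])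
      show "dF (\<zero>\<^bsub>FA\<^esub> \<otimes>\<^bsub>FA\<^esub> r \<otimes>\<^bsub>FA\<^esub> k) = \<zero>\<^bsub>L\<^esub>" using rF k by (simp only: FR.l_null dz)
      show "dF ((h \<oplus>\<^bsub>FA\<^esub> h') \<otimes>\<^bsub>FA\<^esub> r \<otimes>\<^bsub>FA\<^esub> k) = \<zero>\<^bsub>L\<^esub>"
        if "h \<in> carrier FA" "h' \<in> carrier FA" "dF (h \<otimes>\<^bsub>FA\<^esub> r \<otimes>\<^bsub>FA\<^esub> k) = \<zero>\<^bsub>L\<^esub>" "dF (h' \<otimes>\<^bsub>FA\<^esub> r \<otimes>\<^bsub>FA\<^esub> k) = \<zero>\<^bsub>L\<^esub>" for h h'
        using that rF k by (simp only: FR.l_distr FR.m_closed dadd L.M.l_zero L.M.zero_closed)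
      fix a u assume a: "a \<in> carrier R" and u: "u \<in> WS"
      show "dF ((a \<odot>\<^bsub>FA\<^esub> genA u) \<otimes>\<^bsub>FA\<^esub> r \<otimes>\<^bsub>FA\<^esub> k) = \<zero>\<^bsub>L\<^esub>"
      proof (rule free_module_induct[of k WS "\<lambda>k. dF ((a \<odot>\<^bsub>FA\<^esub> genA u) \<otimes>\<^bsub>FA\<^esub> r \<otimes>\<^bsub>FA\<^esub> k) = \<zero>\<^bsub>L\<^esub>", folded free_algebra_simps])
        note c = FA.smult_closed[OF a genA_closed[OF u]] rF FR.m_closed[OF FA.smult_closed[OF a genA_closed[OF u]] rF]
        show "dF ((a \<odot>\<^bsub>FA\<^esub> genA u) \<otimes>\<^bsub>FA\<^esub> r \<otimes>\<^bsub>FA\<^esub> \<zero>\<^bsub>FA\<^esub>) = \<zero>\<^bsub>L\<^esub>" using c by (simp only: FR.r_null dz)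
        show "dF ((a \<odot>\<^bsub>FA\<^esub> genA u) \<otimes>\<^bsub>FA\<^esub> r \<otimes>\<^bsub>FA\<^esub> (k \<oplus>\<^bsub>FA\<^esub> k')) = \<zero>\<^bsub>L\<^esub>"
          if "k \<in> carrier FA" "k' \<in> carrier FA" "dF ((a \<odot>\<^bsub>FA\<^esub> genA u) \<otimes>\<^bsub>FA\<^esub> r \<otimes>\<^bsub>FA\<^esub> k) = \<zero>\<^bsub>L\<^esub>"
            "dF ((a \<odot>\<^bsub>FA\<^esub> genA u) \<otimes>\<^bsub>FA\<^esub> r \<otimes>\<^bsub>FA\<^esub> k') = \<zero>\<^bsub>L\<^esub>" for k k'
          using that c by (simp only: FR.r_distr FR.m_closed dadd L.M.l_zero L.M.zero_closed)
        fix b v assume b: "b \<in> carrier R" and v: "v \<in> WS"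
        have "(a \<odot>\<^bsub>FA\<^esub> genA u) \<otimes>\<^bsub>FA\<^esub> r \<otimes>\<^bsub>FA\<^esub> (b \<odot>\<^bsub>FA\<^esub> genA v) = (b \<otimes> a) \<odot>\<^bsub>FA\<^esub> (genA u \<otimes>\<^bsub>FA\<^esub> r \<otimes>\<^bsub>FA\<^esub> genA v)"
          using a b rF genA_closed[OF u] genA_closed[OF v]
          by (simp only: free_algebra_smult FR.m_closed FA.smult_closed FA.smult_assoc1)
        thus "dF ((a \<odot>\<^bsub>FA\<^esub> genA u) \<otimes>\<^bsub>FA\<^esub> r \<otimes>\<^bsub>FA\<^esub> (b \<odot>\<^bsub>FA\<^esub> genA v)) = \<zero>\<^bsub>L\<^esub>"
          using dF_mid_rel[OF r m_closed[OF b a] u v] by (simp only:)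
      qed (use k in simp)
    qed (use h in simp)
    thus "r \<in> ?K" using rF by blast
  qed
  ultimately have "I \<subseteq> ?K" unfolding ext_ideal_def by (rule FR.genideal_minimal)
  hence "dF (\<one>\<^bsub>FA\<^esub> \<otimes>\<^bsub>FA\<^esub> g \<otimes>\<^bsub>FA\<^esub> \<one>\<^bsub>FA\<^esub>) = \<zero>\<^bsub>L\<^esub>" and "g \<in> carrier FA" using assms FR.one_closed by blast+
  thus ?thesis by (simp only: FR.l_one FR.r_one)
qed

definition dL :: "'a form \<Rightarrow> 'a form" where
  "dL X = the_elem (dF ` X)"

lemma dL_pi: "g \<in> carrier FA \<Longrightarrow> dL (\<pi> g) = dF g"
  unfolding dL_def by (rule FA.the_elem_coset[OF ext_ideal_submodule L.M.abelian_group_axioms dF_addmap dF_ideal])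

lemma dL_addmap: "addmap L L dL"
  unfolding dL_def
  using FA.the_elem_addmap[OF ext_ideal_submodule L.M.abelian_group_axioms dF_addmap dF_ideal]
  unfolding addmap_def ext_algebra_simps by blast

lemma dL_closed [simp, intro]: "X \<in> carrier L \<Longrightarrow> dL X \<in> carrier L"
  by (rule addmap_closed[OF dL_addmap])

lemma dL_add: "X \<in> carrier L \<Longrightarrow> Y \<in> carrier L \<Longrightarrow> dL (X \<oplus>\<^bsub>L\<^esub> Y) = dL X \<oplus>\<^bsub>L\<^esub> dL Y"
  by (rule addmap_add[OF dL_addmap])

lemma dL_word: "a \<in> carrier R \<Longrightarrow> xs \<in> WS \<Longrightarrow>
    dL (a \<odot>\<^bsub>L\<^esub> word xs) = \<iota> (dK a) \<otimes>\<^bsub>L\<^esub> word xs \<oplus>\<^bsub>L\<^esub> a \<odot>\<^bsub>L\<^esub> wd xs"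
  using dL_pi[of "a \<odot>\<^bsub>FA\<^esub> genA xs"] FA.smult_closed[OF _ genA_closed]
  by (simp only: pi_smult genA_closed word_pi[symmetric] dF_gen)

lemma dL_word1: "xs \<in> WS \<Longrightarrow> dL (word xs) = wd xs"
  using dL_word[of \<one> xs] by (simp add: dK_one iota_zero)

lemma dL_smult:
  assumes "a \<in> carrier R" "X \<in> carrier L"
  shows "dL (a \<odot>\<^bsub>L\<^esub> X) = \<iota> (dK a) \<otimes>\<^bsub>L\<^esub> X \<oplus>\<^bsub>L\<^esub> a \<odot>\<^bsub>L\<^esub> dL X"
  using assms(2)
proof (induction rule: ext_induct)
  case (word b xs)
  have "a \<odot>\<^bsub>L\<^esub> (b \<odot>\<^bsub>L\<^esub> word xs) = (a \<otimes> b) \<odot>\<^bsub>L\<^esub> word xs" using word assms by (simp add: L.smult_assoc1)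
  hence "dL (a \<odot>\<^bsub>L\<^esub> (b \<odot>\<^bsub>L\<^esub> word xs)) = \<iota> (dK (a \<otimes> b)) \<otimes>\<^bsub>L\<^esub> word xs \<oplus>\<^bsub>L\<^esub> (a \<otimes> b) \<odot>\<^bsub>L\<^esub> wd xs"
    using dL_word[of "a \<otimes> b" xs] word assms by simp
  thus ?case using word assms
    by (simp add: dL_word iota_dK_mult LR.l_distr smult_mult_left smult_mult_right L.smult_r_distr L.smult_assoc1 L.M.a_ac)
next
  case (add X Y)
  thus ?case using assms by (simp add: L.smult_r_distr dL_add LR.r_distr L.M.a_ac)
qed

lemma dL_power: "X \<in> \<Lambda> p \<Longrightarrow> dL X \<in> \<Lambda> (Suc p)"
proof (induction rule: power_induct)
  case (word a xs)
  have "\<iota> (dK a) \<otimes>\<^bsub>L\<^esub> word xs \<in> \<Lambda> (1 + p)"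
    by (rule power_mult[OF iota_power[OF dK_closed] power_word']) (use word in auto)
  moreover have "a \<odot>\<^bsub>L\<^esub> wd xs \<in> \<Lambda> (Suc p)" using power_smult[OF word(1) wd_power[OF word(2)]] word(3) by simp
  ultimately show ?case using word by (simp add: dL_word power_add)
next
  case (add X Y)
  thus ?case by (simp add: dL_add power_add)
qed

lemma dL_leibniz_word:
  assumes "u \<in> WS" "Y \<in> carrier L"
  shows "dL (word u \<otimes>\<^bsub>L\<^esub> Y) = wd u \<otimes>\<^bsub>L\<^esub> Y \<oplus>\<^bsub>L\<^esub> LR.alt_sign (odd (length u)) (word u \<otimes>\<^bsub>L\<^esub> dL Y)"
  using assms(2)
proof (induction rule: ext_induct)
  case (word b v)
  let ?b = "odd (length u)"
  have db: "\<iota> (dK b) \<in> carrier L" using word by simp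
  note c = db assms(1) word word_closed[OF assms(1)] word_closed[OF word(2)] wd_closed[OF assms(1)] wd_closed[OF word(2)]
  have "dL (word u \<otimes>\<^bsub>L\<^esub> (b \<odot>\<^bsub>L\<^esub> word v)) = \<iota> (dK b) \<otimes>\<^bsub>L\<^esub> word (u @ v) \<oplus>\<^bsub>L\<^esub> b \<odot>\<^bsub>L\<^esub> wd (u @ v)"
    using c dL_word[of b "u @ v"] by (simp add: smult_mult_right word_append)
  also have "\<iota> (dK b) \<otimes>\<^bsub>L\<^esub> word (u @ v) = LR.alt_sign ?b (word u \<otimes>\<^bsub>L\<^esub> (\<iota> (dK b) \<otimes>\<^bsub>L\<^esub> word v))"
  proof -
    have "\<iota> (dK b) \<otimes>\<^bsub>L\<^esub> word (u @ v) = (\<iota> (dK b) \<otimes>\<^bsub>L\<^esub> word u) \<otimes>\<^bsub>L\<^esub> word v"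
      using c by (simp add: word_append LR.m_assoc)
    also have "\<dots> = LR.alt_sign ?b (word u \<otimes>\<^bsub>L\<^esub> \<iota> (dK b)) \<otimes>\<^bsub>L\<^esub> word v"
      using iota_word_comm[of "dK b" u] c by simp
    finally show ?thesis using c by (simp add: LR.alt_sign_mult_left LR.m_assoc)
  qed
  finally show ?case using c
    by (simp add: dL_word wd_append LR.r_distr LR.alt_sign_add smult_mult_right L.smult_r_distr alt_sign_smult L.M.a_ac)
next
  case (add X Y)
  thus ?case using assms by (simp add: dL_add LR.r_distr LR.alt_sign_add L.M.a_ac)
qed

lemma dL_leibniz:
  assumes "X \<in> \<Lambda> p" "Y \<in> carrier L"
  shows "dL (X \<otimes>\<^bsub>L\<^esub> Y) = dL X \<otimes>\<^bsub>L\<^esub> Y \<oplus>\<^bsub>L\<^esub> LR.alt_sign (odd p) (X \<otimes>\<^bsub>L\<^esub> dL Y)"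
  using assms(1)
proof (induction rule: power_induct)
  case (word a u)
  note c = assms(2) word word_closed[OF word(2)] wd_closed[OF word(2)]
  show ?case using c dL_leibniz_word[OF word(2) assms(2)]
    by (simp add: smult_mult_left dL_smult dL_word1 LR.l_distr L.smult_r_distr alt_sign_smult LR.m_assoc L.M.a_ac)
next
  case (add X Y)
  thus ?case using assms by (simp add: dL_add LR.l_distr LR.alt_sign_add L.M.a_ac)
qed

lemma dL_one: "dL \<one>\<^bsub>L\<^esub> = \<zero>\<^bsub>L\<^esub>"
  using dL_word1[of "[]"] by (simp add: word_Nil)

lemma dL_d1: "x \<in> carrier \<Omega> \<Longrightarrow> dL (d1 x) = \<zero>\<^bsub>L\<^esub>"
proof (induction rule: kahler_induct)
  case (gen a b)
  have 1: "dL (\<iota> (dK c)) = \<zero>\<^bsub>L\<^esub>" if "c \<in> carrier R" for c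
    using that dL_word1[of "[dK c]"] by (simp add: d1_dK a_minus_def)
  show ?case
    using gen dL_leibniz[OF iota_power[OF dK_closed[OF gen(1)]] iota_closed[OF dK_closed[OF gen(2)]]]
    by (simp add: d1_gen 1)
next
  case (add X Y)
  thus ?case by (simp add: d1_add dL_add)
qed

lemma dL_wd: "xs \<in> WS \<Longrightarrow> dL (wd xs) = \<zero>\<^bsub>L\<^esub>"
proof (induction xs)
  case Nil
  thus ?case using addmap_zero[OF L.M.abelian_group_axioms L.M.abelian_group_axioms dL_addmap] by simp
next
  case (Cons x xs)
  hence x: "x \<in> carrier \<Omega>" "xs \<in> WS" and IH: "dL (wd xs) = \<zero>\<^bsub>L\<^esub>" by auto
  note c = x word_closed[OF x(2)] wd_closed[OF x(2)] d1_closed[OF x(1)] iota_closed[OF x(1)]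
  have ix: "dL (\<iota> x) = d1 x" using dL_word1[of "[x]"] c by (simp add: word_Nil a_minus_def)
  have "dL (wd (x # xs)) = dL (d1 x \<otimes>\<^bsub>L\<^esub> word xs) \<ominus>\<^bsub>L\<^esub> dL (\<iota> x \<otimes>\<^bsub>L\<^esub> wd xs)"
    using c by (simp add: addmap_minus[OF L.M.abelian_group_axioms L.M.abelian_group_axioms dL_addmap])
  also have "\<dots> = \<zero>\<^bsub>L\<^esub>"
    using c dL_leibniz[OF d1_power[OF x(1)] word_closed[OF x(2)]] dL_leibniz[OF iota_power[OF x(1)] wd_closed[OF x(2)]]
    by (simp add: dL_d1 dL_word1 IH ix L.M.minus_eq_zero_iff)
  finally show ?case .
qed

text \<open>d(da w + a dw) = -da dw + da dw + a ddw; the minus sign is produced by \<open>wd\<close>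
  on the word that starts with da.\<close>

lemma dL_dL: "X \<in> carrier L \<Longrightarrow> dL (dL X) = \<zero>\<^bsub>L\<^esub>"
proof (induction rule: ext_induct)
  case (word a xs)
  note c = word word_closed[OF word(2)] wd_closed[OF word(2)] iota_closed[OF dK_closed[OF word(1)]]
  have "wd (dK a # xs) = \<ominus>\<^bsub>L\<^esub> (\<iota> (dK a) \<otimes>\<^bsub>L\<^esub> wd xs)"
    using c by (simp add: d1_dK a_minus_def)
  moreover have "dL (\<iota> (dK a) \<otimes>\<^bsub>L\<^esub> word xs) = wd (dK a # xs)"
    using dL_word1[of "dK a # xs"] word_Cons[of "dK a" xs] c by simp
  ultimately show ?case using c by (simp add: dL_word dL_word1 dL_add dL_smult dL_wd L.M.l_neg)
next
  case (add X Y)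
  thus ?case by (simp add: dL_add)
qed

section \<open>The specified de Rham differential and its rules\<close>

abbreviation "dR \<equiv> deRham_d R s"

text \<open>Existence is \<open>dL\<close>. For uniqueness, the value on functions and square zero
  force d(da) = 0; Leibniz and additivity fix one-forms, words and all forms, and extensionality
  fixes the values outside the carrier.\<close>

lemma deRham_d_eq: "dR = (\<lambda>X\<in>carrier L. dL X)"
proof -
  let ?P = "\<lambda>d. d \<in> carrier L \<rightarrow>\<^sub>E carrier L \<and>
     (\<forall>x\<in>carrier L. \<forall>y\<in>carrier L. d (x \<oplus>\<^bsub>L\<^esub> y) = d x \<oplus>\<^bsub>L\<^esub> d y) \<and>
     (\<forall>p. \<forall>x\<in>\<Lambda> p. \<forall>y\<in>carrier L. d (x \<otimes>\<^bsub>L\<^esub> y) =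
        (d x \<otimes>\<^bsub>L\<^esub> y) \<oplus>\<^bsub>L\<^esub> (((\<ominus>\<^bsub>L\<^esub> \<one>\<^bsub>L\<^esub>) [^]\<^bsub>L\<^esub> p) \<otimes>\<^bsub>L\<^esub> (x \<otimes>\<^bsub>L\<^esub> d y))) \<and>
     (\<forall>a\<in>carrier R. d (a \<odot>\<^bsub>L\<^esub> \<one>\<^bsub>L\<^esub>) = \<iota> (dK a)) \<and>
     (\<forall>x\<in>carrier L. d (d x) = \<zero>\<^bsub>L\<^esub>)"
  have "(THE d. ?P d) = (\<lambda>X\<in>carrier L. dL X)"
  proof (rule the_equality)
    show "?P (\<lambda>X\<in>carrier L. dL X)"
    proof (intro conjI ballI allI)
      fix p x y assume xy: "x \<in> \<Lambda> p" "y \<in> carrier L"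
      thus "(\<lambda>X\<in>carrier L. dL X) (x \<otimes>\<^bsub>L\<^esub> y) = ((\<lambda>X\<in>carrier L. dL X) x \<otimes>\<^bsub>L\<^esub> y) \<oplus>\<^bsub>L\<^esub>
          (((\<ominus>\<^bsub>L\<^esub> \<one>\<^bsub>L\<^esub>) [^]\<^bsub>L\<^esub> p) \<otimes>\<^bsub>L\<^esub> (x \<otimes>\<^bsub>L\<^esub> (\<lambda>X\<in>carrier L. dL X) y))"
        using power_carrier[OF xy(1)] dL_leibniz[OF xy] by (simp add: neg_one_pow)
    next
      fix a assume a: "a \<in> carrier R"
      thus "(\<lambda>X\<in>carrier L. dL X) (a \<odot>\<^bsub>L\<^esub> \<one>\<^bsub>L\<^esub>) = \<iota> (dK a)"
        using dL_smult[OF a LR.one_closed] by (simp add: dL_one)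
    qed (auto simp: dL_add dL_dL)
  next
    fix d assume P: "?P d"
    hence dc: "d x \<in> carrier L" if "x \<in> carrier L" for x using that by auto
    have dadd: "d (x \<oplus>\<^bsub>L\<^esub> y) = d x \<oplus>\<^bsub>L\<^esub> d y" if "x \<in> carrier L" "y \<in> carrier L" for x y using P that by blast
    have dl: "d (x \<otimes>\<^bsub>L\<^esub> y) = d x \<otimes>\<^bsub>L\<^esub> y \<oplus>\<^bsub>L\<^esub> LR.alt_sign (odd p) (x \<otimes>\<^bsub>L\<^esub> d y)"
      if "x \<in> \<Lambda> p" "y \<in> carrier L" for p x y
    proof -
      have "d (x \<otimes>\<^bsub>L\<^esub> y) = (d x \<otimes>\<^bsub>L\<^esub> y) \<oplus>\<^bsub>L\<^esub> (((\<ominus>\<^bsub>L\<^esub> \<one>\<^bsub>L\<^esub>) [^]\<^bsub>L\<^esub> p) \<otimes>\<^bsub>L\<^esub> (x \<otimes>\<^bsub>L\<^esub> d y))"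
        using P that by blast
      thus ?thesis using that dc power_carrier[OF that(1)] by (simp add: neg_one_pow)
    qed
    have da: "d (a \<odot>\<^bsub>L\<^esub> \<one>\<^bsub>L\<^esub>) = \<iota> (dK a)" if "a \<in> carrier R" for a using P that by blast
    have dd: "d (d x) = \<zero>\<^bsub>L\<^esub>" if "x \<in> carrier L" for x using P that by blast
    have dda: "d (\<iota> (dK a)) = \<zero>\<^bsub>L\<^esub>" if "a \<in> carrier R" for a
      using dd[of "a \<odot>\<^bsub>L\<^esub> \<one>\<^bsub>L\<^esub>"] da[OF that] that by simp
    have dsm: "d (a \<odot>\<^bsub>L\<^esub> X) = \<iota> (dK a) \<otimes>\<^bsub>L\<^esub> X \<oplus>\<^bsub>L\<^esub> a \<odot>\<^bsub>L\<^esub> d X" if "a \<in> carrier R" "X \<in> carrier L" for a X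
    proof -
      have "a \<odot>\<^bsub>L\<^esub> X = (a \<odot>\<^bsub>L\<^esub> \<one>\<^bsub>L\<^esub>) \<otimes>\<^bsub>L\<^esub> X" using that by (simp add: smult_mult_left)
      thus ?thesis using dl[OF power_smult[OF that(1) power_one] that(2)] da[OF that(1)] that dc
        by (simp add: smult_mult_left)
    qed
    have di: "d (\<iota> x) = d1 x" if "x \<in> carrier \<Omega>" for x
      using that
    proof (induction rule: kahler_induct)
      case (gen a b)
      thus ?case by (simp add: iota_smult dsm dda d1_gen)
    next
      case (add x y)
      thus ?case by (simp add: iota_add dadd d1_add)
    qed
    have dw: "d (word xs) = wd xs" if "xs \<in> WS" for xs
      using that
    proof (induction xs)
      case Nil
      thus ?case using da[OF one_closed] by (simp add: word_Nil dK_one iota_zero)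
    next
      case (Cons x xs)
      hence x: "x \<in> carrier \<Omega>" "xs \<in> WS" and IH: "d (word xs) = wd xs" by auto
      show ?case unfolding word_Cons[OF x] using dl[OF iota_power[OF x(1)] word_closed[OF x(2)]] x
        by (simp add: di IH a_minus_def)
    qed
    have "d X = dL X" if "X \<in> carrier L" for X
      using that
    proof (induction rule: ext_induct)
      case (word a xs)
      thus ?case by (simp add: dsm dw dL_word)
    next
      case (add X Y)
      thus ?case by (simp add: dadd dL_add)
    qed
    moreover have "d \<in> extensional (carrier L)" using P by (auto simp: PiE_def)
    ultimately show "d = (\<lambda>X\<in>carrier L. dL X)" by (intro extensionalityI) auto
  qed
  thus ?thesis unfolding deRham_d_def forms_def forms_deg_def Let_def by simp
qed

lemma dR_addmap: "addmap L L dR"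
  unfolding deRham_d_eq using dL_addmap by (auto simp: addmap_def)

lemma dR_closed [simp, intro]: "X \<in> carrier L \<Longrightarrow> dR X \<in> carrier L"
  by (rule addmap_closed[OF dR_addmap])

lemma dR_add: "X \<in> carrier L \<Longrightarrow> Y \<in> carrier L \<Longrightarrow> dR (X \<oplus>\<^bsub>L\<^esub> Y) = dR X \<oplus>\<^bsub>L\<^esub> dR Y"
  by (rule addmap_add[OF dR_addmap])

lemma dR_smult: "a \<in> carrier R \<Longrightarrow> X \<in> carrier L \<Longrightarrow>
    dR (a \<odot>\<^bsub>L\<^esub> X) = \<iota> (dK a) \<otimes>\<^bsub>L\<^esub> X \<oplus>\<^bsub>L\<^esub> a \<odot>\<^bsub>L\<^esub> dR X"
  by (simp add: deRham_d_eq dL_smult)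

lemma dR_power: "X \<in> \<Lambda> p \<Longrightarrow> dR X \<in> \<Lambda> (Suc p)"
  using power_carrier[of X p] by (simp add: deRham_d_eq dL_power)

lemma dR_leibniz:
  "X \<in> \<Lambda> p \<Longrightarrow> Y \<in> carrier L \<Longrightarrow>
    dR (X \<otimes>\<^bsub>L\<^esub> Y) = dR X \<otimes>\<^bsub>L\<^esub> Y \<oplus>\<^bsub>L\<^esub> LR.alt_sign (odd p) (X \<otimes>\<^bsub>L\<^esub> dR Y)"
  using power_carrier[of X p] by (simp add: deRham_d_eq dL_leibniz)

lemma dR_dR: "X \<in> carrier L \<Longrightarrow> dR (dR X) = \<zero>\<^bsub>L\<^esub>"
  by (simp add: deRham_d_eq dL_dL)

lemma dR_one: "dR \<one>\<^bsub>L\<^esub> = \<zero>\<^bsub>L\<^esub>"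
  by (simp add: deRham_d_eq dL_one)

lemma dR_scalar_smult: "X \<in> carrier L \<Longrightarrow> dR (s c \<odot>\<^bsub>L\<^esub> X) = s c \<odot>\<^bsub>L\<^esub> dR X"
  by (simp add: dR_smult dK_scalar iota_zero)

lemma dR_iota_dK: "a \<in> carrier R \<Longrightarrow> dR (\<iota> (dK a)) = \<zero>\<^bsub>L\<^esub>"
  using dR_dR[of "a \<odot>\<^bsub>L\<^esub> \<one>\<^bsub>L\<^esub>"] dR_smult[OF _ LR.one_closed, of a] by (simp add: dR_one)

end

section \<open>Chern--Simons transgression\<close>

text \<open>Natural multiples without scalars: the transgression identity is proved in a mere
  abelian group, and the division is postponed until the forms over k are reached.\<close>

primrec nmul :: "('a, 'm) ring_scheme \<Rightarrow> nat \<Rightarrow> 'a \<Rightarrow> 'a" where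
  "nmul G 0 x = \<zero>\<^bsub>G\<^esub>"
| "nmul G (Suc n) x = nmul G n x \<oplus>\<^bsub>G\<^esub> x"

context abelian_group
begin

lemma nmul_closed [simp, intro]: "x \<in> carrier G \<Longrightarrow> nmul G n x \<in> carrier G"
  by (induction n) auto

lemma nmul_add: "x \<in> carrier G \<Longrightarrow> y \<in> carrier G \<Longrightarrow> nmul G n (x \<oplus> y) = nmul G n x \<oplus> nmul G n y"
  by (induction n) (auto simp: a_ac)

lemma nmul_zero [simp]: "nmul G n \<zero> = \<zero>"
  by (induction n) auto

text \<open>The cancellation pattern of the Bianchi computation in \<open>D_S\<close>, where y is
  the product of \<open>a\<close>, \<open>b\<close> and \<open>Sp i r\<close>.\<close>

lemma minus_telescope:
  assumes "x \<in> carrier G" "y \<in> carrier G" "z \<in> carrier G" "u \<in> carrier G" "v \<in> carrier G"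
  shows "(x \<ominus> y) \<oplus> ((y \<ominus> z) \<oplus> (u \<ominus> v)) = (x \<oplus> u) \<ominus> (z \<oplus> v)"
proof -
  have "(x \<ominus> y) \<oplus> ((y \<ominus> z) \<oplus> (u \<ominus> v)) = x \<oplus> (\<ominus> y \<oplus> (y \<oplus> (\<ominus> z \<oplus> (u \<oplus> \<ominus> v))))"
    using assms by (simp add: a_minus_def a_assoc)
  also have "\<dots> = x \<oplus> (\<ominus> z \<oplus> (u \<oplus> \<ominus> v))" using assms by (simp add: r_neg1)
  finally show ?thesis using assms by (simp add: a_minus_def minus_add a_ac)
qed

lemma nmul_plus: "x \<in> carrier G \<Longrightarrow> nmul G (m + n) x = nmul G m x \<oplus> nmul G n x"
  by (induction n) (auto simp: a_ac)

end

lemma addmap_nmul: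
  assumes "abelian_group G" "abelian_group H" "addmap G H h" "x \<in> carrier G"
  shows "h (nmul G n x) = nmul H n (h x)"
proof -
  interpret G: abelian_group G by fact
  show ?thesis using assms(4)
    by (induction n) (auto simp: addmap_zero[OF assms(1-3)] addmap_add[OF assms(3)])
qed

lemma (in ring) nmul_mult_right: "x \<in> carrier R \<Longrightarrow> y \<in> carrier R \<Longrightarrow> x \<otimes> nmul R n y = nmul R n (x \<otimes> y)"
  by (induction n) (auto simp: r_distr)

text \<open>Matrices of forms with entrywise differential and trace, reduced to what the
  transgression consumes: graded Leibniz rule, graded cyclicity and \<open>d_tr\<close>. The degrees
  are mere subsets, with no direct sum claimed. \<open>b\<close> stands for the connection matrix,
  hence its degree one and the condition \<open>DDb\<close>.\<close>

locale chern_simons = M: ring M + L: abelian_group L for M :: "('m, 'r) ring_scheme" and L :: "('l, 's) ring_scheme" +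
  fixes deg :: "nat \<Rightarrow> 'm set" and D :: "'m \<Rightarrow> 'm" and d :: "'l \<Rightarrow> 'l" and tr :: "'m \<Rightarrow> 'l" and b :: 'm
  assumes deg_carrier: "x \<in> deg p \<Longrightarrow> x \<in> carrier M"
    and deg_add: "x \<in> deg p \<Longrightarrow> y \<in> deg p \<Longrightarrow> x \<oplus>\<^bsub>M\<^esub> y \<in> deg p"
    and deg_mult: "x \<in> deg p \<Longrightarrow> y \<in> deg q \<Longrightarrow> x \<otimes>\<^bsub>M\<^esub> y \<in> deg (p + q)"
    and deg_zero: "\<zero>\<^bsub>M\<^esub> \<in> deg p"
    and deg_one: "\<one>\<^bsub>M\<^esub> \<in> deg 0"
    and deg_D: "x \<in> deg p \<Longrightarrow> D x \<in> deg (Suc p)"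
    and D_addmap: "addmap M M D" and d_addmap: "addmap L L d" and tr_addmap: "addmap M L tr"
    and leibniz: "x \<in> deg p \<Longrightarrow> y \<in> carrier M \<Longrightarrow>
      D (x \<otimes>\<^bsub>M\<^esub> y) = D x \<otimes>\<^bsub>M\<^esub> y \<oplus>\<^bsub>M\<^esub> M.alt_sign (odd p) (x \<otimes>\<^bsub>M\<^esub> D y)"
    and tr_even: "x \<in> deg p \<Longrightarrow> y \<in> deg q \<Longrightarrow> even p \<Longrightarrow> tr (x \<otimes>\<^bsub>M\<^esub> y) = tr (y \<otimes>\<^bsub>M\<^esub> x)"
    and tr_odd: "x \<in> deg p \<Longrightarrow> y \<in> deg q \<Longrightarrow> odd p \<Longrightarrow> odd q \<Longrightarrow> tr (x \<otimes>\<^bsub>M\<^esub> y) = \<ominus>\<^bsub>L\<^esub> tr (y \<otimes>\<^bsub>M\<^esub> x)"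
    and d_tr: "x \<in> carrier M \<Longrightarrow> d (tr x) = tr (D x)"
    and D_one: "D \<one>\<^bsub>M\<^esub> = \<zero>\<^bsub>M\<^esub>"
    and b_deg: "b \<in> deg 1" and DDb: "D (D b) = \<zero>\<^bsub>M\<^esub>"
begin

definition "a = D b"
definition "c = b \<otimes>\<^bsub>M\<^esub> b"

lemma a_deg: "a \<in> deg 2" using deg_D[OF b_deg] by (simp add: a_def numeral_2_eq_2)
lemma c_deg: "c \<in> deg 2" using deg_mult[OF b_deg b_deg] by (simp add: c_def numeral_2_eq_2)

lemma ac_closed [simp]: "a \<in> carrier M" "c \<in> carrier M" "b \<in> carrier M"
  using deg_carrier a_deg c_deg b_deg by auto

lemma D_closed [simp]: "x \<in> carrier M \<Longrightarrow> D x \<in> carrier M" by (rule addmap_closed[OF D_addmap])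

lemma tr_closed [simp]: "x \<in> carrier M \<Longrightarrow> tr x \<in> carrier L" by (rule addmap_closed[OF tr_addmap])
lemma D_add: "x \<in> carrier M \<Longrightarrow> y \<in> carrier M \<Longrightarrow> D (x \<oplus>\<^bsub>M\<^esub> y) = D x \<oplus>\<^bsub>M\<^esub> D y" by (rule addmap_add[OF D_addmap])
lemma tr_add: "x \<in> carrier M \<Longrightarrow> y \<in> carrier M \<Longrightarrow> tr (x \<oplus>\<^bsub>M\<^esub> y) = tr x \<oplus>\<^bsub>L\<^esub> tr y" by (rule addmap_add[OF tr_addmap])
lemma D_zero: "D \<zero>\<^bsub>M\<^esub> = \<zero>\<^bsub>M\<^esub>"
  by (rule addmap_zero[OF M.abelian_group_axioms M.abelian_group_axioms D_addmap])
lemma tr_zero: "tr \<zero>\<^bsub>M\<^esub> = \<zero>\<^bsub>L\<^esub>"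
  by (rule addmap_zero[OF M.abelian_group_axioms L.abelian_group_axioms tr_addmap])
lemma tr_minus: "x \<in> carrier M \<Longrightarrow> y \<in> carrier M \<Longrightarrow> tr (x \<ominus>\<^bsub>M\<^esub> y) = tr x \<ominus>\<^bsub>L\<^esub> tr y"
  by (rule addmap_minus[OF M.abelian_group_axioms L.abelian_group_axioms tr_addmap])

lemma D_even: "x \<in> deg p \<Longrightarrow> even p \<Longrightarrow> y \<in> carrier M \<Longrightarrow> D (x \<otimes>\<^bsub>M\<^esub> y) = D x \<otimes>\<^bsub>M\<^esub> y \<oplus>\<^bsub>M\<^esub> x \<otimes>\<^bsub>M\<^esub> D y"
  using leibniz[of x p y] by simp

lemma D_a: "D a = \<zero>\<^bsub>M\<^esub>" by (simp add: a_def DDb)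

lemma D_c: "D c = a \<otimes>\<^bsub>M\<^esub> b \<ominus>\<^bsub>M\<^esub> b \<otimes>\<^bsub>M\<^esub> a"
  using leibniz[OF b_deg ac_closed(3)] by (simp add: c_def a_def a_minus_def)

text \<open>\<open>S i r\<close> is the sum of all words with \<open>i\<close> letters, \<open>r\<close> of them \<open>c\<close> and the others \<open>a\<close>: the
  coefficient of \<open>t\<^bsup>i+r\<^esup>\<close> in the \<open>i\<close>-th power of the curvature \<open>t a + t\<^sup>2 c\<close> of the connection \<open>t b\<close>.\<close>

primrec S :: "nat \<Rightarrow> nat \<Rightarrow> 'm" where
  "S 0 r = (if r = 0 then \<one>\<^bsub>M\<^esub> else \<zero>\<^bsub>M\<^esub>)"
| "S (Suc i) r = a \<otimes>\<^bsub>M\<^esub> S i r \<oplus>\<^bsub>M\<^esub> c \<otimes>\<^bsub>M\<^esub> (if r = 0 then \<zero>\<^bsub>M\<^esub> else S i (r - 1))"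

text \<open>The index shift that accounts for one more letter \<open>c\<close>; the value zero at r
  = 0 is forced by hand because r - 1 is truncated.\<close>

definition "Sp i r = (if r = 0 then \<zero>\<^bsub>M\<^esub> else S i (r - 1))"

lemma S_Suc: "S (Suc i) r = a \<otimes>\<^bsub>M\<^esub> S i r \<oplus>\<^bsub>M\<^esub> c \<otimes>\<^bsub>M\<^esub> Sp i r"
  by (simp add: Sp_def)

lemma S_deg: "S i r \<in> deg (2 * i)"
proof (induction i arbitrary: r)
  case (Suc i)
  have "Sp i r \<in> deg (2 * i)" using Suc deg_zero by (simp add: Sp_def)
  hence "a \<otimes>\<^bsub>M\<^esub> S i r \<in> deg (2 + 2 * i)" "c \<otimes>\<^bsub>M\<^esub> Sp i r \<in> deg (2 + 2 * i)"
    using deg_mult a_deg c_deg Suc by blast+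
  thus ?case unfolding S_Suc using deg_add by simp
qed (simp add: deg_one deg_zero)

lemma Sp_deg: "Sp i r \<in> deg (2 * i)"
  using S_deg deg_zero by (simp add: Sp_def)

lemma S_closed [simp]: "S i r \<in> carrier M" "Sp i r \<in> carrier M"
  using deg_carrier S_deg Sp_deg by blast+

declare S.simps(2) [simp del]

text \<open>The recursion at the last letter. It follows by induction from the one at the first
  letter because the two touch opposite ends of a word.\<close>

lemma S_Suc_right: "S (Suc i) r = S i r \<otimes>\<^bsub>M\<^esub> a \<oplus>\<^bsub>M\<^esub> Sp i r \<otimes>\<^bsub>M\<^esub> c"
proof (induction i arbitrary: r)
  case 0
  show ?case by (simp add: S_Suc Sp_def)
next
  case (Suc i)
  have p: "Sp (Suc i) r = Sp i r \<otimes>\<^bsub>M\<^esub> a \<oplus>\<^bsub>M\<^esub> Sp i (r - 1) \<otimes>\<^bsub>M\<^esub> c"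
    using Suc[of "r - 1"] by (cases r) (auto simp: Sp_def)
  have p': "Sp (Suc i) r = a \<otimes>\<^bsub>M\<^esub> Sp i r \<oplus>\<^bsub>M\<^esub> c \<otimes>\<^bsub>M\<^esub> Sp i (r - 1)"
    using S_Suc[of i "r - 1"] by (cases r) (auto simp: Sp_def)
  have "S (Suc (Suc i)) r = a \<otimes>\<^bsub>M\<^esub> (S i r \<otimes>\<^bsub>M\<^esub> a \<oplus>\<^bsub>M\<^esub> Sp i r \<otimes>\<^bsub>M\<^esub> c) \<oplus>\<^bsub>M\<^esub>
      c \<otimes>\<^bsub>M\<^esub> (Sp i r \<otimes>\<^bsub>M\<^esub> a \<oplus>\<^bsub>M\<^esub> Sp i (r - 1) \<otimes>\<^bsub>M\<^esub> c)"
    by (simp only: S_Suc[of "Suc i"] Suc p)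
  also have "\<dots> = (a \<otimes>\<^bsub>M\<^esub> S i r \<oplus>\<^bsub>M\<^esub> c \<otimes>\<^bsub>M\<^esub> Sp i r) \<otimes>\<^bsub>M\<^esub> a \<oplus>\<^bsub>M\<^esub>
      (a \<otimes>\<^bsub>M\<^esub> Sp i r \<oplus>\<^bsub>M\<^esub> c \<otimes>\<^bsub>M\<^esub> Sp i (r - 1)) \<otimes>\<^bsub>M\<^esub> c"
    by (simp add: M.l_distr M.r_distr M.m_assoc M.a_ac)
  also have "\<dots> = S (Suc i) r \<otimes>\<^bsub>M\<^esub> a \<oplus>\<^bsub>M\<^esub> Sp (Suc i) r \<otimes>\<^bsub>M\<^esub> c" by (simp only: S_Suc p')
  finally show ?case .
qed

text \<open>The Bianchi identity by coefficients: F = t a + t^2 c satisfies D F = F (t b) - (t b) F,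
  and the same formula passes to the powers of F by the Leibniz rule in even degree.\<close>

lemma D_S: "D (S i r) = Sp i r \<otimes>\<^bsub>M\<^esub> b \<ominus>\<^bsub>M\<^esub> b \<otimes>\<^bsub>M\<^esub> Sp i r"
proof (induction i arbitrary: r)
  case 0
  show ?case by (simp add: Sp_def D_one D_zero a_minus_def M.r_neg)
next
  case (Suc i)
  have DSp: "D (Sp i r) = Sp i (r - 1) \<otimes>\<^bsub>M\<^esub> b \<ominus>\<^bsub>M\<^esub> b \<otimes>\<^bsub>M\<^esub> Sp i (r - 1)"
    using Suc[of "r - 1"] by (cases r) (auto simp: Sp_def D_zero a_minus_def M.r_neg)
  have p': "Sp (Suc i) r = a \<otimes>\<^bsub>M\<^esub> Sp i r \<oplus>\<^bsub>M\<^esub> c \<otimes>\<^bsub>M\<^esub> Sp i (r - 1)"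
    using S_Suc[of i "r - 1"] by (cases r) (auto simp: Sp_def)
  \<comment> \<open>\<open>c\<close> commutes with \<open>b\<close>, being its square, so the letter
    \<open>c\<close> contributes nothing to the commutator with \<open>b\<close>.\<close>
  have "c \<otimes>\<^bsub>M\<^esub> b = b \<otimes>\<^bsub>M\<^esub> c" by (simp add: c_def M.m_assoc)
  hence cb: "c \<otimes>\<^bsub>M\<^esub> (b \<otimes>\<^bsub>M\<^esub> x) = b \<otimes>\<^bsub>M\<^esub> (c \<otimes>\<^bsub>M\<^esub> x)" if "x \<in> carrier M" for x
    using that by (simp add: M.m_assoc[symmetric])
  have "D (S (Suc i) r) = a \<otimes>\<^bsub>M\<^esub> D (S i r) \<oplus>\<^bsub>M\<^esub> (D c \<otimes>\<^bsub>M\<^esub> Sp i r \<oplus>\<^bsub>M\<^esub> c \<otimes>\<^bsub>M\<^esub> D (Sp i r))"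
    by (simp add: S_Suc D_add D_even[OF a_deg] D_even[OF c_deg] D_a)
  also have "\<dots> = (a \<otimes>\<^bsub>M\<^esub> Sp i r \<oplus>\<^bsub>M\<^esub> c \<otimes>\<^bsub>M\<^esub> Sp i (r - 1)) \<otimes>\<^bsub>M\<^esub> b \<ominus>\<^bsub>M\<^esub>
      b \<otimes>\<^bsub>M\<^esub> (a \<otimes>\<^bsub>M\<^esub> Sp i r \<oplus>\<^bsub>M\<^esub> c \<otimes>\<^bsub>M\<^esub> Sp i (r - 1))"
  proof -
    have "a \<otimes>\<^bsub>M\<^esub> D (S i r) = a \<otimes>\<^bsub>M\<^esub> (Sp i r \<otimes>\<^bsub>M\<^esub> b) \<ominus>\<^bsub>M\<^esub> a \<otimes>\<^bsub>M\<^esub> (b \<otimes>\<^bsub>M\<^esub> Sp i r)"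
      "D c \<otimes>\<^bsub>M\<^esub> Sp i r = a \<otimes>\<^bsub>M\<^esub> (b \<otimes>\<^bsub>M\<^esub> Sp i r) \<ominus>\<^bsub>M\<^esub> b \<otimes>\<^bsub>M\<^esub> (a \<otimes>\<^bsub>M\<^esub> Sp i r)"
      "c \<otimes>\<^bsub>M\<^esub> D (Sp i r) = c \<otimes>\<^bsub>M\<^esub> (Sp i (r - 1) \<otimes>\<^bsub>M\<^esub> b) \<ominus>\<^bsub>M\<^esub> b \<otimes>\<^bsub>M\<^esub> (c \<otimes>\<^bsub>M\<^esub> Sp i (r - 1))"
      by (simp_all add: Suc DSp D_c a_minus_def M.l_distr M.r_distr M.m_assoc M.l_minus M.r_minus cb)
    thus ?thesis by (simp add: M.minus_telescope M.l_distr M.r_distr M.m_assoc)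
  qed
  finally show ?case by (simp only: p')
qed

lemma tr_S_Suc: "tr (S (Suc i) r) = tr (a \<otimes>\<^bsub>M\<^esub> S i r) \<oplus>\<^bsub>L\<^esub> tr (c \<otimes>\<^bsub>M\<^esub> Sp i r)"
  by (simp add: S_Suc tr_add)

text \<open>The right-hand side is a coefficient of tr(F' F^i), where F' = a + 2 t c is the
  derivative of F in t: one copy of the c-term sits in \<open>tr (S (Suc i) r)\<close>, the other is
  the extra summand. Both arise from the commutator in \<open>D_S\<close>, whose two terms
  contribute equally once the odd \<open>b\<close> is moved around under the trace.\<close>

lemma d_tr_bS: "d (tr (b \<otimes>\<^bsub>M\<^esub> S i r)) = tr (S (Suc i) r) \<oplus>\<^bsub>L\<^esub> tr (c \<otimes>\<^bsub>M\<^esub> Sp i r)"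
proof -
  have "Sp i r \<otimes>\<^bsub>M\<^esub> b \<in> deg (2 * i + 1)" using deg_mult[OF Sp_deg b_deg] .
  hence "tr (b \<otimes>\<^bsub>M\<^esub> (Sp i r \<otimes>\<^bsub>M\<^esub> b)) = \<ominus>\<^bsub>L\<^esub> tr (Sp i r \<otimes>\<^bsub>M\<^esub> b \<otimes>\<^bsub>M\<^esub> b)"
    by (rule tr_odd[OF b_deg]) auto
  also have "tr (Sp i r \<otimes>\<^bsub>M\<^esub> b \<otimes>\<^bsub>M\<^esub> b) = tr (c \<otimes>\<^bsub>M\<^esub> Sp i r)"
    using tr_even[OF Sp_deg c_deg] by (simp add: c_def M.m_assoc)
  finally have 1: "tr (b \<otimes>\<^bsub>M\<^esub> (Sp i r \<otimes>\<^bsub>M\<^esub> b)) = \<ominus>\<^bsub>L\<^esub> tr (c \<otimes>\<^bsub>M\<^esub> Sp i r)" .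
  have 2: "b \<otimes>\<^bsub>M\<^esub> (b \<otimes>\<^bsub>M\<^esub> Sp i r) = c \<otimes>\<^bsub>M\<^esub> Sp i r" by (simp add: c_def M.m_assoc)
  have "d (tr (b \<otimes>\<^bsub>M\<^esub> S i r)) = tr (a \<otimes>\<^bsub>M\<^esub> S i r \<ominus>\<^bsub>M\<^esub> b \<otimes>\<^bsub>M\<^esub> D (S i r))"
    using leibniz[OF b_deg, of "S i r"] by (simp add: d_tr a_def a_minus_def)
  also have "b \<otimes>\<^bsub>M\<^esub> D (S i r) = b \<otimes>\<^bsub>M\<^esub> (Sp i r \<otimes>\<^bsub>M\<^esub> b) \<ominus>\<^bsub>M\<^esub> c \<otimes>\<^bsub>M\<^esub> Sp i r"
    by (simp add: D_S a_minus_def M.r_distr M.r_minus 2)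
  also have "tr (a \<otimes>\<^bsub>M\<^esub> S i r \<ominus>\<^bsub>M\<^esub> \<dots>) = tr (a \<otimes>\<^bsub>M\<^esub> S i r) \<ominus>\<^bsub>L\<^esub> (\<ominus>\<^bsub>L\<^esub> tr (c \<otimes>\<^bsub>M\<^esub> Sp i r) \<ominus>\<^bsub>L\<^esub> tr (c \<otimes>\<^bsub>M\<^esub> Sp i r))"
    by (simp add: tr_minus 1)
  also have "\<dots> = tr (S (Suc i) r) \<oplus>\<^bsub>L\<^esub> tr (c \<otimes>\<^bsub>M\<^esub> Sp i r)"
    by (simp add: tr_S_Suc L.abel_simps)
  finally show ?thesis .
qed

text \<open>\<open>W i m r\<close> is the coefficient \<open>S (i + m) r\<close> weighted by the number of letters \<open>c\<close> among the first \<open>i\<close>;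
  cyclicity of the trace trades the first letter for a last one.\<close>

primrec W :: "nat \<Rightarrow> nat \<Rightarrow> nat \<Rightarrow> 'm" where
  "W i 0 r = nmul M r (S i r)"
| "W i (Suc m) r = W i m r \<otimes>\<^bsub>M\<^esub> a \<oplus>\<^bsub>M\<^esub> (if r = 0 then \<zero>\<^bsub>M\<^esub> else W i m (r - 1)) \<otimes>\<^bsub>M\<^esub> c"

definition "Wp i m r = (if r = 0 then \<zero>\<^bsub>M\<^esub> else W i m (r - 1))"

lemma deg_nmul: "x \<in> deg p \<Longrightarrow> nmul M n x \<in> deg p"
  by (induction n) (auto simp: deg_zero deg_add)

lemma W_Suc: "W i (Suc m) r = W i m r \<otimes>\<^bsub>M\<^esub> a \<oplus>\<^bsub>M\<^esub> Wp i m r \<otimes>\<^bsub>M\<^esub> c"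
  by (simp add: Wp_def)

lemma W_deg: "W i m r \<in> deg (2 * (i + m))"
proof (induction m arbitrary: r)
  case 0
  thus ?case using deg_nmul[OF S_deg] by simp
next
  case (Suc m)
  have "Wp i m r \<in> deg (2 * (i + m))" using Suc deg_zero by (simp add: Wp_def)
  hence "W i m r \<otimes>\<^bsub>M\<^esub> a \<in> deg (2 * (i + m) + 2)" "Wp i m r \<otimes>\<^bsub>M\<^esub> c \<in> deg (2 * (i + m) + 2)"
    using deg_mult a_deg c_deg Suc by blast+
  thus ?case unfolding W_Suc using deg_add by simp
qed

lemma Wp_deg: "Wp i m r \<in> deg (2 * (i + m))"
  using W_deg deg_zero by (simp add: Wp_def)

lemma W_closed [simp]: "W i m r \<in> carrier M" "Wp i m r \<in> carrier M"
  using deg_carrier W_deg Wp_deg by blast+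

declare W.simps(2) [simp del]

text \<open>A new first letter is weighted as well: \<open>a\<close> changes no count, while
  \<open>c\<close> counts every word once more, which is the last summand.\<close>

lemma W_left:
  "W (Suc i) m r = a \<otimes>\<^bsub>M\<^esub> W i m r \<oplus>\<^bsub>M\<^esub> c \<otimes>\<^bsub>M\<^esub> Wp i m r \<oplus>\<^bsub>M\<^esub> c \<otimes>\<^bsub>M\<^esub> Sp (i + m) r"
proof (induction m arbitrary: r)
  case 0
  show ?case
  proof (cases r)
    case (Suc q)
    have "W (Suc i) 0 r = nmul M (Suc q) (a \<otimes>\<^bsub>M\<^esub> S i r) \<oplus>\<^bsub>M\<^esub> nmul M (Suc q) (c \<otimes>\<^bsub>M\<^esub> S i q)"
      using Suc by (simp add: S_Suc Sp_def M.nmul_add del: nmul.simps)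
    also have "\<dots> = a \<otimes>\<^bsub>M\<^esub> nmul M r (S i r) \<oplus>\<^bsub>M\<^esub> (c \<otimes>\<^bsub>M\<^esub> nmul M q (S i q) \<oplus>\<^bsub>M\<^esub> c \<otimes>\<^bsub>M\<^esub> S i q)"
      unfolding Suc M.nmul_mult_right[OF ac_closed(1) S_closed(1), symmetric]
      by (simp add: M.nmul_mult_right M.r_distr del: nmul.simps(2)) simp
    finally show ?thesis using Suc by (simp add: Wp_def Sp_def M.a_assoc del: nmul.simps(2))
  qed (simp add: Wp_def Sp_def)
next
  case (Suc m)
  have p: "Wp (Suc i) m r = a \<otimes>\<^bsub>M\<^esub> Wp i m r \<oplus>\<^bsub>M\<^esub> c \<otimes>\<^bsub>M\<^esub> Wp i m (r - 1) \<oplus>\<^bsub>M\<^esub> c \<otimes>\<^bsub>M\<^esub> Sp (i + m) (r - 1)"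
    using Suc[of "r - 1"] by (cases r) (auto simp: Wp_def Sp_def)
  have q: "Wp i (Suc m) r = Wp i m r \<otimes>\<^bsub>M\<^esub> a \<oplus>\<^bsub>M\<^esub> Wp i m (r - 1) \<otimes>\<^bsub>M\<^esub> c"
    using W_Suc[of i m "r - 1"] by (cases r) (auto simp: Wp_def)
  have q': "Sp (i + Suc m) r = Sp (i + m) r \<otimes>\<^bsub>M\<^esub> a \<oplus>\<^bsub>M\<^esub> Sp (i + m) (r - 1) \<otimes>\<^bsub>M\<^esub> c"
    using S_Suc_right[of "i + m" "r - 1"] by (cases r) (auto simp: Sp_def)
  show ?case unfolding W_Suc Suc p q q'
    by (simp add: M.l_distr M.r_distr M.m_assoc M.a_ac)
qed

lemma W_zero: "W 0 m r = \<zero>\<^bsub>M\<^esub>"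
proof (induction m arbitrary: r)
  case 0
  show ?case by (cases r) auto
next
  case (Suc m)
  thus ?case by (simp add: W_Suc Wp_def)
qed

text \<open>Each of the i weighted positions contributes the same trace, since rotation brings its
  letter to the front. For i = 0 the truncated index is harmless, both sides being zero.\<close>

lemma tr_W: "tr (W i m r) = nmul L i (tr (c \<otimes>\<^bsub>M\<^esub> Sp (i + m - 1) r))"
proof (induction i arbitrary: m)
  case 0
  show ?case by (simp add: W_zero tr_zero)
next
  case (Suc i)
  have 1: "tr (a \<otimes>\<^bsub>M\<^esub> W i m r) = tr (W i m r \<otimes>\<^bsub>M\<^esub> a)" "tr (c \<otimes>\<^bsub>M\<^esub> Wp i m r) = tr (Wp i m r \<otimes>\<^bsub>M\<^esub> c)"
    using tr_even[OF a_deg W_deg] tr_even[OF c_deg Wp_deg] by auto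
  have "tr (W (Suc i) m r) = tr (W i (Suc m) r) \<oplus>\<^bsub>L\<^esub> tr (c \<otimes>\<^bsub>M\<^esub> Sp (i + m) r)"
    by (simp add: W_left tr_add 1 W_Suc)
  also have "tr (W i (Suc m) r) = nmul L i (tr (c \<otimes>\<^bsub>M\<^esub> Sp (i + m) r))" using Suc[of "Suc m"] by simp
  finally show ?case by simp
qed

text \<open>Double counting of words of length i + 1 with one marked \<open>c\<close>: every word
  has r possible marks, and up to rotation a mark at any of the i + 1 places is a mark at the
  front.\<close>

lemma nmul_tr_S: "nmul L r (tr (S (Suc i) r)) = nmul L (Suc i) (tr (c \<otimes>\<^bsub>M\<^esub> Sp i r))"
  using tr_W[of "Suc i" 0 r] addmap_nmul[OF M.abelian_group_axioms L.abelian_group_axioms tr_addmap S_closed(1)]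
  by simp

text \<open>Coefficient form of d/dt tr F^(i+1) = (i + 1) d tr(b F^i): differentiation in t
  multiplies the coefficient of t^(i+1+r) by its exponent.\<close>

lemma transgression:
  "nmul L (Suc i + r) (tr (S (Suc i) r)) = nmul L (Suc i) (d (tr (b \<otimes>\<^bsub>M\<^esub> S i r)))"
proof -
  have "nmul L (Suc i + r) (tr (S (Suc i) r)) = nmul L (Suc i) (tr (S (Suc i) r)) \<oplus>\<^bsub>L\<^esub> nmul L (Suc i) (tr (c \<otimes>\<^bsub>M\<^esub> Sp i r))"
    using nmul_tr_S[of r i] by (simp only: L.nmul_plus tr_closed S_closed)
  also have "\<dots> = nmul L (Suc i) (d (tr (b \<otimes>\<^bsub>M\<^esub> S i r)))"
    by (simp add: d_tr_bS L.nmul_add del: nmul.simps)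
  finally show ?thesis .
qed

lemma S_vanish: "r > i \<Longrightarrow> S i r = \<zero>\<^bsub>M\<^esub>"
proof (induction i arbitrary: r)
  case (Suc i)
  thus ?case by (simp add: S_Suc Sp_def)
qed simp

text \<open>The i-th power of t a + t^2 c at t = 1.\<close>

lemma curvature_pow: "(a \<oplus>\<^bsub>M\<^esub> c) [^]\<^bsub>M\<^esub> i = (\<Oplus>\<^bsub>M\<^esub> r\<in>{..i}. S i r)"
proof (induction i)
  case 0
  show ?case by simp
next
  case (Suc i)
  have "(\<Oplus>\<^bsub>M\<^esub> r\<in>{..Suc i}. S (Suc i) r) =
      (\<Oplus>\<^bsub>M\<^esub> r\<in>{..Suc i}. S i r \<otimes>\<^bsub>M\<^esub> a) \<oplus>\<^bsub>M\<^esub> (\<Oplus>\<^bsub>M\<^esub> r\<in>{..Suc i}. Sp i r \<otimes>\<^bsub>M\<^esub> c)"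
    unfolding S_Suc_right by (rule M.finsum_addf) auto
  also have "(\<Oplus>\<^bsub>M\<^esub> r\<in>{..Suc i}. S i r \<otimes>\<^bsub>M\<^esub> a) = (\<Oplus>\<^bsub>M\<^esub> r\<in>{..i}. S i r) \<otimes>\<^bsub>M\<^esub> a"
    by (simp add: S_vanish M.finsum_ldistr Pi_def)
  also have "(\<Oplus>\<^bsub>M\<^esub> r\<in>{..Suc i}. Sp i r \<otimes>\<^bsub>M\<^esub> c) = (\<Oplus>\<^bsub>M\<^esub> r\<in>{..i}. S i r) \<otimes>\<^bsub>M\<^esub> c"
  proof -
    have "(\<Oplus>\<^bsub>M\<^esub> r\<in>{..Suc i}. Sp i r \<otimes>\<^bsub>M\<^esub> c) = (\<Oplus>\<^bsub>M\<^esub> r\<in>{..i}. Sp i (Suc r) \<otimes>\<^bsub>M\<^esub> c) \<oplus>\<^bsub>M\<^esub> Sp i 0 \<otimes>\<^bsub>M\<^esub> c"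
      by (rule M.finsum_Suc2) auto
    thus ?thesis by (simp add: M.finsum_ldistr Pi_def Sp_def)
  qed
  finally show ?case using Suc by (simp add: M.r_distr M.finsum_closed Pi_def)
qed

lemma tr_curvature_pow: "tr ((a \<oplus>\<^bsub>M\<^esub> c) [^]\<^bsub>M\<^esub> i) = (\<Oplus>\<^bsub>L\<^esub> r\<in>{..i}. tr (S i r))"
  unfolding curvature_pow
  by (rule addmap_finsum[OF M.abelian_group_axioms L.abelian_group_axioms tr_addmap]) auto

end

subsection \<open>Matrix rings\<close>

text \<open>Zero padding outside the n x n block makes equality of matrices equality of functions,
  and lets a row or a column be stored as a square matrix.\<close>

definition mat_ring :: "('l, 'x) ring_scheme \<Rightarrow> nat \<Rightarrow> (nat \<Rightarrow> nat \<Rightarrow> 'l) ring" where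
  "mat_ring R n = \<lparr>carrier = {A. (\<forall>i j. A i j \<in> carrier R) \<and> (\<forall>i j. i \<ge> n \<or> j \<ge> n \<longrightarrow> A i j = \<zero>\<^bsub>R\<^esub>)},
     mult = (\<lambda>A B i j. \<Oplus>\<^bsub>R\<^esub> k\<in>{..<n}. A i k \<otimes>\<^bsub>R\<^esub> B k j),
     one = (\<lambda>i j. if i = j \<and> i < n then \<one>\<^bsub>R\<^esub> else \<zero>\<^bsub>R\<^esub>),
     zero = (\<lambda>i j. \<zero>\<^bsub>R\<^esub>), add = (\<lambda>A B i j. A i j \<oplus>\<^bsub>R\<^esub> B i j)\<rparr>"

context ring
begin

lemma mat_val: "A \<in> carrier (mat_ring R n) \<Longrightarrow> A i j \<in> carrier R"
  by (simp add: mat_ring_def)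

lemma mat_ring_simps:
  "\<zero>\<^bsub>mat_ring R n\<^esub> = (\<lambda>i j. \<zero>)"
  "A \<oplus>\<^bsub>mat_ring R n\<^esub> B = (\<lambda>i j. A i j \<oplus> B i j)"
  "A \<otimes>\<^bsub>mat_ring R n\<^esub> B = (\<lambda>i j. \<Oplus> k\<in>{..<n}. A i k \<otimes> B k j)"
  "\<one>\<^bsub>mat_ring R n\<^esub> = (\<lambda>i j. if i = j \<and> i < n then \<one> else \<zero>)"
  by (simp_all add: mat_ring_def)

lemma finsum_delta:
  assumes "i < n" "f i \<in> carrier R"
  shows "(\<Oplus> k\<in>{..<n::nat}. if k = i then f k else \<zero>) = f i"
proof -
  have "(\<Oplus> k\<in>{..<n}. if k = i then f k else \<zero>) = (\<Oplus> k\<in>{i}. f k)"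
    using assms by (intro add.finprod_mono_neutral_cong_right) auto
  thus ?thesis using assms by simp
qed

lemma mat_ring_ring: "ring (mat_ring R n)"
proof (rule ringI)
  let ?M = "mat_ring R n"
  have c: "(\<lambda>i j. \<Oplus> k\<in>{..<n}. A i k \<otimes> B k j) \<in> carrier ?M" if "A \<in> carrier ?M" "B \<in> carrier ?M" for A B
  proof -
    note v = mat_val[OF that(1)] mat_val[OF that(2)]
    have "(\<Oplus> k\<in>{..<n}. A i k \<otimes> B k j) = \<zero>" if "i \<ge> n \<or> j \<ge> n" for i j
    proof -
      have "A i k \<otimes> B k j = \<zero>" for k
        using that \<open>A \<in> carrier ?M\<close> \<open>B \<in> carrier ?M\<close> v by (auto simp: mat_ring_def)
      thus ?thesis by simp
    qed
    thus ?thesis using v by (simp add: mat_ring_def Pi_def)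
  qed
  show "abelian_group ?M"
  proof (rule abelian_groupI)
    fix A assume A: "A \<in> carrier ?M"
    hence "(\<lambda>i j. \<ominus> A i j) \<in> carrier ?M" "(\<lambda>i j. \<ominus> A i j) \<oplus>\<^bsub>?M\<^esub> A = \<zero>\<^bsub>?M\<^esub>"
      by (simp_all add: mat_ring_def l_neg)
    thus "\<exists>B\<in>carrier ?M. B \<oplus>\<^bsub>?M\<^esub> A = \<zero>\<^bsub>?M\<^esub>" by blast
  qed (simp_all add: mat_ring_def a_ac)
  show "monoid ?M"
  proof (rule monoidI)
    fix A B C assume "A \<in> carrier ?M" "B \<in> carrier ?M" "C \<in> carrier ?M"
    note ABC = this[THEN mat_val]
    have "(\<Oplus> k\<in>{..<n}. (\<Oplus> l\<in>{..<n}. A i l \<otimes> B l k) \<otimes> C k j) =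
        (\<Oplus> l\<in>{..<n}. A i l \<otimes> (\<Oplus> k\<in>{..<n}. B l k \<otimes> C k j))" for i j
    proof -
      have "(\<Oplus> k\<in>{..<n}. (\<Oplus> l\<in>{..<n}. A i l \<otimes> B l k) \<otimes> C k j) = (\<Oplus> k\<in>{..<n}. \<Oplus> l\<in>{..<n}. A i l \<otimes> B l k \<otimes> C k j)"
        using ABC by (intro finsum_cong') (auto simp: finsum_ldistr Pi_def)
      also have "\<dots> = (\<Oplus> l\<in>{..<n}. \<Oplus> k\<in>{..<n}. A i l \<otimes> B l k \<otimes> C k j)"
        using ABC by (intro finsum_swap) auto
      also have "\<dots> = (\<Oplus> l\<in>{..<n}. A i l \<otimes> (\<Oplus> k\<in>{..<n}. B l k \<otimes> C k j))"
        using ABC by (intro finsum_cong') (auto simp: finsum_rdistr Pi_def m_assoc)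
      finally show ?thesis .
    qed
    thus "A \<otimes>\<^bsub>?M\<^esub> B \<otimes>\<^bsub>?M\<^esub> C = A \<otimes>\<^bsub>?M\<^esub> (B \<otimes>\<^bsub>?M\<^esub> C)" by (simp add: mat_ring_simps)
  next
    fix A assume "A \<in> carrier ?M"
    note A = mat_val[OF this]
    have z: "A i j = \<zero>" if "i \<ge> n \<or> j \<ge> n" for i j using \<open>A \<in> carrier ?M\<close> that by (auto simp: mat_ring_def)
    have "(\<Oplus> k\<in>{..<n}. (if i = k \<and> i < n then \<one> else \<zero>) \<otimes> A k j) = A i j" for i j
    proof (cases "i < n")
      case True
      have "(\<Oplus> k\<in>{..<n}. (if i = k \<and> i < n then \<one> else \<zero>) \<otimes> A k j) = (\<Oplus> k\<in>{..<n}. if k = i then A k j else \<zero>)"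
        using A True by (intro finsum_cong') auto
      thus ?thesis using finsum_delta[of i n "\<lambda>k. A k j"] A True by simp
    qed (use z A in auto)
    thus "\<one>\<^bsub>?M\<^esub> \<otimes>\<^bsub>?M\<^esub> A = A" by (simp add: mat_ring_simps)
    have "(\<Oplus> k\<in>{..<n}. A i k \<otimes> (if k = j \<and> k < n then \<one> else \<zero>)) = A i j" for i j
    proof (cases "j < n")
      case True
      have "(\<Oplus> k\<in>{..<n}. A i k \<otimes> (if k = j \<and> k < n then \<one> else \<zero>)) = (\<Oplus> k\<in>{..<n}. if k = j then A i k else \<zero>)"
        using A True by (intro finsum_cong') auto
      thus ?thesis using finsum_delta[of j n "\<lambda>k. A i k"] A True by simp
    next
      case False
      have "(\<Oplus> k\<in>{..<n}. A i k \<otimes> (if k = j \<and> k < n then \<one> else \<zero>)) = (\<Oplus> k\<in>{..<n}. \<zero>)"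
        using A False by (intro finsum_cong') auto
      thus ?thesis using z False by simp
    qed
    thus "A \<otimes>\<^bsub>?M\<^esub> \<one>\<^bsub>?M\<^esub> = A" by (simp add: mat_ring_simps)
  next
    show "\<one>\<^bsub>?M\<^esub> \<in> carrier ?M" by (auto simp: mat_ring_def)
  qed (simp add: mat_ring_simps(3) c)
  fix A B C assume "A \<in> carrier ?M" "B \<in> carrier ?M" "C \<in> carrier ?M"
  note ABC = this[THEN mat_val]
  have "(\<Oplus> k\<in>{..<n}. (A i k \<oplus> B i k) \<otimes> C k j) = (\<Oplus> k\<in>{..<n}. A i k \<otimes> C k j) \<oplus> (\<Oplus> k\<in>{..<n}. B i k \<otimes> C k j)" for i j
    using ABC by (subst finsum_addf[symmetric]) (auto simp: l_distr)
  thus "(A \<oplus>\<^bsub>?M\<^esub> B) \<otimes>\<^bsub>?M\<^esub> C = A \<otimes>\<^bsub>?M\<^esub> C \<oplus>\<^bsub>?M\<^esub> B \<otimes>\<^bsub>?M\<^esub> C" by (simp add: mat_ring_simps)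
  have "(\<Oplus> k\<in>{..<n}. C i k \<otimes> (A k j \<oplus> B k j)) = (\<Oplus> k\<in>{..<n}. C i k \<otimes> A k j) \<oplus> (\<Oplus> k\<in>{..<n}. C i k \<otimes> B k j)" for i j
    using ABC by (subst finsum_addf[symmetric]) (auto simp: r_distr)
  thus "C \<otimes>\<^bsub>?M\<^esub> (A \<oplus>\<^bsub>?M\<^esub> B) = C \<otimes>\<^bsub>?M\<^esub> A \<oplus>\<^bsub>?M\<^esub> C \<otimes>\<^bsub>?M\<^esub> B" by (simp add: mat_ring_simps)
qed

lemma mat_inv: "A \<in> carrier (mat_ring R n) \<Longrightarrow> \<ominus>\<^bsub>mat_ring R n\<^esub> A = (\<lambda>i j. \<ominus> A i j)"
proof -
  assume A: "A \<in> carrier (mat_ring R n)"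
  interpret M: ring "mat_ring R n" by (rule mat_ring_ring)
  have "(\<lambda>i j. \<ominus> A i j) \<in> carrier (mat_ring R n)" using A by (simp add: mat_ring_def)
  moreover have "(\<lambda>i j. \<ominus> A i j) \<oplus>\<^bsub>mat_ring R n\<^esub> A = \<zero>\<^bsub>mat_ring R n\<^esub>"
    using A by (simp add: mat_ring_def l_neg)
  ultimately show ?thesis using A M.minus_equality by blast
qed

end

subsection \<open>Matrices of differential forms\<close>

context kalgebra
begin

definition mdeg :: "nat \<Rightarrow> nat \<Rightarrow> (nat \<Rightarrow> nat \<Rightarrow> 'a form) set" where
  "mdeg n p = {A \<in> carrier (mat_ring L n). \<forall>i j. A i j \<in> \<Lambda> p}"

definition md :: "(nat \<Rightarrow> nat \<Rightarrow> 'a form) \<Rightarrow> nat \<Rightarrow> nat \<Rightarrow> 'a form" where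
  "md A = (\<lambda>i j. dR (A i j))"

definition mtr :: "nat \<Rightarrow> (nat \<Rightarrow> nat \<Rightarrow> 'a form) \<Rightarrow> 'a form" where
  "mtr n A = (\<Oplus>\<^bsub>L\<^esub> i\<in>{..<n}. A i i)"

lemma dR_zero: "dR \<zero>\<^bsub>L\<^esub> = \<zero>\<^bsub>L\<^esub>"
  by (rule addmap_zero[OF L.M.abelian_group_axioms L.M.abelian_group_axioms dR_addmap])

lemma dR_finsum: "f \<in> A \<rightarrow> carrier L \<Longrightarrow> dR (\<Oplus>\<^bsub>L\<^esub> i\<in>A. f i) = (\<Oplus>\<^bsub>L\<^esub> i\<in>A. dR (f i))"
  by (rule addmap_finsum[OF L.M.abelian_group_axioms L.M.abelian_group_axioms dR_addmap])

lemma alt_sign_finsum: "f \<in> A \<rightarrow> carrier L \<Longrightarrow>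
    LR.alt_sign b (\<Oplus>\<^bsub>L\<^esub> i\<in>A. f i) = (\<Oplus>\<^bsub>L\<^esub> i\<in>A. LR.alt_sign b (f i))"
  by (rule addmap_finsum[OF L.M.abelian_group_axioms L.M.abelian_group_axioms])
    (auto intro!: addmapI simp: LR.alt_sign_add)

lemma mdegI: "A \<in> carrier (mat_ring L n) \<Longrightarrow> (\<And>i j. A i j \<in> \<Lambda> p) \<Longrightarrow> A \<in> mdeg n p"
  by (simp add: mdeg_def)

lemma mdegD: "A \<in> mdeg n p \<Longrightarrow> A \<in> carrier (mat_ring L n)" "A \<in> mdeg n p \<Longrightarrow> A i j \<in> \<Lambda> p"
  by (auto simp: mdeg_def)

lemma md_carrier: "A \<in> carrier (mat_ring L n) \<Longrightarrow> md A \<in> carrier (mat_ring L n)"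
  by (auto simp: mat_ring_def md_def dR_zero)

text \<open>Cyclicity of the trace with its sign is graded commutativity of the entries plus an
  exchange of the two sums; the remaining axioms reduce to the entries.\<close>

lemma chern_simons_mat:
  assumes B: "B \<in> mdeg n 1"
  shows "chern_simons (mat_ring L n) L (mdeg n) md dR (mtr n) B"
proof -
  let ?M = "mat_ring L n"
  interpret M: ring ?M by (rule LR.mat_ring_ring)
  note mv = LR.mat_val
  have alt: "M.alt_sign b A = (\<lambda>i j. LR.alt_sign b (A i j))" if "A \<in> carrier ?M" for A b
    using that by (simp add: M.alt_sign_def LR.alt_sign_def LR.mat_inv)
  have tr: "mtr n (X \<otimes>\<^bsub>?M\<^esub> Y) = LR.alt_sign (odd p \<and> odd q) (mtr n (Y \<otimes>\<^bsub>?M\<^esub> X))"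
    if X: "X \<in> mdeg n p" and Y: "Y \<in> mdeg n q" for X Y p q
  proof -
    note c = mv[OF mdegD(1)[OF X]] mv[OF mdegD(1)[OF Y]]
    have "mtr n (X \<otimes>\<^bsub>?M\<^esub> Y) = (\<Oplus>\<^bsub>L\<^esub> i\<in>{..<n}. \<Oplus>\<^bsub>L\<^esub> k\<in>{..<n}. LR.alt_sign (odd p \<and> odd q) (Y k i \<otimes>\<^bsub>L\<^esub> X i k))"
      unfolding mtr_def LR.mat_ring_simps
      by (simp only: power_comm[OF mdegD(2)[OF X] mdegD(2)[OF Y]])
    also have "\<dots> = (\<Oplus>\<^bsub>L\<^esub> k\<in>{..<n}. \<Oplus>\<^bsub>L\<^esub> i\<in>{..<n}. LR.alt_sign (odd p \<and> odd q) (Y k i \<otimes>\<^bsub>L\<^esub> X i k))"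
      using c by (intro L.M.finsum_swap) auto
    also have "\<dots> = LR.alt_sign (odd p \<and> odd q) (mtr n (Y \<otimes>\<^bsub>?M\<^esub> X))"
      unfolding mtr_def LR.mat_ring_simps using c by (simp add: alt_sign_finsum Pi_def)
    finally show ?thesis .
  qed
  show ?thesis
  proof (unfold_locales)
    fix X Y p assume X: "X \<in> mdeg n p" and Y: "Y \<in> carrier ?M"
    note c = mv[OF mdegD(1)[OF X]] mv[OF Y]
    have m: "X \<otimes>\<^bsub>?M\<^esub> md Y \<in> carrier ?M" by (rule M.m_closed[OF mdegD(1)[OF X] md_carrier[OF Y]])
    have "dR (\<Oplus>\<^bsub>L\<^esub> k\<in>{..<n}. X i k \<otimes>\<^bsub>L\<^esub> Y k j) =
       (\<Oplus>\<^bsub>L\<^esub> k\<in>{..<n}. dR (X i k) \<otimes>\<^bsub>L\<^esub> Y k j) \<oplus>\<^bsub>L\<^esub> LR.alt_sign (odd p) (\<Oplus>\<^bsub>L\<^esub> k\<in>{..<n}. X i k \<otimes>\<^bsub>L\<^esub> dR (Y k j))" for i j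
    proof -
      have "dR (\<Oplus>\<^bsub>L\<^esub> k\<in>{..<n}. X i k \<otimes>\<^bsub>L\<^esub> Y k j) =
        (\<Oplus>\<^bsub>L\<^esub> k\<in>{..<n}. dR (X i k) \<otimes>\<^bsub>L\<^esub> Y k j \<oplus>\<^bsub>L\<^esub> LR.alt_sign (odd p) (X i k \<otimes>\<^bsub>L\<^esub> dR (Y k j)))"
        using c by (subst dR_finsum) (simp_all add: dR_leibniz[OF mdegD(2)[OF X]] Pi_def)
      thus ?thesis using c by (simp add: alt_sign_finsum Pi_def L.M.finsum_addf)
    qed
    thus "md (X \<otimes>\<^bsub>?M\<^esub> Y) = md X \<otimes>\<^bsub>?M\<^esub> Y \<oplus>\<^bsub>?M\<^esub> M.alt_sign (odd p) (X \<otimes>\<^bsub>?M\<^esub> md Y)"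
      unfolding alt[OF m] by (simp add: LR.mat_ring_simps md_def)
  next
    fix X Y p q assume "X \<in> mdeg n p" "Y \<in> mdeg n q" "even p"
    thus "mtr n (X \<otimes>\<^bsub>?M\<^esub> Y) = mtr n (Y \<otimes>\<^bsub>?M\<^esub> X)" using tr[of X p Y q] by simp
  next
    fix X Y p q assume "X \<in> mdeg n p" "Y \<in> mdeg n q" "odd p" "odd q"
    thus "mtr n (X \<otimes>\<^bsub>?M\<^esub> Y) = \<ominus>\<^bsub>L\<^esub> mtr n (Y \<otimes>\<^bsub>?M\<^esub> X)" using tr[of X p Y q] by simp
  next
    fix X assume "X \<in> carrier ?M"
    thus "dR (mtr n X) = mtr n (md X)"
      unfolding mtr_def md_def using mv by (intro dR_finsum) blast
  next
    fix X Y p q assume X: "X \<in> mdeg n p" and Y: "Y \<in> mdeg n q"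
    show "X \<otimes>\<^bsub>?M\<^esub> Y \<in> mdeg n (p + q)"
    proof (rule mdegI)
      show "X \<otimes>\<^bsub>?M\<^esub> Y \<in> carrier ?M" using mdegD(1)[OF X] mdegD(1)[OF Y] by simp
      show "(X \<otimes>\<^bsub>?M\<^esub> Y) i j \<in> \<Lambda> (p + q)" for i j
        unfolding LR.mat_ring_simps by (intro power_finsum power_mult mdegD(2)[OF X] mdegD(2)[OF Y])
    qed
  next
    fix X p assume X: "X \<in> mdeg n p"
    show "md X \<in> mdeg n (Suc p)"
      using md_carrier[OF mdegD(1)[OF X]] dR_power[OF mdegD(2)[OF X]] by (simp add: mdeg_def md_def)
  next
    show "addmap ?M ?M md"
    proof (rule addmapI)
      fix X Y assume "X \<in> carrier ?M" "Y \<in> carrier ?M"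
      thus "md (X \<oplus>\<^bsub>?M\<^esub> Y) = md X \<oplus>\<^bsub>?M\<^esub> md Y"
        unfolding LR.mat_ring_simps md_def using mv by (intro ext dR_add) blast+
    qed (rule md_carrier)
  next
    show "addmap ?M L (mtr n)"
    proof (rule addmapI)
      fix X assume X: "X \<in> carrier ?M"
      show "mtr n X \<in> carrier L" unfolding mtr_def using mv[OF X] by (intro L.M.finsum_closed) blast
    next
      fix X Y assume XY: "X \<in> carrier ?M" "Y \<in> carrier ?M"
      show "mtr n (X \<oplus>\<^bsub>?M\<^esub> Y) = mtr n X \<oplus>\<^bsub>L\<^esub> mtr n Y"
        unfolding LR.mat_ring_simps mtr_def using mv[OF XY(1)] mv[OF XY(2)] by (intro L.M.finsum_addf) blast+
    qed
  next
    show "addmap L L dR" by (rule dR_addmap)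
  next
    show "B \<in> mdeg n 1" by (rule B)
  next
    show "md (md B) = \<zero>\<^bsub>?M\<^esub>"
      unfolding LR.mat_ring_simps md_def using mv[OF mdegD(1)[OF B]] by (intro ext dR_dR) blast
  next
    show "md \<one>\<^bsub>?M\<^esub> = \<zero>\<^bsub>?M\<^esub>"
      unfolding LR.mat_ring_simps md_def by (intro ext) (simp add: dR_one dR_zero)
  next
    show "\<one>\<^bsub>?M\<^esub> \<in> mdeg n 0"
      by (auto simp: mdeg_def power_one power_zero) (auto simp: LR.mat_ring_simps power_one power_zero)
  next
    show "\<zero>\<^bsub>?M\<^esub> \<in> mdeg n p" for p
      by (auto simp: mdeg_def power_zero) (auto simp: LR.mat_ring_simps power_zero)
  next
    fix X Y p assume X: "X \<in> mdeg n p" and Y: "Y \<in> mdeg n p"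
    show "X \<oplus>\<^bsub>?M\<^esub> Y \<in> mdeg n p"
    proof (rule mdegI)
      show "X \<oplus>\<^bsub>?M\<^esub> Y \<in> carrier ?M" using mdegD(1)[OF X] mdegD(1)[OF Y] by simp
      show "(X \<oplus>\<^bsub>?M\<^esub> Y) i j \<in> \<Lambda> p" for i j
        unfolding LR.mat_ring_simps by (intro power_add mdegD(2)[OF X] mdegD(2)[OF Y])
    qed
  next
    show "X \<in> carrier ?M" if "X \<in> mdeg n p" for X p using that by (rule mdegD(1))
  qed
qed

lemma s_zero: "s 0 = \<zero>"
proof -
  have "s 0 \<oplus> s 0 = s 0" using s_add[of 0 0] by simp
  thus ?thesis using add.l_cancel_one[of "s 0" "s 0"] by simp
qed

lemma nmul_scalar: "X \<in> carrier L \<Longrightarrow> nmul L m X = s (of_nat m) \<odot>\<^bsub>L\<^esub> X"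
proof (induction m)
  case (Suc m)
  have "s (of_nat (Suc m)) = s (of_nat m) \<oplus> \<one>" using s_add[of "of_nat m" 1] by (simp add: s_one add.commute)
  thus ?case using Suc by (simp add: L.smult_l_distr)
qed (simp add: s_zero)

text \<open>The power is the sum of the \<open>cs.S i r\<close> over r, and
  \<open>transgression\<close> makes the trace of each summand exact once multiplication by i + r
  can be undone in k.\<close>

lemma tr_curvature_pow_exact:
  assumes B: "B \<in> mdeg n 1" and i: "i \<ge> 1"
  shows "\<exists>\<omega>\<in>\<Lambda> (2 * i - 1). mtr n ((md B \<oplus>\<^bsub>mat_ring L n\<^esub> B \<otimes>\<^bsub>mat_ring L n\<^esub> B) [^]\<^bsub>mat_ring L n\<^esub> i) = dR \<omega>"
proof -
  interpret cs: chern_simons "mat_ring L n" L "mdeg n" md dR "mtr n" B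
    by (rule chern_simons_mat[OF B])
  obtain j where j: "i = Suc j" using i by (cases i) auto
  define Y where "Y r = mtr n (B \<otimes>\<^bsub>mat_ring L n\<^esub> cs.S j r)" for r
  \<comment> \<open>The integral of i t^(i + r - 1) over [0, 1]; the denominator is nonzero because
    i \<ge> 1 and k has characteristic zero.\<close>
  define q where "q r = (of_nat i / of_nat (i + r) :: 'k)" for r
  have trL: "mtr n X \<in> \<Lambda> p" if "X \<in> mdeg n p" for X p
    unfolding mtr_def by (intro power_finsum mdegD(2)[OF that])
  have Yd: "Y r \<in> \<Lambda> (2 * i - 1)" for r
    using trL[OF cs.deg_mult[OF B cs.S_deg, of j r]] by (simp add: Y_def j)
  have Yc: "Y r \<in> carrier L" for r using power_carrier[OF Yd] .
  have eq: "mtr n (cs.S i r) = dR (s (q r) \<odot>\<^bsub>L\<^esub> Y r)" for r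
  proof -
    let ?X = "mtr n (cs.S i r)"
    have X: "?X \<in> carrier L" by simp
    have "s (of_nat (i + r)) \<odot>\<^bsub>L\<^esub> ?X = s (of_nat i) \<odot>\<^bsub>L\<^esub> dR (Y r)"
      using cs.transgression[of j r] nmul_scalar[OF X, of "i + r"] nmul_scalar[OF dR_closed[OF Yc], of i r]
      by (simp add: j Y_def del: nmul.simps of_nat_Suc of_nat_add)
    hence "s (1 / of_nat (i + r)) \<odot>\<^bsub>L\<^esub> (s (of_nat (i + r)) \<odot>\<^bsub>L\<^esub> ?X) =
      s (1 / of_nat (i + r)) \<odot>\<^bsub>L\<^esub> (s (of_nat i) \<odot>\<^bsub>L\<^esub> dR (Y r))" by simp
    hence "s (1 / of_nat (i + r) * of_nat (i + r)) \<odot>\<^bsub>L\<^esub> ?X = s (1 / of_nat (i + r) * of_nat i) \<odot>\<^bsub>L\<^esub> dR (Y r)"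
      using X dR_closed[OF Yc] by (simp only: s_mult L.smult_assoc1 s_closed)
    moreover have "(1 / of_nat (i + r) * of_nat (i + r) :: 'k) = 1"
      using i by (simp del: of_nat_add)
    moreover have "(1 / of_nat (i + r) * of_nat i :: 'k) = q r" by (simp add: q_def)
    ultimately show ?thesis using X Yc by (simp add: s_one dR_scalar_smult)
  qed
  let ?\<omega> = "\<Oplus>\<^bsub>L\<^esub> r\<in>{..i}. s (q r) \<odot>\<^bsub>L\<^esub> Y r"
  have "mtr n ((md B \<oplus>\<^bsub>mat_ring L n\<^esub> B \<otimes>\<^bsub>mat_ring L n\<^esub> B) [^]\<^bsub>mat_ring L n\<^esub> i) = dR ?\<omega>"
    using cs.tr_curvature_pow[of i] Yc by (simp add: cs.a_def cs.c_def eq dR_finsum Pi_def)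
  moreover have "?\<omega> \<in> \<Lambda> (2 * i - 1)" by (intro power_finsum power_smult Yd s_closed)
  ultimately show ?thesis by blast
qed

end

section \<open>Connections and curvature\<close>

lemma module_homD:
  assumes "T \<in> module_hom R M N"
  shows "x \<in> carrier M \<Longrightarrow> T x \<in> carrier N"
    and "x \<in> carrier M \<Longrightarrow> y \<in> carrier M \<Longrightarrow> T (x \<oplus>\<^bsub>M\<^esub> y) = T x \<oplus>\<^bsub>N\<^esub> T y"
    and "a \<in> carrier R \<Longrightarrow> x \<in> carrier M \<Longrightarrow> T (a \<odot>\<^bsub>M\<^esub> x) = a \<odot>\<^bsub>N\<^esub> T x"
    and "T \<in> extensional (carrier M)"
  using assms by (auto simp: module_hom_def PiE_def)

lemma module_homI:
  assumes "\<And>x. x \<in> carrier M \<Longrightarrow> T x \<in> carrier N"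
    and "\<And>x y. x \<in> carrier M \<Longrightarrow> y \<in> carrier M \<Longrightarrow> T (x \<oplus>\<^bsub>M\<^esub> y) = T x \<oplus>\<^bsub>N\<^esub> T y"
    and "\<And>a x. a \<in> carrier R \<Longrightarrow> x \<in> carrier M \<Longrightarrow> T (a \<odot>\<^bsub>M\<^esub> x) = a \<odot>\<^bsub>N\<^esub> T x"
    and "T \<in> extensional (carrier M)"
  shows "T \<in> module_hom R M N"
  using assms by (auto simp: module_hom_def PiE_def)

lemma (in module) end_module_module: "module R (end_module R M)"
proof (rule moduleI)
  let ?N = "end_module R M"
  note simps = end_module_def
  have c: "carrier ?N = module_hom R M M" by (simp add: end_module_def)
  show "cring R" by (rule R.is_cring)
  show "abelian_group ?N"
  proof (rule abelian_groupI)
    fix S T assume "S \<in> carrier ?N" "T \<in> carrier ?N"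
    note h = this[unfolded c]
    show "S \<oplus>\<^bsub>?N\<^esub> T \<in> carrier ?N" unfolding c
      by (rule module_homI) (simp_all add: end_module_def module_homD[OF h(1)] module_homD[OF h(2)] smult_r_distr M.a_ac)
    show "S \<oplus>\<^bsub>?N\<^esub> T = T \<oplus>\<^bsub>?N\<^esub> S"
      using module_homD(1)[OF h(1)] module_homD(1)[OF h(2)] by (auto simp: end_module_def M.a_comm)
  next
    show "\<zero>\<^bsub>?N\<^esub> \<in> carrier ?N" unfolding c by (rule module_homI) (simp_all add: end_module_def)
  next
    fix S T U assume "S \<in> carrier ?N" "T \<in> carrier ?N" "U \<in> carrier ?N"
    note h = this[unfolded c]
    show "S \<oplus>\<^bsub>?N\<^esub> T \<oplus>\<^bsub>?N\<^esub> U = S \<oplus>\<^bsub>?N\<^esub> (T \<oplus>\<^bsub>?N\<^esub> U)"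
      using module_homD(1)[OF h(1)] module_homD(1)[OF h(2)] module_homD(1)[OF h(3)]
      by (auto simp: end_module_def M.a_assoc)
  next
    fix S assume "S \<in> carrier ?N"
    note h = this[unfolded c]
    show "\<zero>\<^bsub>?N\<^esub> \<oplus>\<^bsub>?N\<^esub> S = S"
      using module_homD(1,4)[OF h] by (intro extensionalityI[of _ "carrier M"]) (auto simp: end_module_def)
    let ?T = "\<lambda>x\<in>carrier M. \<ominus>\<^bsub>M\<^esub> S x"
    have "?T \<in> carrier ?N" unfolding c
      by (rule module_homI) (simp_all add: module_homD[OF h] M.minus_add M.a_comm smult_r_minus)
    moreover have "?T \<oplus>\<^bsub>?N\<^esub> S = \<zero>\<^bsub>?N\<^esub>"
      using module_homD(1)[OF h] by (auto simp: end_module_def M.l_neg)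
    ultimately show "\<exists>T\<in>carrier ?N. T \<oplus>\<^bsub>?N\<^esub> S = \<zero>\<^bsub>?N\<^esub>" by blast
  qed
  fix a S assume a: "a \<in> carrier R" and "S \<in> carrier ?N"
  note h = this(2)[unfolded c]
  show "a \<odot>\<^bsub>?N\<^esub> S \<in> carrier ?N" unfolding c
    by (rule module_homI)
      (simp_all add: end_module_def module_homD[OF h] a smult_r_distr smult_assoc1[symmetric] R.m_comm)
next
  let ?N = "end_module R M"
  have c: "carrier ?N = module_hom R M M" by (simp add: end_module_def)
  {
    fix a b S assume a: "a \<in> carrier R" "b \<in> carrier R" and "S \<in> carrier ?N"
    note h = this(3)[unfolded c]
    show "(a \<oplus> b) \<odot>\<^bsub>?N\<^esub> S = a \<odot>\<^bsub>?N\<^esub> S \<oplus>\<^bsub>?N\<^esub> b \<odot>\<^bsub>?N\<^esub> S"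
      "a \<otimes> b \<odot>\<^bsub>?N\<^esub> S = a \<odot>\<^bsub>?N\<^esub> (b \<odot>\<^bsub>?N\<^esub> S)"
      using module_homD(1)[OF h] a by (auto simp: end_module_def smult_l_distr smult_assoc1)
  }
  {
    fix a S T assume a: "a \<in> carrier R" and "S \<in> carrier ?N" "T \<in> carrier ?N"
    note h = this(2,3)[unfolded c]
    show "a \<odot>\<^bsub>?N\<^esub> (S \<oplus>\<^bsub>?N\<^esub> T) = a \<odot>\<^bsub>?N\<^esub> S \<oplus>\<^bsub>?N\<^esub> a \<odot>\<^bsub>?N\<^esub> T"
      using module_homD(1)[OF h(1)] module_homD(1)[OF h(2)] a by (auto simp: end_module_def smult_r_distr)
  }
  {
    fix S assume "S \<in> carrier ?N"
    note h = this[unfolded c]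
    show "\<one> \<odot>\<^bsub>?N\<^esub> S = S"
      using module_homD(1,4)[OF h] by (intro extensionalityI[of _ "carrier M"]) (auto simp: end_module_def)
  }
qed

subsection \<open>Dual bases\<close>

locale dual_based = M: module R M for R :: "('a, 'r) ring_scheme" and M :: "('a, 'm, 's) module_scheme" +
  fixes n :: nat and e :: "nat \<Rightarrow> 'm" and \<phi> :: "nat \<Rightarrow> 'm \<Rightarrow> 'a"
  assumes dual_basis: "dual_basis R M n e \<phi>"
begin

lemma e_closed: "j < n \<Longrightarrow> e j \<in> carrier M"
  using dual_basis by (simp add: dual_basis_def)

lemma phi_hom: "j < n \<Longrightarrow> \<phi> j \<in> module_hom R M (ring_module R)"
  using dual_basis by (simp add: dual_basis_def)

lemma phi_closed: "j < n \<Longrightarrow> x \<in> carrier M \<Longrightarrow> \<phi> j x \<in> carrier R"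
  using module_homD(1)[OF phi_hom] by (simp add: ring_module_def)

lemma phi_add: "j < n \<Longrightarrow> x \<in> carrier M \<Longrightarrow> y \<in> carrier M \<Longrightarrow> \<phi> j (x \<oplus>\<^bsub>M\<^esub> y) = \<phi> j x \<oplus>\<^bsub>R\<^esub> \<phi> j y"
  using module_homD(2)[OF phi_hom] by (simp add: ring_module_def)

lemma phi_smult: "j < n \<Longrightarrow> a \<in> carrier R \<Longrightarrow> x \<in> carrier M \<Longrightarrow> \<phi> j (a \<odot>\<^bsub>M\<^esub> x) = a \<otimes>\<^bsub>R\<^esub> \<phi> j x"
  using module_homD(3)[OF phi_hom] by (simp add: ring_module_def)

lemma expand: "x \<in> carrier M \<Longrightarrow> (\<Oplus>\<^bsub>M\<^esub> j\<in>{..<n}. \<phi> j x \<odot>\<^bsub>M\<^esub> e j) = x"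
  using dual_basis by (simp add: dual_basis_def)

lemma linear_expand:
  assumes G: "abelian_group G" and h: "addmap M G h" and x: "x \<in> carrier M"
  shows "h x = (\<Oplus>\<^bsub>G\<^esub> j\<in>{..<n}. h (\<phi> j x \<odot>\<^bsub>M\<^esub> e j))"
proof -
  have "h x = h (\<Oplus>\<^bsub>M\<^esub> j\<in>{..<n}. \<phi> j x \<odot>\<^bsub>M\<^esub> e j)" by (simp only: expand[OF x])
  also have "\<dots> = (\<Oplus>\<^bsub>G\<^esub> j\<in>{..<n}. h (\<phi> j x \<odot>\<^bsub>M\<^esub> e j))"
    using x e_closed phi_closed by (intro addmap_finsum[OF M.M.abelian_group_axioms G h]) auto
  finally show ?thesis .
qed

lemma phi_addmap: "j < n \<Longrightarrow> addmap M R (\<phi> j)"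
  by (rule addmapI) (auto simp: phi_closed phi_add)

text \<open>The trace does not depend on the dual basis: \<open>\<Sum> \<psi>\<^sub>i (T \<epsilon>\<^sub>i)\<close> for another dual basis is
  \<open>\<Sum> \<phi>\<^sub>j (\<epsilon>\<^sub>i) \<psi>\<^sub>i (T e\<^sub>j)\<close>.\<close>

lemma module_trace_eq:
  assumes T: "T \<in> module_hom R M M"
  shows "module_trace R M T = (\<Oplus>\<^bsub>R\<^esub> j\<in>{..<n}. \<phi> j (T (e j)))"
proof -
  have ex: "\<exists>z. (case z of (m, e, \<phi>) \<Rightarrow> dual_basis R M m e \<phi>)" using dual_basis by auto
  obtain m \<epsilon> \<psi> where z: "(SOME (m, e, \<phi>). dual_basis R M m e \<phi>) = (m, \<epsilon>, \<psi>)" by (metis prod_cases3)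
  have "dual_basis R M m \<epsilon> \<psi>" using someI_ex[OF ex] unfolding z by simp
  then interpret B: dual_based R M m \<epsilon> \<psi> by unfold_locales
  note Th = module_homD[OF T]
  have TM: "addmap M M T" using Th by (auto intro: addmapI)
  have "module_trace R M T = (\<Oplus>\<^bsub>R\<^esub> i\<in>{..<m}. \<psi> i (T (\<epsilon> i)))" unfolding module_trace_def z by simp
  also have "\<dots> = (\<Oplus>\<^bsub>R\<^esub> i\<in>{..<m}. \<Oplus>\<^bsub>R\<^esub> j\<in>{..<n}. \<phi> j (\<epsilon> i) \<otimes>\<^bsub>R\<^esub> \<psi> i (T (e j)))"
  proof (rule M.R.finsum_cong')
    fix i assume i: "i \<in> {..<m}"
    have a: "addmap M R (\<lambda>x. \<psi> i (T x))"
      using i by (intro addmapI) (auto simp: Th B.phi_closed B.phi_add)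
    have "\<psi> i (T (\<epsilon> i)) = (\<Oplus>\<^bsub>R\<^esub> j\<in>{..<n}. \<psi> i (T (\<phi> j (\<epsilon> i) \<odot>\<^bsub>M\<^esub> e j)))"
      using i B.e_closed by (intro linear_expand[OF M.R.abelian_group_axioms a]) auto
    also have "\<dots> = (\<Oplus>\<^bsub>R\<^esub> j\<in>{..<n}. \<phi> j (\<epsilon> i) \<otimes>\<^bsub>R\<^esub> \<psi> i (T (e j)))"
      using i B.e_closed by (intro M.R.finsum_cong') (auto simp: Th e_closed phi_closed B.phi_closed B.phi_smult)
    finally show "\<psi> i (T (\<epsilon> i)) = (\<Oplus>\<^bsub>R\<^esub> j\<in>{..<n}. \<phi> j (\<epsilon> i) \<otimes>\<^bsub>R\<^esub> \<psi> i (T (e j)))" .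
  qed (auto intro!: M.R.finsum_closed simp: B.phi_closed B.e_closed Th e_closed phi_closed)
  also have "\<dots> = (\<Oplus>\<^bsub>R\<^esub> j\<in>{..<n}. \<Oplus>\<^bsub>R\<^esub> i\<in>{..<m}. \<phi> j (\<epsilon> i) \<otimes>\<^bsub>R\<^esub> \<psi> i (T (e j)))"
    by (intro M.R.finsum_swap) (auto simp: B.phi_closed B.e_closed Th e_closed phi_closed)
  also have "\<dots> = (\<Oplus>\<^bsub>R\<^esub> j\<in>{..<n}. \<phi> j (T (e j)))"
  proof (rule M.R.finsum_cong')
    fix j assume j: "j \<in> {..<n}"
    have "\<phi> j (T (e j)) = (\<Oplus>\<^bsub>R\<^esub> i\<in>{..<m}. \<phi> j (\<psi> i (T (e j)) \<odot>\<^bsub>M\<^esub> \<epsilon> i))"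
      using j by (intro B.linear_expand[OF M.R.abelian_group_axioms phi_addmap]) (auto simp: Th e_closed)
    also have "\<dots> = (\<Oplus>\<^bsub>R\<^esub> i\<in>{..<m}. \<phi> j (\<epsilon> i) \<otimes>\<^bsub>R\<^esub> \<psi> i (T (e j)))"
      using j by (intro M.R.finsum_cong') (auto simp: Th e_closed B.e_closed phi_closed B.phi_closed phi_smult M.R.m_comm)
    finally show "(\<Oplus>\<^bsub>R\<^esub> i\<in>{..<m}. \<phi> j (\<epsilon> i) \<otimes>\<^bsub>R\<^esub> \<psi> i (T (e j))) = \<phi> j (T (e j))" by simp
  qed (auto simp: Th e_closed phi_closed)
  finally show ?thesis .
qed

end

locale dual_based_tensor = dual_based R M n e \<phi> + two_modules R M N
  for R :: "('a, 'r) ring_scheme" and M :: "('a, 'm, 's) module_scheme" and N :: "('a, 'n, 't) module_scheme" and n e \<phi>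
begin

text \<open>Contraction of the left factor with \<open>\<phi> l\<close>. The e l generate without
  being a free basis, so not every tuple consists of coordinates, but by \<open>coord_expand\<close>
  the coordinates determine the element.\<close>

definition coord :: "nat \<Rightarrow> ('m \<times> 'n \<Rightarrow> 'a) set \<Rightarrow> 'n" where
  "coord l = tensor_lift R M N (\<lambda>x y. \<phi> l x \<odot>\<^bsub>N\<^esub> y)"

lemma coord_balanced: "l < n \<Longrightarrow> balanced R M N N (\<lambda>x y. \<phi> l x \<odot>\<^bsub>N\<^esub> y)"
  by (rule balancedI)
    (auto simp: phi_closed phi_add phi_smult N.smult_r_distr N.smult_l_distr N.smult_assoc1[symmetric] M.R.m_comm)

lemma coord_addmap: "l < n \<Longrightarrow> addmap T N (coord l)"
  unfolding coord_def by (rule tensor_lift_addmap[OF N.M.abelian_group_axioms coord_balanced])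

lemma coord_elem: "l < n \<Longrightarrow> x \<in> carrier M \<Longrightarrow> y \<in> carrier N \<Longrightarrow> coord l (te x y) = \<phi> l x \<odot>\<^bsub>N\<^esub> y"
  unfolding coord_def by (rule tensor_lift_elem[OF N.M.abelian_group_axioms coord_balanced])

lemma coord_closed: "l < n \<Longrightarrow> X \<in> carrier T \<Longrightarrow> coord l X \<in> carrier N"
  by (rule addmap_closed[OF coord_addmap])

lemma coord_add: "l < n \<Longrightarrow> X \<in> carrier T \<Longrightarrow> Y \<in> carrier T \<Longrightarrow> coord l (X \<oplus>\<^bsub>T\<^esub> Y) = coord l X \<oplus>\<^bsub>N\<^esub> coord l Y"
  by (rule addmap_add[OF coord_addmap])

lemma coord_smult:
  assumes l: "l < n" and a: "a \<in> carrier R" and X: "X \<in> carrier T"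
  shows "coord l (a \<odot>\<^bsub>T\<^esub> X) = a \<odot>\<^bsub>N\<^esub> coord l X"
  using X
proof (induction rule: tensor_induct)
  case (elem x y)
  thus ?case using l a coord_elem[OF l, of "a \<odot>\<^bsub>M\<^esub> x" y]
    by (simp add: tensor_elem_smult_left coord_elem phi_closed phi_smult N.smult_assoc1)
next
  case (add X Y)
  thus ?case using l a by (simp add: T.smult_r_distr coord_add coord_closed N.smult_r_distr)
qed

lemma coord_expand: "X \<in> carrier T \<Longrightarrow> (\<Oplus>\<^bsub>T\<^esub> l\<in>{..<n}. te (e l) (coord l X)) = X"
proof (induction rule: tensor_induct)
  case (elem x y)
  have "te x y = (\<Oplus>\<^bsub>T\<^esub> l\<in>{..<n}. te (\<phi> l x \<odot>\<^bsub>M\<^esub> e l) y)"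
    by (rule linear_expand[OF T.M.abelian_group_axioms tensor_elem_addmap(2)[OF elem(2)] elem(1)])
  also have "\<dots> = (\<Oplus>\<^bsub>T\<^esub> l\<in>{..<n}. te (e l) (coord l (te x y)))"
    using elem by (intro T.M.finsum_cong')
      (auto simp: coord_elem phi_closed e_closed tensor_elem_smult_left tensor_elem_smult_right)
  finally show ?case ..
next
  case (add X Y)
  have "(\<Oplus>\<^bsub>T\<^esub> l\<in>{..<n}. te (e l) (coord l (X \<oplus>\<^bsub>T\<^esub> Y))) =
      (\<Oplus>\<^bsub>T\<^esub> l\<in>{..<n}. te (e l) (coord l X) \<oplus>\<^bsub>T\<^esub> te (e l) (coord l Y))"
    using add by (intro T.M.finsum_cong') (auto simp: coord_add coord_closed e_closed tensor_elem_add_right)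
  thus ?case using add by (simp add: T.M.finsum_addf Pi_def e_closed coord_closed)
qed

end

subsection \<open>The extended connection\<close>

locale connection_module = kalgebra R s + dual_based R E n e \<phi>
  for R :: "('a, 'r) ring_scheme" (structure) and s :: "'k::field_char_0 \<Rightarrow> 'a"
    and E :: "('a, 'e, 't) module_scheme" and n e \<phi> +
  fixes D :: "'e \<Rightarrow> ('e \<times> ('a \<Rightarrow> 'a) set \<Rightarrow> 'a) set"
  assumes connection: "connection R s E D"
begin

sublocale TE: dual_based_tensor R E "kahler R s" n e \<phi> by unfold_locales
sublocale V: dual_based_tensor R E "ext_algebra R (kahler R s)" n e \<phi> by unfold_locales

lemma D_closed: "x \<in> carrier E \<Longrightarrow> D x \<in> carrier TE.T"
  and D_add: "x \<in> carrier E \<Longrightarrow> y \<in> carrier E \<Longrightarrow> D (x \<oplus>\<^bsub>E\<^esub> y) = D x \<oplus>\<^bsub>TE.T\<^esub> D y"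
  and D_smult: "a \<in> carrier R \<Longrightarrow> x \<in> carrier E \<Longrightarrow>
    D (a \<odot>\<^bsub>E\<^esub> x) = a \<odot>\<^bsub>TE.T\<^esub> D x \<oplus>\<^bsub>TE.T\<^esub> TE.te x (dK a)"
  using connection by (auto simp: connection_def Let_def)

definition wedge where
  "wedge Y \<omega> = tensor_lift R E V.T (\<lambda>x \<eta>. V.te x (\<iota> \<eta> \<otimes>\<^bsub>L\<^esub> \<omega>)) Y"

lemma wedge_balanced: "\<omega> \<in> carrier L \<Longrightarrow> balanced R E \<Omega> V.T (\<lambda>x \<eta>. V.te x (\<iota> \<eta> \<otimes>\<^bsub>L\<^esub> \<omega>))"
  by (rule balancedI)
    (auto simp: iota_add iota_smult LR.l_distr V.tensor_elem_add_left V.tensor_elem_add_right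
      V.tensor_elem_smult_left V.tensor_elem_smult_right smult_mult_left)

lemma wedge_addmap: "\<omega> \<in> carrier L \<Longrightarrow> addmap TE.T V.T (\<lambda>Y. wedge Y \<omega>)"
  unfolding wedge_def by (rule TE.tensor_lift_addmap[OF V.T.M.abelian_group_axioms wedge_balanced])

lemma wedge_elem: "x \<in> carrier E \<Longrightarrow> \<eta> \<in> carrier \<Omega> \<Longrightarrow> \<omega> \<in> carrier L \<Longrightarrow>
    wedge (TE.te x \<eta>) \<omega> = V.te x (\<iota> \<eta> \<otimes>\<^bsub>L\<^esub> \<omega>)"
  unfolding wedge_def by (rule TE.tensor_lift_elem[OF V.T.M.abelian_group_axioms wedge_balanced])

lemma wedge_closed: "Y \<in> carrier TE.T \<Longrightarrow> \<omega> \<in> carrier L \<Longrightarrow> wedge Y \<omega> \<in> carrier V.T"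
  by (rule addmap_closed[OF wedge_addmap])

lemma wedge_add_left: "Y \<in> carrier TE.T \<Longrightarrow> Y' \<in> carrier TE.T \<Longrightarrow> \<omega> \<in> carrier L \<Longrightarrow>
    wedge (Y \<oplus>\<^bsub>TE.T\<^esub> Y') \<omega> = wedge Y \<omega> \<oplus>\<^bsub>V.T\<^esub> wedge Y' \<omega>"
  by (rule addmap_add[OF wedge_addmap])

lemma wedge_add_right:
  assumes "Y \<in> carrier TE.T" "\<omega> \<in> carrier L" "\<omega>' \<in> carrier L"
  shows "wedge Y (\<omega> \<oplus>\<^bsub>L\<^esub> \<omega>') = wedge Y \<omega> \<oplus>\<^bsub>V.T\<^esub> wedge Y \<omega>'"
  using assms(1)
proof (induction rule: TE.tensor_induct)
  case (elem x \<eta>)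
  thus ?case using assms by (simp add: wedge_elem LR.r_distr V.tensor_elem_add_right)
next
  case (add X Y)
  thus ?case using assms by (simp add: wedge_add_left wedge_closed V.T.M.a_ac)
qed

lemma wedge_smult_right:
  assumes "Y \<in> carrier TE.T" "\<omega> \<in> carrier L" "a \<in> carrier R"
  shows "wedge Y (a \<odot>\<^bsub>L\<^esub> \<omega>) = a \<odot>\<^bsub>V.T\<^esub> wedge Y \<omega>"
  using assms(1)
proof (induction rule: TE.tensor_induct)
  case (elem x \<eta>)
  thus ?case using assms by (simp add: wedge_elem smult_mult_right V.tensor_elem_smult_right)
next
  case (add X Y)
  thus ?case using assms by (simp add: wedge_add_left wedge_closed V.T.smult_r_distr)
qed

lemma wedge_smult_left:
  assumes "Y \<in> carrier TE.T" "\<omega> \<in> carrier L" "a \<in> carrier R"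
  shows "wedge (a \<odot>\<^bsub>TE.T\<^esub> Y) \<omega> = a \<odot>\<^bsub>V.T\<^esub> wedge Y \<omega>"
  using assms(1)
proof (induction rule: TE.tensor_induct)
  case (elem x \<eta>)
  thus ?case using assms wedge_elem[of "a \<odot>\<^bsub>E\<^esub> x" \<eta> \<omega>]
    by (simp add: wedge_elem TE.tensor_elem_smult_left V.tensor_elem_smult_left)
next
  case (add X Y)
  thus ?case using assms by (simp add: TE.T.smult_r_distr wedge_add_left wedge_closed V.T.smult_r_distr)
qed

abbreviation "nab \<equiv> connection_ext R s E D"

lemma nab_props:
  shows nab_addmap: "addmap V.T V.T nab"
    and nab_elem: "x \<in> carrier E \<Longrightarrow> \<omega> \<in> carrier L \<Longrightarrow>
      nab (V.te x \<omega>) = wedge (D x) \<omega> \<oplus>\<^bsub>V.T\<^esub> V.te x (dR \<omega>)"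
proof -
  let ?\<phi> = "\<lambda>x \<omega>. wedge (D x) \<omega> \<oplus>\<^bsub>V.T\<^esub> V.te x (dR \<omega>)"
  have b: "balanced R E L V.T ?\<phi>"
  proof (rule balancedI)
    fix a x \<omega> assume c: "a \<in> carrier R" "x \<in> carrier E" "\<omega> \<in> carrier L"
    note c' = wedge_closed[OF D_closed[OF c(2)] c(3)] D_closed[OF c(2)]
    \<comment> \<open>The non-linear term, x tensor da w, occurs once on each side: on the left from
      the Leibniz rule of the connection, on the right from d(a w).\<close>
    show "?\<phi> (a \<odot>\<^bsub>E\<^esub> x) \<omega> = ?\<phi> x (a \<odot>\<^bsub>L\<^esub> \<omega>)"
      using c c' by (simp add: D_smult wedge_add_left wedge_smult_left wedge_smult_right wedge_elem dR_smult
          V.tensor_elem_smult_left V.tensor_elem_smult_right V.tensor_elem_add_right V.T.M.a_assoc)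
  qed (auto simp: D_closed D_add wedge_closed wedge_add_left wedge_add_right dR_add V.tensor_elem_add_left
      V.tensor_elem_add_right V.T.M.a_ac)
  have eq: "nab = tensor_lift R E V.T ?\<phi>"
    by (simp add: connection_ext_def Let_def vforms_def forms_def wedge_def[abs_def])
  show "addmap V.T V.T nab" unfolding eq by (rule V.tensor_lift_addmap[OF V.T.M.abelian_group_axioms b])
  show "nab (V.te x \<omega>) = ?\<phi> x \<omega>" if "x \<in> carrier E" "\<omega> \<in> carrier L"
    unfolding eq by (rule V.tensor_lift_elem[OF V.T.M.abelian_group_axioms b that])
qed

lemma nab_closed: "X \<in> carrier V.T \<Longrightarrow> nab X \<in> carrier V.T"
  by (rule addmap_closed[OF nab_addmap])

lemma nab_add: "X \<in> carrier V.T \<Longrightarrow> Y \<in> carrier V.T \<Longrightarrow> nab (X \<oplus>\<^bsub>V.T\<^esub> Y) = nab X \<oplus>\<^bsub>V.T\<^esub> nab Y"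
  by (rule addmap_add[OF nab_addmap])

definition K where "K x = nab (nab (V.te x \<one>\<^bsub>L\<^esub>))"

lemma nab_one: "x \<in> carrier E \<Longrightarrow> nab (V.te x \<one>\<^bsub>L\<^esub>) = wedge (D x) \<one>\<^bsub>L\<^esub>"
  by (simp add: nab_elem dR_one V.tensor_elem_zero wedge_closed D_closed)

lemma K_closed: "x \<in> carrier E \<Longrightarrow> K x \<in> carrier V.T"
  by (simp add: K_def nab_closed)

lemma K_add: "x \<in> carrier E \<Longrightarrow> y \<in> carrier E \<Longrightarrow> K (x \<oplus>\<^bsub>E\<^esub> y) = K x \<oplus>\<^bsub>V.T\<^esub> K y"
  by (simp add: K_def V.tensor_elem_add_left nab_add nab_closed)

text \<open>Leibniz rule for an E-valued one-form Y, in the form nabla(a Y) + Y da = a nabla(Y):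
  moving da across the one-form in Y costs a sign.\<close>

lemma nab_smult_wedge:
  assumes a: "a \<in> carrier R" and Y: "Y \<in> carrier TE.T"
  shows "nab (a \<odot>\<^bsub>V.T\<^esub> wedge Y \<one>\<^bsub>L\<^esub>) \<oplus>\<^bsub>V.T\<^esub> wedge Y (\<iota> (dK a)) = a \<odot>\<^bsub>V.T\<^esub> nab (wedge Y \<one>\<^bsub>L\<^esub>)"
  using Y
proof (induction rule: TE.tensor_induct)
  case (elem y \<eta>)
  note c = elem a iota_closed[OF elem(2)] iota_closed[OF dK_closed[OF a]]
  have 1: "a \<odot>\<^bsub>V.T\<^esub> wedge (TE.te y \<eta>) \<one>\<^bsub>L\<^esub> = V.te y (a \<odot>\<^bsub>L\<^esub> \<iota> \<eta>)"
    using c by (simp add: wedge_elem V.tensor_elem_smult_right)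
  have 2: "V.te y (\<iota> (dK a) \<otimes>\<^bsub>L\<^esub> \<iota> \<eta>) \<oplus>\<^bsub>V.T\<^esub> V.te y (\<iota> \<eta> \<otimes>\<^bsub>L\<^esub> \<iota> (dK a)) = \<zero>\<^bsub>V.T\<^esub>"
    using c iota_anticomm[OF dK_closed[OF a] elem(2)]
    by (simp add: V.tensor_elem_add_right[symmetric] L.M.l_neg V.tensor_elem_zero)
  have "nab (V.te y (a \<odot>\<^bsub>L\<^esub> \<iota> \<eta>)) = a \<odot>\<^bsub>V.T\<^esub> wedge (D y) (\<iota> \<eta>) \<oplus>\<^bsub>V.T\<^esub>
      (V.te y (\<iota> (dK a) \<otimes>\<^bsub>L\<^esub> \<iota> \<eta>) \<oplus>\<^bsub>V.T\<^esub> a \<odot>\<^bsub>V.T\<^esub> V.te y (dR (\<iota> \<eta>)))"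
    using c nab_elem[of y "a \<odot>\<^bsub>L\<^esub> \<iota> \<eta>"]
    by (simp add: wedge_smult_right D_closed dR_smult V.tensor_elem_add_right V.tensor_elem_smult_right)
  hence "nab (V.te y (a \<odot>\<^bsub>L\<^esub> \<iota> \<eta>)) \<oplus>\<^bsub>V.T\<^esub> V.te y (\<iota> \<eta> \<otimes>\<^bsub>L\<^esub> \<iota> (dK a)) =
     (V.te y (\<iota> (dK a) \<otimes>\<^bsub>L\<^esub> \<iota> \<eta>) \<oplus>\<^bsub>V.T\<^esub> V.te y (\<iota> \<eta> \<otimes>\<^bsub>L\<^esub> \<iota> (dK a))) \<oplus>\<^bsub>V.T\<^esub>
     (a \<odot>\<^bsub>V.T\<^esub> wedge (D y) (\<iota> \<eta>) \<oplus>\<^bsub>V.T\<^esub> a \<odot>\<^bsub>V.T\<^esub> V.te y (dR (\<iota> \<eta>)))"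
    using c by (simp add: D_closed wedge_closed V.T.M.a_ac)
  also have "\<dots> = a \<odot>\<^bsub>V.T\<^esub> nab (V.te y (\<iota> \<eta>))"
    unfolding 2 using c by (simp add: nab_elem D_closed wedge_closed V.T.smult_r_distr)
  finally show ?case using c 1 by (simp add: wedge_elem)
next
  case (add X Y)
  have [simp]: "\<iota> (dK a) \<in> carrier L" using a by simp
  have "nab (a \<odot>\<^bsub>V.T\<^esub> wedge (X \<oplus>\<^bsub>TE.T\<^esub> Y) \<one>\<^bsub>L\<^esub>) \<oplus>\<^bsub>V.T\<^esub> wedge (X \<oplus>\<^bsub>TE.T\<^esub> Y) (\<iota> (dK a)) =
    (nab (a \<odot>\<^bsub>V.T\<^esub> wedge X \<one>\<^bsub>L\<^esub>) \<oplus>\<^bsub>V.T\<^esub> wedge X (\<iota> (dK a))) \<oplus>\<^bsub>V.T\<^esub>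
    (nab (a \<odot>\<^bsub>V.T\<^esub> wedge Y \<one>\<^bsub>L\<^esub>) \<oplus>\<^bsub>V.T\<^esub> wedge Y (\<iota> (dK a)))"
    using add(1,2) a
    by (simp add: wedge_add_left V.T.smult_r_distr nab_add nab_closed wedge_closed V.T.M.a_ac)
  thus ?case unfolding add(3,4) using add(1,2) a
    by (simp add: wedge_add_left V.T.smult_r_distr nab_add nab_closed wedge_closed)
qed

text \<open>Linearity of the curvature: the two terms containing nabla x and da cancel by
  \<open>nab_smult_wedge\<close>, and d(da) = 0.\<close>

lemma K_smult:
  assumes a: "a \<in> carrier R" and x: "x \<in> carrier E"
  shows "K (a \<odot>\<^bsub>E\<^esub> x) = a \<odot>\<^bsub>V.T\<^esub> K x"
proof -
  note c = a x D_closed[OF x] iota_closed[OF dK_closed[OF a]]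
  have "nab (V.te (a \<odot>\<^bsub>E\<^esub> x) \<one>\<^bsub>L\<^esub>) = a \<odot>\<^bsub>V.T\<^esub> wedge (D x) \<one>\<^bsub>L\<^esub> \<oplus>\<^bsub>V.T\<^esub> V.te x (\<iota> (dK a))"
    using c by (simp add: nab_one D_smult wedge_add_left wedge_smult_left wedge_elem)
  hence "K (a \<odot>\<^bsub>E\<^esub> x) = nab (a \<odot>\<^bsub>V.T\<^esub> wedge (D x) \<one>\<^bsub>L\<^esub>) \<oplus>\<^bsub>V.T\<^esub> wedge (D x) (\<iota> (dK a))"
    using c by (simp add: K_def nab_add nab_elem[of x "\<iota> (dK a)"] wedge_closed dR_iota_dK V.tensor_elem_zero)
  thus ?thesis using nab_smult_wedge[OF a D_closed[OF x]] x by (simp add: K_def nab_one)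
qed

text \<open>The connection matrix with respect to the generators e, read off through the dual basis.
  As the generators are not free, it is subject to \<open>theta_phi\<close> and
  \<open>theta_right\<close>.\<close>

definition \<theta> where "\<theta> l j = TE.coord l (D (e j))"

lemma theta_closed: "l < n \<Longrightarrow> j < n \<Longrightarrow> \<theta> l j \<in> carrier \<Omega>"
  by (simp add: \<theta>_def TE.coord_closed D_closed e_closed)

text \<open>The expression d\<theta> + \<theta> \<theta> of a free module. It provides coefficients
  of \<open>K (e j)\<close>, which become coordinates only after multiplication by the projection
  matrix, as in \<open>entry_curv\<close>.\<close>

definition W where
  "W l j = (\<Oplus>\<^bsub>L\<^esub> m\<in>{..<n}. \<iota> (\<theta> l m) \<otimes>\<^bsub>L\<^esub> \<iota> (\<theta> m j)) \<oplus>\<^bsub>L\<^esub> dR (\<iota> (\<theta> l j))"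

lemma W_power: "l < n \<Longrightarrow> j < n \<Longrightarrow> W l j \<in> \<Lambda> 2"
proof -
  assume lj: "l < n" "j < n"
  have "\<iota> (\<theta> l m) \<otimes>\<^bsub>L\<^esub> \<iota> (\<theta> m j) \<in> \<Lambda> (1 + 1)" if "m \<in> {..<n}" for m
    using that lj by (intro power_mult iota_power theta_closed) auto
  moreover have "dR (\<iota> (\<theta> l j)) \<in> \<Lambda> (Suc 1)"
    using lj by (intro dR_power iota_power theta_closed)
  ultimately show ?thesis unfolding W_def numeral_2_eq_2 by (intro power_add power_finsum) simp_all
qed

lemma W_closed: "l < n \<Longrightarrow> j < n \<Longrightarrow> W l j \<in> carrier L"
  using power_carrier[OF W_power] .

lemma D_e: "j < n \<Longrightarrow> D (e j) = (\<Oplus>\<^bsub>TE.T\<^esub> l\<in>{..<n}. TE.te (e l) (\<theta> l j))"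
  unfolding \<theta>_def using TE.coord_expand[OF D_closed[OF e_closed]] by simp

lemma wedge_D_e:
  assumes "j < n" "\<omega> \<in> carrier L"
  shows "wedge (D (e j)) \<omega> = (\<Oplus>\<^bsub>V.T\<^esub> l\<in>{..<n}. V.te (e l) (\<iota> (\<theta> l j) \<otimes>\<^bsub>L\<^esub> \<omega>))"
proof -
  have "wedge (D (e j)) \<omega> = (\<Oplus>\<^bsub>V.T\<^esub> l\<in>{..<n}. wedge (TE.te (e l) (\<theta> l j)) \<omega>)"
    unfolding D_e[OF assms(1)] using assms e_closed theta_closed
    by (intro addmap_finsum[OF TE.T.M.abelian_group_axioms V.T.M.abelian_group_axioms wedge_addmap]) auto
  also have "\<dots> = (\<Oplus>\<^bsub>V.T\<^esub> l\<in>{..<n}. V.te (e l) (\<iota> (\<theta> l j) \<otimes>\<^bsub>L\<^esub> \<omega>))"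
    using assms by (intro V.T.M.finsum_cong') (auto simp: wedge_elem e_closed theta_closed)
  finally show ?thesis .
qed

lemma K_e:
  assumes j: "j < n"
  shows "K (e j) = (\<Oplus>\<^bsub>V.T\<^esub> l\<in>{..<n}. V.te (e l) (W l j))"
proof -
  note th = theta_closed e_closed iota_closed[OF theta_closed]
  have "nab (V.te (e j) \<one>\<^bsub>L\<^esub>) = (\<Oplus>\<^bsub>V.T\<^esub> m\<in>{..<n}. V.te (e m) (\<iota> (\<theta> m j)))"
  proof -
    have "nab (V.te (e j) \<one>\<^bsub>L\<^esub>) = (\<Oplus>\<^bsub>V.T\<^esub> m\<in>{..<n}. V.te (e m) (\<iota> (\<theta> m j) \<otimes>\<^bsub>L\<^esub> \<one>\<^bsub>L\<^esub>))"
      using j by (simp add: nab_one e_closed wedge_D_e)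
    also have "\<dots> = (\<Oplus>\<^bsub>V.T\<^esub> m\<in>{..<n}. V.te (e m) (\<iota> (\<theta> m j)))"
      using j th by (intro V.T.M.finsum_cong') auto
    finally show ?thesis .
  qed
  hence "K (e j) = (\<Oplus>\<^bsub>V.T\<^esub> m\<in>{..<n}. nab (V.te (e m) (\<iota> (\<theta> m j))))"
    unfolding K_def using j th
    by (simp add: addmap_finsum[OF V.T.M.abelian_group_axioms V.T.M.abelian_group_axioms nab_addmap] Pi_def)
  also have "\<dots> = (\<Oplus>\<^bsub>V.T\<^esub> m\<in>{..<n}. (\<Oplus>\<^bsub>V.T\<^esub> l\<in>{..<n}. V.te (e l) (\<iota> (\<theta> l m) \<otimes>\<^bsub>L\<^esub> \<iota> (\<theta> m j))) \<oplus>\<^bsub>V.T\<^esub>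
      V.te (e m) (dR (\<iota> (\<theta> m j))))"
    using j th by (intro V.T.M.finsum_cong') (auto simp: nab_elem wedge_D_e intro!: V.T.M.finsum_closed V.T.M.a_closed)
  also have "\<dots> = (\<Oplus>\<^bsub>V.T\<^esub> m\<in>{..<n}. \<Oplus>\<^bsub>V.T\<^esub> l\<in>{..<n}. V.te (e l) (\<iota> (\<theta> l m) \<otimes>\<^bsub>L\<^esub> \<iota> (\<theta> m j))) \<oplus>\<^bsub>V.T\<^esub>
      (\<Oplus>\<^bsub>V.T\<^esub> m\<in>{..<n}. V.te (e m) (dR (\<iota> (\<theta> m j))))"
    using j th by (intro V.T.M.finsum_addf) (auto intro!: V.T.M.finsum_closed)
  also have "(\<Oplus>\<^bsub>V.T\<^esub> m\<in>{..<n}. \<Oplus>\<^bsub>V.T\<^esub> l\<in>{..<n}. V.te (e l) (\<iota> (\<theta> l m) \<otimes>\<^bsub>L\<^esub> \<iota> (\<theta> m j))) =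
      (\<Oplus>\<^bsub>V.T\<^esub> l\<in>{..<n}. \<Oplus>\<^bsub>V.T\<^esub> m\<in>{..<n}. V.te (e l) (\<iota> (\<theta> l m) \<otimes>\<^bsub>L\<^esub> \<iota> (\<theta> m j)))"
    using j th by (intro V.T.M.finsum_swap) auto
  also have "\<dots> = (\<Oplus>\<^bsub>V.T\<^esub> l\<in>{..<n}. V.te (e l) (\<Oplus>\<^bsub>L\<^esub> m\<in>{..<n}. \<iota> (\<theta> l m) \<otimes>\<^bsub>L\<^esub> \<iota> (\<theta> m j)))"
    using j th
    by (intro V.T.M.finsum_cong' addmap_finsum[OF L.M.abelian_group_axioms V.T.M.abelian_group_axioms V.tensor_elem_addmap(1), symmetric])
      (auto intro!: L.M.finsum_closed)
  also have "\<dots> \<oplus>\<^bsub>V.T\<^esub> (\<Oplus>\<^bsub>V.T\<^esub> m\<in>{..<n}. V.te (e m) (dR (\<iota> (\<theta> m j)))) =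
     (\<Oplus>\<^bsub>V.T\<^esub> l\<in>{..<n}. V.te (e l) (\<Oplus>\<^bsub>L\<^esub> m\<in>{..<n}. \<iota> (\<theta> l m) \<otimes>\<^bsub>L\<^esub> \<iota> (\<theta> m j)) \<oplus>\<^bsub>V.T\<^esub> V.te (e l) (dR (\<iota> (\<theta> l j))))"
    using j th by (intro V.T.M.finsum_addf[symmetric]) (auto intro!: L.M.finsum_closed)
  also have "\<dots> = (\<Oplus>\<^bsub>V.T\<^esub> l\<in>{..<n}. V.te (e l) (W l j))"
    unfolding W_def using j th
    by (intro V.T.M.finsum_cong') (auto simp: V.tensor_elem_add_right intro!: L.M.finsum_closed)
  finally show ?thesis .
qed

end

subsection \<open>The curvature matrix\<close>

context connection_module
begin

abbreviation "N \<equiv> end_module R E"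
abbreviation "EF \<equiv> end_forms R s E"

sublocale N: module R N by (rule M.end_module_module)
sublocale EL: two_modules R "end_module R E" "ext_algebra R (kahler R s)" by unfold_locales

lemma N_carrier: "carrier N = module_hom R E E"
  by (simp add: end_module_def)

lemma N_simps:
  "x \<in> carrier E \<Longrightarrow> (S \<oplus>\<^bsub>N\<^esub> T) x = S x \<oplus>\<^bsub>E\<^esub> T x"
  "x \<in> carrier E \<Longrightarrow> (a \<odot>\<^bsub>N\<^esub> T) x = a \<odot>\<^bsub>E\<^esub> T x"
  "x \<in> carrier E \<Longrightarrow> (S \<otimes>\<^bsub>N\<^esub> T) x = S (T x)"
  by (simp_all add: end_module_def compose_def)

lemma N_app: "S \<in> carrier N \<Longrightarrow> x \<in> carrier E \<Longrightarrow> S x \<in> carrier E"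
  unfolding N_carrier by (rule module_homD(1))

lemma N_app_add: "S \<in> carrier N \<Longrightarrow> x \<in> carrier E \<Longrightarrow> y \<in> carrier E \<Longrightarrow> S (x \<oplus>\<^bsub>E\<^esub> y) = S x \<oplus>\<^bsub>E\<^esub> S y"
  unfolding N_carrier by (rule module_homD(2))

lemma N_app_smult: "S \<in> carrier N \<Longrightarrow> a \<in> carrier R \<Longrightarrow> x \<in> carrier E \<Longrightarrow> S (a \<odot>\<^bsub>E\<^esub> x) = a \<odot>\<^bsub>E\<^esub> S x"
  unfolding N_carrier by (rule module_homD(3))

lemma N_ext:
  assumes "S \<in> carrier N" "T \<in> carrier N" "\<And>x. x \<in> carrier E \<Longrightarrow> S x = T x"
  shows "S = T"
  using assms module_homD(4) unfolding N_carrier by (intro extensionalityI[of _ "carrier E"]) auto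

lemma N_mult_closed: "S \<in> carrier N \<Longrightarrow> T \<in> carrier N \<Longrightarrow> S \<otimes>\<^bsub>N\<^esub> T \<in> carrier N"
proof -
  assume ST: "S \<in> carrier N" "T \<in> carrier N"
  show "S \<otimes>\<^bsub>N\<^esub> T \<in> carrier N" unfolding N_carrier
    by (rule module_homI) (use ST in \<open>simp_all add: N_simps N_app N_app_add N_app_smult\<close>, simp add: end_module_def)
qed

lemma N_one_closed: "\<one>\<^bsub>N\<^esub> \<in> carrier N"
  unfolding N_carrier by (rule module_homI) (simp_all add: end_module_def)

lemma N_one_app: "x \<in> carrier E \<Longrightarrow> \<one>\<^bsub>N\<^esub> x = x"
  by (simp add: end_module_def)

lemma EF_simps:
  "carrier EF = carrier EL.T" "\<zero>\<^bsub>EF\<^esub> = \<zero>\<^bsub>EL.T\<^esub>" "X \<oplus>\<^bsub>EF\<^esub> Y = X \<oplus>\<^bsub>EL.T\<^esub> Y" "a \<odot>\<^bsub>EF\<^esub> X = a \<odot>\<^bsub>EL.T\<^esub> X"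
  "\<one>\<^bsub>EF\<^esub> = EL.te \<one>\<^bsub>N\<^esub> \<one>\<^bsub>L\<^esub>"
  by (simp_all add: end_forms_def Let_def forms_def)

sublocale EF: module R EF
  unfolding end_forms_def Let_def forms_def by (rule module_update[OF EL.T.module_axioms])

subsubsection \<open>Matrix entries\<close>

definition entry :: "nat \<Rightarrow> nat \<Rightarrow> _ \<Rightarrow> 'a form" where
  "entry l j = tensor_lift R N L (\<lambda>S \<omega>. \<phi> l (S (e j)) \<odot>\<^bsub>L\<^esub> \<omega>)"

lemma entry_balanced: "l < n \<Longrightarrow> j < n \<Longrightarrow> balanced R N L L (\<lambda>S \<omega>. \<phi> l (S (e j)) \<odot>\<^bsub>L\<^esub> \<omega>)"
  by (rule balancedI) (auto simp: N_simps N_app e_closed phi_closed phi_add phi_smult L.smult_r_distr L.smult_l_distr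
      L.smult_assoc1[symmetric] m_comm)

lemma entry_addmap: "l < n \<Longrightarrow> j < n \<Longrightarrow> addmap EL.T L (entry l j)"
  unfolding entry_def by (rule EL.tensor_lift_addmap[OF L.M.abelian_group_axioms entry_balanced])

lemma entry_elem: "l < n \<Longrightarrow> j < n \<Longrightarrow> S \<in> carrier N \<Longrightarrow> \<omega> \<in> carrier L \<Longrightarrow>
    entry l j (EL.te S \<omega>) = \<phi> l (S (e j)) \<odot>\<^bsub>L\<^esub> \<omega>"
  unfolding entry_def by (rule EL.tensor_lift_elem[OF L.M.abelian_group_axioms entry_balanced])

lemma entry_closed: "l < n \<Longrightarrow> j < n \<Longrightarrow> X \<in> carrier EL.T \<Longrightarrow> entry l j X \<in> carrier L"
  by (rule addmap_closed[OF entry_addmap])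

lemma entry_add: "l < n \<Longrightarrow> j < n \<Longrightarrow> X \<in> carrier EL.T \<Longrightarrow> Y \<in> carrier EL.T \<Longrightarrow>
    entry l j (X \<oplus>\<^bsub>EL.T\<^esub> Y) = entry l j X \<oplus>\<^bsub>L\<^esub> entry l j Y"
  by (rule addmap_add[OF entry_addmap])

lemma phi_app_closed: "S \<in> carrier N \<Longrightarrow> l < n \<Longrightarrow> j < n \<Longrightarrow> \<phi> l (S (e j)) \<in> carrier R"
  by (rule phi_closed[OF _ N_app[OF _ e_closed]])

text \<open>The rank one endomorphism given by e_l and the functional phi_j, a matrix unit
  compressed to E; by \<open>unit_expand\<close> these span End(E).\<close>

definition unit_end :: "nat \<Rightarrow> nat \<Rightarrow> 'e \<Rightarrow> 'e" where
  "unit_end l j = (\<lambda>x\<in>carrier E. \<phi> j x \<odot>\<^bsub>E\<^esub> e l)"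

lemma unit_end_closed: "l < n \<Longrightarrow> j < n \<Longrightarrow> unit_end l j \<in> carrier N"
  unfolding N_carrier unit_end_def
  by (rule module_homI) (simp_all add: phi_closed phi_add phi_smult e_closed M.smult_l_distr M.smult_assoc1)

lemma unit_end_app: "x \<in> carrier E \<Longrightarrow> unit_end l j x = \<phi> j x \<odot>\<^bsub>E\<^esub> e l"
  by (simp add: unit_end_def)

lemma N_finsum_app:
  assumes "finite A" "\<And>i. i \<in> A \<Longrightarrow> S i \<in> carrier N" "x \<in> carrier E"
  shows "(\<Oplus>\<^bsub>N\<^esub> i\<in>A. S i) x = (\<Oplus>\<^bsub>E\<^esub> i\<in>A. S i x)"
  using assms
proof (induction A)
  case empty
  thus ?case by simp (simp add: end_module_def)
next
  case (insert i A)
  thus ?case by (simp add: Pi_def N_simps N_app)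
qed

lemma unit_expand:
  assumes S: "S \<in> carrier N"
  shows "(\<Oplus>\<^bsub>N\<^esub> l\<in>{..<n}. \<Oplus>\<^bsub>N\<^esub> j\<in>{..<n}. \<phi> l (S (e j)) \<odot>\<^bsub>N\<^esub> unit_end l j) = S"
proof (rule N_ext[OF _ S])
  have c: "\<phi> l (S (e j)) \<odot>\<^bsub>N\<^esub> unit_end l j \<in> carrier N" if "l < n" "j < n" for l j
    by (rule N.smult_closed[OF phi_app_closed[OF S that] unit_end_closed[OF that]])
  show "(\<Oplus>\<^bsub>N\<^esub> l\<in>{..<n}. \<Oplus>\<^bsub>N\<^esub> j\<in>{..<n}. \<phi> l (S (e j)) \<odot>\<^bsub>N\<^esub> unit_end l j) \<in> carrier N"
    using c by (intro N.M.finsum_closed) (auto intro!: N.M.finsum_closed)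
  fix x assume x: "x \<in> carrier E"
  have "(\<Oplus>\<^bsub>N\<^esub> l\<in>{..<n}. \<Oplus>\<^bsub>N\<^esub> j\<in>{..<n}. \<phi> l (S (e j)) \<odot>\<^bsub>N\<^esub> unit_end l j) x =
    (\<Oplus>\<^bsub>E\<^esub> l\<in>{..<n}. \<phi> l (S x) \<odot>\<^bsub>E\<^esub> e l)"
  proof -
    have "(\<Oplus>\<^bsub>N\<^esub> l\<in>{..<n}. \<Oplus>\<^bsub>N\<^esub> j\<in>{..<n}. \<phi> l (S (e j)) \<odot>\<^bsub>N\<^esub> unit_end l j) x =
      (\<Oplus>\<^bsub>E\<^esub> l\<in>{..<n}. (\<Oplus>\<^bsub>N\<^esub> j\<in>{..<n}. \<phi> l (S (e j)) \<odot>\<^bsub>N\<^esub> unit_end l j) x)"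
      using c x by (intro N_finsum_app) (auto intro!: N.M.finsum_closed)
    also have "\<dots> = (\<Oplus>\<^bsub>E\<^esub> l\<in>{..<n}. \<phi> l (S x) \<odot>\<^bsub>E\<^esub> e l)"
    proof (rule M.M.finsum_cong')
      fix l assume l: "l \<in> {..<n}"
      have "(\<Oplus>\<^bsub>N\<^esub> j\<in>{..<n}. \<phi> l (S (e j)) \<odot>\<^bsub>N\<^esub> unit_end l j) x =
          (\<Oplus>\<^bsub>E\<^esub> j\<in>{..<n}. (\<phi> l (S (e j)) \<odot>\<^bsub>N\<^esub> unit_end l j) x)"
        using c l x by (intro N_finsum_app) auto
      also have "\<dots> = (\<Oplus>\<^bsub>E\<^esub> j\<in>{..<n}. \<phi> l (S (\<phi> j x \<odot>\<^bsub>E\<^esub> e j)) \<odot>\<^bsub>E\<^esub> e l)"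
        using l x S by (intro M.M.finsum_cong')
          (auto simp: N_simps unit_end_app phi_smult N_app_smult N_app e_closed phi_closed M.smult_assoc1[symmetric] m_comm)
      also have "\<dots> = \<phi> l (S x) \<odot>\<^bsub>E\<^esub> e l"
      proof -
        have "addmap E E (\<lambda>y. \<phi> l (S y) \<odot>\<^bsub>E\<^esub> e l)"
          using l S by (intro addmapI) (auto simp: N_app N_app_add phi_closed phi_add e_closed M.smult_l_distr)
        from linear_expand[OF M.M.abelian_group_axioms this x] show ?thesis by simp
      qed
      finally show "(\<Oplus>\<^bsub>N\<^esub> j\<in>{..<n}. \<phi> l (S (e j)) \<odot>\<^bsub>N\<^esub> unit_end l j) x = \<phi> l (S x) \<odot>\<^bsub>E\<^esub> e l" .
    qed (use S x in \<open>auto simp: phi_closed N_app e_closed\<close>)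
    finally show ?thesis .
  qed
  thus "(\<Oplus>\<^bsub>N\<^esub> l\<in>{..<n}. \<Oplus>\<^bsub>N\<^esub> j\<in>{..<n}. \<phi> l (S (e j)) \<odot>\<^bsub>N\<^esub> unit_end l j) x = S x"
    using expand[OF N_app[OF S x]] by simp
qed

text \<open>An endomorphism-valued form is recovered from its entries, whatever the module of forms
  looks like. This injectivity is what makes the curvature unique.\<close>

lemma entry_expand:
  "X \<in> carrier EL.T \<Longrightarrow> (\<Oplus>\<^bsub>EL.T\<^esub> l\<in>{..<n}. \<Oplus>\<^bsub>EL.T\<^esub> j\<in>{..<n}. EL.te (unit_end l j) (entry l j X)) = X"
proof (induction rule: EL.tensor_induct)
  case (elem S \<omega>)
  have c: "\<phi> l (S (e j)) \<odot>\<^bsub>N\<^esub> unit_end l j \<in> carrier N" if "l < n" "j < n" for l j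
    by (rule N.smult_closed[OF phi_app_closed[OF elem(1) that] unit_end_closed[OF that]])
  have ph: "\<phi> l (S (e j)) \<in> carrier R" if "l < n" "j < n" for l j by (rule phi_app_closed[OF elem(1) that])
  have am: "addmap N EL.T (\<lambda>S. EL.te S \<omega>)" by (rule EL.tensor_elem_addmap(2)[OF elem(2)])
  note fs = addmap_finsum[OF N.M.abelian_group_axioms EL.T.M.abelian_group_axioms am]
  have "EL.te S \<omega> = EL.te (\<Oplus>\<^bsub>N\<^esub> l\<in>{..<n}. \<Oplus>\<^bsub>N\<^esub> j\<in>{..<n}. \<phi> l (S (e j)) \<odot>\<^bsub>N\<^esub> unit_end l j) \<omega>"
    by (simp only: unit_expand[OF elem(1)])
  also have "\<dots> = (\<Oplus>\<^bsub>EL.T\<^esub> l\<in>{..<n}. EL.te (\<Oplus>\<^bsub>N\<^esub> j\<in>{..<n}. \<phi> l (S (e j)) \<odot>\<^bsub>N\<^esub> unit_end l j) \<omega>)"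
    using c by (intro fs) (auto intro!: N.M.finsum_closed)
  also have "\<dots> = (\<Oplus>\<^bsub>EL.T\<^esub> l\<in>{..<n}. \<Oplus>\<^bsub>EL.T\<^esub> j\<in>{..<n}. EL.te (\<phi> l (S (e j)) \<odot>\<^bsub>N\<^esub> unit_end l j) \<omega>)"
    using c elem by (intro EL.T.M.finsum_cong' fs) (auto intro!: EL.T.M.finsum_closed)
  also have "\<dots> = (\<Oplus>\<^bsub>EL.T\<^esub> l\<in>{..<n}. \<Oplus>\<^bsub>EL.T\<^esub> j\<in>{..<n}. EL.te (unit_end l j) (entry l j (EL.te S \<omega>)))"
    using elem c ph by (intro EL.T.M.finsum_cong')
      (auto simp: entry_elem EL.tensor_elem_smult_left EL.tensor_elem_smult_right unit_end_closed intro!: EL.T.M.finsum_closed)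
  finally show ?case ..
next
  case (add X Y)
  have c: "EL.te (unit_end l j) (entry l j Z) \<in> carrier EL.T" if "l < n" "j < n" "Z \<in> carrier EL.T" for l j Z
    using that by (intro EL.tensor_elem_closed unit_end_closed entry_closed)
  have "(\<Oplus>\<^bsub>EL.T\<^esub> l\<in>{..<n}. \<Oplus>\<^bsub>EL.T\<^esub> j\<in>{..<n}. EL.te (unit_end l j) (entry l j (X \<oplus>\<^bsub>EL.T\<^esub> Y))) =
    (\<Oplus>\<^bsub>EL.T\<^esub> l\<in>{..<n}. (\<Oplus>\<^bsub>EL.T\<^esub> j\<in>{..<n}. EL.te (unit_end l j) (entry l j X)) \<oplus>\<^bsub>EL.T\<^esub>
       (\<Oplus>\<^bsub>EL.T\<^esub> j\<in>{..<n}. EL.te (unit_end l j) (entry l j Y)))"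
  proof (rule EL.T.M.finsum_cong')
    fix l assume l: "l \<in> {..<n}"
    have "(\<Oplus>\<^bsub>EL.T\<^esub> j\<in>{..<n}. EL.te (unit_end l j) (entry l j (X \<oplus>\<^bsub>EL.T\<^esub> Y))) =
      (\<Oplus>\<^bsub>EL.T\<^esub> j\<in>{..<n}. EL.te (unit_end l j) (entry l j X) \<oplus>\<^bsub>EL.T\<^esub> EL.te (unit_end l j) (entry l j Y))"
      using l add c by (intro EL.T.M.finsum_cong') (auto simp: entry_add entry_closed EL.tensor_elem_add_right unit_end_closed)
    also have "\<dots> = (\<Oplus>\<^bsub>EL.T\<^esub> j\<in>{..<n}. EL.te (unit_end l j) (entry l j X)) \<oplus>\<^bsub>EL.T\<^esub>
       (\<Oplus>\<^bsub>EL.T\<^esub> j\<in>{..<n}. EL.te (unit_end l j) (entry l j Y))"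
      using l add c by (intro EL.T.M.finsum_addf) auto
    finally show "(\<Oplus>\<^bsub>EL.T\<^esub> j\<in>{..<n}. EL.te (unit_end l j) (entry l j (X \<oplus>\<^bsub>EL.T\<^esub> Y))) = \<dots>" .
  qed (use add c in \<open>auto intro!: EL.T.M.finsum_closed EL.T.M.a_closed\<close>)
  also have "\<dots> = (\<Oplus>\<^bsub>EL.T\<^esub> l\<in>{..<n}. \<Oplus>\<^bsub>EL.T\<^esub> j\<in>{..<n}. EL.te (unit_end l j) (entry l j X)) \<oplus>\<^bsub>EL.T\<^esub>
       (\<Oplus>\<^bsub>EL.T\<^esub> l\<in>{..<n}. \<Oplus>\<^bsub>EL.T\<^esub> j\<in>{..<n}. EL.te (unit_end l j) (entry l j Y))"
    using add c by (intro EL.T.M.finsum_addf) (auto intro!: EL.T.M.finsum_closed)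
  finally show ?case using add by simp
qed

subsubsection \<open>Evaluation and the curvature\<close>

abbreviation "app \<equiv> end_forms_apply R s E"

lemma app_props:
  assumes x: "x \<in> carrier E"
  shows app_addmap: "addmap EL.T V.T (\<lambda>X. app X x)"
    and app_elem: "S \<in> carrier N \<Longrightarrow> \<omega> \<in> carrier L \<Longrightarrow> app (EL.te S \<omega>) x = V.te (S x) \<omega>"
proof -
  have b: "balanced R N L V.T (\<lambda>S \<omega>. V.te (S x) \<omega>)"
    using x by (intro balancedI)
      (auto simp: N_app N_simps V.tensor_elem_add_left V.tensor_elem_add_right V.tensor_elem_smult_left V.tensor_elem_smult_right)
  have eq: "app X x = tensor_lift R N V.T (\<lambda>S \<omega>. V.te (S x) \<omega>) X" for X
    by (simp add: end_forms_apply_def vforms_def forms_def)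
  show "addmap EL.T V.T (\<lambda>X. app X x)"
    unfolding eq by (rule EL.tensor_lift_addmap[OF V.T.M.abelian_group_axioms b])
  show "app (EL.te S \<omega>) x = V.te (S x) \<omega>" if "S \<in> carrier N" "\<omega> \<in> carrier L"
    unfolding eq by (rule EL.tensor_lift_elem[OF V.T.M.abelian_group_axioms b that])
qed

lemma coord_app:
  assumes "l < n" "j < n" "X \<in> carrier EL.T"
  shows "V.coord l (app X (e j)) = entry l j X"
  using assms(3)
proof (induction rule: EL.tensor_induct)
  case (elem S \<omega>)
  thus ?case using assms by (simp add: app_elem e_closed V.coord_elem N_app entry_elem)
next
  case (add X Y)
  thus ?case using assms e_closed[OF assms(2)]
    by (simp add: addmap_add[OF app_addmap] addmap_closed[OF app_addmap] V.coord_add entry_add)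
qed

definition curv where
  "curv = (\<Oplus>\<^bsub>EF\<^esub> l\<in>{..<n}. \<Oplus>\<^bsub>EF\<^esub> j\<in>{..<n}. EL.te (unit_end l j) (W l j))"

lemma end_forms_deg_gens:
  "{EL.te S \<omega> | S \<omega>. S \<in> carrier N \<and> \<omega> \<in> \<Lambda> 2} \<subseteq> carrier EF"
  unfolding EF_simps using power_carrier by auto

lemma end_forms_deg_eq: "end_forms_deg R s E 2 = module_span R EF {EL.te S \<omega> | S \<omega>. S \<in> carrier N \<and> \<omega> \<in> \<Lambda> 2}"
  by (simp add: end_forms_deg_def forms_def forms_deg_def)

lemma span_finsum:
  assumes "\<And>i. i \<in> A \<Longrightarrow> f i \<in> end_forms_deg R s E 2"
  shows "(\<Oplus>\<^bsub>EF\<^esub> i\<in>A. f i) \<in> end_forms_deg R s E 2"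
proof -
  note sub = EF.span_submodule[OF end_forms_deg_gens, folded end_forms_deg_eq]
  note z = additive_subgroup.zero_closed[OF abelian_subgroup.axioms(1)[OF EF.submodule_abelian_subgroup[OF sub]]]
  note ad = EF.submoduleE(5)[OF sub] and ca = subsetD[OF EF.submoduleE(1)[OF sub]]
  show ?thesis using assms
  proof (induction A rule: infinite_finite_induct)
    case (insert x A)
    have "f \<in> A \<rightarrow> carrier EF" "f x \<in> carrier EF" using insert.prems ca by blast+
    thus ?case using insert by (simp add: ad)
  qed (simp_all add: z)
qed

text \<open>\<open>end_forms\<close> changes only the product and the unit of the tensor product,
  and finite sums do not see these fields.\<close>

lemma EF_finsum: "finsum EF f A = finsum EL.T f A"
  unfolding finsum_def finprod_def EF_simps by simp

lemma unit_W_closed: "l < n \<Longrightarrow> j < n \<Longrightarrow> EL.te (unit_end l j) (W l j) \<in> carrier EL.T"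
  by (intro EL.tensor_elem_closed unit_end_closed W_closed)

lemma curv_deg: "curv \<in> end_forms_deg R s E 2"
  unfolding curv_def
proof (intro span_finsum)
  fix l j assume "l \<in> {..<n}" "j \<in> {..<n}"
  hence "EL.te (unit_end l j) (W l j) \<in> {EL.te S \<omega> | S \<omega>. S \<in> carrier N \<and> \<omega> \<in> \<Lambda> 2}"
    using unit_end_closed W_power by blast
  thus "EL.te (unit_end l j) (W l j) \<in> end_forms_deg R s E 2"
    unfolding end_forms_deg_eq by (rule subsetD[OF EF.span_superset])
qed

lemma curv_closed: "curv \<in> carrier EL.T"
  unfolding curv_def EF_finsum using unit_W_closed by (intro EL.T.M.finsum_closed) (auto intro!: EL.T.M.finsum_closed)

text \<open>The definition of \<open>curv\<close> and \<open>K_e\<close> give agreement on the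
  generators; linearity of \<open>K\<close> carries the scalars \<open>\<phi> j x\<close>
  inside.\<close>

lemma app_curv:
  assumes x: "x \<in> carrier E"
  shows "app curv x = K x"
proof -
  note fs = addmap_finsum[OF EL.T.M.abelian_group_axioms V.T.M.abelian_group_axioms app_addmap[OF x]]
  have vc: "V.te (e l) (W l j) \<in> carrier V.T" if "l < n" "j < n" for l j
    using that by (intro V.tensor_elem_closed e_closed W_closed)
  have "app curv x = (\<Oplus>\<^bsub>V.T\<^esub> l\<in>{..<n}. app (\<Oplus>\<^bsub>EL.T\<^esub> j\<in>{..<n}. EL.te (unit_end l j) (W l j)) x)"
    unfolding curv_def EF_finsum using unit_W_closed by (intro fs) (auto intro!: EL.T.M.finsum_closed)
  also have "\<dots> = (\<Oplus>\<^bsub>V.T\<^esub> l\<in>{..<n}. \<Oplus>\<^bsub>V.T\<^esub> j\<in>{..<n}. app (EL.te (unit_end l j) (W l j)) x)"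
    using unit_W_closed x addmap_closed[OF app_addmap[OF x]]
    by (intro V.T.M.finsum_cong' fs) (auto intro!: V.T.M.finsum_closed)
  also have "\<dots> = (\<Oplus>\<^bsub>V.T\<^esub> l\<in>{..<n}. \<Oplus>\<^bsub>V.T\<^esub> j\<in>{..<n}. \<phi> j x \<odot>\<^bsub>V.T\<^esub> V.te (e l) (W l j))"
    using x vc by (intro V.T.M.finsum_cong')
      (auto simp: app_elem unit_end_closed W_closed unit_end_app V.tensor_elem_smult_left phi_closed e_closed
        intro!: V.T.M.finsum_closed)
  also have "\<dots> = (\<Oplus>\<^bsub>V.T\<^esub> j\<in>{..<n}. \<Oplus>\<^bsub>V.T\<^esub> l\<in>{..<n}. \<phi> j x \<odot>\<^bsub>V.T\<^esub> V.te (e l) (W l j))"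
    using x vc by (intro V.T.M.finsum_swap) (auto simp: phi_closed)
  also have "\<dots> = (\<Oplus>\<^bsub>V.T\<^esub> j\<in>{..<n}. K (\<phi> j x \<odot>\<^bsub>E\<^esub> e j))"
    using x vc by (intro V.T.M.finsum_cong')
      (auto simp: K_smult phi_closed e_closed K_e V.T.finsum_smult_ldistr Pi_def K_closed intro!: V.T.M.finsum_closed)
  also have "\<dots> = K x"
    by (rule linear_expand[symmetric, OF V.T.M.abelian_group_axioms _ x]) (auto intro!: addmapI simp: K_closed K_add)
  finally show ?thesis .
qed

text \<open>A competitor has the same evaluations, hence by \<open>coord_app\<close> the same
  entries, hence equals \<open>curv\<close> by \<open>entry_expand\<close>.\<close>

lemma curvature_eq: "curvature R s E D = curv"
  unfolding curvature_def forms_def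
proof (rule the_equality)
  show "curv \<in> end_forms_deg R s E 2 \<and> (\<forall>x\<in>carrier E. app curv x = nab (nab (V.te x \<one>\<^bsub>L\<^esub>)))"
    using curv_deg app_curv by (simp add: K_def)
next
  fix X assume X: "X \<in> end_forms_deg R s E 2 \<and> (\<forall>x\<in>carrier E. app X x = nab (nab (V.te x \<one>\<^bsub>L\<^esub>)))"
  hence XT: "X \<in> carrier EL.T"
    using EF.span_subset[OF end_forms_deg_gens] unfolding end_forms_deg_eq EF_simps by blast
  have "entry l j X = entry l j curv" if "l < n" "j < n" for l j
    using that X coord_app[OF that XT] coord_app[OF that curv_closed] app_curv e_closed by (simp add: K_def)
  hence "(\<Oplus>\<^bsub>EL.T\<^esub> l\<in>{..<n}. \<Oplus>\<^bsub>EL.T\<^esub> j\<in>{..<n}. EL.te (unit_end l j) (entry l j X)) =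
     (\<Oplus>\<^bsub>EL.T\<^esub> l\<in>{..<n}. \<Oplus>\<^bsub>EL.T\<^esub> j\<in>{..<n}. EL.te (unit_end l j) (entry l j curv))"
    using curv_closed by (intro EL.T.M.finsum_cong')
      (auto intro!: EL.T.M.finsum_closed EL.tensor_elem_closed unit_end_closed entry_closed)
  thus "X = curv" unfolding entry_expand[OF XT] entry_expand[OF curv_closed] .
qed

lemma entry_curv:
  assumes lj: "l < n" "j < n"
  shows "entry l j curv = (\<Oplus>\<^bsub>L\<^esub> m\<in>{..<n}. \<phi> l (e m) \<odot>\<^bsub>L\<^esub> W m j)"
proof -
  have vc: "V.te (e m) (W m j) \<in> carrier V.T" if "m < n" for m
    using that lj by (intro V.tensor_elem_closed e_closed W_closed)
  have "entry l j curv = V.coord l (\<Oplus>\<^bsub>V.T\<^esub> m\<in>{..<n}. V.te (e m) (W m j))"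
    using coord_app[OF lj curv_closed] app_curv[OF e_closed[OF lj(2)]] K_e[OF lj(2)] by simp
  also have "\<dots> = (\<Oplus>\<^bsub>L\<^esub> m\<in>{..<n}. V.coord l (V.te (e m) (W m j)))"
    using vc by (intro addmap_finsum[OF V.T.M.abelian_group_axioms L.M.abelian_group_axioms V.coord_addmap[OF lj(1)]]) auto
  also have "\<dots> = (\<Oplus>\<^bsub>L\<^esub> m\<in>{..<n}. \<phi> l (e m) \<odot>\<^bsub>L\<^esub> W m j)"
    using lj by (intro L.M.finsum_cong') (auto simp: V.coord_elem e_closed W_closed phi_closed)
  finally show ?thesis .
qed

subsubsection \<open>Products and traces\<close>

text \<open>The product is a lift inside a lift. The inner map has to be balanced for fixed S,
  \<alpha>, and its value at a fixed Y balanced in S, \<alpha>; the latter is checked by induction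
  on Y.\<close>

lemma EF_mult_props:
  shows EF_mult_left: "Y \<in> carrier EL.T \<Longrightarrow> addmap EL.T EL.T (\<lambda>X. X \<otimes>\<^bsub>EF\<^esub> Y)"
    and EF_mult_right: "S \<in> carrier N \<Longrightarrow> \<alpha> \<in> carrier L \<Longrightarrow> addmap EL.T EL.T (\<lambda>Y. EL.te S \<alpha> \<otimes>\<^bsub>EF\<^esub> Y)"
    and EF_mult_elem: "S \<in> carrier N \<Longrightarrow> \<alpha> \<in> carrier L \<Longrightarrow> T \<in> carrier N \<Longrightarrow> \<beta> \<in> carrier L \<Longrightarrow>
      EL.te S \<alpha> \<otimes>\<^bsub>EF\<^esub> EL.te T \<beta> = EL.te (S \<otimes>\<^bsub>N\<^esub> T) (\<alpha> \<otimes>\<^bsub>L\<^esub> \<beta>)"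
proof -
  define G where "G S \<alpha> Y = tensor_lift R N EL.T (\<lambda>T \<beta>. EL.te (S \<otimes>\<^bsub>N\<^esub> T) (\<alpha> \<otimes>\<^bsub>L\<^esub> \<beta>)) Y" for S \<alpha> Y
  have mult: "X \<otimes>\<^bsub>EF\<^esub> Y = tensor_lift R N EL.T (\<lambda>S \<alpha>. G S \<alpha> Y) X" for X Y
    by (simp add: end_forms_def Let_def forms_def G_def)
  have n1: "S \<otimes>\<^bsub>N\<^esub> (T \<oplus>\<^bsub>N\<^esub> T') = S \<otimes>\<^bsub>N\<^esub> T \<oplus>\<^bsub>N\<^esub> S \<otimes>\<^bsub>N\<^esub> T'"
    "(T \<oplus>\<^bsub>N\<^esub> T') \<otimes>\<^bsub>N\<^esub> S = T \<otimes>\<^bsub>N\<^esub> S \<oplus>\<^bsub>N\<^esub> T' \<otimes>\<^bsub>N\<^esub> S"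
    if "S \<in> carrier N" "T \<in> carrier N" "T' \<in> carrier N" for S T T'
    by (rule N_ext; use that in \<open>simp add: N_mult_closed N_simps N_app N_app_add\<close>)+
  have n2: "S \<otimes>\<^bsub>N\<^esub> (a \<odot>\<^bsub>N\<^esub> T) = a \<odot>\<^bsub>N\<^esub> (S \<otimes>\<^bsub>N\<^esub> T)" "(a \<odot>\<^bsub>N\<^esub> S) \<otimes>\<^bsub>N\<^esub> T = a \<odot>\<^bsub>N\<^esub> (S \<otimes>\<^bsub>N\<^esub> T)"
    if "S \<in> carrier N" "T \<in> carrier N" "a \<in> carrier R" for S T a
    by (rule N_ext; use that in \<open>simp add: N_mult_closed N_simps N_app N_app_smult\<close>)+
  have b1: "balanced R N L EL.T (\<lambda>T \<beta>. EL.te (S \<otimes>\<^bsub>N\<^esub> T) (\<alpha> \<otimes>\<^bsub>L\<^esub> \<beta>))" if "S \<in> carrier N" "\<alpha> \<in> carrier L" for S \<alpha>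
    using that by (intro balancedI)
      (auto simp: N_mult_closed n1 n2 LR.r_distr smult_mult_right EL.tensor_elem_add_left EL.tensor_elem_add_right
        EL.tensor_elem_smult_left EL.tensor_elem_smult_right)
  have Gm: "addmap EL.T EL.T (G S \<alpha>)" if "S \<in> carrier N" "\<alpha> \<in> carrier L" for S \<alpha>
    unfolding G_def by (rule EL.tensor_lift_addmap[OF EL.T.M.abelian_group_axioms b1[OF that]])
  have Ge: "G S \<alpha> (EL.te T \<beta>) = EL.te (S \<otimes>\<^bsub>N\<^esub> T) (\<alpha> \<otimes>\<^bsub>L\<^esub> \<beta>)"
    if "S \<in> carrier N" "\<alpha> \<in> carrier L" "T \<in> carrier N" "\<beta> \<in> carrier L" for S \<alpha> T \<beta>
    unfolding G_def by (rule EL.tensor_lift_elem[OF EL.T.M.abelian_group_axioms b1[OF that(1,2)] that(3,4)])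
  have b2: "balanced R N L EL.T (\<lambda>S \<alpha>. G S \<alpha> Y)" if Y: "Y \<in> carrier EL.T" for Y
  proof (rule balancedI)
    show "G S \<alpha> Y \<in> carrier EL.T" if "S \<in> carrier N" "\<alpha> \<in> carrier L" for S \<alpha>
      by (rule addmap_closed[OF Gm[OF that] Y])
    show "G S (\<alpha> \<oplus>\<^bsub>L\<^esub> \<alpha>') Y = G S \<alpha> Y \<oplus>\<^bsub>EL.T\<^esub> G S \<alpha>' Y" if h: "S \<in> carrier N" "\<alpha> \<in> carrier L" "\<alpha>' \<in> carrier L" for S \<alpha> \<alpha>'
      using Y
    proof (induction rule: EL.tensor_induct)
      case (elem T \<beta>)
      thus ?case using h by (simp add: Ge LR.l_distr N_mult_closed EL.tensor_elem_add_right)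
    next
      case (add X Y)
      thus ?case using h by (simp add: addmap_add[OF Gm] addmap_closed[OF Gm] EL.T.M.a_ac)
    qed
    show "G (S \<oplus>\<^bsub>N\<^esub> S') \<alpha> Y = G S \<alpha> Y \<oplus>\<^bsub>EL.T\<^esub> G S' \<alpha> Y" if h: "S \<in> carrier N" "S' \<in> carrier N" "\<alpha> \<in> carrier L" for S S' \<alpha>
      using Y
    proof (induction rule: EL.tensor_induct)
      case (elem T \<beta>)
      thus ?case using h by (simp add: Ge n1 N_mult_closed EL.tensor_elem_add_left)
    next
      case (add X Y)
      thus ?case using h by (simp add: addmap_add[OF Gm] addmap_closed[OF Gm] EL.T.M.a_ac)
    qed
    show "G (a \<odot>\<^bsub>N\<^esub> S) \<alpha> Y = G S (a \<odot>\<^bsub>L\<^esub> \<alpha>) Y" if h: "a \<in> carrier R" "S \<in> carrier N" "\<alpha> \<in> carrier L" for a S \<alpha>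
      using Y
    proof (induction rule: EL.tensor_induct)
      case (elem T \<beta>)
      thus ?case using h by (simp add: Ge n2 N_mult_closed smult_mult_left EL.tensor_elem_smult_left EL.tensor_elem_smult_right)
    next
      case (add X Y)
      thus ?case using h by (simp add: addmap_add[OF Gm] addmap_closed[OF Gm] EL.T.M.a_ac)
    qed
  qed
  show "addmap EL.T EL.T (\<lambda>X. X \<otimes>\<^bsub>EF\<^esub> Y)" if "Y \<in> carrier EL.T"
    unfolding mult by (rule EL.tensor_lift_addmap[OF EL.T.M.abelian_group_axioms b2[OF that]])
  have me: "EL.te S \<alpha> \<otimes>\<^bsub>EF\<^esub> Y = G S \<alpha> Y" if "S \<in> carrier N" "\<alpha> \<in> carrier L" "Y \<in> carrier EL.T" for S \<alpha> Y
    unfolding mult by (rule EL.tensor_lift_elem[OF EL.T.M.abelian_group_axioms b2[OF that(3)] that(1,2)])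
  show "addmap EL.T EL.T (\<lambda>Y. EL.te S \<alpha> \<otimes>\<^bsub>EF\<^esub> Y)" if h: "S \<in> carrier N" "\<alpha> \<in> carrier L"
    using Gm[OF h] by (auto simp: addmap_def me[OF h])
  show "EL.te S \<alpha> \<otimes>\<^bsub>EF\<^esub> EL.te T \<beta> = EL.te (S \<otimes>\<^bsub>N\<^esub> T) (\<alpha> \<otimes>\<^bsub>L\<^esub> \<beta>)"
    if "S \<in> carrier N" "\<alpha> \<in> carrier L" "T \<in> carrier N" "\<beta> \<in> carrier L"
    using that by (simp add: me Ge)
qed

lemma EF_mult_closed: "X \<in> carrier EL.T \<Longrightarrow> Y \<in> carrier EL.T \<Longrightarrow> X \<otimes>\<^bsub>EF\<^esub> Y \<in> carrier EL.T"
  by (rule addmap_closed[OF EF_mult_left])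

lemma entry_mult:
  assumes lj: "l < n" "j < n" and X: "X \<in> carrier EL.T" and Y: "Y \<in> carrier EL.T"
  shows "entry l j (X \<otimes>\<^bsub>EF\<^esub> Y) = (\<Oplus>\<^bsub>L\<^esub> k\<in>{..<n}. entry l k X \<otimes>\<^bsub>L\<^esub> entry k j Y)"
  using X
proof (induction rule: EL.tensor_induct)
  case (elem S \<alpha>)
  have pS: "\<phi> l (S (e k)) \<in> carrier R" if "k < n" for k by (rule phi_app_closed[OF elem(1) lj(1) that])
  from Y show ?case
  proof (induction rule: EL.tensor_induct)
    case el: (elem T \<beta>)
    have pT: "\<phi> k (T (e j)) \<in> carrier R" if "k < n" for k by (rule phi_app_closed[OF el(1) that lj(2)])
    have am: "addmap E L (\<lambda>x. \<phi> l (S x) \<odot>\<^bsub>L\<^esub> (\<alpha> \<otimes>\<^bsub>L\<^esub> \<beta>))"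
      using lj elem el by (intro addmapI) (auto simp: N_app N_app_add phi_closed phi_add L.smult_l_distr)
    have "entry l j (EL.te S \<alpha> \<otimes>\<^bsub>EF\<^esub> EL.te T \<beta>) = \<phi> l (S (T (e j))) \<odot>\<^bsub>L\<^esub> (\<alpha> \<otimes>\<^bsub>L\<^esub> \<beta>)"
      using lj elem el by (simp add: EF_mult_elem entry_elem N_mult_closed N_simps e_closed)
    also have "\<dots> = (\<Oplus>\<^bsub>L\<^esub> k\<in>{..<n}. \<phi> l (S (\<phi> k (T (e j)) \<odot>\<^bsub>E\<^esub> e k)) \<odot>\<^bsub>L\<^esub> (\<alpha> \<otimes>\<^bsub>L\<^esub> \<beta>))"
      using lj el by (intro linear_expand[OF L.M.abelian_group_axioms am]) (auto simp: N_app e_closed)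
    also have "\<dots> = (\<Oplus>\<^bsub>L\<^esub> k\<in>{..<n}. entry l k (EL.te S \<alpha>) \<otimes>\<^bsub>L\<^esub> entry k j (EL.te T \<beta>))"
      using lj elem el pS pT by (intro L.M.finsum_cong')
        (auto simp: entry_elem N_app_smult e_closed phi_smult N_app smult_mult_left smult_mult_right L.smult_assoc1[symmetric] m_comm)
    finally show ?case .
  next
    case (add Y Y')
    note m = EF_mult_right[OF elem]
    have ec: "entry l k (EL.te S \<alpha>) \<in> carrier L" if "k < n" for k using lj that elem by (intro entry_closed) auto
    have "entry l j (EL.te S \<alpha> \<otimes>\<^bsub>EF\<^esub> (Y \<oplus>\<^bsub>EL.T\<^esub> Y')) =
      (\<Oplus>\<^bsub>L\<^esub> k\<in>{..<n}. entry l k (EL.te S \<alpha>) \<otimes>\<^bsub>L\<^esub> entry k j Y) \<oplus>\<^bsub>L\<^esub> (\<Oplus>\<^bsub>L\<^esub> k\<in>{..<n}. entry l k (EL.te S \<alpha>) \<otimes>\<^bsub>L\<^esub> entry k j Y')"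
      using add lj by (simp add: addmap_add[OF m] entry_add addmap_closed[OF m])
    also have "\<dots> = (\<Oplus>\<^bsub>L\<^esub> k\<in>{..<n}. entry l k (EL.te S \<alpha>) \<otimes>\<^bsub>L\<^esub> entry k j Y \<oplus>\<^bsub>L\<^esub> entry l k (EL.te S \<alpha>) \<otimes>\<^bsub>L\<^esub> entry k j Y')"
      using add lj ec by (intro L.M.finsum_addf[symmetric]) (auto simp: entry_closed)
    also have "\<dots> = (\<Oplus>\<^bsub>L\<^esub> k\<in>{..<n}. entry l k (EL.te S \<alpha>) \<otimes>\<^bsub>L\<^esub> entry k j (Y \<oplus>\<^bsub>EL.T\<^esub> Y'))"
      using add lj ec by (intro L.M.finsum_cong') (auto simp: entry_add entry_closed LR.r_distr)
    finally show ?case .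
  qed
next
  case (add X X')
  note m = EF_mult_left[OF Y]
  have "entry l j ((X \<oplus>\<^bsub>EL.T\<^esub> X') \<otimes>\<^bsub>EF\<^esub> Y) =
    (\<Oplus>\<^bsub>L\<^esub> k\<in>{..<n}. entry l k X \<otimes>\<^bsub>L\<^esub> entry k j Y) \<oplus>\<^bsub>L\<^esub> (\<Oplus>\<^bsub>L\<^esub> k\<in>{..<n}. entry l k X' \<otimes>\<^bsub>L\<^esub> entry k j Y)"
    using add lj by (simp add: addmap_add[OF m] entry_add addmap_closed[OF m])
  also have "\<dots> = (\<Oplus>\<^bsub>L\<^esub> k\<in>{..<n}. entry l k X \<otimes>\<^bsub>L\<^esub> entry k j Y \<oplus>\<^bsub>L\<^esub> entry l k X' \<otimes>\<^bsub>L\<^esub> entry k j Y)"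
    using add lj Y by (intro L.M.finsum_addf[symmetric]) (auto simp: entry_closed)
  also have "\<dots> = (\<Oplus>\<^bsub>L\<^esub> k\<in>{..<n}. entry l k (X \<oplus>\<^bsub>EL.T\<^esub> X') \<otimes>\<^bsub>L\<^esub> entry k j Y)"
    using add lj Y by (intro L.M.finsum_cong') (auto simp: entry_add entry_closed LR.l_distr)
  finally show ?case .
qed

text \<open>The first power is by definition one times X, so this law starts the comparison of
  powers.\<close>

lemma EF_l_one: "X \<in> carrier EL.T \<Longrightarrow> \<one>\<^bsub>EF\<^esub> \<otimes>\<^bsub>EF\<^esub> X = X"
  unfolding EF_simps
proof (induction rule: EL.tensor_induct)
  case (elem S \<omega>)
  have "\<one>\<^bsub>N\<^esub> \<otimes>\<^bsub>N\<^esub> S = S"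
    using elem by (intro N_ext) (simp_all add: N_mult_closed N_one_closed N_simps N_one_app N_app)
  thus ?case using elem by (simp add: EF_mult_elem N_one_closed)
next
  case (add X Y)
  thus ?case using addmap_add[OF EF_mult_right[OF N_one_closed LR.one_closed]] by simp
qed

text \<open>The embedding of endomorphism-valued forms into matrices; the unit goes to the
  projection matrix with entries \<open>\<phi> l (e j)\<close>.\<close>

definition ematrix where
  "ematrix X = (\<lambda>l j. if l < n \<and> j < n then entry l j X else \<zero>\<^bsub>L\<^esub>)"

lemma ematrix_carrier: "X \<in> carrier EL.T \<Longrightarrow> ematrix X \<in> carrier (mat_ring L n)"
  by (auto simp: ematrix_def mat_ring_def entry_closed)

lemma ematrix_mult:
  assumes "X \<in> carrier EL.T" "Y \<in> carrier EL.T"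
  shows "ematrix (X \<otimes>\<^bsub>EF\<^esub> Y) = ematrix X \<otimes>\<^bsub>mat_ring L n\<^esub> ematrix Y"
proof (intro ext)
  fix l j
  show "ematrix (X \<otimes>\<^bsub>EF\<^esub> Y) l j = (ematrix X \<otimes>\<^bsub>mat_ring L n\<^esub> ematrix Y) l j"
  proof (cases "l < n \<and> j < n")
    case True
    have "(\<Oplus>\<^bsub>L\<^esub> k\<in>{..<n}. entry l k X \<otimes>\<^bsub>L\<^esub> entry k j Y) = (\<Oplus>\<^bsub>L\<^esub> k\<in>{..<n}. ematrix X l k \<otimes>\<^bsub>L\<^esub> ematrix Y k j)"
      using True assms by (intro L.M.finsum_cong') (auto simp: ematrix_def entry_closed)
    thus ?thesis using True assms by (simp add: LR.mat_ring_simps entry_mult) (simp add: ematrix_def entry_mult)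
  next
    case False
    have "ematrix X l k \<otimes>\<^bsub>L\<^esub> ematrix Y k j = \<zero>\<^bsub>L\<^esub>" for k
      using False assms by (auto simp: ematrix_def entry_closed)
    thus ?thesis using False by (simp add: LR.mat_ring_simps) (auto simp: ematrix_def)
  qed
qed

lemma EF_pow_closed: "X \<in> carrier EL.T \<Longrightarrow> X [^]\<^bsub>EF\<^esub> (i::nat) \<in> carrier EL.T"
  by (induction i) (auto simp: EF_mult_closed EF_simps N_one_closed)

text \<open>Exponent zero is excluded because the embedding into matrices is multiplicative but in
  general does not preserve the unit.\<close>

lemma ematrix_pow:
  assumes X: "X \<in> carrier EL.T" and i: "i \<ge> 1"
  shows "ematrix (X [^]\<^bsub>EF\<^esub> (i::nat)) = ematrix X [^]\<^bsub>mat_ring L n\<^esub> i"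
  using i
proof (induction i rule: dec_induct)
  case base
  interpret MR: ring "mat_ring L n" by (rule LR.mat_ring_ring)
  show ?case using EF_l_one[OF X] ematrix_carrier[OF X] by simp
next
  case (step i)
  thus ?case by (simp add: ematrix_mult EF_pow_closed X)
qed

text \<open>On a pure tensor, \<open>module_trace_eq\<close> replaces the unknown dual basis in the
  trace by the present one, and the sum becomes that of the diagonal entries.\<close>

lemma trace_eq:
  assumes X: "X \<in> carrier EL.T"
  shows "trace_forms R s E X = mtr n (ematrix X)"
proof -
  have tr: "module_trace R E S = (\<Oplus> j\<in>{..<n}. \<phi> j (S (e j)))" if "S \<in> carrier N" for S
    using module_trace_eq that unfolding N_carrier .
  have pc: "\<phi> j (S (e j)) \<in> carrier R" if "S \<in> carrier N" "j < n" for S j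
    by (rule phi_app_closed[OF that that(2)])
  have trc: "module_trace R E S \<in> carrier R" if "S \<in> carrier N" for S
    unfolding tr[OF that] using pc[OF that] by (intro finsum_closed) auto
  have tra: "module_trace R E (S \<oplus>\<^bsub>N\<^esub> T) = module_trace R E S \<oplus> module_trace R E T" if h: "S \<in> carrier N" "T \<in> carrier N" for S T
  proof -
    have "(\<Oplus> j\<in>{..<n}. \<phi> j ((S \<oplus>\<^bsub>N\<^esub> T) (e j))) = (\<Oplus> j\<in>{..<n}. \<phi> j (S (e j)) \<oplus> \<phi> j (T (e j)))"
      using h pc by (intro finsum_cong') (auto simp: N_simps e_closed N_app phi_add)
    thus ?thesis using h pc by (simp add: tr finsum_addf Pi_def)
  qed
  have trs: "module_trace R E (a \<odot>\<^bsub>N\<^esub> S) = a \<otimes> module_trace R E S" if h: "S \<in> carrier N" "a \<in> carrier R" for S a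
  proof -
    have "(\<Oplus> j\<in>{..<n}. \<phi> j ((a \<odot>\<^bsub>N\<^esub> S) (e j))) = (\<Oplus> j\<in>{..<n}. a \<otimes> \<phi> j (S (e j)))"
      using h pc by (intro finsum_cong') (auto simp: N_simps e_closed N_app phi_smult)
    thus ?thesis using h pc by (simp add: tr finsum_rdistr Pi_def)
  qed
  have b: "balanced R N L L (\<lambda>S \<omega>. module_trace R E S \<odot>\<^bsub>L\<^esub> \<omega>)"
    by (rule balancedI) (auto simp: trc tra trs L.smult_r_distr L.smult_l_distr L.smult_assoc1[symmetric] m_comm)
  have eq: "trace_forms R s E = tensor_lift R N L (\<lambda>S \<omega>. module_trace R E S \<odot>\<^bsub>L\<^esub> \<omega>)"
    by (simp add: trace_forms_def forms_def)
  note ta = EL.tensor_lift_addmap[OF L.M.abelian_group_axioms b, folded eq]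
    and te = EL.tensor_lift_elem[OF L.M.abelian_group_axioms b, folded eq]
  have mt: "mtr n (ematrix X) = (\<Oplus>\<^bsub>L\<^esub> j\<in>{..<n}. entry j j X)" if "X \<in> carrier EL.T" for X
    unfolding mtr_def using that by (intro L.M.finsum_cong') (auto simp: ematrix_def entry_closed)
  have "trace_forms R s E X = (\<Oplus>\<^bsub>L\<^esub> j\<in>{..<n}. entry j j X)"
    using X
  proof (induction rule: EL.tensor_induct)
    case (elem S \<omega>)
    have "addmap R L (\<lambda>a. a \<odot>\<^bsub>L\<^esub> \<omega>)" using elem by (intro addmapI) (auto simp: L.smult_l_distr)
    from addmap_finsum[OF abelian_group_axioms L.M.abelian_group_axioms this, of "\<lambda>j. \<phi> j (S (e j))" "{..<n}"]
    have "module_trace R E S \<odot>\<^bsub>L\<^esub> \<omega> = (\<Oplus>\<^bsub>L\<^esub> j\<in>{..<n}. \<phi> j (S (e j)) \<odot>\<^bsub>L\<^esub> \<omega>)"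
      using elem pc by (simp add: tr Pi_def)
    also have "\<dots> = (\<Oplus>\<^bsub>L\<^esub> j\<in>{..<n}. entry j j (EL.te S \<omega>))"
      using elem pc by (intro L.M.finsum_cong') (auto simp: entry_elem)
    finally show ?case using elem by (simp add: te)
  next
    case (add X Y)
    have "(\<Oplus>\<^bsub>L\<^esub> j\<in>{..<n}. entry j j (X \<oplus>\<^bsub>EL.T\<^esub> Y)) = (\<Oplus>\<^bsub>L\<^esub> j\<in>{..<n}. entry j j X \<oplus>\<^bsub>L\<^esub> entry j j Y)"
      using add by (intro L.M.finsum_cong') (auto simp: entry_add entry_closed)
    thus ?case using add by (simp add: addmap_add[OF ta] L.M.finsum_addf Pi_def entry_closed)
  qed
  thus ?thesis using mt[OF X] by simp
qed

lemma chern_form_eq: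
  assumes "i \<ge> 1"
  shows "chern_form R s E D i = s (1 / fact i) \<odot>\<^bsub>L\<^esub> mtr n (ematrix curv [^]\<^bsub>mat_ring L n\<^esub> i)"
  unfolding chern_form_def forms_def curvature_eq
  using trace_eq[OF EF_pow_closed[OF curv_closed]] ematrix_pow[OF curv_closed assms] by simp

end

section \<open>Modules with a free complement of rank one\<close>

text \<open>If \<open>E \<oplus> A\<close> is free, a connection on \<open>E\<close> extends by the trivial connection of \<open>A\<close> to a connection
  \<open>d + \<Theta>\<close> on the free module, with the same curvature.\<close>

lemma (in chern_simons) complement_curvature:
  assumes F: "F \<in> deg 0" and G: "G \<in> deg 0" and U: "U \<in> deg 0" and t: "t \<in> deg 1"
    and GF: "G \<otimes>\<^bsub>M\<^esub> F = U" and UG: "U \<otimes>\<^bsub>M\<^esub> G = G" and FU: "F \<otimes>\<^bsub>M\<^esub> U = F" and DU: "D U = \<zero>\<^bsub>M\<^esub>"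
    and P: "P = \<one>\<^bsub>M\<^esub> \<ominus>\<^bsub>M\<^esub> F \<otimes>\<^bsub>M\<^esub> G" and Pt: "P \<otimes>\<^bsub>M\<^esub> t = t"
    and tP: "t = t \<otimes>\<^bsub>M\<^esub> P \<oplus>\<^bsub>M\<^esub> P \<otimes>\<^bsub>M\<^esub> D P" and DDG: "D (D G) = \<zero>\<^bsub>M\<^esub>"
    and T: "T = t \<oplus>\<^bsub>M\<^esub> F \<otimes>\<^bsub>M\<^esub> D G"
  shows "D T \<oplus>\<^bsub>M\<^esub> T \<otimes>\<^bsub>M\<^esub> T = P \<otimes>\<^bsub>M\<^esub> (t \<otimes>\<^bsub>M\<^esub> t \<oplus>\<^bsub>M\<^esub> D t)"
proof -
  note c [simp] = deg_carrier[OF F] deg_carrier[OF G] deg_carrier[OF U] deg_carrier[OF t]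
  have Pc [simp]: "P \<in> carrier M" by (simp add: P)
  note M0 = M.minus_eq_zero_iff
  have D0: "D (x \<otimes>\<^bsub>M\<^esub> y) = D x \<otimes>\<^bsub>M\<^esub> y \<oplus>\<^bsub>M\<^esub> x \<otimes>\<^bsub>M\<^esub> D y" if "x \<in> deg 0" "y \<in> carrier M" for x y
    using D_even[OF that(1) _ that(2)] by simp
  have neg: "x = \<ominus>\<^bsub>M\<^esub> y" if "x \<oplus>\<^bsub>M\<^esub> y = \<zero>\<^bsub>M\<^esub>" "x \<in> carrier M" "y \<in> carrier M" for x y
    using M.minus_equality[OF that(1) that(3,2)] by simp
  have GFx: "G \<otimes>\<^bsub>M\<^esub> (F \<otimes>\<^bsub>M\<^esub> x) = U \<otimes>\<^bsub>M\<^esub> x" if "x \<in> carrier M" for x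
    using that by (simp add: GF[symmetric] M.m_assoc)
  \<comment> \<open>\<open>P\<close> annihilates the complement embedded by \<open>F\<close>; next,
    \<open>G\<close> annihilates the image of \<open>P\<close>. The two summands are thereby
    separated.\<close>
  have PF: "P \<otimes>\<^bsub>M\<^esub> F = \<zero>\<^bsub>M\<^esub>"
    by (simp add: P a_minus_def M.l_distr M.l_minus M.m_assoc GF FU M.r_neg)
  have "G \<otimes>\<^bsub>M\<^esub> P = \<zero>\<^bsub>M\<^esub>"
    by (simp add: P a_minus_def M.r_distr M.r_minus GFx UG M.r_neg)
  hence Gt: "G \<otimes>\<^bsub>M\<^esub> t = \<zero>\<^bsub>M\<^esub>" using M.m_assoc[of G P t] by (simp add: Pt)
  have DP: "D P = \<ominus>\<^bsub>M\<^esub> (D F \<otimes>\<^bsub>M\<^esub> G \<oplus>\<^bsub>M\<^esub> F \<otimes>\<^bsub>M\<^esub> D G)"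
    by (simp add: P a_minus_def D_add D_one addmap_inv[OF M.abelian_group_axioms M.abelian_group_axioms D_addmap] D0[OF F])
  have PFx: "P \<otimes>\<^bsub>M\<^esub> (F \<otimes>\<^bsub>M\<^esub> x) = \<zero>\<^bsub>M\<^esub>" if "x \<in> carrier M" for x
    using that PF by (simp add: M.m_assoc[symmetric])
  have PDP: "P \<otimes>\<^bsub>M\<^esub> D P = \<ominus>\<^bsub>M\<^esub> (P \<otimes>\<^bsub>M\<^esub> (D F \<otimes>\<^bsub>M\<^esub> G))"
    by (simp add: DP M.r_minus M.r_distr PFx)
  have DFU: "D F \<otimes>\<^bsub>M\<^esub> U = D F" using D0[OF F, of U] by (simp add: FU DU)
  \<comment> \<open>Relation \<open>tP\<close> multiplied by \<open>F\<close> on the right: t P F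
    vanishes, and in P (D P) F the product G F = U is absorbed by D F.\<close>
  have tF: "t \<otimes>\<^bsub>M\<^esub> F = \<ominus>\<^bsub>M\<^esub> (P \<otimes>\<^bsub>M\<^esub> D F)"
  proof -
    have "t \<otimes>\<^bsub>M\<^esub> F = (t \<otimes>\<^bsub>M\<^esub> P \<oplus>\<^bsub>M\<^esub> P \<otimes>\<^bsub>M\<^esub> D P) \<otimes>\<^bsub>M\<^esub> F" using tP by simp
    also have "\<dots> = \<ominus>\<^bsub>M\<^esub> (P \<otimes>\<^bsub>M\<^esub> D F)"
      unfolding PDP by (simp add: M.l_distr M.l_minus M.m_assoc PF GF DFU)
    finally show ?thesis .
  qed
  have DGt: "D G \<otimes>\<^bsub>M\<^esub> t = \<ominus>\<^bsub>M\<^esub> (G \<otimes>\<^bsub>M\<^esub> D t)"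
    using D0[OF G, of t] by (intro neg) (simp_all add: Gt D_zero)
  have DGF: "D G \<otimes>\<^bsub>M\<^esub> F = \<ominus>\<^bsub>M\<^esub> (G \<otimes>\<^bsub>M\<^esub> D F)"
    using D0[OF G, of F] by (intro neg) (simp_all add: GF DU)
  have TT: "T \<otimes>\<^bsub>M\<^esub> T = (t \<otimes>\<^bsub>M\<^esub> t \<oplus>\<^bsub>M\<^esub> t \<otimes>\<^bsub>M\<^esub> F \<otimes>\<^bsub>M\<^esub> D G) \<oplus>\<^bsub>M\<^esub> (F \<otimes>\<^bsub>M\<^esub> (D G \<otimes>\<^bsub>M\<^esub> t) \<oplus>\<^bsub>M\<^esub> F \<otimes>\<^bsub>M\<^esub> (D G \<otimes>\<^bsub>M\<^esub> F) \<otimes>\<^bsub>M\<^esub> D G)"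
    by (simp add: T M.l_distr M.r_distr M.m_assoc M.a_ac)
  let ?x = "D F \<otimes>\<^bsub>M\<^esub> D G" and ?y = "F \<otimes>\<^bsub>M\<^esub> (G \<otimes>\<^bsub>M\<^esub> (D F \<otimes>\<^bsub>M\<^esub> D G))" and ?z = "F \<otimes>\<^bsub>M\<^esub> (G \<otimes>\<^bsub>M\<^esub> D t)"
  have "t \<otimes>\<^bsub>M\<^esub> F \<otimes>\<^bsub>M\<^esub> D G = ?y \<ominus>\<^bsub>M\<^esub> ?x"
    unfolding tF by (simp add: P a_minus_def M.l_distr M.l_minus M.minus_add M.minus_minus M.m_assoc M.a_comm)
  moreover have "F \<otimes>\<^bsub>M\<^esub> (D G \<otimes>\<^bsub>M\<^esub> t) = \<ominus>\<^bsub>M\<^esub> ?z" unfolding DGt by (simp add: M.r_minus)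
  moreover have "F \<otimes>\<^bsub>M\<^esub> (D G \<otimes>\<^bsub>M\<^esub> F) \<otimes>\<^bsub>M\<^esub> D G = \<ominus>\<^bsub>M\<^esub> ?y"
    unfolding DGF by (simp add: M.r_minus M.l_minus M.m_assoc)
  ultimately have TT': "T \<otimes>\<^bsub>M\<^esub> T = (t \<otimes>\<^bsub>M\<^esub> t \<oplus>\<^bsub>M\<^esub> (?y \<ominus>\<^bsub>M\<^esub> ?x)) \<oplus>\<^bsub>M\<^esub> (\<ominus>\<^bsub>M\<^esub> ?z \<oplus>\<^bsub>M\<^esub> \<ominus>\<^bsub>M\<^esub> ?y)"
    unfolding TT by simp
  have DT: "D T = D t \<oplus>\<^bsub>M\<^esub> ?x"
    by (simp add: T D_add D0[OF F] DDG)
  \<comment> \<open>The ?x and ?y are cross terms of the two summands of \<open>T\<close> and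
    cancel; D t and ?z combine to (1 - F G) D t = P D t.\<close>
  have "D T \<oplus>\<^bsub>M\<^esub> T \<otimes>\<^bsub>M\<^esub> T = t \<otimes>\<^bsub>M\<^esub> t \<oplus>\<^bsub>M\<^esub> (D t \<oplus>\<^bsub>M\<^esub> \<ominus>\<^bsub>M\<^esub> ?z) \<oplus>\<^bsub>M\<^esub> ((?x \<oplus>\<^bsub>M\<^esub> \<ominus>\<^bsub>M\<^esub> ?x) \<oplus>\<^bsub>M\<^esub> (?y \<oplus>\<^bsub>M\<^esub> \<ominus>\<^bsub>M\<^esub> ?y))"
    unfolding DT TT' by (simp add: a_minus_def M.a_ac)
  also have "\<dots> = P \<otimes>\<^bsub>M\<^esub> t \<otimes>\<^bsub>M\<^esub> t \<oplus>\<^bsub>M\<^esub> P \<otimes>\<^bsub>M\<^esub> D t"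
    unfolding Pt by (simp add: P M.r_neg a_minus_def M.l_distr M.l_minus M.m_assoc)
  finally show ?thesis by (simp add: M.r_distr M.m_assoc)
qed

section \<open>The curvature as the curvature of a connection on a free module\<close>

context connection_module
begin

text \<open>P t = t: the columns of \<theta> are coordinates of elements, and the projection fixes
  coordinates.\<close>

lemma theta_phi:
  assumes "l < n" "j < n"
  shows "(\<Oplus>\<^bsub>\<Omega>\<^esub> k\<in>{..<n}. \<phi> l (e k) \<odot>\<^bsub>\<Omega>\<^esub> \<theta> k j) = \<theta> l j"
proof -
  have "\<theta> l j = TE.coord l (\<Oplus>\<^bsub>TE.T\<^esub> k\<in>{..<n}. TE.te (e k) (\<theta> k j))"
    unfolding D_e[OF assms(2), symmetric] by (rule \<theta>_def)
  also have "\<dots> = (\<Oplus>\<^bsub>\<Omega>\<^esub> k\<in>{..<n}. TE.coord l (TE.te (e k) (\<theta> k j)))"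
    using assms e_closed theta_closed
    by (intro addmap_finsum[OF TE.T.M.abelian_group_axioms \<Omega>.M.abelian_group_axioms TE.coord_addmap]) auto
  also have "\<dots> = (\<Oplus>\<^bsub>\<Omega>\<^esub> k\<in>{..<n}. \<phi> l (e k) \<odot>\<^bsub>\<Omega>\<^esub> \<theta> k j)"
    using assms by (intro \<Omega>.M.finsum_cong') (auto simp: TE.coord_elem e_closed theta_closed phi_closed)
  finally show ?thesis ..
qed

text \<open>The connection applied to the expansion of e_j in the generators; as matrices, t = t P +
  P dP.\<close>

lemma theta_right:
  assumes "l < n" "j < n"
  shows "\<theta> l j = (\<Oplus>\<^bsub>\<Omega>\<^esub> k\<in>{..<n}. \<phi> k (e j) \<odot>\<^bsub>\<Omega>\<^esub> \<theta> l k \<oplus>\<^bsub>\<Omega>\<^esub> \<phi> l (e k) \<odot>\<^bsub>\<Omega>\<^esub> dK (\<phi> k (e j)))"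
proof -
  have am: "addmap E \<Omega> (\<lambda>x. TE.coord l (D x))"
    using assms by (intro addmapI) (auto simp: TE.coord_closed TE.coord_add D_closed D_add)
  have "\<theta> l j = (\<Oplus>\<^bsub>\<Omega>\<^esub> k\<in>{..<n}. TE.coord l (D (\<phi> k (e j) \<odot>\<^bsub>E\<^esub> e k)))"
    unfolding \<theta>_def by (rule linear_expand[OF \<Omega>.M.abelian_group_axioms am e_closed[OF assms(2)]])
  also have "\<dots> = (\<Oplus>\<^bsub>\<Omega>\<^esub> k\<in>{..<n}. \<phi> k (e j) \<odot>\<^bsub>\<Omega>\<^esub> \<theta> l k \<oplus>\<^bsub>\<Omega>\<^esub> \<phi> l (e k) \<odot>\<^bsub>\<Omega>\<^esub> dK (\<phi> k (e j)))"
    using assms by (intro \<Omega>.M.finsum_cong')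
      (auto simp: D_smult TE.coord_add TE.coord_smult TE.coord_elem D_closed e_closed phi_closed \<theta>_def TE.coord_closed)
  finally show ?thesis .
qed

lemma iota_finsum: "f \<in> A \<rightarrow> carrier \<Omega> \<Longrightarrow> \<iota> (\<Oplus>\<^bsub>\<Omega>\<^esub> i\<in>A. f i) = (\<Oplus>\<^bsub>L\<^esub> i\<in>A. \<iota> (f i))"
  by (rule addmap_finsum[OF \<Omega>.M.abelian_group_axioms L.M.abelian_group_axioms iota_addmap])

lemma smult_finsum_one: "f \<in> A \<rightarrow> carrier R \<Longrightarrow> (\<Oplus> i\<in>A. f i) \<odot>\<^bsub>L\<^esub> \<one>\<^bsub>L\<^esub> = (\<Oplus>\<^bsub>L\<^esub> i\<in>A. f i \<odot>\<^bsub>L\<^esub> \<one>\<^bsub>L\<^esub>)"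
  by (rule addmap_finsum[OF abelian_group_axioms L.M.abelian_group_axioms]) (auto intro!: addmapI simp: L.smult_l_distr)

lemma dR_smult_one: "a \<in> carrier R \<Longrightarrow> dR (a \<odot>\<^bsub>L\<^esub> \<one>\<^bsub>L\<^esub>) = \<iota> (dK a)"
  by (simp add: dR_smult dR_one)

text \<open>A^n is E plus A by sending x to the pair of sum x_j e_j and G x, with F embedding A. The
  sum of the given connection and d has matrix t + F dG, and its curvature P (t t + dt) is by
  \<open>entry_curv\<close> the matrix of the curvature of E.\<close>

lemma curvature_matrix:
  assumes n: "n > 0"
    and f: "\<And>l. l < n \<Longrightarrow> f l \<in> carrier R" and g: "\<And>l. l < n \<Longrightarrow> g l \<in> carrier R"
    and fg: "(\<Oplus> l\<in>{..<n}. f l \<otimes> g l) = \<one>"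
    and \<phi>e: "\<And>l j. l < n \<Longrightarrow> j < n \<Longrightarrow> \<phi> l (e j) = (if l = j then \<one> else \<zero>) \<ominus> f l \<otimes> g j"
  shows "\<exists>B\<in>mdeg n 1. ematrix curv = md B \<oplus>\<^bsub>mat_ring L n\<^esub> B \<otimes>\<^bsub>mat_ring L n\<^esub> B"
proof -
  let ?M = "mat_ring L n"
  interpret MR: ring ?M by (rule LR.mat_ring_ring)
  have z1: "\<zero>\<^bsub>?M\<^esub> \<in> mdeg n 1" by (auto simp: mdeg_def power_zero) (auto simp: LR.mat_ring_simps power_zero)
  \<comment> \<open>Instantiated at the zero connection matrix in order to have the degree rules and
    \<open>complement_curvature\<close> at hand; the matrix \<open>B\<close> is built from
    them.\<close>
  interpret cs: chern_simons ?M L "mdeg n" md dR "mtr n" "\<zero>\<^bsub>?M\<^esub>" by (rule chern_simons_mat[OF z1])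
  \<comment> \<open>The column f and the row g as square matrices supported in column 0 and row 0,
    with \<open>U\<close> the identity of size one. Index 0 lies in the block because n > 0.\<close>
  define F where "F = (\<lambda>i j::nat. if j = 0 \<and> i < n then f i \<odot>\<^bsub>L\<^esub> \<one>\<^bsub>L\<^esub> else \<zero>\<^bsub>L\<^esub>)"
  define G where "G = (\<lambda>i::nat. \<lambda>j. if i = 0 \<and> j < n then g j \<odot>\<^bsub>L\<^esub> \<one>\<^bsub>L\<^esub> else \<zero>\<^bsub>L\<^esub>)"
  define U where "U = (\<lambda>(i::nat) (j::nat). if i = 0 \<and> j = 0 then \<one>\<^bsub>L\<^esub> else \<zero>\<^bsub>L\<^esub>)"
  define t where "t = (\<lambda>l j. if l < n \<and> j < n then \<iota> (\<theta> l j) else \<zero>\<^bsub>L\<^esub>)"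
  define P where "P = (\<lambda>l j. if l < n \<and> j < n then \<phi> l (e j) \<odot>\<^bsub>L\<^esub> \<one>\<^bsub>L\<^esub> else \<zero>\<^bsub>L\<^esub>)"
  have pe: "\<phi> l (e j) \<in> carrier R" if "l < n" "j < n" for l j using that by (intro phi_closed e_closed)
  have one_pow: "a \<odot>\<^bsub>L\<^esub> \<one>\<^bsub>L\<^esub> \<in> \<Lambda> 0" if "a \<in> carrier R" for a using that power_one by (rule power_smult)
  have F: "F \<in> mdeg n 0" and G: "G \<in> mdeg n 0"
    using n f g one_pow by (auto simp: mdeg_def mat_ring_def F_def G_def power_zero)
  have U: "U \<in> mdeg n 0" using n by (auto simp: mdeg_def mat_ring_def U_def power_zero power_one)
  have t: "t \<in> mdeg n 1"
    using iota_power[OF theta_closed] iota_closed[OF theta_closed]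
    by (auto simp: mdeg_def mat_ring_def t_def power_zero)
  have Pc: "P \<in> carrier ?M" using pe by (auto simp: mat_ring_def P_def)
  note val = LR.mat_val[OF mdegD(1)[OF F]] LR.mat_val[OF mdegD(1)[OF G]] LR.mat_val[OF mdegD(1)[OF U]]
     LR.mat_val[OF mdegD(1)[OF t]] LR.mat_val[OF Pc]
  have one_one: "(a \<odot>\<^bsub>L\<^esub> \<one>\<^bsub>L\<^esub>) \<otimes>\<^bsub>L\<^esub> X = a \<odot>\<^bsub>L\<^esub> X" "X \<otimes>\<^bsub>L\<^esub> (a \<odot>\<^bsub>L\<^esub> \<one>\<^bsub>L\<^esub>) = a \<odot>\<^bsub>L\<^esub> X" if "a \<in> carrier R" "X \<in> carrier L" for a X
    using that by (simp_all add: smult_mult_left smult_mult_right)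
  have delta0: "(\<Oplus>\<^bsub>L\<^esub> k\<in>{..<n}. h k) = h 0" if "\<And>k. h k \<in> carrier L" "\<And>k. k \<noteq> 0 \<Longrightarrow> h k = \<zero>\<^bsub>L\<^esub>" for h
  proof -
    have "(\<Oplus>\<^bsub>L\<^esub> k\<in>{..<n}. h k) = (\<Oplus>\<^bsub>L\<^esub> k\<in>{..<n}. if k = 0 then h k else \<zero>\<^bsub>L\<^esub>)"
      using that by (intro L.M.finsum_cong') auto
    thus ?thesis using LR.finsum_delta[of 0 n h] n that(1) by simp
  qed
  have GF: "G \<otimes>\<^bsub>?M\<^esub> F = U"
  proof (intro ext)
    fix i j
    show "(G \<otimes>\<^bsub>?M\<^esub> F) i j = U i j"
    proof (cases "i = 0 \<and> j = 0")
      case True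
      have "(G \<otimes>\<^bsub>?M\<^esub> F) i j = (\<Oplus>\<^bsub>L\<^esub> k\<in>{..<n}. (f k \<otimes> g k) \<odot>\<^bsub>L\<^esub> \<one>\<^bsub>L\<^esub>)"
        unfolding LR.mat_ring_simps using True f g
        by (intro L.M.finsum_cong') (auto simp: F_def G_def one_one L.smult_assoc1[symmetric] m_comm)
      also have "\<dots> = \<one>\<^bsub>L\<^esub>" using f g smult_finsum_one[of "\<lambda>k. f k \<otimes> g k" "{..<n}"] fg by (simp add: Pi_def)
      finally show ?thesis using True by (simp add: U_def)
    next
      case False
      have "G i k \<otimes>\<^bsub>L\<^esub> F k j = \<zero>\<^bsub>L\<^esub>" for k using False f g by (auto simp: F_def G_def)
      thus ?thesis using False by (auto simp: LR.mat_ring_simps U_def)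
    qed
  qed
  have UG: "U \<otimes>\<^bsub>?M\<^esub> G = G"
  proof (intro ext)
    fix i j
    have "(U \<otimes>\<^bsub>?M\<^esub> G) i j = U i 0 \<otimes>\<^bsub>L\<^esub> G 0 j"
      unfolding LR.mat_ring_simps using val by (intro delta0) (auto simp: U_def)
    also have "\<dots> = G i j"
    proof (cases "i = 0")
      case True
      thus ?thesis using val(2)[of 0 j] by (simp add: U_def)
    next
      case False
      hence "G i j = \<zero>\<^bsub>L\<^esub>" by (simp add: G_def)
      thus ?thesis using False val(2)[of 0 j] by (simp add: U_def)
    qed
    finally show "(U \<otimes>\<^bsub>?M\<^esub> G) i j = G i j" .
  qed
  have FU: "F \<otimes>\<^bsub>?M\<^esub> U = F"
  proof (intro ext)
    fix i j
    have "(F \<otimes>\<^bsub>?M\<^esub> U) i j = F i 0 \<otimes>\<^bsub>L\<^esub> U 0 j"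
      unfolding LR.mat_ring_simps using val by (intro delta0) (auto simp: U_def)
    also have "\<dots> = F i j"
    proof (cases "j = 0")
      case True
      thus ?thesis using val(1)[of i 0] by (simp add: U_def)
    next
      case False
      hence "F i j = \<zero>\<^bsub>L\<^esub>" by (simp add: F_def)
      thus ?thesis using False val(1)[of i 0] by (simp add: U_def)
    qed
    finally show "(F \<otimes>\<^bsub>?M\<^esub> U) i j = F i j" .
  qed
  have DU: "md U = \<zero>\<^bsub>?M\<^esub>"
    unfolding LR.mat_ring_simps md_def U_def by (intro ext) (simp add: dR_one dR_zero)
  have P: "P = \<one>\<^bsub>?M\<^esub> \<ominus>\<^bsub>?M\<^esub> F \<otimes>\<^bsub>?M\<^esub> G"
  proof (intro ext)
    fix l j
    have FG: "(F \<otimes>\<^bsub>?M\<^esub> G) l j = F l 0 \<otimes>\<^bsub>L\<^esub> G 0 j"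
      unfolding LR.mat_ring_simps using val by (intro delta0) (auto simp: F_def)
    have "(\<one>\<^bsub>?M\<^esub> \<ominus>\<^bsub>?M\<^esub> F \<otimes>\<^bsub>?M\<^esub> G) l j = \<one>\<^bsub>?M\<^esub> l j \<oplus>\<^bsub>L\<^esub> \<ominus>\<^bsub>L\<^esub> (F l 0 \<otimes>\<^bsub>L\<^esub> G 0 j)"
      using LR.mat_inv[OF MR.m_closed[OF mdegD(1)[OF F] mdegD(1)[OF G]]]
      unfolding a_minus_def LR.mat_ring_simps(2) FG[symmetric] by simp
    also have "\<dots> = P l j"
    proof (cases "l < n \<and> j < n")
      case True
      hence "P l j = (if l = j then \<one> else \<zero>) \<odot>\<^bsub>L\<^esub> \<one>\<^bsub>L\<^esub> \<oplus>\<^bsub>L\<^esub> \<ominus>\<^bsub>L\<^esub> ((f l \<otimes> g j) \<odot>\<^bsub>L\<^esub> \<one>\<^bsub>L\<^esub>)"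
        using f g by (simp add: P_def \<phi>e a_minus_def L.smult_l_distr L.smult_l_minus)
      thus ?thesis using True f g by (simp add: LR.mat_ring_simps(4) F_def G_def one_one(1) L.smult_assoc1)
    next
      case False
      thus ?thesis by (auto simp: LR.mat_ring_simps(4) F_def G_def P_def f g)
    qed
    finally show "P l j = (\<one>\<^bsub>?M\<^esub> \<ominus>\<^bsub>?M\<^esub> F \<otimes>\<^bsub>?M\<^esub> G) l j" ..
  qed
  have PX: "(P \<otimes>\<^bsub>?M\<^esub> X) l j = (\<Oplus>\<^bsub>L\<^esub> k\<in>{..<n}. \<phi> l (e k) \<odot>\<^bsub>L\<^esub> X k j)" if "X \<in> carrier ?M" "l < n" for X l j
    unfolding LR.mat_ring_simps using that LR.mat_val[OF that(1)] pe
    by (intro L.M.finsum_cong') (auto simp: P_def one_one)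
  have outside: "X l j = \<zero>\<^bsub>L\<^esub>" if "X \<in> carrier ?M" "\<not> (l < n \<and> j < n)" for X l j
    using that by (auto simp: mat_ring_def not_less)
  have Pt: "P \<otimes>\<^bsub>?M\<^esub> t = t"
  proof (intro ext)
    fix l j
    show "(P \<otimes>\<^bsub>?M\<^esub> t) l j = t l j"
    proof (cases "l < n \<and> j < n")
      case True
      have "(P \<otimes>\<^bsub>?M\<^esub> t) l j = (\<Oplus>\<^bsub>L\<^esub> k\<in>{..<n}. \<iota> (\<phi> l (e k) \<odot>\<^bsub>\<Omega>\<^esub> \<theta> k j))"
        using True PX[OF mdegD(1)[OF t]] pe theta_closed
        by (simp, intro L.M.finsum_cong') (auto simp: t_def iota_smult)
      also have "\<dots> = \<iota> (\<Oplus>\<^bsub>\<Omega>\<^esub> k\<in>{..<n}. \<phi> l (e k) \<odot>\<^bsub>\<Omega>\<^esub> \<theta> k j)"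
        using True pe theta_closed by (intro iota_finsum[symmetric]) auto
      finally show ?thesis using True by (simp add: theta_phi t_def)
    next
      case False
      thus ?thesis using outside[OF MR.m_closed[OF Pc mdegD(1)[OF t]]] outside[OF mdegD(1)[OF t]] by simp
    qed
  qed
  have tP: "t = t \<otimes>\<^bsub>?M\<^esub> P \<oplus>\<^bsub>?M\<^esub> P \<otimes>\<^bsub>?M\<^esub> md P"
  proof (intro ext)
    fix l j
    have tPc: "t \<otimes>\<^bsub>?M\<^esub> P \<in> carrier ?M" "P \<otimes>\<^bsub>?M\<^esub> md P \<in> carrier ?M"
      using mdegD(1)[OF t] Pc md_carrier[OF Pc] by simp_all
    show "t l j = (t \<otimes>\<^bsub>?M\<^esub> P \<oplus>\<^bsub>?M\<^esub> P \<otimes>\<^bsub>?M\<^esub> md P) l j"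
    proof (cases "l < n \<and> j < n")
      case True
      note cl = pe theta_closed dK_closed[OF pe] iota_closed[OF theta_closed] iota_closed[OF dK_closed[OF pe]]
      have "t l j = (\<Oplus>\<^bsub>L\<^esub> k\<in>{..<n}. \<iota> (\<phi> k (e j) \<odot>\<^bsub>\<Omega>\<^esub> \<theta> l k \<oplus>\<^bsub>\<Omega>\<^esub> \<phi> l (e k) \<odot>\<^bsub>\<Omega>\<^esub> dK (\<phi> k (e j))))"
        using True theta_right[of l j] cl
        by (simp add: t_def, subst iota_finsum[symmetric]) auto
      also have "\<dots> = (\<Oplus>\<^bsub>L\<^esub> k\<in>{..<n}. t l k \<otimes>\<^bsub>L\<^esub> P k j \<oplus>\<^bsub>L\<^esub> P l k \<otimes>\<^bsub>L\<^esub> md P k j)"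
        using True cl by (intro L.M.finsum_cong')
          (auto simp: t_def P_def md_def iota_add iota_smult one_one dR_smult_one)
      also have "\<dots> = (\<Oplus>\<^bsub>L\<^esub> k\<in>{..<n}. t l k \<otimes>\<^bsub>L\<^esub> P k j) \<oplus>\<^bsub>L\<^esub> (\<Oplus>\<^bsub>L\<^esub> k\<in>{..<n}. P l k \<otimes>\<^bsub>L\<^esub> md P k j)"
        using val LR.mat_val[OF md_carrier[OF Pc]] by (intro L.M.finsum_addf) auto
      finally show ?thesis by (simp add: LR.mat_ring_simps)
    next
      case False
      thus ?thesis using outside[OF MR.a_closed[OF tPc]] outside[OF mdegD(1)[OF t]] by simp
    qed
  qed
  have DDG: "md (md G) = \<zero>\<^bsub>?M\<^esub>"
    unfolding LR.mat_ring_simps md_def using val(2) by (intro ext dR_dR) blast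
  define B where "B = t \<oplus>\<^bsub>?M\<^esub> F \<otimes>\<^bsub>?M\<^esub> md G"
  have "F \<otimes>\<^bsub>?M\<^esub> md G \<in> mdeg n (0 + Suc 0)" by (rule cs.deg_mult[OF F cs.deg_D[OF G]])
  hence B: "B \<in> mdeg n 1" unfolding B_def using cs.deg_add[OF t] by simp
  have "md B \<oplus>\<^bsub>?M\<^esub> B \<otimes>\<^bsub>?M\<^esub> B = P \<otimes>\<^bsub>?M\<^esub> (t \<otimes>\<^bsub>?M\<^esub> t \<oplus>\<^bsub>?M\<^esub> md t)"
    by (rule cs.complement_curvature[OF F G U t GF UG FU DU P Pt tP DDG B_def])
  also have "\<dots> = ematrix curv"
  proof (intro ext)
    fix l j
    have tt: "t \<otimes>\<^bsub>?M\<^esub> t \<oplus>\<^bsub>?M\<^esub> md t \<in> carrier ?M" using mdegD(1)[OF t] md_carrier by simp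
    show "(P \<otimes>\<^bsub>?M\<^esub> (t \<otimes>\<^bsub>?M\<^esub> t \<oplus>\<^bsub>?M\<^esub> md t)) l j = ematrix curv l j"
    proof (cases "l < n \<and> j < n")
      case True
      have "(t \<otimes>\<^bsub>?M\<^esub> t \<oplus>\<^bsub>?M\<^esub> md t) m j = W m j" if "m < n" for m
      proof -
        have "(\<Oplus>\<^bsub>L\<^esub> k\<in>{..<n}. t m k \<otimes>\<^bsub>L\<^esub> t k j) = (\<Oplus>\<^bsub>L\<^esub> k\<in>{..<n}. \<iota> (\<theta> m k) \<otimes>\<^bsub>L\<^esub> \<iota> (\<theta> k j))"
          using that True iota_closed[OF theta_closed] by (intro L.M.finsum_cong') (auto simp: t_def)
        thus ?thesis using that True by (simp add: LR.mat_ring_simps W_def md_def) (simp add: t_def)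
      qed
      hence "(\<Oplus>\<^bsub>L\<^esub> k\<in>{..<n}. \<phi> l (e k) \<odot>\<^bsub>L\<^esub> (t \<otimes>\<^bsub>?M\<^esub> t \<oplus>\<^bsub>?M\<^esub> md t) k j) = (\<Oplus>\<^bsub>L\<^esub> k\<in>{..<n}. \<phi> l (e k) \<odot>\<^bsub>L\<^esub> W k j)"
        using True pe W_closed by (intro L.M.finsum_cong') auto
      thus ?thesis using True PX[OF tt, of l j] by (simp add: ematrix_def entry_curv)
    next
      case False
      thus ?thesis using outside[OF MR.m_closed[OF Pc tt]] outside[OF ematrix_carrier[OF curv_closed]] by simp
    qed
  qed
  finally show ?thesis using B by (intro bexI[of _ B]) simp_all
qed

end

subsection \<open>Vanishing of the Chern character\<close>

text \<open>The matrix of the \<open>\<phi> l (e j)\<close> is the projection 1 - f g, a column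
  times a row with g f = 1: E is the complement of a free summand of rank one in A^n.\<close>

locale stably_trivial = kalgebra R s + dual_based R E n e \<phi>
  for R :: "('a, 'r) ring_scheme" (structure) and s :: "'k::field_char_0 \<Rightarrow> 'a"
    and E :: "('a, 'e, 't) module_scheme" and n e \<phi> +
  fixes f g :: "nat \<Rightarrow> 'a"
  assumes n_pos: "n > 0"
    and f_closed: "\<And>l. l < n \<Longrightarrow> f l \<in> carrier R" and g_closed: "\<And>l. l < n \<Longrightarrow> g l \<in> carrier R"
    and fg: "(\<Oplus> l\<in>{..<n}. f l \<otimes> g l) = \<one>"
    and \<phi>e: "\<And>l j. l < n \<Longrightarrow> j < n \<Longrightarrow> \<phi> l (e j) = (if l = j then \<one> else \<zero>) \<ominus> f l \<otimes> g j"
begin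

lemma connection_exists: "\<exists>D. connection R s E D"
proof -
  interpret TE: two_modules R E "kahler R s" by unfold_locales
  \<comment> \<open>The Grassmann connection, d on A^n compressed to E. Its existence is what gives
    meaning to the choice in \<open>chern_character\<close>.\<close>
  define D where "D x = (\<Oplus>\<^bsub>TE.T\<^esub> j\<in>{..<n}. TE.te (e j) (dK (\<phi> j x)))" for x
  have c: "TE.te (e j) (dK (\<phi> j x)) \<in> carrier TE.T" if "j < n" "x \<in> carrier E" for j x
    using that by (intro TE.tensor_elem_closed e_closed dK_closed phi_closed)
  have sm: "D (a \<odot>\<^bsub>E\<^esub> x) = a \<odot>\<^bsub>TE.T\<^esub> D x \<oplus>\<^bsub>TE.T\<^esub> TE.te x (dK a)" if a: "a \<in> carrier R" and x: "x \<in> carrier E" for a x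
  proof -
    have "D (a \<odot>\<^bsub>E\<^esub> x) = (\<Oplus>\<^bsub>TE.T\<^esub> j\<in>{..<n}. a \<odot>\<^bsub>TE.T\<^esub> TE.te (e j) (dK (\<phi> j x)) \<oplus>\<^bsub>TE.T\<^esub> TE.te (\<phi> j x \<odot>\<^bsub>E\<^esub> e j) (dK a))"
      unfolding D_def using a x c by (intro TE.T.M.finsum_cong')
        (auto simp: phi_smult phi_closed e_closed dK_mult TE.tensor_elem_add_right TE.tensor_elem_smult_right TE.tensor_elem_smult_left)
    also have "\<dots> = (\<Oplus>\<^bsub>TE.T\<^esub> j\<in>{..<n}. a \<odot>\<^bsub>TE.T\<^esub> TE.te (e j) (dK (\<phi> j x))) \<oplus>\<^bsub>TE.T\<^esub>
        (\<Oplus>\<^bsub>TE.T\<^esub> j\<in>{..<n}. TE.te (\<phi> j x \<odot>\<^bsub>E\<^esub> e j) (dK a))"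
      using a x c by (intro TE.T.M.finsum_addf) (auto simp: phi_closed e_closed)
    also have "(\<Oplus>\<^bsub>TE.T\<^esub> j\<in>{..<n}. TE.te (\<phi> j x \<odot>\<^bsub>E\<^esub> e j) (dK a)) = TE.te x (dK a)"
      using a x by (intro linear_expand[symmetric] TE.T.M.abelian_group_axioms TE.tensor_elem_addmap) auto
    also have "(\<Oplus>\<^bsub>TE.T\<^esub> j\<in>{..<n}. a \<odot>\<^bsub>TE.T\<^esub> TE.te (e j) (dK (\<phi> j x))) = a \<odot>\<^bsub>TE.T\<^esub> D x"
      unfolding D_def using a x c by (intro TE.T.finsum_smult_ldistr[symmetric]) auto
    finally show ?thesis .
  qed
  have Dc: "D x \<in> carrier TE.T" if "x \<in> carrier E" for x
    unfolding D_def using that c by (intro TE.T.M.finsum_closed) auto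
  have Da: "D (x \<oplus>\<^bsub>E\<^esub> y) = D x \<oplus>\<^bsub>TE.T\<^esub> D y" if xy: "x \<in> carrier E" "y \<in> carrier E" for x y
  proof -
    have "D (x \<oplus>\<^bsub>E\<^esub> y) = (\<Oplus>\<^bsub>TE.T\<^esub> j\<in>{..<n}. TE.te (e j) (dK (\<phi> j x)) \<oplus>\<^bsub>TE.T\<^esub> TE.te (e j) (dK (\<phi> j y)))"
      unfolding D_def using xy c by (intro TE.T.M.finsum_cong')
        (auto simp: phi_add phi_closed e_closed dK_add TE.tensor_elem_add_right)
    thus ?thesis unfolding D_def using xy c by (simp add: TE.T.M.finsum_addf Pi_def)
  qed
  have "connection R s E D"
    unfolding connection_def Let_def
    using Dc Da sm by (auto simp: dK_scalar TE.tensor_elem_zero)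
  thus ?thesis by blast
qed

lemma exact_forms_eq: "i \<ge> 1 \<Longrightarrow> exact_forms R s (2 * i) = dR ` \<Lambda> (2 * i - 1)"
  by (cases i) (simp_all add: exact_forms_def forms_deg_def)

theorem chern_character_zero:
  assumes i: "i \<ge> 1"
  shows "chern_character R s E i = \<zero>\<^bsub>deRham_cohomology R s (2 * i)\<^esub>"
proof -
  define D where "D = (SOME D. connection R s E D)"
  have "connection R s E D" unfolding D_def by (rule someI_ex[OF connection_exists])
  then interpret C: connection_module R s E n e \<phi> D by unfold_locales
  obtain B where B: "B \<in> mdeg n 1" "C.ematrix C.curv = md B \<oplus>\<^bsub>mat_ring L n\<^esub> B \<otimes>\<^bsub>mat_ring L n\<^esub> B"
    using C.curvature_matrix[OF n_pos f_closed g_closed fg \<phi>e] by blast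
  obtain \<omega> where w: "\<omega> \<in> \<Lambda> (2 * i - 1)" "mtr n (C.ematrix C.curv [^]\<^bsub>mat_ring L n\<^esub> i) = dR \<omega>"
    using tr_curvature_pow_exact[OF B(1) i] unfolding B(2) by blast
  have "chern_form R s E D i = dR (s (1 / fact i) \<odot>\<^bsub>L\<^esub> \<omega>)"
    using C.chern_form_eq[OF i] w power_carrier[OF w(1)] by (simp add: dR_scalar_smult)
  moreover have "s (1 / fact i) \<odot>\<^bsub>L\<^esub> \<omega> \<in> \<Lambda> (2 * i - 1)" using w by (intro power_smult) auto
  ultimately have mem: "chern_form R s E D i \<in> exact_forms R s (2 * i)" using exact_forms_eq[OF i] by blast
  have sub: "exact_forms R s (2 * i) \<subseteq> carrier L"
    unfolding exact_forms_eq[OF i] using power_carrier by auto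
  have "subgroup (exact_forms R s (2 * i)) (add_monoid L)"
  proof (rule L.M.add.subgroupI)
    show "exact_forms R s (2 * i) \<noteq> {}" using mem by blast
    fix x y assume "x \<in> exact_forms R s (2 * i)"
    then obtain u where u: "u \<in> \<Lambda> (2 * i - 1)" "x = dR u" unfolding exact_forms_eq[OF i] by blast
    have "\<ominus>\<^bsub>L\<^esub> x = dR (\<ominus>\<^bsub>L\<^esub> u)"
      using u power_carrier[OF u(1)] by (simp add: addmap_inv[OF L.M.abelian_group_axioms L.M.abelian_group_axioms dR_addmap])
    thus "\<ominus>\<^bsub>L\<^esub> x \<in> exact_forms R s (2 * i)" unfolding exact_forms_eq[OF i] using power_inv[OF u(1)] by blast
    assume "y \<in> exact_forms R s (2 * i)"
    then obtain v where v: "v \<in> \<Lambda> (2 * i - 1)" "y = dR v" unfolding exact_forms_eq[OF i] by blast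
    have "x \<oplus>\<^bsub>L\<^esub> y = dR (u \<oplus>\<^bsub>L\<^esub> v)" using u v power_carrier by (simp add: dR_add)
    thus "x \<oplus>\<^bsub>L\<^esub> y \<in> exact_forms R s (2 * i)" unfolding exact_forms_eq[OF i] using power_add[OF u(1) v(1)] by blast
  qed (rule sub)
  \<comment> \<open>The class is a coset of the exact forms, and the zero of the cohomology is the
    set of exact forms itself.\<close>
  hence "exact_forms R s (2 * i) +>\<^bsub>L\<^esub> chern_form R s E D i = exact_forms R s (2 * i)"
    using mem sub by (intro L.M.a_coset_join2) auto
  thus ?thesis
    by (simp add: chern_character_def D_def[symmetric] forms_def deRham_cohomology_def Let_def quot_module_def)
qed

end

section \<open>Polynomials\<close>

abbreviation "plookup \<equiv> Poly_Mapping.lookup"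
abbreviation "pkeys \<equiv> Poly_Mapping.keys"

definition var :: "nat \<Rightarrow> 'k::field mpoly" where
  "var j = Poly_Mapping.single (Poly_Mapping.single j 1) 1"

text \<open>Indexed by a set of variables rather than a number, because the dimension argument
  adjoins single variables to arbitrary subsets.\<close>

definition polys_in :: "nat set \<Rightarrow> 'k::field mpoly set" where
  "polys_in I = {p. \<forall>m\<in>pkeys p. pkeys m \<subseteq> I}"

lemma pkeys_add_nat: "pkeys (m + m' :: nat \<Rightarrow>\<^sub>0 nat) = pkeys m \<union> pkeys m'"
  by (auto simp: in_keys_iff lookup_add)

lemma polys_in_zero [simp]: "0 \<in> polys_in I"
  by (simp add: polys_in_def)

lemma polys_in_add: "p \<in> polys_in I \<Longrightarrow> q \<in> polys_in I \<Longrightarrow> p + q \<in> polys_in I"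
  unfolding polys_in_def using Poly_Mapping.keys_add[of p q] by blast

lemma polys_in_uminus: "p \<in> polys_in I \<Longrightarrow> - p \<in> polys_in I"
  by (simp add: polys_in_def)

lemma polys_in_diff: "p \<in> polys_in I \<Longrightarrow> q \<in> polys_in I \<Longrightarrow> p - q \<in> polys_in I"
  using polys_in_add[of p I "- q"] polys_in_uminus[of q I] by simp

lemma polys_in_mult: "p \<in> polys_in I \<Longrightarrow> q \<in> polys_in I \<Longrightarrow> p * q \<in> polys_in I"
  unfolding polys_in_def using keys_mult[of p q] by (force simp: pkeys_add_nat)

lemma polys_in_single: "pkeys m \<subseteq> I \<Longrightarrow> Poly_Mapping.single m c \<in> polys_in I"
  by (simp add: polys_in_def)

lemma polys_in_const [simp]: "mpoly_const c \<in> polys_in I"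
  by (simp add: mpoly_const_def polys_in_single)

lemma polys_in_one [simp]: "1 \<in> polys_in I"
  using polys_in_single[of 0 I 1] by simp

lemma polys_in_var: "j \<in> I \<Longrightarrow> var j \<in> polys_in I"
  by (simp add: var_def polys_in_single)

lemma polys_in_sum: "(\<And>i. i \<in> A \<Longrightarrow> f i \<in> polys_in I) \<Longrightarrow> sum f A \<in> polys_in I"
  by (induction A rule: infinite_finite_induct) (auto intro: polys_in_add)

lemma polys_in_power: "p \<in> polys_in I \<Longrightarrow> p ^ k \<in> polys_in I"
  by (induction k) (auto intro: polys_in_mult)

lemma polys_in_mono: "I \<subseteq> J \<Longrightarrow> polys_in I \<subseteq> polys_in J"
  by (auto simp: polys_in_def)

lemma polys_in_empty:
  assumes "p \<in> polys_in {}"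
  shows "p = mpoly_const (plookup p 0)"
proof (rule poly_mapping_eqI)
  fix m show "plookup p m = plookup (mpoly_const (plookup p 0)) m"
    using assms by (auto simp: mpoly_const_def lookup_single when_def polys_in_def in_keys_iff)
qed

lemma poly_mapping_sum:
  fixes p :: "'a \<Rightarrow>\<^sub>0 'b::comm_monoid_add"
  shows "(\<Sum>m\<in>pkeys p. Poly_Mapping.single m (plookup p m)) = p"
proof (rule poly_mapping_eqI)
  fix k
  have "plookup (\<Sum>m\<in>pkeys p. Poly_Mapping.single m (plookup p m)) k = (\<Sum>m\<in>pkeys p. if m = k then plookup p m else 0)"
    by (simp add: lookup_sum lookup_single when_def)
  also have "\<dots> = plookup p k" by (simp add: in_keys_iff)
  finally show "plookup (\<Sum>m\<in>pkeys p. Poly_Mapping.single m (plookup p m)) k = plookup p k" .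
qed

lemma poly_mapping_induct:
  fixes p :: "'a \<Rightarrow>\<^sub>0 'b::comm_monoid_add"
  assumes "\<And>m c. m \<in> pkeys p \<Longrightarrow> P (Poly_Mapping.single m c)" "\<And>q r. P q \<Longrightarrow> P r \<Longrightarrow> P (q + r)" "P 0"
  shows "P p"
proof -
  have "P (\<Sum>m\<in>A. Poly_Mapping.single m (plookup p m))" if "finite A" "A \<subseteq> pkeys p" for A
    using that by (induction A) (auto intro: assms)
  from this[of "pkeys p"] show ?thesis by (simp add: poly_mapping_sum)
qed

lemma add_single_diff: "plookup m j \<noteq> 0 \<Longrightarrow> (m - Poly_Mapping.single j 1) + Poly_Mapping.single j (1::nat) = m"
  by (rule poly_mapping_eqI) (auto simp: lookup_add lookup_minus lookup_single when_def)

text \<open>Monomials are built by multiplying with one variable at a time, by induction on the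
  total degree.\<close>

lemma polys_in_induct [consumes 1, case_names const var add]:
  assumes p: "p \<in> polys_in I"
    and const: "\<And>c. P (mpoly_const c)"
    and var: "\<And>j q. j \<in> I \<Longrightarrow> q \<in> polys_in I \<Longrightarrow> P q \<Longrightarrow> P (var j * q)"
    and add: "\<And>q r. q \<in> polys_in I \<Longrightarrow> r \<in> polys_in I \<Longrightarrow> P q \<Longrightarrow> P r \<Longrightarrow> P (q + r)"
  shows "P p"
proof -
  have mono: "P (Poly_Mapping.single m c)" if "pkeys m \<subseteq> I" for m c
    using that
  proof (induction "\<Sum>j\<in>pkeys m. plookup m j" arbitrary: m rule: less_induct)
    case less
    show ?case
    proof (cases "m = 0")
      case True
      thus ?thesis using const by (simp add: mpoly_const_def)
    next
      case False
      then obtain j where j: "j \<in> pkeys m" by (metis all_not_in_conv keys_eq_empty)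
      define m' where "m' = m - Poly_Mapping.single j 1"
      have m: "m' + Poly_Mapping.single j 1 = m" unfolding m'_def by (rule add_single_diff) (use j in \<open>simp add: in_keys_iff\<close>)
      have k: "pkeys m' \<subseteq> pkeys m" using pkeys_add_nat[of m' "Poly_Mapping.single j 1"] m by auto
      have "(\<Sum>i\<in>pkeys m'. plookup m' i) = (\<Sum>i\<in>pkeys m. plookup m' i)"
        using k by (intro sum.mono_neutral_left) (auto simp: in_keys_iff)
      also have "\<dots> < (\<Sum>i\<in>pkeys m. plookup m i)"
      proof (rule sum_strict_mono_ex1)
        show "\<forall>x\<in>pkeys m. plookup m' x \<le> plookup m x" by (simp add: m'_def lookup_minus)
        show "\<exists>a\<in>pkeys m. plookup m' a < plookup m a"
          using j by (intro bexI[of _ j]) (auto simp: m'_def lookup_minus in_keys_iff)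
      qed simp
      finally have "P (Poly_Mapping.single m' c)" using less k by blast
      moreover have "var j * Poly_Mapping.single m' c = Poly_Mapping.single m c"
        using m by (simp add: var_def mult_single add.commute)
      ultimately show ?thesis
        using var[of j "Poly_Mapping.single m' c"] j less.prems k polys_in_single[of m' I c] by auto
    qed
  qed
  have "p \<in> polys_in I \<longrightarrow> p \<in> polys_in I \<and> P p" (is "_ \<longrightarrow> ?Q p")
  proof
    assume "p \<in> polys_in I"
    show "?Q p"
    proof (rule poly_mapping_induct[of p ?Q])
      show "?Q (Poly_Mapping.single m c)" if "m \<in> pkeys p" for m c
        using that p mono[of m c] polys_in_single[of m I c] by (auto simp: polys_in_def)
      show "?Q (q + r)" if "?Q q" "?Q r" for q r using that add polys_in_add by blast
      show "?Q 0" using const[of 0] by (simp add: mpoly_const_def)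
    qed
  qed
  thus ?thesis using p by blast
qed

subsection \<open>Partial derivatives\<close>

text \<open>Given by its coefficients: the monomial m of the derivative comes from m + e_j with
  factor m_j + 1. The shift is injective, which keeps the support finite.\<close>

definition pd :: "nat \<Rightarrow> 'k::field_char_0 mpoly \<Rightarrow> 'k mpoly" where
  "pd j p = Abs_poly_mapping (\<lambda>m. plookup p (m + Poly_Mapping.single j 1) * of_nat (plookup m j + 1))"

lemma lookup_pd: "plookup (pd j p) m = plookup p (m + Poly_Mapping.single j 1) * of_nat (plookup m j + 1)"
proof -
  have "{m. plookup p (m + Poly_Mapping.single j 1) * of_nat (plookup m j + 1) \<noteq> (0::'a)} \<subseteq>
      (\<lambda>m. m + Poly_Mapping.single j 1) -` pkeys p"
    by (auto simp: in_keys_iff)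
  moreover have "finite ((\<lambda>m. m + Poly_Mapping.single j (1::nat)) -` pkeys p)"
    by (rule finite_vimageI) (auto simp: inj_on_def)
  ultimately have "finite {m. plookup p (m + Poly_Mapping.single j 1) * of_nat (plookup m j + 1) \<noteq> (0::'a)}"
    by (rule finite_subset)
  thus ?thesis unfolding pd_def by simp
qed

lemma pd_add: "pd j (p + q) = pd j p + pd j q"
  by (rule poly_mapping_eqI) (simp only: lookup_pd lookup_add distrib_right)

lemma pd_zero [simp]: "pd j 0 = 0"
  by (rule poly_mapping_eqI) (simp add: lookup_pd)

lemma pd_sum: "pd j (sum f A) = (\<Sum>i\<in>A. pd j (f i))"
  by (induction A rule: infinite_finite_induct) (auto simp: pd_add)

text \<open>If the variable does not occur, the difference of exponents is truncated, but then its
  coefficient is zero.\<close>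

lemma pd_single: "pd j (Poly_Mapping.single m c) = Poly_Mapping.single (m - Poly_Mapping.single j 1) (c * of_nat (plookup m j))"
proof (rule poly_mapping_eqI)
  fix m0
  show "plookup (pd j (Poly_Mapping.single m c)) m0 = plookup (Poly_Mapping.single (m - Poly_Mapping.single j 1) (c * of_nat (plookup m j))) m0"
  proof (cases "m = m0 + Poly_Mapping.single j 1")
    case True
    thus ?thesis by (simp add: lookup_pd lookup_single lookup_add)
  next
    case False
    hence "m - Poly_Mapping.single j 1 \<noteq> m0 \<or> plookup m j = 0" using add_single_diff by fastforce
    thus ?thesis using False by (auto simp: lookup_pd lookup_single when_def)
  qed
qed

lemma pd_const [simp]: "pd j (mpoly_const c) = 0"
  by (simp add: mpoly_const_def pd_single)

lemma pd_var: "pd j (var i) = (if i = j then 1 else 0)"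
  by (auto simp: var_def pd_single lookup_single when_def)

text \<open>Both sides are additive in p and in q, which leaves monomials; there the truncated
  exponents agree wherever the coefficient is nonzero.\<close>

lemma pd_mult: "pd j (p * q) = p * pd j q + q * pd j p"
proof (rule poly_mapping_induct[of p "\<lambda>p. pd j (p * q) = p * pd j q + q * pd j p"])
  fix m c
  show "pd j (Poly_Mapping.single m c * q) = Poly_Mapping.single m c * pd j q + q * pd j (Poly_Mapping.single m c)"
  proof (rule poly_mapping_induct[of q "\<lambda>q. pd j (Poly_Mapping.single m c * q) = Poly_Mapping.single m c * pd j q + q * pd j (Poly_Mapping.single m c)"])
    fix m' c'
    let ?e = "Poly_Mapping.single j (1::nat)"
    have 1: "Poly_Mapping.single (m + (m' - ?e)) (c * (c' * of_nat (plookup m' j))) =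
        Poly_Mapping.single (m + m' - ?e) (c * (c' * of_nat (plookup m' j)))"
    proof (cases "plookup m' j = 0")
      case False
      have "m + (m' - ?e) + ?e - ?e = m + m' - ?e" by (metis add.assoc add_single_diff[OF False])
      thus ?thesis by simp
    qed simp
    have 2: "Poly_Mapping.single (m' + (m - ?e)) (c' * (c * of_nat (plookup m j))) =
        Poly_Mapping.single (m + m' - ?e) (c' * (c * of_nat (plookup m j)))"
    proof (cases "plookup m j = 0")
      case False
      have "m' + (m - ?e) + ?e - ?e = m + m' - ?e" by (metis add.assoc add.commute add_single_diff[OF False])
      thus ?thesis by simp
    qed simp
    show "pd j (Poly_Mapping.single m c * Poly_Mapping.single m' c') =
        Poly_Mapping.single m c * pd j (Poly_Mapping.single m' c') + Poly_Mapping.single m' c' * pd j (Poly_Mapping.single m c)"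
      unfolding mult_single pd_single 1 2 by (simp add: single_add[symmetric] lookup_add algebra_simps)
  qed (simp_all add: algebra_simps pd_add)
qed (simp_all add: algebra_simps pd_add)

lemma pkeys_pd: "m \<in> pkeys (pd j p) \<Longrightarrow> m + Poly_Mapping.single j 1 \<in> pkeys p"
  by (auto simp: in_keys_iff lookup_pd)

lemma pd_polys_in: "p \<in> polys_in I \<Longrightarrow> pd j p \<in> polys_in I"
  using pkeys_pd[of _ j p] by (fastforce simp: polys_in_def pkeys_add_nat)

lemma pd_eq_zero: "p \<in> polys_in I \<Longrightarrow> j \<notin> I \<Longrightarrow> pd j p = 0"
proof (rule ccontr)
  assume a: "p \<in> polys_in I" "j \<notin> I" "pd j p \<noteq> 0"
  then obtain m where "m \<in> pkeys (pd j p)" by (metis all_not_in_conv keys_eq_empty)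
  from pkeys_pd[OF this] a(1) have "pkeys (m + Poly_Mapping.single j 1) \<subseteq> I" by (auto simp: polys_in_def)
  thus False using a(2) by (simp add: pkeys_add_nat)
qed

text \<open>Characteristic zero: a monomial containing x_j to a power e > 0 leaves e times its
  coefficient in the derivative.\<close>

lemma polys_in_of_pd_zero:
  assumes "p \<in> polys_in (insert j I)" "pd j p = 0"
  shows "p \<in> polys_in I"
proof (rule ccontr)
  assume "p \<notin> polys_in I"
  then obtain m where m: "m \<in> pkeys p" "\<not> pkeys m \<subseteq> I" by (auto simp: polys_in_def)
  moreover have "pkeys m \<subseteq> insert j I" using assms(1) m(1) by (simp add: polys_in_def)
  ultimately have "j \<in> pkeys m" by blast
  hence j: "plookup m j \<noteq> 0" by (simp add: in_keys_iff)
  have "plookup (pd j p) (m - Poly_Mapping.single j 1) = plookup p m * of_nat (plookup m j - 1 + 1)"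
    unfolding lookup_pd add_single_diff[OF j] by (simp add: lookup_minus)
  moreover have "\<dots> \<noteq> 0"
    using m(1) j of_nat_eq_0_iff[of "plookup m j - 1 + 1", where 'a = 'a] by (simp add: in_keys_iff del: of_nat_add)
  ultimately show False using assms(2) by simp
qed

subsection \<open>Linear algebra modulo a prime ideal\<close>

text \<open>The domain C / (P \<inter> C) without forming a quotient. \<open>P\<close> may reach
  beyond \<open>C\<close>, so that a prime of the polynomial ring in all variables can be paired
  with the subring in fewer variables.\<close>

locale prime_in_subring =
  fixes C P :: "'a::comm_ring_1 set"
  assumes C: "1 \<in> C" "\<And>x y. x \<in> C \<Longrightarrow> y \<in> C \<Longrightarrow> x + y \<in> C" "\<And>x. x \<in> C \<Longrightarrow> - x \<in> C" "\<And>x y. x \<in> C \<Longrightarrow> y \<in> C \<Longrightarrow> x * y \<in> C"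
    and P: "0 \<in> P" "1 \<notin> P" "\<And>x y. x \<in> P \<Longrightarrow> y \<in> P \<Longrightarrow> x + y \<in> P" "\<And>x y. x \<in> C \<Longrightarrow> y \<in> P \<Longrightarrow> x * y \<in> P"
    and prime: "\<And>x y. x \<in> C \<Longrightarrow> y \<in> C \<Longrightarrow> x * y \<in> P \<Longrightarrow> x \<in> P \<or> y \<in> P"
begin

lemma C_diff: "x \<in> C \<Longrightarrow> y \<in> C \<Longrightarrow> x - y \<in> C"
  using C(2)[of x "- y"] C(3) by simp

lemma C_zero: "0 \<in> C"
  using C_diff[OF C(1) C(1)] by simp

lemma C_sum: "(\<And>i. i \<in> A \<Longrightarrow> f i \<in> C) \<Longrightarrow> sum f A \<in> C"
  by (induction A rule: infinite_finite_induct) (auto intro: C C_zero)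

lemma P_sum: "(\<And>i. i \<in> A \<Longrightarrow> f i \<in> P) \<Longrightarrow> sum f A \<in> P"
  by (induction A rule: infinite_finite_induct) (auto intro: P)

text \<open>More vectors than coordinates over a domain: elimination without division. A coefficient
  outside \<open>P\<close> is one that is nonzero in the domain.\<close>

lemma linear_relation:
  assumes "finite A" "finite I" "card A < card I" "\<And>i a. i \<in> I \<Longrightarrow> a \<in> A \<Longrightarrow> v i a \<in> C"
  shows "\<exists>d. (\<forall>i\<in>I. d i \<in> C) \<and> (\<exists>i\<in>I. d i \<notin> P) \<and> (\<forall>a\<in>A. (\<Sum>i\<in>I. d i * v i a) \<in> P)"
  using assms
proof (induction A arbitrary: I v)
  case empty
  thus ?case using C(1) P(2) by (intro exI[of _ "\<lambda>_. 1"]) (auto simp: card_gt_0_iff)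
next
  case (insert a A)
  show ?case
  proof (cases "\<forall>i\<in>I. v i a \<in> P")
    case True
    obtain d where "\<forall>i\<in>I. d i \<in> C" "\<exists>i\<in>I. d i \<notin> P" "\<forall>b\<in>A. (\<Sum>i\<in>I. d i * v i b) \<in> P"
      using insert.IH[of I v] insert.prems insert.hyps by auto
    thus ?thesis using True by (intro exI[of _ d]) (auto intro!: P_sum P)
  next
    case False
    then obtain i0 where i0: "i0 \<in> I" "v i0 a \<notin> P" by blast
    let ?I = "I - {i0}"
    \<comment> \<open>Cross-multiplication with the pivot \<open>v i0 a\<close> clears column a
      exactly, not merely modulo \<open>P\<close>.\<close>
    define w where "w i b = v i0 a * v i b - v i a * v i0 b" for i b
    have vC: "v i b \<in> C" if "i \<in> I" "b \<in> insert a A" for i b using insert.prems that by blast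
    have "card A < card ?I" using insert.prems insert.hyps i0 by simp
    moreover have "w i b \<in> C" if "i \<in> ?I" "b \<in> A" for i b
      unfolding w_def using that i0 vC by (intro C_diff C) auto
    ultimately obtain d where d: "\<forall>i\<in>?I. d i \<in> C" "\<exists>i\<in>?I. d i \<notin> P" "\<forall>b\<in>A. (\<Sum>i\<in>?I. d i * w i b) \<in> P"
      using insert.IH[of ?I w] insert.prems by auto
    \<comment> \<open>The old relation is scaled by the pivot and stays nontrivial by primality; the
      coefficient of i0 makes the cross terms recombine to \<open>w\<close>.\<close>
    define D where "D i = (if i = i0 then - (\<Sum>i\<in>?I. d i * v i a) else d i * v i0 a)" for i
    have "D i \<in> C" if "i \<in> I" for i
      unfolding D_def using that d(1) i0 vC by (auto intro!: C C_sum)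
    moreover have "\<exists>i\<in>I. D i \<notin> P"
    proof -
      obtain i where i: "i \<in> ?I" "d i \<notin> P" using d(2) by blast
      hence "d i * v i0 a \<notin> P" using prime[of "d i" "v i0 a"] d(1) i0 vC by auto
      thus ?thesis using i by (intro bexI[of _ i]) (auto simp: D_def)
    qed
    moreover have "(\<Sum>i\<in>I. D i * v i b) \<in> P" if b: "b \<in> insert a A" for b
    proof -
      have "(\<Sum>i\<in>I. D i * v i b) = D i0 * v i0 b + (\<Sum>i\<in>?I. D i * v i b)"
        using i0 insert.prems by (simp add: sum.remove)
      also have "\<dots> = (\<Sum>i\<in>?I. d i * w i b)"
        by (simp add: D_def w_def right_diff_distrib sum_subtractf sum_distrib_left mult_ac)
      finally have eq: "(\<Sum>i\<in>I. D i * v i b) = (\<Sum>i\<in>?I. d i * w i b)" .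
      show ?thesis
      proof (cases "b = a")
        case True
        thus ?thesis unfolding eq by (simp add: w_def P)
      qed (use b d(3) eq in auto)
    qed
    ultimately show ?thesis by blast
  qed
qed

end

section \<open>Chains of primes and the Jacobian criterion\<close>

text \<open>The coefficients are required to vanish beyond the bound, so that expansions of
  different lengths can be added.\<close>

lemma polys_in_expansion:
  assumes "p \<in> polys_in (insert j I)"
  shows "\<exists>e c. (\<forall>l. c l \<in> polys_in I) \<and> (\<forall>l\<ge>e. c l = 0) \<and> p = (\<Sum>l<e. c l * var j ^ l)"
  using assms
proof (induction p rule: polys_in_induct)
  case (const a)
  show ?case
    by (rule exI[of _ 1], rule exI[of _ "\<lambda>l. if l = 0 then mpoly_const a else 0"]) auto
next
  case (var i q)
  then obtain e c where c: "\<forall>l. c l \<in> polys_in I" "\<forall>l\<ge>e. c l = 0" "q = (\<Sum>l<e. c l * var j ^ l)" by blast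
  show ?case
  proof (cases "i = j")
    case True
    let ?c = "\<lambda>l. case l of 0 \<Rightarrow> 0 | Suc l \<Rightarrow> c l"
    have "var i * q = (\<Sum>l<Suc e. ?c l * var j ^ l)"
      unfolding sum.lessThan_Suc_shift c(3) using True by (simp add: sum_distrib_left mult_ac)
    moreover have "\<forall>l. ?c l \<in> polys_in I" using c(1) by (auto split: nat.split)
    moreover have "\<forall>l\<ge>Suc e. ?c l = 0" using c(2) by (auto split: nat.split)
    ultimately show ?thesis by blast
  next
    case False
    hence "var i \<in> polys_in I" using var(1) by (auto intro: polys_in_var)
    moreover have "var i * q = (\<Sum>l<e. (var i * c l) * var j ^ l)"
      unfolding c(3) by (simp add: sum_distrib_left mult_ac)
    ultimately show ?thesis using c(1,2)
      by (intro exI[of _ e] exI[of _ "\<lambda>l. var i * c l"]) (auto intro: polys_in_mult)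
  qed
next
  case (add q r)
  then obtain e c e' c' where c: "\<forall>l. c l \<in> polys_in I" "\<forall>l\<ge>e. c l = 0" "q = (\<Sum>l<e. c l * var j ^ l)"
    and c': "\<forall>l. c' l \<in> polys_in I" "\<forall>l\<ge>e'. c' l = 0" "r = (\<Sum>l<e'. c' l * var j ^ l)" by blast
  have "q = (\<Sum>l<max e e'. c l * var j ^ l)"
    unfolding c(3) using c(2) by (intro sum.mono_neutral_left) auto
  moreover have "r = (\<Sum>l<max e e'. c' l * var j ^ l)"
    unfolding c'(3) using c'(2) by (intro sum.mono_neutral_left) auto
  ultimately have "q + r = (\<Sum>l<max e e'. (c l + c' l) * var j ^ l)"
    by (simp only: sum.distrib distrib_right)
  thus ?case using c(1,2) c'(1,2)
    by (intro exI[of _ "max e e'"] exI[of _ "\<lambda>l. c l + c' l"]) (auto intro: polys_in_add)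
qed

text \<open>An expansion of minimal length is taken; a vanishing top coefficient would allow a
  shorter one.\<close>

lemma polys_in_leading_term:
  assumes "p \<in> polys_in (insert j I)" "p \<noteq> 0"
  shows "\<exists>e c. (\<forall>l. c l \<in> polys_in I) \<and> c e \<noteq> 0 \<and> p = (\<Sum>l<e. c l * var j ^ l) + c e * var j ^ e"
proof -
  let ?Q = "\<lambda>e. \<exists>c. (\<forall>l. c l \<in> polys_in I) \<and> p = (\<Sum>l<e. c l * var j ^ l)"
  define e where "e = (LEAST e. ?Q e)"
  have ex: "\<exists>e. ?Q e" using polys_in_expansion[OF assms(1)] by blast
  have e: "?Q e" unfolding e_def by (rule LeastI_ex[OF ex])
  then obtain c where c: "\<forall>l. c l \<in> polys_in I" "p = (\<Sum>l<e. c l * var j ^ l)" by blast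
  have "e \<noteq> 0"
  proof
    assume "e = 0"
    thus False using c(2) assms(2) by simp
  qed
  then obtain e' where e': "e = Suc e'" by (cases e) auto
  have "\<not> ?Q e'" using not_less_Least[of e' ?Q] e' unfolding e_def by simp
  hence "c e' \<noteq> 0" using c unfolding e' by fastforce
  thus ?thesis using c unfolding e' by auto
qed

section \<open>Independent variables along a chain of primes\<close>

definition poly_prime :: "nat set \<Rightarrow> 'k::field mpoly set \<Rightarrow> bool" where
  "poly_prime N P \<longleftrightarrow> P \<subseteq> polys_in N \<and> prime_in_subring (polys_in N) P"

lemma prime_in_subring_polys_in:
  assumes "poly_prime N P" "I \<subseteq> N"
  shows "prime_in_subring (polys_in I) P"
proof -
  interpret prime_in_subring "polys_in N" P using assms by (simp add: poly_prime_def)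
  have I: "polys_in I \<subseteq> polys_in N" by (rule polys_in_mono[OF assms(2)])
  have pr: "x \<in> P \<or> y \<in> P" if "x \<in> polys_in I" "y \<in> polys_in I" "x * y \<in> P" for x y
    by (rule prime) (use that I in auto)
  have ml: "x * y \<in> P" if "x \<in> polys_in I" "y \<in> P" for x y
    by (rule P(4)) (use that I in auto)
  show ?thesis
  proof (rule prime_in_subring.intro)
    show "x \<in> P \<or> y \<in> P" if "x \<in> polys_in I" "y \<in> polys_in I" "x * y \<in> P" for x y by (rule pr[OF that])
  qed (intro polys_in_one polys_in_add polys_in_uminus polys_in_mult P(1,2,3) ml; assumption)+
qed

text \<open>An element of Q outside P is transcendental modulo P over the independent variables: the
  constant coefficient of a relation lies in \<open>Q\<close>, hence is zero, and a factor
  \<open>h\<close> can be removed since \<open>P\<close> is prime.\<close>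

lemma powers_independent:
  assumes P: "poly_prime N P" and Q: "poly_prime N Q" and sub: "P \<subseteq> Q" and I: "I \<subseteq> N"
    and indep: "Q \<inter> polys_in I \<subseteq> {0}" and h: "h \<in> Q" "h \<notin> P"
    and u: "\<And>i. i \<le> m \<Longrightarrow> u i \<in> polys_in I" and rel: "(\<Sum>i\<le>m. u i * h ^ i) \<in> P" and i: "i \<le> m"
  shows "u i = 0"
  using u rel i
proof (induction m arbitrary: u i)
  case 0
  thus ?case using indep sub by auto
next
  case (Suc m)
  interpret P: prime_in_subring "polys_in N" P using P by (simp add: poly_prime_def)
  interpret Q: prime_in_subring "polys_in N" Q using Q by (simp add: poly_prime_def)
  have hN: "h \<in> polys_in N" using h Q by (auto simp: poly_prime_def)
  have IN: "polys_in I \<subseteq> polys_in N" by (rule polys_in_mono[OF I])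
  let ?r = "\<Sum>i\<le>m. u (Suc i) * h ^ i"
  have r: "?r \<in> polys_in N"
    using Suc.prems(1) IN hN by (intro polys_in_sum polys_in_mult polys_in_power) auto
  have eq: "(\<Sum>i\<le>Suc m. u i * h ^ i) = u 0 + ?r * h"
    unfolding sum.atMost_Suc_shift by (simp add: sum_distrib_left sum_distrib_right mult_ac)
  have "?r * h \<in> Q" by (rule Q.P(4)[OF r h(1)])
  moreover have "(u 0 + ?r * h) \<in> Q" using Suc.prems(2) sub unfolding eq by blast
  ultimately have "(u 0 + ?r * h) + (- 1) * (?r * h) \<in> Q"
    by (intro Q.P(3)[OF _ Q.P(4)[OF polys_in_uminus[OF polys_in_one]]])
  hence u0: "u 0 = 0" using indep Suc.prems(1)[of 0] by auto
  hence "?r * h \<in> P" using Suc.prems(2) unfolding eq by simp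
  hence "?r \<in> P" using P.prime[OF r hN] h by blast
  hence "u (Suc i) = 0" if "i \<le> m" for i
    by (rule Suc.IH[rotated]) (use that Suc.prems in auto)
  thus ?case using u0 Suc.prems(3) by (cases i) auto
qed

text \<open>
  If every further variable were algebraic over \<open>k[x\<^sub>I]\<close> modulo \<open>P\<close>, then so would be every
  \<open>h \<in> Q - P\<close>, and the constant term of an equation for \<open>h\<close> would lie in \<open>Q \<inter> k[x\<^sub>I] = 0\<close>.
\<close>

lemma independent_extend:
  assumes N: "finite N" and P: "poly_prime N P" and Q: "poly_prime N Q" and PQ: "P \<subset> Q" and I: "I \<subseteq> N"
    and indep: "Q \<inter> polys_in I \<subseteq> {0}"
  shows "\<exists>j\<in>N - I. P \<inter> polys_in (insert j I) \<subseteq> {0}"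
proof (rule ccontr)
  assume "\<not> ?thesis"
  hence "\<forall>j\<in>N - I. \<exists>p. p \<in> P \<and> p \<in> polys_in (insert j I) \<and> p \<noteq> 0" by blast
  then obtain p where p: "\<And>j. j \<in> N - I \<Longrightarrow> p j \<in> P \<and> p j \<in> polys_in (insert j I) \<and> p j \<noteq> 0" by metis
  have "\<forall>j\<in>N - I. \<exists>e c. (\<forall>l. c l \<in> polys_in I) \<and> c e \<noteq> 0 \<and> p j = (\<Sum>l<e. c l * var j ^ l) + c e * var j ^ e"
    using polys_in_leading_term p by blast
  from bchoice[OF this] obtain e where "\<forall>j\<in>N - I. \<exists>c. (\<forall>l. c l \<in> polys_in I) \<and> c (e j) \<noteq> 0 \<and>
      p j = (\<Sum>l<e j. c l * var j ^ l) + c (e j) * var j ^ e j" by blast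
  from bchoice[OF this] obtain c where ec: "\<And>j. j \<in> N - I \<Longrightarrow> (\<forall>l. c j l \<in> polys_in I) \<and> c j (e j) \<noteq> 0 \<and>
      p j = (\<Sum>l<e j. c j l * var j ^ l) + c j (e j) * var j ^ e j" by blast
  interpret P: prime_in_subring "polys_in N" P using P by (simp add: poly_prime_def)
  interpret PI: prime_in_subring "polys_in I" P by (rule prime_in_subring_polys_in[OF P I])
  have IN: "polys_in I \<subseteq> polys_in N" by (rule polys_in_mono[OF I])
  have CP: "x = 0" if "x \<in> polys_in I" "x \<in> P" for x using indep PQ that by blast
  define J where "J = N - I"
  have J: "finite J" "J \<subseteq> N" using N by (auto simp: J_def)
  \<comment> \<open>With leading exponent zero, \<open>p j\<close> would be a nonzero element of
    \<open>P\<close> in the independent variables. Hence the box \<open>B\<close> contains the zero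
    exponent and its monomials include 1.\<close>
  have e0: "e j > 0" if "j \<in> J" for j
  proof (rule ccontr)
    assume "\<not> e j > 0"
    moreover have j: "j \<in> N - I" using that by (simp add: J_def)
    ultimately have "p j = c j (e j)" using ec[OF j] by simp
    hence "p j \<in> polys_in I" using ec[OF j] by metis
    thus False using CP[of "p j"] p[OF j] by blast
  qed
  \<comment> \<open>Exponents below the degrees of the equations: their monomials will span
    everything modulo \<open>P\<close> over the fraction field of k[x_I].\<close>
  define B where "B = PiE J (\<lambda>j. {..<e j})"
  have B: "finite B" unfolding B_def by (rule finite_PiE) (use J in auto)
  define mon :: "(nat \<Rightarrow> nat) \<Rightarrow> 'a mpoly" where "mon \<sigma> = (\<Prod>j\<in>J. var j ^ \<sigma> j)" for \<sigma>
  \<comment> \<open>The monomial without one variable, so that the exponent of that variable can be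
    replaced.\<close>
  define rest :: "nat \<Rightarrow> (nat \<Rightarrow> nat) \<Rightarrow> 'a mpoly" where "rest i \<sigma> = (\<Prod>j\<in>J - {i}. var j ^ \<sigma> j)" for i \<sigma>
  have varN: "var j \<in> polys_in N" if "j \<in> J" for j using that J by (auto intro: polys_in_var)
  have prodN: "(\<Prod>j\<in>K. var j ^ \<sigma> j) \<in> polys_in N" if "K \<subseteq> J" for K and \<sigma> :: "nat \<Rightarrow> nat"
  proof -
    have "finite K" using that J finite_subset by blast
    thus ?thesis using that by (induction K) (auto intro: polys_in_mult polys_in_power varN)
  qed
  have monN: "mon \<sigma> \<in> polys_in N" and restN: "rest i \<sigma> \<in> polys_in N" for i \<sigma>
    unfolding mon_def rest_def by (rule prodN; auto)+
  have mon_rest: "mon (\<sigma>(i := l)) = var i ^ l * rest i \<sigma>" if "i \<in> J" for i l \<sigma>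
    unfolding mon_def rest_def using that J by (simp add: prod.remove)
  \<comment> \<open>The span of the box monomials modulo \<open>P\<close> with coefficients in
    k[x_I]; the set \<open>T\<close> further down also admits a nonzero denominator from
    k[x_I].\<close>
  define M where "M = {q \<in> polys_in N. \<exists>\<gamma>. (\<forall>a\<in>B. \<gamma> a \<in> polys_in I) \<and> q - (\<Sum>a\<in>B. \<gamma> a * mon a) \<in> P}"
  have MI: "q \<in> M" if "q \<in> polys_in N" "\<And>a. a \<in> B \<Longrightarrow> \<gamma> a \<in> polys_in I" "q - (\<Sum>a\<in>B. \<gamma> a * mon a) \<in> P" for q \<gamma>
    using that unfolding M_def by blast
  have ME: "\<exists>\<gamma>. (\<forall>a\<in>B. \<gamma> a \<in> polys_in I) \<and> q - (\<Sum>a\<in>B. \<gamma> a * mon a) \<in> P" if "q \<in> M" for q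
    using that unfolding M_def by blast
  have MN: "q \<in> polys_in N" if "q \<in> M" for q using that by (simp add: M_def)
  have M_add: "q + r \<in> M" if "q \<in> M" "r \<in> M" for q r
  proof -
    obtain \<gamma> \<gamma>' where \<gamma>: "\<forall>a\<in>B. \<gamma> a \<in> polys_in I" "q - (\<Sum>a\<in>B. \<gamma> a * mon a) \<in> P"
      "\<forall>a\<in>B. \<gamma>' a \<in> polys_in I" "r - (\<Sum>a\<in>B. \<gamma>' a * mon a) \<in> P"
      using ME[OF \<open>q \<in> M\<close>] ME[OF \<open>r \<in> M\<close>] by blast
    have eq: "q + r - (\<Sum>a\<in>B. (\<gamma> a + \<gamma>' a) * mon a) =
        (q - (\<Sum>a\<in>B. \<gamma> a * mon a)) + (r - (\<Sum>a\<in>B. \<gamma>' a * mon a))"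
      by (simp add: distrib_right sum.distrib)
    show ?thesis
      by (rule MI[of _ "\<lambda>a. \<gamma> a + \<gamma>' a"], unfold eq) (use \<gamma> that MN in \<open>auto intro!: polys_in_add P.P(3)\<close>)
  qed
  have M_mult: "x * q \<in> M" if "q \<in> M" "x \<in> polys_in I" for q x
  proof -
    obtain \<gamma> where \<gamma>: "\<forall>a\<in>B. \<gamma> a \<in> polys_in I" "q - (\<Sum>a\<in>B. \<gamma> a * mon a) \<in> P"
      using ME[OF \<open>q \<in> M\<close>] by blast
    have eq: "x * q - (\<Sum>a\<in>B. (x * \<gamma> a) * mon a) = x * (q - (\<Sum>a\<in>B. \<gamma> a * mon a))"
      by (simp add: right_diff_distrib sum_distrib_left mult_ac)
    show ?thesis
      by (rule MI[of _ "\<lambda>a. x * \<gamma> a"], unfold eq) (use \<gamma> that MN IN in \<open>auto intro!: polys_in_mult P.P(4)\<close>)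
  qed
  have M_P: "q \<in> M" if "q \<in> P" for q
  proof -
    have "q \<in> polys_in N" using that P by (auto simp: poly_prime_def)
    thus ?thesis using that by (intro MI[of _ "\<lambda>_. 0"]) auto
  qed
  have M_mon: "mon a \<in> M" if "a \<in> B" for a
  proof -
    have "(\<Sum>b\<in>B. (if b = a then 1 else 0) * mon b) = (\<Sum>b\<in>B. if b = a then mon b else 0)"
      by (intro sum.cong) auto
    hence "(\<Sum>b\<in>B. (if b = a then 1 else 0) * mon b) = mon a" using that B by simp
    thus ?thesis using monN[of a] P.P(1) by (intro MI[of _ "\<lambda>b. if b = a then 1 else 0"]) auto
  qed
  have M_sum: "sum F A \<in> M" if "\<And>i. i \<in> A \<Longrightarrow> F i \<in> M" for F and A :: "'z set"
    using that by (induction A rule: infinite_finite_induct) (auto intro: M_add M_P P.P(1))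
  define T where "T = {q \<in> polys_in N. \<exists>x\<in>polys_in I. x \<noteq> 0 \<and> x * q \<in> M}"
  have nz: "x * y \<noteq> (0::'a mpoly)" if "x \<in> polys_in I" "y \<in> polys_in I" "x \<noteq> 0" "y \<noteq> 0" for x y
    using PI.prime[of x y] that CP P.P(1) by auto
  have TI: "q \<in> T" if "q \<in> polys_in N" "x \<in> polys_in I" "x \<noteq> 0" "x * q \<in> M" for q x
    using that unfolding T_def by blast
  have TN: "q \<in> polys_in N" if "q \<in> T" for q using that by (simp add: T_def)
  have T_add: "q + r \<in> T" if qr: "q \<in> T" "r \<in> T" for q r
  proof -
    obtain x y where x: "x \<in> polys_in I" "x \<noteq> 0" "x * q \<in> M" "y \<in> polys_in I" "y \<noteq> 0" "y * r \<in> M"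
      using qr by (auto simp: T_def)
    have "(x * y) * (q + r) = y * (x * q) + x * (y * r)" by (simp add: algebra_simps)
    hence "(x * y) * (q + r) \<in> M" using M_add[OF M_mult[OF x(3,4)] M_mult[OF x(6,1)]] by simp
    moreover have "x * y \<in> polys_in I" "x * y \<noteq> 0" using x nz by (auto intro: polys_in_mult)
    ultimately show ?thesis using TI[of "q + r" "x * y"] TN qr by (auto intro: polys_in_add)
  qed
  have T_mult: "x * q \<in> T" if q: "q \<in> T" "x \<in> polys_in I" for q x
  proof -
    obtain y where y: "y \<in> polys_in I" "y \<noteq> 0" "y * q \<in> M" using q by (auto simp: T_def)
    have "y * (x * q) \<in> M" using M_mult[OF y(3) q(2)] by (simp add: mult_ac)
    thus ?thesis using TI[of "x * q" y] y q IN TN by (auto intro: polys_in_mult)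
  qed
  have T_sum: "sum F A \<in> T" if "\<And>i. i \<in> A \<Longrightarrow> F i \<in> T" for F and A :: "'z set"
  proof -
    have "0 \<in> T" using M_P[OF P.P(1)] TI[of 0 1] by simp
    thus ?thesis using that by (induction A rule: infinite_finite_induct) (auto intro: T_add)
  qed
  have T_M: "q \<in> T" if "q \<in> M" for q
    using that MN[OF that] TI[of q 1] by simp
  have T_div: "q \<in> T" if q: "q \<in> polys_in N" "x \<in> polys_in I" "x \<noteq> 0" "x * q \<in> T" for x q
  proof -
    obtain y where y: "y \<in> polys_in I" "y \<noteq> 0" "y * (x * q) \<in> M" using q by (auto simp: T_def)
    hence "(y * x) * q \<in> M" by (simp add: mult_ac)
    thus ?thesis using y q nz[of y x] TI[of q "y * x"] by (auto intro: polys_in_mult)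
  qed
  \<comment> \<open>When the exponent leaves the box, the equation \<open>p j\<close> rewrites the
    top power by lower ones, at the price of its leading coefficient as a denominator.\<close>
  have T_var_mon: "var j * mon a \<in> T" if j: "j \<in> J" and a: "a \<in> B" for j a
  proof -
    have aj: "a j < e j" using a j by (auto simp: B_def)
    have upd: "a(j := l) \<in> B" if "l < e j" for l
      using a j that unfolding B_def by (auto simp: PiE_def extensional_def)
    have m: "var j * mon a = var j ^ Suc (a j) * rest j a"
      using mon_rest[OF j, of a "a j"] by (simp add: mult_ac)
    show ?thesis
    proof (cases "Suc (a j) = e j")
      case False
      hence "a(j := Suc (a j)) \<in> B" using aj upd by simp
      thus ?thesis unfolding m mon_rest[OF j, symmetric] by (intro T_M M_mon)
    next
      case True
      have q: "\<And>l. c j l \<in> polys_in I" "c j (e j) \<noteq> 0"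
          "p j = (\<Sum>l<e j. c j l * var j ^ l) + c j (e j) * var j ^ e j"
        using ec[of j] j by (auto simp: J_def)
      have "c j (e j) * (var j * mon a) = p j * rest j a + (\<Sum>l<e j. (- c j l) * mon (a(j := l)))"
        unfolding m True mon_rest[OF j] q(3) by (simp add: sum_negf algebra_simps sum_distrib_left)
      moreover have "p j * rest j a \<in> P" using P.P(4)[OF restN] p[of j] j by (simp add: J_def mult.commute)
      moreover have "(\<Sum>l<e j. (- c j l) * mon (a(j := l))) \<in> M"
        using upd by (intro M_sum M_mult M_mon polys_in_uminus q) auto
      ultimately have "c j (e j) * (var j * mon a) \<in> M" using M_add M_P by simp
      from T_div[OF polys_in_mult[OF varN[OF j] monN] q(1,2) T_M[OF this]] show ?thesis .
    qed
  qed
  have T_all: "q \<in> T" if "q \<in> polys_in N" for q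
    using that
  proof (induction q rule: polys_in_induct)
    case (const a)
    have "(\<lambda>j\<in>J. 0) \<in> B" using e0 by (auto simp: B_def)
    hence "mon (\<lambda>j\<in>J. 0) \<in> T" by (intro T_M M_mon)
    moreover have "mon (\<lambda>j\<in>J. 0) = 1" by (simp add: mon_def)
    ultimately show ?case using T_mult[of 1 "mpoly_const a"] by simp
  next
    case (var j q)
    show ?case
    proof (cases "j \<in> I")
      case True
      show ?thesis by (rule T_mult[OF var(3) polys_in_var[OF True]])
    next
      case False
      hence j: "j \<in> J" using var by (simp add: J_def)
      obtain x where x: "x \<in> polys_in I" "x \<noteq> 0" "x * q \<in> M" using var by (auto simp: T_def)
      obtain \<gamma> where \<gamma>: "\<forall>a\<in>B. \<gamma> a \<in> polys_in I" "x * q - (\<Sum>a\<in>B. \<gamma> a * mon a) \<in> P"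
        using ME[OF x(3)] by blast
      have "x * (var j * q) = var j * (x * q - (\<Sum>a\<in>B. \<gamma> a * mon a)) + (\<Sum>a\<in>B. \<gamma> a * (var j * mon a))"
        by (simp add: right_diff_distrib sum_distrib_left mult_ac)
      moreover have "var j * (x * q - (\<Sum>a\<in>B. \<gamma> a * mon a)) \<in> T"
        by (rule T_M[OF M_P[OF P.P(4)[OF varN[OF j] \<gamma>(2)]]])
      moreover have "(\<Sum>a\<in>B. \<gamma> a * (var j * mon a)) \<in> T"
        using \<gamma> by (intro T_sum T_mult T_var_mon j) auto
      ultimately have "x * (var j * q) \<in> T" using T_add by simp
      from T_div[OF polys_in_mult[OF varN[OF j] var(2)] x(1,2) this] show ?thesis .
    qed
  next
    case (add q r)
    thus ?case using T_add by blast
  qed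
  \<comment> \<open>The powers of \<open>h\<close> up to \<open>card B\<close> are one more than the
    spanning monomials, so they satisfy a nontrivial relation over k[x_I] modulo \<open>P\<close>,
    which \<open>powers_independent\<close> excludes.\<close>
  obtain h where h: "h \<in> Q" "h \<notin> P" using PQ by blast
  have hN: "h \<in> polys_in N" using h Q by (auto simp: poly_prime_def)
  have "\<forall>i. \<exists>x \<gamma>. x \<in> polys_in I \<and> x \<noteq> 0 \<and> (\<forall>a\<in>B. \<gamma> a \<in> polys_in I) \<and> x * h ^ i - (\<Sum>a\<in>B. \<gamma> a * mon a) \<in> P"
  proof
    fix i
    obtain x where x: "x \<in> polys_in I" "x \<noteq> 0" "x * h ^ i \<in> M"
      using T_all[OF polys_in_power[OF hN]] unfolding T_def by blast
    thus "\<exists>x \<gamma>. x \<in> polys_in I \<and> x \<noteq> 0 \<and> (\<forall>a\<in>B. \<gamma> a \<in> polys_in I) \<and> x * h ^ i - (\<Sum>a\<in>B. \<gamma> a * mon a) \<in> P"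
      using ME[OF x(3)] by blast
  qed
  from this[unfolded choice_iff] obtain x \<gamma> where x\<gamma>: "\<forall>i. x i \<in> polys_in I \<and> x i \<noteq> 0 \<and>
      (\<forall>a\<in>B. \<gamma> i a \<in> polys_in I) \<and> x i * h ^ i - (\<Sum>a\<in>B. \<gamma> i a * mon a) \<in> P"
    by blast
  hence x: "\<And>i. x i \<in> polys_in I" "\<And>i. x i \<noteq> 0" and \<gamma>: "\<And>i a. a \<in> B \<Longrightarrow> \<gamma> i a \<in> polys_in I"
    and x\<gamma>: "\<And>i. x i * h ^ i - (\<Sum>a\<in>B. \<gamma> i a * mon a) \<in> P"
    by simp_all
  obtain d where d: "\<forall>i\<in>{..card B}. d i \<in> polys_in I" "\<exists>i\<in>{..card B}. d i \<notin> P"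
      "\<forall>a\<in>B. (\<Sum>i\<in>{..card B}. d i * \<gamma> i a) \<in> P"
    using PI.linear_relation[of B "{..card B}" \<gamma>] B \<gamma> by auto
  have "(\<Sum>i\<le>card B. (d i * x i) * h ^ i) =
      (\<Sum>i\<le>card B. d i * (x i * h ^ i - (\<Sum>a\<in>B. \<gamma> i a * mon a))) + (\<Sum>i\<le>card B. \<Sum>a\<in>B. d i * \<gamma> i a * mon a)"
    by (simp add: right_diff_distrib sum_subtractf sum_distrib_left mult_ac)
  also have "(\<Sum>i\<le>card B. \<Sum>a\<in>B. d i * \<gamma> i a * mon a) = (\<Sum>a\<in>B. mon a * (\<Sum>i\<le>card B. d i * \<gamma> i a))"
    by (subst sum.swap) (simp add: sum_distrib_left mult_ac)
  also have "(\<Sum>i\<le>card B. d i * (x i * h ^ i - (\<Sum>a\<in>B. \<gamma> i a * mon a))) + \<dots> \<in> P"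
  proof (rule P.P(3))
    show "(\<Sum>i\<le>card B. d i * (x i * h ^ i - (\<Sum>a\<in>B. \<gamma> i a * mon a))) \<in> P"
      using d(1) x\<gamma> IN by (intro P.P_sum P.P(4)) auto
    show "(\<Sum>a\<in>B. mon a * (\<Sum>i\<le>card B. d i * \<gamma> i a)) \<in> P"
      by (rule P.P_sum, rule P.P(4)[OF monN]) (use d(3) in blast)
  qed
  finally have "(\<Sum>i\<le>card B. (d i * x i) * h ^ i) \<in> P" .
  moreover have "d i * x i \<in> polys_in I" if "i \<le> card B" for i
    using d(1) x(1) that by (auto intro: polys_in_mult)
  moreover obtain i where i: "i \<le> card B" "d i \<notin> P" using d(2) by blast
  ultimately have "d i * x i = 0"
    using powers_independent[OF P Q _ I indep h, of "card B" "\<lambda>i. d i * x i" i] PQ by blast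
  moreover have "d i \<noteq> 0" using i P.P(1) by auto
  ultimately show False using nz[of "d i" "x i"] x d(1) i by auto
qed

text \<open>Among the nonzero elements of \<open>P\<close> in k[x_I, x_j] one of least degree in x_j
  is taken. Its derivative is nonzero because x_j must occur, and has smaller degree, so it lies
  outside \<open>P\<close>.\<close>

lemma minimal_equation:
  assumes P: "poly_prime N P" and indep: "P \<inter> polys_in I \<subseteq> {0}"
    and p: "p \<in> P" "p \<in> polys_in (insert j I)" "p \<noteq> 0"
  shows "\<exists>q\<in>P. q \<in> polys_in (insert j I) \<and> pd j q \<notin> P"
proof -
  define D where "D = (\<lambda>k::nat. {q \<in> P. q \<in> polys_in (insert j I) \<and> q \<noteq> 0 \<and> (\<forall>m\<in>pkeys q. plookup m j \<le> k)})"
  have "p \<in> D (\<Sum>m\<in>pkeys p. plookup m j)" using p by (auto simp: D_def intro: member_le_sum)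
  hence ex: "\<exists>k. D k \<noteq> {}" by blast
  define k where "k = (LEAST k. D k \<noteq> {})"
  have "D k \<noteq> {}" unfolding k_def by (rule LeastI_ex[OF ex])
  then obtain q where q: "q \<in> P" "q \<in> polys_in (insert j I)" "q \<noteq> 0" "\<And>m. m \<in> pkeys q \<Longrightarrow> plookup m j \<le> k"
    by (auto simp: D_def)
  have "q \<notin> polys_in I" using q indep by blast
  hence nz: "pd j q \<noteq> 0" using polys_in_of_pd_zero[OF q(2)] by blast
  have deg: "plookup m j + 1 \<le> k" if "m \<in> pkeys (pd j q)" for m
    using q(4)[OF pkeys_pd[OF that]] by (simp add: lookup_add)
  obtain m where "m \<in> pkeys (pd j q)" using nz by (metis all_not_in_conv keys_eq_empty)
  hence k: "k > 0" using deg by force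
  have "pd j q \<notin> P"
  proof
    assume "pd j q \<in> P"
    hence "pd j q \<in> D (k - 1)" using nz deg q(2) by (force simp: D_def intro: pd_polys_in)
    thus False using not_less_Least[of "k - 1" "\<lambda>k. D k \<noteq> {}"] k unfolding k_def by fastforce
  qed
  thus ?thesis using q by blast
qed

text \<open>Read from the top of the chain downwards: each strict inclusion frees one further
  variable by \<open>independent_extend\<close>.\<close>

lemma chain_independent:
  fixes P :: "nat \<Rightarrow> 'k::field mpoly set"
  assumes N: "finite N" and chain: "\<And>i. i \<le> d \<Longrightarrow> poly_prime N (P i)" "\<And>i. i < d \<Longrightarrow> P i \<subset> P (Suc i)"
    and I: "I \<subseteq> N" "P d \<inter> polys_in I \<subseteq> {0}"
  shows "\<exists>I'\<subseteq>N. P 0 \<inter> polys_in I' \<subseteq> {0} \<and> card I' = card I + d"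
  using chain I
proof (induction d arbitrary: I)
  case 0
  thus ?case by auto
next
  case (Suc d)
  obtain j where j: "j \<in> N - I" "P d \<inter> polys_in (insert j I) \<subseteq> {0}"
    using independent_extend[OF N, of "P d" "P (Suc d)" I] Suc.prems by auto
  have "finite I" using Suc.prems(3) N finite_subset by blast
  thus ?case using Suc.IH[of "insert j I"] Suc.prems j by auto
qed

text \<open>
  Choosing \<open>I\<close> maximal with \<open>P \<inter> k[x\<^sub>I] = 0\<close> leaves more than \<open>d\<close> variables \<open>x\<^sub>j\<close>, each
  with an equation \<open>p\<^sub>j \<in> P \<inter> k[x\<^sub>I, x\<^sub>j]\<close> that is separable modulo \<open>P\<close>. A syzygy of the \<open>p\<^sub>j\<close> modulo
  \<open>P \<cdot> Y + (f)\<close> is then contradicted by differentiation.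
\<close>

lemma jacobian_criterion:
  fixes P :: "nat \<Rightarrow> 'k::field_char_0 mpoly set" and Q Y :: "'k mpoly set"
  assumes N: "finite N" and Q: "poly_prime N Q" and f: "f \<noteq> 0" "f \<in> P 0" and df: "\<And>j. j \<in> N \<Longrightarrow> pd j f \<in> Q"
    and chain: "\<And>i. i \<le> d \<Longrightarrow> poly_prime N (P i)" "\<And>i. i < d \<Longrightarrow> P i \<subset> P (Suc i)" "P d \<subseteq> Q"
    and Y: "Y \<subseteq> Q" "finite Y" "card Y \<le> d"
    and gen: "\<And>p. p \<in> Q \<Longrightarrow> \<exists>u\<in>polys_in N - Q. \<exists>a. (\<forall>y\<in>Y. a y \<in> polys_in N) \<and>
      (\<exists>b\<in>polys_in N. u * p = (\<Sum>y\<in>Y. a y * y) + b * f)"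
  shows False
proof -
  interpret Q: prime_in_subring "polys_in N" Q using Q by (simp add: poly_prime_def)
  define F where "F = {I. I \<subseteq> N \<and> Q \<inter> polys_in I \<subseteq> {0}}"
  \<comment> \<open>Nonzero constants are units, so the empty set of variables is independent and a
    maximal independent \<open>I\<close> exists.\<close>
  have "Q \<inter> polys_in {} \<subseteq> {0}"
  proof
    fix x assume x: "x \<in> Q \<inter> polys_in {}"
    obtain c where c: "x = mpoly_const c" using polys_in_empty[of x] x by blast
    show "x \<in> {0}"
    proof (rule ccontr)
      assume "x \<notin> {0}"
      hence "c \<noteq> 0" using c by (auto simp: mpoly_const_def)
      hence "mpoly_const (inverse c) * x = 1" unfolding c mpoly_const_def by (simp add: mult_single)
      thus False using Q.P(4)[of "mpoly_const (inverse c)" x] x Q.P(2) by simp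
    qed
  qed
  hence F: "{} \<in> F" by (simp add: F_def)
  have finF: "finite F" by (rule finite_subset[of _ "Pow N"]) (use N in \<open>auto simp: F_def\<close>)
  from finite_has_maximal2[OF finF F] obtain I where I: "I \<in> F" "\<forall>I'\<in>F. I \<subseteq> I' \<longrightarrow> I = I'"
    by (elim bexE conjE)
  have "I \<subseteq> N \<and> Q \<inter> polys_in I \<subseteq> {0}" using I(1) by (simp only: F_def mem_Collect_eq)
  hence IN: "I \<subseteq> N" "Q \<inter> polys_in I \<subseteq> {0}" by (rule conjunct1, rule conjunct2)
  have finI: "finite I" by (rule finite_subset[OF IN(1) N])
  have "P d \<inter> polys_in I \<subseteq> {0}" using chain(3) IN(2) by blast
  hence "\<exists>I'\<subseteq>N. P 0 \<inter> polys_in I' \<subseteq> {0} \<and> card I' = card I + d"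
    by (intro chain_independent[of N d P I] N chain(1,2) IN(1))
  then obtain I' where I': "I' \<subseteq> N" "P 0 \<inter> polys_in I' \<subseteq> {0}" "card I' = card I + d" by blast
  have "f \<in> polys_in N" using f chain(1)[of 0] by (auto simp: poly_prime_def)
  \<comment> \<open>\<open>f\<close> is a nonzero element of \<open>P 0\<close>, so not all
    variables are independent modulo \<open>P 0\<close>. This one missing variable makes the
    complement of \<open>I\<close> larger than d.\<close>
  hence "I' \<noteq> N" using f I' by blast
  hence "card I + d < card N" using I' N psubset_card_mono[of N I'] by auto
  define J where "J = N - I"
  have J: "finite J" "J \<subseteq> N" "card Y < card J"
    using N IN(1) finI Y(3) \<open>card I + d < card N\<close> by (simp_all add: J_def card_Diff_subset)
  \<comment> \<open>By maximality of \<open>I\<close>, each further variable satisfies an equation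
    modulo \<open>Q\<close>, and a minimal one is separable.\<close>
  have "\<exists>q\<in>Q. q \<in> polys_in (insert j I) \<and> pd j q \<notin> Q" if j: "j \<in> J" for j
  proof -
    have "\<not> Q \<inter> polys_in (insert j I) \<subseteq> {0}"
    proof
      assume "Q \<inter> polys_in (insert j I) \<subseteq> {0}"
      hence "insert j I \<in> F" using IN(1) j by (simp add: F_def J_def)
      hence "I = insert j I" using I(2) by (meson subset_insertI)
      thus False using j by (auto simp: J_def)
    qed
    then obtain p where "p \<in> Q" "p \<in> polys_in (insert j I)" "p \<noteq> 0" by blast
    from minimal_equation[OF Q IN(2) this] show ?thesis .
  qed
  then obtain p where p: "\<And>j. j \<in> J \<Longrightarrow> p j \<in> Q" "\<And>j. j \<in> J \<Longrightarrow> p j \<in> polys_in (insert j I)"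
      "\<And>j. j \<in> J \<Longrightarrow> pd j (p j) \<notin> Q"
    by metis
  have "\<forall>j\<in>J. \<exists>u a b. u \<in> polys_in N \<and> u \<notin> Q \<and> (\<forall>y\<in>Y. a y \<in> polys_in N) \<and> b \<in> polys_in N \<and>
      u * p j = (\<Sum>y\<in>Y. a y * y) + b * f"
  proof
    fix j assume "j \<in> J"
    from gen[OF p(1)[OF this]] obtain u a b where *: "u \<in> polys_in N - Q" "\<forall>y\<in>Y. a y \<in> polys_in N"
        "b \<in> polys_in N" "u * p j = (\<Sum>y\<in>Y. a y * y) + b * f"
      by (elim bexE exE conjE)
    show "\<exists>u a b. u \<in> polys_in N \<and> u \<notin> Q \<and> (\<forall>y\<in>Y. a y \<in> polys_in N) \<and> b \<in> polys_in N \<and>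
      u * p j = (\<Sum>y\<in>Y. a y * y) + b * f"
      by (intro exI[of _ u] exI[of _ a] exI[of _ b] conjI *) (use *(1) in auto)
  qed
  from this[unfolded bchoice_iff] obtain u a b where uab: "\<forall>j\<in>J. u j \<in> polys_in N \<and> u j \<notin> Q \<and>
      (\<forall>y\<in>Y. a j y \<in> polys_in N) \<and> b j \<in> polys_in N \<and> u j * p j = (\<Sum>y\<in>Y. a j y * y) + b j * f"
    by (elim exE)
  hence u: "\<And>j. j \<in> J \<Longrightarrow> u j \<in> polys_in N" "\<And>j. j \<in> J \<Longrightarrow> u j \<notin> Q"
    and a: "\<And>j y. j \<in> J \<Longrightarrow> y \<in> Y \<Longrightarrow> a j y \<in> polys_in N" and b: "\<And>j. j \<in> J \<Longrightarrow> b j \<in> polys_in N"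
    and eq: "\<And>j. j \<in> J \<Longrightarrow> u j * p j = (\<Sum>y\<in>Y. a j y * y) + b j * f"
    by blast+
  \<comment> \<open>There are more equations than elements of \<open>Y\<close>, so a combination
    nontrivial modulo \<open>Q\<close> has all its coefficients at \<open>Y\<close> in
    \<open>Q\<close>.\<close>
  obtain D where D: "\<forall>j\<in>J. D j \<in> polys_in N" "\<exists>j\<in>J. D j \<notin> Q" "\<forall>y\<in>Y. (\<Sum>j\<in>J. D j * a j y) \<in> Q"
    using Q.linear_relation[OF Y(2) J(1,3)] a by blast
  have chainQ: "P i \<subseteq> P d" if "i \<le> d" for i
    using that by (induction rule: inc_induct) (use chain(2) in auto)
  have fQ: "f \<in> Q" using f chainQ[of 0] chain(3) by blast
  have QN: "Q \<subseteq> polys_in N" using Q by (simp add: poly_prime_def)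
  have rel: "(\<Sum>j\<in>J. D j * u j * p j) = (\<Sum>y\<in>Y. (\<Sum>j\<in>J. D j * a j y) * y) + (\<Sum>j\<in>J. D j * b j) * f"
  proof -
    have "(\<Sum>j\<in>J. D j * u j * p j) = (\<Sum>j\<in>J. D j * ((\<Sum>y\<in>Y. a j y * y) + b j * f))"
      using eq by (intro sum.cong) (auto simp: mult.assoc)
    also have "\<dots> = (\<Sum>j\<in>J. \<Sum>y\<in>Y. D j * a j y * y) + (\<Sum>j\<in>J. D j * b j) * f"
      by (simp add: distrib_left sum.distrib sum_distrib_left sum_distrib_right mult_ac)
    also have "(\<Sum>j\<in>J. \<Sum>y\<in>Y. D j * a j y * y) = (\<Sum>y\<in>Y. (\<Sum>j\<in>J. D j * a j y) * y)"
      by (subst sum.swap) (simp add: sum_distrib_right)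
    finally show ?thesis .
  qed
  \<comment> \<open>Differentiation of \<open>rel\<close> in x_i: on the right every term keeps a
    factor in \<open>Q\<close>, the derivatives of f included. On the left, up to terms in
    \<open>Q\<close>, only j = i survives, because the other \<open>p j\<close> do not contain
    x_i.\<close>
  have DQ: "D i \<in> Q" if i: "i \<in> J" for i
  proof -
    have pdQ: "x * pd i y \<in> Q" if "x \<in> Q" "y \<in> polys_in N" for x y
      using Q.P(4)[OF pd_polys_in[OF that(2)] that(1)] by (simp add: mult.commute)
    have "pd i (\<Sum>j\<in>J. D j * u j * p j) \<in> Q"
      unfolding rel pd_add pd_sum[of i "\<lambda>y. (\<Sum>j\<in>J. D j * a j y) * y"] pd_mult[of i _ f]
        pd_mult[of i "\<Sum>j\<in>J. D j * a j y" y for y]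
    proof (intro Q.P(3) Q.P_sum)
      have c: "(\<Sum>j\<in>J. D j * a j y) \<in> polys_in N" if "y \<in> Y" for y
        using D(1) a that by (intro polys_in_sum polys_in_mult) auto
      have c': "(\<Sum>j\<in>J. D j * b j) \<in> polys_in N"
        using D(1) b by (intro polys_in_sum polys_in_mult) auto
      show "(\<Sum>j\<in>J. D j * a j y) * pd i y \<in> Q" if "y \<in> Y" for y
        by (rule pdQ) (use D(3) Y(1) QN that in auto)
      show "y * pd i (\<Sum>j\<in>J. D j * a j y) \<in> Q" if "y \<in> Y" for y
        by (rule pdQ[OF _ c]) (use Y(1) that in auto)
      show "(\<Sum>j\<in>J. D j * b j) * pd i f \<in> Q"
        by (rule Q.P(4)[OF c' df]) (use i J in auto)
      show "f * pd i (\<Sum>j\<in>J. D j * b j) \<in> Q"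
        by (rule pdQ[OF fQ c'])
    qed
    moreover have "pd i (\<Sum>j\<in>J. D j * u j * p j) =
        (\<Sum>j\<in>J. D j * u j * pd i (p j)) + (\<Sum>j\<in>J. p j * pd i (D j * u j))"
      unfolding pd_sum pd_mult[of i _ "p j" for j] by (rule sum.distrib)
    moreover have "(\<Sum>j\<in>J. D j * u j * pd i (p j)) = (\<Sum>j\<in>J. if j = i then D j * u j * pd i (p j) else 0)"
    proof (rule sum.cong)
      fix j assume j: "j \<in> J"
      have "pd i (p j) = 0" if "i \<noteq> j"
        by (rule pd_eq_zero[OF p(2)[OF j]]) (use i that in \<open>auto simp: J_def\<close>)
      thus "D j * u j * pd i (p j) = (if j = i then D j * u j * pd i (p j) else 0)" by auto
    qed simp
    moreover have s: "(\<Sum>j\<in>J. p j * pd i (D j * u j)) \<in> Q"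
      using D(1) u(1) p(1) by (intro Q.P_sum pdQ polys_in_mult) auto
    ultimately have "D i * u i * pd i (p i) + (\<Sum>j\<in>J. p j * pd i (D j * u j)) \<in> Q"
      using i J(1) by simp
    from Q.P(3)[OF this Q.P(4)[OF polys_in_uminus[OF polys_in_one] s]] have "D i * u i * pd i (p i) \<in> Q" by simp
    moreover have "p i \<in> polys_in N" using p(1)[OF i] QN by blast
    ultimately show ?thesis
      using Q.prime[of "D i * u i" "pd i (p i)"] Q.prime[of "D i" "u i"] p(3)[OF i] u[OF i] D(1) i
      by (auto intro: polys_in_mult pd_polys_in)
  qed
  thus False using D(2) by blast
qed

section \<open>Localization at a prime\<close>

text \<open>Zorn's lemma for the ideals above \<open>I\<close> that avoid the unit; the union of a
  chain still avoids it.\<close>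

lemma (in cring) exists_maximalideal:
  assumes "ideal I R" "\<one> \<notin> I"
  shows "\<exists>m. maximalideal m R \<and> I \<subseteq> m"
proof -
  define A where "A = {J. ideal J R \<and> I \<subseteq> J \<and> \<one> \<notin> J}"
  have "\<exists>m\<in>A. \<forall>X\<in>A. m \<subseteq> X \<longrightarrow> X = m"
  proof (rule subset_Zorn_nonempty)
    show "A \<noteq> {}" using assms by (auto simp: A_def)
    fix C assume C: "C \<noteq> {}" "subset.chain A C"
    have "subset.chain {I. ideal I R} C"
      using C(2) unfolding subset.chain_def A_def by blast
    from chain_Union_is_ideal[OF this] C(1) have "ideal (\<Union> C) R" by simp
    thus "\<Union> C \<in> A" using C unfolding subset.chain_def A_def by blast
  qed
  then obtain m where m: "m \<in> A" "\<And>X. X \<in> A \<Longrightarrow> m \<subseteq> X \<Longrightarrow> X = m" by blast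
  have "maximalideal m R"
  proof (rule maximalidealI)
    show "ideal m R" "carrier R \<noteq> m" using m(1) by (auto simp: A_def)
    fix J assume J: "ideal J R" "m \<subseteq> J" "J \<subseteq> carrier R"
    show "J = m \<or> J = carrier R"
    proof (cases "\<one> \<in> J")
      case True
      thus ?thesis using ideal.one_imp_carrier[OF J(1)] by blast
    next
      case False
      thus ?thesis using m J by (auto simp: A_def)
    qed
  qed
  thus ?thesis using m(1) by (auto simp: A_def)
qed

text \<open>The operations of \<open>localization\<close> are unions over all pairs of
  representatives; they collapse once every pair yields the same fraction.\<close>

lemma UN_pairs_const:
  assumes c: "\<And>a s b t. (a, s) \<in> A \<Longrightarrow> (b, t) \<in> B \<Longrightarrow> G a s b t = X" and "(a, s) \<in> A" "(b, t) \<in> B"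
  shows "(\<Union>(a, s)\<in>A. \<Union>(b, t)\<in>B. G a s b t) = X"
proof -
  have "(\<Union>(a, s)\<in>A. \<Union>(b, t)\<in>B. G a s b t) = (\<Union>x\<in>A. \<Union>y\<in>B. X)"
    by (intro SUP_cong refl) (use c in auto)
  also have "\<dots> = X" using assms(2,3) by auto
  finally show ?thesis .
qed

text \<open>\<open>L_cring\<close> is assumed because regularity delivers it: a
  \<open>regular_local_ring\<close> is a \<open>cring\<close> by definition. The formulas for
  computing with fractions are proved below.\<close>

locale prime_localization = cring R + primeideal p R for R :: "('a, 'b) ring_scheme" (structure) and p +
  fixes S :: "'a set" and L :: "('a \<times> 'a) set ring"
  assumes S_def: "S = carrier R - p" and L_def: "L = localization R S"
    and L_cring: "cring L"
begin

abbreviation "fr \<equiv> loc_frac R S"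

lemma S_one: "\<one> \<in> S" using I_notcarr one_imp_carrier by (auto simp: S_def)

lemma S_closed: "s \<in> S \<Longrightarrow> s \<in> carrier R" by (simp add: S_def)

lemma S_mult: "s \<in> S \<Longrightarrow> t \<in> S \<Longrightarrow> s \<otimes> t \<in> S" using I_prime by (auto simp: S_def)

lemma frac_rel:
  assumes "a \<in> carrier R" "s \<in> carrier R" "b \<in> carrier R" "t \<in> carrier R" "u \<in> carrier R"
  shows "u \<otimes> ((t \<otimes> a) \<ominus> (s \<otimes> b)) = \<zero> \<longleftrightarrow> u \<otimes> (t \<otimes> a) = u \<otimes> (s \<otimes> b)"
  using assms minus_eq_zero_iff[of "u \<otimes> (t \<otimes> a)" "u \<otimes> (s \<otimes> b)"] by (simp add: r_distr r_minus minus_eq)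

lemma frac_mem:
  assumes "a \<in> carrier R" "s \<in> S"
  shows "(b, t) \<in> fr a s \<longleftrightarrow> b \<in> carrier R \<and> t \<in> S \<and> (\<exists>u\<in>S. u \<otimes> (t \<otimes> a) = u \<otimes> (s \<otimes> b))"
  using assms frac_rel[of a s b t] S_closed unfolding loc_frac_def by auto

lemma frac_self: "a \<in> carrier R \<Longrightarrow> s \<in> S \<Longrightarrow> (a, s) \<in> fr a s"
  using S_one by (auto simp: frac_mem)

lemma frac_mono:
  assumes a: "a \<in> carrier R" "s \<in> S" and b: "(b, t) \<in> fr a s"
  shows "fr a s \<subseteq> fr b t"
proof clarify
  fix c r assume "(c, r) \<in> fr a s"
  then obtain v where v: "c \<in> carrier R" "r \<in> S" "v \<in> S" "v \<otimes> (r \<otimes> a) = v \<otimes> (s \<otimes> c)"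
    using a by (auto simp: frac_mem)
  obtain u where u: "b \<in> carrier R" "t \<in> S" "u \<in> S" "u \<otimes> (t \<otimes> a) = u \<otimes> (s \<otimes> b)"
    using a b by (auto simp: frac_mem)
  note cl = a(1) v(1) u(1) a(2)[THEN S_closed] v(2,3)[THEN S_closed] u(2,3)[THEN S_closed]
  \<comment> \<open>The multiplier for transitivity: those of the two equalities times the
    denominator that they share.\<close>
  have "(u \<otimes> v \<otimes> s) \<otimes> (r \<otimes> b) = v \<otimes> r \<otimes> (u \<otimes> (s \<otimes> b))" using cl by (simp add: m_ac)
  also have "\<dots> = u \<otimes> t \<otimes> (v \<otimes> (r \<otimes> a))" unfolding u(4)[symmetric] using cl by (simp add: m_ac)
  also have "\<dots> = (u \<otimes> v \<otimes> s) \<otimes> (t \<otimes> c)" unfolding v(4) using cl by (simp add: m_ac)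
  finally have "(u \<otimes> v \<otimes> s) \<otimes> (r \<otimes> b) = (u \<otimes> v \<otimes> s) \<otimes> (t \<otimes> c)" .
  moreover have "u \<otimes> v \<otimes> s \<in> S" using a u v by (intro S_mult)
  ultimately show "(c, r) \<in> fr b t" using u v by (auto simp: frac_mem)
qed

lemma frac_sym: "a \<in> carrier R \<Longrightarrow> s \<in> S \<Longrightarrow> (b, t) \<in> fr a s \<Longrightarrow> (a, s) \<in> fr b t"
  using frac_mono[of a s b t] frac_self by blast

lemma frac_eqI: "a \<in> carrier R \<Longrightarrow> s \<in> S \<Longrightarrow> (b, t) \<in> fr a s \<Longrightarrow> fr b t = fr a s"
  using frac_mono[of a s b t] frac_mono[of b t a s] frac_sym[of a s b t] frac_mem[of a s b t] by auto

lemma frac_eq_iff: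
  assumes "a \<in> carrier R" "s \<in> S" "b \<in> carrier R" "t \<in> S"
  shows "fr a s = fr b t \<longleftrightarrow> (\<exists>u\<in>S. u \<otimes> (t \<otimes> a) = u \<otimes> (s \<otimes> b))"
  using frac_eqI[of a s b t] frac_mem[of a s b t] frac_self[of b t] assms by auto

lemma L_carrier: "carrier L = {fr a s | a s. a \<in> carrier R \<and> s \<in> S}"
  by (simp add: L_def localization_def)

lemma frac_closed: "a \<in> carrier R \<Longrightarrow> s \<in> S \<Longrightarrow> fr a s \<in> carrier L"
  by (auto simp: L_carrier)

lemma L_one: "\<one>\<^bsub>L\<^esub> = fr \<one> \<one>" and L_zero: "\<zero>\<^bsub>L\<^esub> = fr \<zero> \<one>"
  by (simp_all add: L_def localization_def)

lemma frac_mult: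
  assumes a: "a \<in> carrier R" "s \<in> S" and b: "b \<in> carrier R" "t \<in> S"
  shows "fr a s \<otimes>\<^bsub>L\<^esub> fr b t = fr (a \<otimes> b) (s \<otimes> t)"
proof -
  have main: "fr (a' \<otimes> b') (s' \<otimes> t') = fr (a \<otimes> b) (s \<otimes> t)"
    if a': "(a', s') \<in> fr a s" and b': "(b', t') \<in> fr b t" for a' s' b' t'
  proof -
    obtain u where u: "a' \<in> carrier R" "s' \<in> S" "u \<in> S" "u \<otimes> (s' \<otimes> a) = u \<otimes> (s \<otimes> a')"
      using a' a by (auto simp: frac_mem)
    obtain v where v: "b' \<in> carrier R" "t' \<in> S" "v \<in> S" "v \<otimes> (t' \<otimes> b) = v \<otimes> (t \<otimes> b')"
      using b' b by (auto simp: frac_mem)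
    note cl = a(1) b(1) u(1) v(1) a(2)[THEN S_closed] b(2)[THEN S_closed] u(2,3)[THEN S_closed] v(2,3)[THEN S_closed]
    have "u \<otimes> v \<otimes> ((s \<otimes> t) \<otimes> (a' \<otimes> b')) = (u \<otimes> (s \<otimes> a')) \<otimes> (v \<otimes> (t \<otimes> b'))" using cl by (simp add: m_ac)
    also have "\<dots> = u \<otimes> v \<otimes> ((s' \<otimes> t') \<otimes> (a \<otimes> b))" unfolding u(4)[symmetric] v(4)[symmetric] using cl by (simp add: m_ac)
    finally have "u \<otimes> v \<otimes> ((s \<otimes> t) \<otimes> (a' \<otimes> b')) = u \<otimes> v \<otimes> ((s' \<otimes> t') \<otimes> (a \<otimes> b))" .
    moreover have "u \<otimes> v \<in> S" "s' \<otimes> t' \<in> S" "s \<otimes> t \<in> S" using a b u v by (auto intro: S_mult)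
    ultimately show ?thesis using cl by (subst frac_eq_iff) auto
  qed
  have L_op: "fr a s \<otimes>\<^bsub>L\<^esub> fr b t =
      (\<Union>(a', s')\<in>fr a s. \<Union>(b', t')\<in>fr b t. fr (a' \<otimes> b') (s' \<otimes> t'))"
    by (simp add: L_def localization_def)
  show ?thesis unfolding L_op by (rule UN_pairs_const[OF main frac_self[OF a] frac_self[OF b]])
qed

lemma frac_add:
  assumes a: "a \<in> carrier R" "s \<in> S" and b: "b \<in> carrier R" "t \<in> S"
  shows "fr a s \<oplus>\<^bsub>L\<^esub> fr b t = fr ((t \<otimes> a) \<oplus> (s \<otimes> b)) (s \<otimes> t)"
proof -
  have main: "fr ((t' \<otimes> a') \<oplus> (s' \<otimes> b')) (s' \<otimes> t') = fr ((t \<otimes> a) \<oplus> (s \<otimes> b)) (s \<otimes> t)"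
    if a': "(a', s') \<in> fr a s" and b': "(b', t') \<in> fr b t" for a' s' b' t'
  proof -
    obtain u where u: "a' \<in> carrier R" "s' \<in> S" "u \<in> S" "u \<otimes> (s' \<otimes> a) = u \<otimes> (s \<otimes> a')"
      using a' a by (auto simp: frac_mem)
    obtain v where v: "b' \<in> carrier R" "t' \<in> S" "v \<in> S" "v \<otimes> (t' \<otimes> b) = v \<otimes> (t \<otimes> b')"
      using b' b by (auto simp: frac_mem)
    note cl = a(1) b(1) u(1) v(1) a(2)[THEN S_closed] b(2)[THEN S_closed] u(2,3)[THEN S_closed] v(2,3)[THEN S_closed]
    have "u \<otimes> v \<otimes> ((s \<otimes> t) \<otimes> ((t' \<otimes> a') \<oplus> (s' \<otimes> b'))) =
        v \<otimes> t \<otimes> t' \<otimes> (u \<otimes> (s \<otimes> a')) \<oplus> u \<otimes> s \<otimes> s' \<otimes> (v \<otimes> (t \<otimes> b'))"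
      using cl by (simp add: m_ac r_distr)
    also have "\<dots> = u \<otimes> v \<otimes> ((s' \<otimes> t') \<otimes> ((t \<otimes> a) \<oplus> (s \<otimes> b)))"
      unfolding u(4)[symmetric] v(4)[symmetric] using cl by (simp add: m_ac r_distr)
    finally have "u \<otimes> v \<otimes> ((s \<otimes> t) \<otimes> ((t' \<otimes> a') \<oplus> (s' \<otimes> b'))) =
        u \<otimes> v \<otimes> ((s' \<otimes> t') \<otimes> ((t \<otimes> a) \<oplus> (s \<otimes> b)))" .
    moreover have "u \<otimes> v \<in> S" "s' \<otimes> t' \<in> S" "s \<otimes> t \<in> S" using a b u v by (auto intro: S_mult)
    ultimately show ?thesis using cl by (subst frac_eq_iff) auto
  qed
  have L_op: "fr a s \<oplus>\<^bsub>L\<^esub> fr b t =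
      (\<Union>(a', s')\<in>fr a s. \<Union>(b', t')\<in>fr b t. fr ((t' \<otimes> a') \<oplus> (s' \<otimes> b')) (s' \<otimes> t'))"
    by (simp add: L_def localization_def)
  show ?thesis unfolding L_op by (rule UN_pairs_const[OF main frac_self[OF a] frac_self[OF b]])
qed

section \<open>Units and ideals of the localization\<close>

sublocale L: cring L by (rule L_cring)

lemma frac_zero: "s \<in> S \<Longrightarrow> fr \<zero> s = \<zero>\<^bsub>L\<^esub>"
  unfolding L_zero using S_one S_closed by (subst frac_eq_iff) auto

lemma frac_inv:
  assumes "s \<in> S" "t \<in> S"
  shows "fr s t \<otimes>\<^bsub>L\<^esub> fr t s = \<one>\<^bsub>L\<^esub>"
proof -
  have "fr (s \<otimes> t) (t \<otimes> s) = fr \<one> \<one>"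
    using assms S_one S_mult S_closed by (subst frac_eq_iff) (auto simp: m_comm intro!: bexI[of _ \<one>])
  thus ?thesis using assms S_closed by (simp add: frac_mult L_one)
qed

lemma frac_split:
  assumes "a \<in> carrier R" "s \<in> S"
  shows "fr a s \<otimes>\<^bsub>L\<^esub> fr s \<one> = fr a \<one>" "fr a \<one> \<otimes>\<^bsub>L\<^esub> fr \<one> s = fr a s"
proof -
  have "fr (a \<otimes> s) (s \<otimes> \<one>) = fr a \<one>" "fr (a \<otimes> \<one>) (\<one> \<otimes> s) = fr a s"
    using assms S_one S_mult S_closed by (subst frac_eq_iff; auto simp: m_ac intro!: bexI[of _ \<one>])+
  thus "fr a s \<otimes>\<^bsub>L\<^esub> fr s \<one> = fr a \<one>" "fr a \<one> \<otimes>\<^bsub>L\<^esub> fr \<one> s = fr a s"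
    using assms S_one S_closed by (simp_all only: frac_mult one_closed)
qed

lemma frac_one_hom: "ring_hom_ring R L (\<lambda>a. fr a \<one>)"
proof (rule ring_hom_ringI)
  fix x y assume x: "x \<in> carrier R" "y \<in> carrier R"
  show "fr (x \<otimes> y) \<one> = fr x \<one> \<otimes>\<^bsub>L\<^esub> fr y \<one>" "fr (x \<oplus> y) \<one> = fr x \<one> \<oplus>\<^bsub>L\<^esub> fr y \<one>"
    using x S_one by (simp_all add: frac_mult frac_add)
qed (auto intro: frac_closed S_one ring_axioms L.ring_axioms simp: L_one)

lemma frac_ideal:
  assumes J: "ideal J R"
  shows "ideal {fr a s | a s. a \<in> J \<and> s \<in> S} L" (is "ideal ?J L")
proof -
  interpret J: ideal J R by (rule J)
  have JR: "a \<in> carrier R" if "a \<in> J" for a using that J.Icarr by simp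
  have mult: "fr b t \<otimes>\<^bsub>L\<^esub> fr a s \<in> ?J" if "a \<in> J" "s \<in> S" "b \<in> carrier R" "t \<in> S" for a s b t
  proof -
    have "b \<otimes> a \<in> J" "t \<otimes> s \<in> S" using that J.I_l_closed S_mult by auto
    thus ?thesis unfolding frac_mult[OF that(3,4) JR[OF that(1)] that(2)] by blast
  qed
  show ?thesis
  proof (rule idealI[OF L.ring_axioms])
    show "subgroup ?J (add_monoid L)"
    proof (rule group.subgroupI)
      show "Group.group (add_monoid L)" by (rule L.add.is_group)
      show "?J \<subseteq> carrier (add_monoid L)" using JR frac_closed by auto
      show "?J \<noteq> {}" using J.zero_closed S_one by blast
      fix x assume "x \<in> ?J"
      then obtain a s where a: "x = fr a s" "a \<in> J" "s \<in> S" by blast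
      have "\<ominus>\<^bsub>L\<^esub> x = fr (\<ominus> \<one>) \<one> \<otimes>\<^bsub>L\<^esub> fr a s"
      proof (rule L.minus_equality)
        have "fr (\<ominus> \<one>) \<one> \<otimes>\<^bsub>L\<^esub> fr a s \<oplus>\<^bsub>L\<^esub> x = fr (s \<otimes> (\<ominus> \<one> \<otimes> a) \<oplus> s \<otimes> a) (s \<otimes> s)"
          using a JR S_one S_closed by (simp add: frac_mult frac_add S_mult)
        also have "s \<otimes> (\<ominus> \<one> \<otimes> a) \<oplus> s \<otimes> a = \<zero>"
          using a JR S_closed by (simp add: l_minus r_minus l_neg)
        finally show "fr (\<ominus> \<one>) \<one> \<otimes>\<^bsub>L\<^esub> fr a s \<oplus>\<^bsub>L\<^esub> x = \<zero>\<^bsub>L\<^esub>" using a by (simp add: frac_zero S_mult)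
      qed (use a JR[OF a(2)] S_one in \<open>simp_all add: frac_closed\<close>)
      thus "inv\<^bsub>add_monoid L\<^esub> x \<in> ?J"
        using mult[OF a(2,3), of "\<ominus> \<one>" \<one>] S_one by (simp add: a_inv_def)
      fix y assume "y \<in> ?J"
      then obtain b t where b: "y = fr b t" "b \<in> J" "t \<in> S" by blast
      have "(t \<otimes> a) \<oplus> (s \<otimes> b) \<in> J" using a b S_closed J.I_l_closed J.a_closed by simp
      thus "x \<otimes>\<^bsub>add_monoid L\<^esub> y \<in> ?J"
        using a b JR frac_add[of a s b t] S_mult[of s t] by auto
    qed
  next
    fix a x assume "a \<in> ?J" "x \<in> carrier L"
    then obtain b t c r where b: "a = fr b t" "b \<in> J" "t \<in> S" "x = fr c r" "c \<in> carrier R" "r \<in> S"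
      by (auto simp: L_carrier)
    thus "x \<otimes>\<^bsub>L\<^esub> a \<in> ?J" using mult by simp
    thus "a \<otimes>\<^bsub>L\<^esub> x \<in> ?J" using b JR L.m_comm[of a x] frac_closed by simp
  qed
qed

lemma frac_mem_ideal:
  assumes J: "ideal J R" and x: "x \<in> carrier R" and m: "fr x \<one> \<in> {fr a s | a s. a \<in> J \<and> s \<in> S}"
  shows "\<exists>u\<in>S. u \<otimes> x \<in> J"
proof -
  interpret J: ideal J R by (rule J)
  obtain a s where a: "fr x \<one> = fr a s" "a \<in> J" "s \<in> S" using m by blast
  have aR: "a \<in> carrier R" using a J.Icarr by simp
  obtain u where u: "u \<in> S" "u \<otimes> (s \<otimes> x) = u \<otimes> (\<one> \<otimes> a)"
    using a x S_one aR by (auto simp: frac_eq_iff)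
  have "(u \<otimes> s) \<otimes> x = u \<otimes> a" using u a x aR S_closed by (simp add: m_assoc)
  moreover have "u \<otimes> a \<in> J" using J.I_l_closed a u S_closed by simp
  ultimately show ?thesis using S_mult[OF u(1) a(3)] by metis
qed

text \<open>A fraction outside this ideal has its numerator outside \<open>p\<close> and is
  therefore a unit.\<close>

lemma frac_maximal: "maximalideal {fr a s | a s. a \<in> p \<and> s \<in> S} L" (is "maximalideal ?m L")
proof (rule maximalidealI)
  show m: "ideal ?m L" by (rule frac_ideal) (rule is_ideal)
  have "fr \<one> \<one> \<notin> ?m"
  proof
    assume "fr \<one> \<one> \<in> ?m"
    from frac_mem_ideal[OF is_ideal one_closed this] show False by (auto simp: S_def)
  qed
  thus "carrier L \<noteq> ?m" using frac_closed[OF one_closed S_one] by blast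
  fix J assume J: "ideal J L" "?m \<subseteq> J" "J \<subseteq> carrier L"
  interpret J: ideal J L by (rule J)
  show "J = ?m \<or> J = carrier L"
  proof (cases "J \<subseteq> ?m")
    case False
    then obtain x where x: "x \<in> J" "x \<notin> ?m" by blast
    then obtain a s where a: "x = fr a s" "a \<in> carrier R" "s \<in> S" using J(3) by (auto simp: L_carrier)
    have "a \<in> S"
    proof (rule ccontr)
      assume "a \<notin> S"
      hence "a \<in> p" using a(2) by (simp add: S_def)
      thus False using x(2) a(1,3) by blast
    qed
    have "fr s a \<otimes>\<^bsub>L\<^esub> x \<in> J" by (rule J.I_l_closed[OF x(1) frac_closed[OF S_closed[OF a(3)] \<open>a \<in> S\<close>]])
    moreover have "fr s a \<otimes>\<^bsub>L\<^esub> x = \<one>\<^bsub>L\<^esub>" unfolding a(1) by (rule frac_inv[OF a(3) \<open>a \<in> S\<close>])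
    ultimately show ?thesis using J.one_imp_carrier by simp
  qed (use J in blast)
qed

text \<open>a/s and a/1 differ by a unit, so an ideal of the localization is determined by its
  contraction.\<close>

lemma vimage_strict:
  assumes P: "ideal P L" "ideal P' L" "P \<subset> P'"
  shows "{r \<in> carrier R. fr r \<one> \<in> P} \<subset> {r \<in> carrier R. fr r \<one> \<in> P'}"
proof -
  interpret P: ideal P L by (rule P(1))
  interpret P': ideal P' L by (rule P(2))
  obtain x where x: "x \<in> P'" "x \<notin> P" using P by blast
  then obtain a s where a: "x = fr a s" "a \<in> carrier R" "s \<in> S" using P'.Icarr[OF x(1)] by (auto simp: L_carrier)
  have "fr a \<one> \<in> P'" unfolding frac_split(1)[OF a(2,3), symmetric]
    using P'.I_r_closed[OF x(1) frac_closed[OF S_closed[OF a(3)] S_one]] unfolding a(1) .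
  moreover have "fr a \<one> \<notin> P"
  proof
    assume "fr a \<one> \<in> P"
    hence "fr a \<one> \<otimes>\<^bsub>L\<^esub> fr \<one> s \<in> P" using P.I_r_closed frac_closed[OF one_closed a(3)] by blast
    thus False using x a frac_split(2)[OF a(2,3)] by simp
  qed
  ultimately show ?thesis using P a by blast
qed

lemma vimage_subset:
  assumes P: "primeideal P L"
  shows "{r \<in> carrier R. fr r \<one> \<in> P} \<subseteq> p"
proof (rule ccontr)
  interpret P: primeideal P L by (rule P)
  assume "\<not> ?thesis"
  then obtain s where s: "s \<in> S" "fr s \<one> \<in> P" by (auto simp: S_def)
  hence "\<one>\<^bsub>L\<^esub> \<in> P" using frac_inv[OF s(1) S_one] P.I_r_closed[OF s(2) frac_closed[OF one_closed s(1)]] by simp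
  thus False using P.one_imp_carrier P.I_notcarr by simp
qed

text \<open>The number d links the two halves of regularity: it is the size of a generating set of
  the maximal ideal and, as the Krull dimension, the length of an actual chain of primes. Both are
  contracted to the original ring.\<close>

lemma regular_chain_generators:
  assumes reg: "regular_local_ring L"
  shows "\<exists>d P Y. (\<forall>i\<le>d. primeideal (P i) R \<and> P i \<subseteq> p) \<and> (\<forall>i<d. P i \<subset> P (Suc i)) \<and>
    Y \<subseteq> p \<and> finite Y \<and> card Y \<le> (d::nat) \<and> (\<forall>x\<in>p. \<exists>u\<in>carrier R - p. u \<otimes> x \<in> Idl Y)"
proof -
  define m where "m = {fr a s | a s. a \<in> p \<and> s \<in> S}"
  have m: "maximalideal m L" unfolding m_def by (rule frac_maximal)
  obtain G where G: "G \<subseteq> m" "finite G" "Idl\<^bsub>L\<^esub> G = m" "enat (card G) = krull_dim L"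
    using reg m unfolding regular_local_ring_def by blast
  define d where "d = card G"
  define A where "A = {enat l | l (P :: nat \<Rightarrow> _ set). (\<forall>i\<le>l. primeideal (P i) L) \<and> (\<forall>i<l. P i \<subset> P (Suc i))}"
  have "enat 0 \<in> A" unfolding A_def using L.maximalideal_prime[OF m]
    by (intro CollectI exI[of _ 0] exI[of _ "\<lambda>_. m"]) simp
  hence A: "A \<noteq> {}" by blast
  \<comment> \<open>A finite supremum of a nonempty set in \<open>enat\<close> is attained, so a
    chain of length exactly d exists; the chain consisting of \<open>m\<close> alone shows
    nonemptiness.\<close>
  have "Sup A = enat d" using G(4) by (simp add: d_def A_def krull_dim_def)
  hence "finite A \<and> Max A = enat d" using A unfolding Sup_enat_def by (auto split: if_splits)
  hence "enat d \<in> A" using Max_in[of A] A by metis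
  then obtain P :: "nat \<Rightarrow> ('a \<times> 'a) set set" where P: "\<forall>i\<le>d. primeideal (P i) L" "\<forall>i<d. P i \<subset> P (Suc i)"
    unfolding A_def by auto
  interpret h: ring_hom_ring R L "\<lambda>a. fr a \<one>" by (rule frac_one_hom)
  define P' where "P' i = {r \<in> carrier R. fr r \<one> \<in> P i}" for i
  have P'1: "\<forall>i\<le>d. primeideal (P' i) R \<and> P' i \<subseteq> p"
    using P(1) vimage_subset h.primeideal_vimage[OF cring_axioms] unfolding P'_def by blast
  have P'2: "\<forall>i<d. P' i \<subset> P' (Suc i)"
  proof (intro allI impI)
    fix i assume i: "i < d"
    have *: "ideal (P i) L" "ideal (P (Suc i)) L" using P(1) i by (auto simp: primeideal_def)
    have "P i \<subset> P (Suc i)" using P(2) i by blast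
    from vimage_strict[OF * this] show "P' i \<subset> P' (Suc i)" unfolding P'_def .
  qed
  \<comment> \<open>Numerators generate the same ideal, denominators being units. Two generators may
    get the same numerator, hence only an upper bound on the number.\<close>
  have "\<forall>y\<in>G. \<exists>a. a \<in> p \<and> (\<exists>s\<in>S. y = fr a s)" using G(1) by (auto simp: m_def)
  from bchoice[OF this] obtain num where num: "\<forall>y\<in>G. num y \<in> p \<and> (\<exists>s\<in>S. y = fr (num y) s)" ..
  define Y where "Y = num ` G"
  have Y: "Y \<subseteq> p" "finite Y" "card Y \<le> d"
    using num G(2) card_image_le[OF G(2)] by (auto simp: Y_def d_def)
  have YR: "Y \<subseteq> carrier R" using Y(1) Icarr by blast
  have gen: "\<exists>u\<in>carrier R - p. u \<otimes> x \<in> Idl Y" if x: "x \<in> p" for x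
  proof -
    have I: "ideal (Idl Y) R" by (rule genideal_ideal[OF YR])
    have "G \<subseteq> {fr a s | a s. a \<in> Idl Y \<and> s \<in> S}"
    proof
      fix y assume y: "y \<in> G"
      have "num y \<in> Idl Y" using genideal_self[OF YR] y by (auto simp: Y_def)
      thus "y \<in> {fr a s | a s. a \<in> Idl Y \<and> s \<in> S}" using num y by blast
    qed
    hence "m \<subseteq> {fr a s | a s. a \<in> Idl Y \<and> s \<in> S}"
      using L.genideal_minimal[OF frac_ideal[OF I]] G(3) by blast
    moreover have "fr x \<one> \<in> m" using x S_one by (auto simp: m_def)
    ultimately show ?thesis using frac_mem_ideal[OF I Icarr[OF x]] by (auto simp: S_def)
  qed
  show ?thesis using P'1 P'2 Y gen
    by (intro exI[of _ d] exI[of _ P'] exI[of _ Y]) blast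
qed

end

section \<open>Kaehler differentials and derivations of a hypersurface\<close>

context kalgebra
begin

abbreviation "T \<equiv> derivations R s"

lemma TD:
  assumes "D \<in> carrier T"
  shows "a \<in> carrier R \<Longrightarrow> D a \<in> carrier R"
    and "a \<in> carrier R \<Longrightarrow> b \<in> carrier R \<Longrightarrow> D (a \<oplus> b) = D a \<oplus> D b"
    and "a \<in> carrier R \<Longrightarrow> D (s c \<otimes> a) = s c \<otimes> D a"
    and "a \<in> carrier R \<Longrightarrow> b \<in> carrier R \<Longrightarrow> D (a \<otimes> b) = (a \<otimes> D b) \<oplus> (b \<otimes> D a)"
    and "D \<in> extensional (carrier R)"
  using assms by (auto simp: derivations_def PiE_def)

lemma TI:
  assumes "\<And>a. a \<in> carrier R \<Longrightarrow> D a \<in> carrier R"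
    and "\<And>a b. a \<in> carrier R \<Longrightarrow> b \<in> carrier R \<Longrightarrow> D (a \<oplus> b) = D a \<oplus> D b"
    and "\<And>c a. a \<in> carrier R \<Longrightarrow> D (s c \<otimes> a) = s c \<otimes> D a"
    and "\<And>a b. a \<in> carrier R \<Longrightarrow> b \<in> carrier R \<Longrightarrow> D (a \<otimes> b) = (a \<otimes> D b) \<oplus> (b \<otimes> D a)"
    and "D \<in> extensional (carrier R)"
  shows "D \<in> carrier T"
  using assms by (simp add: derivations_def PiE_def)

lemma T_simps:
  "a \<in> carrier R \<Longrightarrow> (D \<oplus>\<^bsub>T\<^esub> D') a = D a \<oplus> D' a"
  "a \<in> carrier R \<Longrightarrow> (r \<odot>\<^bsub>T\<^esub> D) a = r \<otimes> D a"
  "a \<in> carrier R \<Longrightarrow> \<zero>\<^bsub>T\<^esub> a = \<zero>"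
  "D \<oplus>\<^bsub>T\<^esub> D' \<in> extensional (carrier R)" "r \<odot>\<^bsub>T\<^esub> D \<in> extensional (carrier R)" "\<zero>\<^bsub>T\<^esub> \<in> extensional (carrier R)"
  by (simp_all add: derivations_def)

lemma T_eqI:
  assumes "D \<in> extensional (carrier R)" "D' \<in> extensional (carrier R)" "\<And>a. a \<in> carrier R \<Longrightarrow> D a = D' a"
  shows "D = D'"
  by (rule extensionalityI[OF assms])

lemma T_add_closed: "D \<in> carrier T \<Longrightarrow> D' \<in> carrier T \<Longrightarrow> D \<oplus>\<^bsub>T\<^esub> D' \<in> carrier T"
  by (rule TI) (auto simp: T_simps TD r_distr a_ac)

lemma T_smult_closed: "r \<in> carrier R \<Longrightarrow> D \<in> carrier T \<Longrightarrow> r \<odot>\<^bsub>T\<^esub> D \<in> carrier T"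
proof (rule TI)
  fix c a assume "r \<in> carrier R" "D \<in> carrier T" "a \<in> carrier R"
  thus "(r \<odot>\<^bsub>T\<^esub> D) (s c \<otimes> a) = s c \<otimes> (r \<odot>\<^bsub>T\<^esub> D) a" by (simp add: T_simps TD(1,3) m_lcomm)
qed (auto simp: T_simps TD r_distr m_ac)

lemma T_zero_closed: "\<zero>\<^bsub>T\<^esub> \<in> carrier T"
  by (rule TI) (auto simp: T_simps)

sublocale T: module R T
proof (rule moduleI)
  show "abelian_group T"
  proof (rule abelian_groupI)
    fix D assume D: "D \<in> carrier T"
    show "\<exists>D'\<in>carrier T. D' \<oplus>\<^bsub>T\<^esub> D = \<zero>\<^bsub>T\<^esub>"
    proof (rule bexI)
      show "(\<ominus> \<one>) \<odot>\<^bsub>T\<^esub> D \<in> carrier T" by (rule T_smult_closed[OF _ D]) simp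
      show "(\<ominus> \<one>) \<odot>\<^bsub>T\<^esub> D \<oplus>\<^bsub>T\<^esub> D = \<zero>\<^bsub>T\<^esub>"
        by (rule T_eqI) (simp_all add: T_simps TD[OF D] l_minus l_neg)
    qed
  qed (auto intro!: T_add_closed T_zero_closed T_eqI simp: T_simps TD a_ac)
qed (auto intro!: T_smult_closed T_add_closed T_eqI is_cring simp: T_simps TD l_distr r_distr m_assoc)

end

text \<open>One set of data for both modules. For differentials, the dx_l are generators and the
  \<open>\<delta> l\<close> give the functionals; for derivations the \<open>\<delta> l\<close> are
  generators and evaluation at x_l is the functional, which exchanges f and g.\<close>

locale derivation_frame = kalgebra R s for R :: "('a, 'r) ring_scheme" (structure) and s :: "'k::field_char_0 \<Rightarrow> 'a" +
  fixes n :: nat and x f g :: "nat \<Rightarrow> 'a" and \<delta> :: "nat \<Rightarrow> 'a \<Rightarrow> 'a"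
  assumes n_pos: "n > 0"
    and x_closed: "l < n \<Longrightarrow> x l \<in> carrier R"
    and f_closed: "l < n \<Longrightarrow> f l \<in> carrier R" and g_closed: "l < n \<Longrightarrow> g l \<in> carrier R"
    and fg: "(\<Oplus> l\<in>{..<n}. f l \<otimes> g l) = \<one>"
    and \<delta>_addmap: "l < n \<Longrightarrow> addmap R R (\<delta> l)"
    and \<delta>_mult: "l < n \<Longrightarrow> a \<in> carrier R \<Longrightarrow> b \<in> carrier R \<Longrightarrow> \<delta> l (a \<otimes> b) = a \<otimes> \<delta> l b \<oplus> b \<otimes> \<delta> l a"
    and \<delta>_scalar: "l < n \<Longrightarrow> \<delta> l (s c) = \<zero>"
    and \<delta>_x: "l < n \<Longrightarrow> j < n \<Longrightarrow> \<delta> l (x j) = (if l = j then \<one> else \<zero>) \<ominus> f l \<otimes> g j"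
    and dK_expand: "a \<in> carrier R \<Longrightarrow> dK a = (\<Oplus>\<^bsub>\<Omega>\<^esub> l\<in>{..<n}. \<delta> l a \<odot>\<^bsub>\<Omega>\<^esub> dK (x l))"
    and derivation_expand: "D \<in> carrier (derivations R s) \<Longrightarrow> a \<in> carrier R \<Longrightarrow>
      D a = (\<Oplus> l\<in>{..<n}. D (x l) \<otimes> \<delta> l a)"
begin

lemmas \<delta>_closed = addmap_closed[OF \<delta>_addmap]

text \<open>Contraction of one-forms with the derivation \<open>\<delta> l\<close>.\<close>

definition pairing :: "nat \<Rightarrow> ('a \<Rightarrow> 'a) set \<Rightarrow> 'a" where
  "pairing l = kahler_lift R (\<lambda>b a. a \<otimes> \<delta> l b)"

lemma
  assumes l: "l < n"
  shows pairing_addmap: "addmap \<Omega> R (pairing l)"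
    and pairing_gen: "a \<in> carrier R \<Longrightarrow> b \<in> carrier R \<Longrightarrow> pairing l (a \<odot>\<^bsub>\<Omega>\<^esub> dK b) = a \<otimes> \<delta> l b"
proof -
  have 1: "addmap R R (\<lambda>a. a \<otimes> \<delta> l b)" if "b \<in> carrier R" for b
    using \<delta>_closed[OF l that] by (auto intro!: addmapI simp: l_distr)
  have 2: "c \<otimes> \<delta> l (a \<oplus> b) = c \<otimes> \<delta> l a \<oplus> c \<otimes> \<delta> l b" if "a \<in> carrier R" "b \<in> carrier R" "c \<in> carrier R" for a b c
    using that \<delta>_closed[OF l] by (simp add: addmap_add[OF \<delta>_addmap[OF l]] r_distr)
  have 3: "c \<otimes> \<delta> l (a \<otimes> b) = (c \<otimes> a) \<otimes> \<delta> l b \<oplus> (c \<otimes> b) \<otimes> \<delta> l a" if "a \<in> carrier R" "b \<in> carrier R" "c \<in> carrier R" for a b c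
    using that \<delta>_closed[OF l] by (simp add: \<delta>_mult[OF l] r_distr m_assoc)
  have 4: "c \<otimes> \<delta> l (s k) = \<zero>" if "c \<in> carrier R" for c k
    using that by (simp add: \<delta>_scalar[OF l])
  show "addmap \<Omega> R (pairing l)" unfolding pairing_def
    by (rule kahler_lift_addmap[OF abelian_group_axioms 1 2 3 4])
  show "pairing l (a \<odot>\<^bsub>\<Omega>\<^esub> dK b) = a \<otimes> \<delta> l b" if "a \<in> carrier R" "b \<in> carrier R" unfolding pairing_def
    by (rule kahler_lift_gen[OF abelian_group_axioms 1 2 3 4 that])
qed

lemma pairing_smult:
  assumes l: "l < n" and r: "r \<in> carrier R" and X: "X \<in> carrier \<Omega>"
  shows "pairing l (r \<odot>\<^bsub>\<Omega>\<^esub> X) = r \<otimes> pairing l X"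
  using X
proof (induction rule: kahler_induct)
  case (gen a b)
  have "r \<odot>\<^bsub>\<Omega>\<^esub> (a \<odot>\<^bsub>\<Omega>\<^esub> dK b) = (r \<otimes> a) \<odot>\<^bsub>\<Omega>\<^esub> dK b" using gen r by (simp add: \<Omega>.smult_assoc1)
  thus ?case using gen r \<delta>_closed[OF l] by (simp add: pairing_gen[OF l] m_assoc)
next
  case (add X Y)
  thus ?case using r addmap_closed[OF pairing_addmap[OF l]]
    by (simp add: \<Omega>.smult_r_distr addmap_add[OF pairing_addmap[OF l]] r_distr)
qed

lemma pairing_expand:
  assumes X: "X \<in> carrier \<Omega>"
  shows "X = (\<Oplus>\<^bsub>\<Omega>\<^esub> l\<in>{..<n}. pairing l X \<odot>\<^bsub>\<Omega>\<^esub> dK (x l))"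
  using X
proof (induction rule: kahler_induct)
  case (gen a b)
  have "a \<odot>\<^bsub>\<Omega>\<^esub> dK b = (\<Oplus>\<^bsub>\<Omega>\<^esub> l\<in>{..<n}. a \<odot>\<^bsub>\<Omega>\<^esub> (\<delta> l b \<odot>\<^bsub>\<Omega>\<^esub> dK (x l)))"
    unfolding dK_expand[OF gen(2)] using gen \<delta>_closed x_closed
    by (intro \<Omega>.finsum_smult_ldistr) auto
  also have "\<dots> = (\<Oplus>\<^bsub>\<Omega>\<^esub> l\<in>{..<n}. pairing l (a \<odot>\<^bsub>\<Omega>\<^esub> dK b) \<odot>\<^bsub>\<Omega>\<^esub> dK (x l))"
    using gen \<delta>_closed x_closed
    by (intro \<Omega>.M.finsum_cong') (auto simp: pairing_gen \<Omega>.smult_assoc1)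
  finally show ?case .
next
  case (add X Y)
  have c: "pairing l Z \<odot>\<^bsub>\<Omega>\<^esub> dK (x l) \<in> carrier \<Omega>" if "l < n" "Z \<in> carrier \<Omega>" for l Z
    using that addmap_closed[OF pairing_addmap] x_closed by simp
  have "X \<oplus>\<^bsub>\<Omega>\<^esub> Y = (\<Oplus>\<^bsub>\<Omega>\<^esub> l\<in>{..<n}. pairing l X \<odot>\<^bsub>\<Omega>\<^esub> dK (x l)) \<oplus>\<^bsub>\<Omega>\<^esub>
      (\<Oplus>\<^bsub>\<Omega>\<^esub> l\<in>{..<n}. pairing l Y \<odot>\<^bsub>\<Omega>\<^esub> dK (x l))"
    using add(3,4) by (rule arg_cong2)
  also have "\<dots> = (\<Oplus>\<^bsub>\<Omega>\<^esub> l\<in>{..<n}. pairing l X \<odot>\<^bsub>\<Omega>\<^esub> dK (x l) \<oplus>\<^bsub>\<Omega>\<^esub> pairing l Y \<odot>\<^bsub>\<Omega>\<^esub> dK (x l))"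
    using c add(1,2) by (intro \<Omega>.M.finsum_addf[symmetric]) auto
  also have "\<dots> = (\<Oplus>\<^bsub>\<Omega>\<^esub> l\<in>{..<n}. pairing l (X \<oplus>\<^bsub>\<Omega>\<^esub> Y) \<odot>\<^bsub>\<Omega>\<^esub> dK (x l))"
    using c add(1,2) x_closed addmap_closed[OF pairing_addmap]
    by (intro \<Omega>.M.finsum_cong') (auto simp: addmap_add[OF pairing_addmap] \<Omega>.smult_l_distr)
  finally show ?case .
qed

lemma kahler_stably_trivial:
  "stably_trivial R s \<Omega> n (\<lambda>l. dK (x l)) (\<lambda>l. \<lambda>X\<in>carrier \<Omega>. pairing l X) f g"
proof (intro stably_trivial.intro dual_based.intro dual_based_axioms.intro stably_trivial_axioms.intro)
  have "(\<lambda>X\<in>carrier \<Omega>. pairing l X) \<in> module_hom R \<Omega> (ring_module R)" if l: "l < n" for l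
    by (rule module_homI)
      (auto simp: ring_module_def addmap_closed[OF pairing_addmap[OF l]] addmap_add[OF pairing_addmap[OF l]] pairing_smult[OF l])
  thus "dual_basis R \<Omega> n (\<lambda>l. dK (x l)) (\<lambda>l. \<lambda>X\<in>carrier \<Omega>. pairing l X)"
    using x_closed pairing_expand unfolding dual_basis_def by simp
  fix l j assume lj: "l < n" "j < n"
  have "pairing l (dK (x j)) = \<delta> l (x j)"
    using pairing_gen[OF lj(1) one_closed x_closed[OF lj(2)]] \<delta>_closed[OF lj(1) x_closed[OF lj(2)]] lj x_closed
    by (simp add: \<Omega>.smult_one)
  thus "(\<lambda>X\<in>carrier \<Omega>. pairing l X) (dK (x j)) = (if l = j then \<one> else \<zero>) \<ominus> f l \<otimes> g j"
    using \<delta>_x lj x_closed by simp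
qed (use n_pos f_closed g_closed fg kalgebra_axioms \<Omega>.module_axioms in auto)

lemma delta_mem: "l < n \<Longrightarrow> (\<lambda>a\<in>carrier R. \<delta> l a) \<in> carrier T"
  by (rule TI) (auto simp: \<delta>_closed addmap_add[OF \<delta>_addmap] \<delta>_mult \<delta>_scalar)

text \<open>The l-th functional takes the j-th generator to \<open>\<delta> j (x l)\<close>, the
  transpose of the matrix for differentials; hence the swap of f and g.\<close>

lemma derivations_stably_trivial:
  "stably_trivial R s T n (\<lambda>l. \<lambda>a\<in>carrier R. \<delta> l a) (\<lambda>l. \<lambda>D\<in>carrier T. D (x l)) g f"
proof (intro stably_trivial.intro dual_based.intro dual_based_axioms.intro stably_trivial_axioms.intro)
  have hom: "(\<lambda>D\<in>carrier T. D (x l)) \<in> module_hom R T (ring_module R)" if l: "l < n" for l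
    by (rule module_homI) (auto simp: ring_module_def TD(1) T_simps x_closed[OF l])
  have expand: "D = (\<Oplus>\<^bsub>T\<^esub> l\<in>{..<n}. D (x l) \<odot>\<^bsub>T\<^esub> (\<lambda>a\<in>carrier R. \<delta> l a))" (is "_ = ?S")
    if D: "D \<in> carrier T" for D
  proof (rule T_eqI[OF TD(5)[OF D]])
    have c: "(\<lambda>l. D (x l) \<odot>\<^bsub>T\<^esub> (\<lambda>a\<in>carrier R. \<delta> l a)) \<in> {..<n} \<rightarrow> carrier T"
      using D delta_mem x_closed by (auto intro: T_smult_closed TD(1))
    have S: "?S \<in> carrier T" by (rule T.M.finsum_closed[OF c])
    thus "?S \<in> extensional (carrier R)" by (rule TD(5))
    fix a assume a: "a \<in> carrier R"
    have ev: "addmap T R (\<lambda>D. D a)" by (rule addmapI) (auto simp: TD(1) T_simps a)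
    have "?S a = (\<Oplus> l\<in>{..<n}. (D (x l) \<odot>\<^bsub>T\<^esub> (\<lambda>a\<in>carrier R. \<delta> l a)) a)"
      by (rule addmap_finsum[OF T.M.abelian_group_axioms abelian_group_axioms ev c])
    also have "\<dots> = D a"
      unfolding derivation_expand[OF D a] using a by (simp add: T_simps)
    finally show "D a = ?S a" ..
  qed
  show "dual_basis R T n (\<lambda>l. \<lambda>a\<in>carrier R. \<delta> l a) (\<lambda>l. \<lambda>D\<in>carrier T. D (x l))"
    unfolding dual_basis_def using delta_mem hom expand by simp
  fix l j assume lj: "l < n" "j < n"
  show "(\<lambda>D\<in>carrier T. D (x l)) (\<lambda>a\<in>carrier R. \<delta> j a) = (if l = j then \<one> else \<zero>) \<ominus> g l \<otimes> f j"
    using \<delta>_x[OF lj(2,1)] lj x_closed f_closed g_closed delta_mem by (simp add: m_comm)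
next
  show "(\<Oplus> l\<in>{..<n}. g l \<otimes> f l) = \<one>"
    using fg f_closed g_closed by (simp add: m_comm cong: finsum_cong)
qed (use n_pos f_closed g_closed kalgebra_axioms T.module_axioms in auto)

end

text \<open>Lets a derivation of the ring be treated as a derivation with values in a module, as
  \<open>tangent_expand\<close> requires.\<close>

lemma (in cring) ring_module_module: "module R (ring_module R)"
proof (rule moduleI)
  show "abelian_group (ring_module R)"
  proof (rule abelian_groupI)
    fix x assume "x \<in> carrier (ring_module R)"
    thus "\<exists>y\<in>carrier (ring_module R). y \<oplus>\<^bsub>ring_module R\<^esub> x = \<zero>\<^bsub>ring_module R\<^esub>"
      by (intro bexI[of _ "\<ominus> x"]) (auto simp: ring_module_def l_neg)
  qed (simp_all add: ring_module_def a_ac)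
qed (simp_all add: ring_module_def is_cring l_distr r_distr m_assoc)

section \<open>The coordinate ring of a hypersurface\<close>

locale hypersurface =
  fixes n :: nat and f :: "'k::field_char_0 mpoly"
  assumes f_mem: "f \<in> polys_in {..<n}"
begin

abbreviation "PR \<equiv> poly_ring n :: 'k mpoly ring"
abbreviation "Rn \<equiv> polys_in {..<n} :: 'k mpoly set"
abbreviation "A \<equiv> hypersurface_ring n f"
abbreviation "sc \<equiv> hypersurface_scalar n f"

definition cls :: "'k mpoly \<Rightarrow> 'k mpoly set" where
  "cls p = (PIdl\<^bsub>PR\<^esub> f) +>\<^bsub>PR\<^esub> p"

lemma PR_simps [simp]:
  "carrier PR = Rn" "p \<otimes>\<^bsub>PR\<^esub> q = p * q" "\<one>\<^bsub>PR\<^esub> = 1" "p \<oplus>\<^bsub>PR\<^esub> q = p + q" "\<zero>\<^bsub>PR\<^esub> = 0"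
  by (simp_all add: poly_ring_def polys_in_def)

sublocale PR: cring PR
proof (rule cringI)
  show "abelian_group PR"
  proof (rule abelian_groupI)
    fix p assume "p \<in> carrier PR"
    thus "\<exists>q\<in>carrier PR. q \<oplus>\<^bsub>PR\<^esub> p = \<zero>\<^bsub>PR\<^esub>"
      by (intro bexI[of _ "- p"]) (auto intro: polys_in_uminus)
  qed (auto intro: polys_in_add)
  show "Group.comm_monoid PR"
    by (rule comm_monoidI) (auto intro: polys_in_mult simp: mult_ac)
qed (simp add: distrib_right)

lemma PR_minus: "p \<in> Rn \<Longrightarrow> q \<in> Rn \<Longrightarrow> p \<ominus>\<^bsub>PR\<^esub> q = p - q"
  using PR.minus_equality[of "- q" q] polys_in_uminus[of q "{..<n}"] by (simp add: a_minus_def)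

lemma I_ideal: "ideal (PIdl\<^bsub>PR\<^esub> f) PR"
  by (rule PR.cgenideal_ideal) (simp add: f_mem)

lemma A_cring: "cring A"
  unfolding hypersurface_ring_def by (rule ideal.quotient_is_cring[OF I_ideal PR.is_cring])

sublocale A: cring A by (rule A_cring)

sublocale cls: ring_hom_ring PR A cls
  using ideal.rcos_ring_hom_ring[OF I_ideal] by (simp add: hypersurface_ring_def cls_def[abs_def])

lemma A_carrier: "carrier A = cls ` Rn"
  by (auto simp: hypersurface_ring_def FactRing_def A_RCOSETS_def' cls_def)

lemma cls_closed [simp, intro]: "p \<in> Rn \<Longrightarrow> cls p \<in> carrier A"
  using cls.hom_closed by simp

lemma cls_add: "p \<in> Rn \<Longrightarrow> q \<in> Rn \<Longrightarrow> cls (p + q) = cls p \<oplus>\<^bsub>A\<^esub> cls q"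
  and cls_mult: "p \<in> Rn \<Longrightarrow> q \<in> Rn \<Longrightarrow> cls (p * q) = cls p \<otimes>\<^bsub>A\<^esub> cls q"
  and cls_one: "cls 1 = \<one>\<^bsub>A\<^esub>" and cls_zero: "cls 0 = \<zero>\<^bsub>A\<^esub>"
  using cls.hom_add[of p q] cls.hom_mult[of p q] cls.hom_one cls.hom_zero by simp_all

lemma cls_eq_iff:
  assumes "p \<in> Rn" "q \<in> Rn"
  shows "cls p = cls q \<longleftrightarrow> (\<exists>x\<in>Rn. p - q = x * f)"
  using PR.quotient_eq_iff_same_a_r_cos[OF I_ideal, of p q] assms
  by (auto simp: cls_def PR_minus cgenideal_def)

lemma cls_f: "cls f = \<zero>\<^bsub>A\<^esub>"
  unfolding cls_zero[symmetric] using cls_eq_iff[OF f_mem, of 0] by (auto intro!: bexI[of _ 1])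

lemma cls_diff: "p \<in> Rn \<Longrightarrow> q \<in> Rn \<Longrightarrow> cls (p - q) = cls p \<ominus>\<^bsub>A\<^esub> cls q"
  using cls_add[of "p - q" q] by (simp add: polys_in_diff A.minus_eq A.a_assoc A.r_neg)

lemma cls_sum:
  assumes "\<And>i. i \<in> S \<Longrightarrow> h i \<in> Rn" "finite S"
  shows "cls (sum h S) = (\<Oplus>\<^bsub>A\<^esub> i\<in>S. cls (h i))"
  using assms(2,1) by (induction S) (auto simp: cls_zero cls_add polys_in_sum)

lemma sc_eq: "sc c = cls (mpoly_const c)"
  by (simp add: hypersurface_scalar_def cls_def)

subsection \<open>The gradient of a regular hypersurface\<close>

text \<open>The ideal generated by \<open>f\<close> and a family, with explicit coefficients. It
  serves for the partial derivatives of f and, with \<open>h\<close> the identity, for lifts of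
  local generators.\<close>

definition combinations :: "'i set \<Rightarrow> ('i \<Rightarrow> 'k mpoly) \<Rightarrow> 'k mpoly set" where
  "combinations Y h = {q. \<exists>a b. (\<forall>y\<in>Y. a y \<in> Rn) \<and> b \<in> Rn \<and> q = (\<Sum>y\<in>Y. a y * h y) + b * f}"

lemma combinationsI: "(\<And>y. y \<in> Y \<Longrightarrow> a y \<in> Rn) \<Longrightarrow> b \<in> Rn \<Longrightarrow> (\<Sum>y\<in>Y. a y * h y) + b * f \<in> combinations Y h"
  unfolding combinations_def by blast

lemma combinations_gen:
  assumes "finite Y" "y \<in> Y"
  shows "h y \<in> combinations Y h"
proof -
  have "(\<Sum>z\<in>Y. (if z = y then 1 else 0) * h z) = (\<Sum>z\<in>Y. if z = y then h z else 0)"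
    by (rule sum.cong) auto
  hence "h y = (\<Sum>z\<in>Y. (if z = y then 1 else 0) * h z) + 0 * f" using assms by simp
  also have "\<dots> \<in> combinations Y h" by (rule combinationsI) auto
  finally show ?thesis .
qed

lemma combinations_ideal:
  assumes h: "\<And>y. y \<in> Y \<Longrightarrow> h y \<in> Rn"
  shows "ideal (combinations Y h) PR"
proof -
  have sub: "combinations Y h \<subseteq> Rn"
    unfolding combinations_def using h f_mem by (auto intro!: polys_in_add polys_in_sum polys_in_mult)
  have add: "p + q \<in> combinations Y h" if pq: "p \<in> combinations Y h" "q \<in> combinations Y h" for p q
  proof -
    obtain a b a' b' where a: "\<forall>y\<in>Y. a y \<in> Rn" "b \<in> Rn" "p = (\<Sum>y\<in>Y. a y * h y) + b * f"
      "\<forall>y\<in>Y. a' y \<in> Rn" "b' \<in> Rn" "q = (\<Sum>y\<in>Y. a' y * h y) + b' * f"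
      using pq unfolding combinations_def by blast
    have "p + q = (\<Sum>y\<in>Y. (a y + a' y) * h y) + (b + b') * f"
      unfolding a(3,6) by (simp add: distrib_right sum.distrib)
    also have "\<dots> \<in> combinations Y h" using a by (intro combinationsI) (auto intro: polys_in_add)
    finally show ?thesis .
  qed
  have mult: "r * p \<in> combinations Y h" if p: "p \<in> combinations Y h" "r \<in> Rn" for p r
  proof -
    obtain a b where a: "\<forall>y\<in>Y. a y \<in> Rn" "b \<in> Rn" "p = (\<Sum>y\<in>Y. a y * h y) + b * f"
      using p unfolding combinations_def by blast
    have "r * p = (\<Sum>y\<in>Y. (r * a y) * h y) + (r * b) * f"
      unfolding a(3) by (simp add: distrib_left sum_distrib_left mult_ac)
    also have "\<dots> \<in> combinations Y h" using a p by (intro combinationsI) (auto intro: polys_in_mult)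
    finally show ?thesis .
  qed
  show ?thesis
  proof (rule idealI[OF PR.ring_axioms])
    show "subgroup (combinations Y h) (add_monoid PR)"
    proof (rule PR.add.subgroupI)
      show "combinations Y h \<noteq> {}" using combinationsI[of Y "\<lambda>_. 0" 0 h] by auto
      fix p assume p: "p \<in> combinations Y h"
      have "\<ominus>\<^bsub>PR\<^esub> p = (- 1) * p"
        using p sub PR.minus_equality[of "- p" p] polys_in_uminus[of p "{..<n}"] by auto
      thus "\<ominus>\<^bsub>PR\<^esub> p \<in> combinations Y h" using mult[OF p, of "- 1"] polys_in_uminus[of 1 "{..<n}"] by simp
    qed (use sub add in auto)
  qed (use mult in \<open>auto simp: mult.commute\<close>)
qed

lemma cls_image_ideal: "ideal J PR \<Longrightarrow> ideal (cls ` J) A"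
  using PR.ring_ideal_imp_quot_ideal[OF I_ideal] by (simp add: hypersurface_ring_def cls_def[abs_def])

text \<open>Multiples of \<open>f\<close> belong to the ideal, so membership can be tested in the
  quotient ring.\<close>

lemma cls_in_combinations:
  assumes p: "p \<in> Rn" "cls p \<in> cls ` combinations Y h" and h: "\<And>y. y \<in> Y \<Longrightarrow> h y \<in> Rn"
  shows "p \<in> combinations Y h"
proof -
  obtain q where q: "q \<in> combinations Y h" "cls p = cls q" using p by blast
  then obtain a b where a: "\<forall>y\<in>Y. a y \<in> Rn" "b \<in> Rn" "q = (\<Sum>y\<in>Y. a y * h y) + b * f"
    unfolding combinations_def by blast
  have "q \<in> Rn" using ideal.Icarr[OF combinations_ideal[OF h] q(1)] by simp
  then obtain x where x: "x \<in> Rn" "p - q = x * f" using cls_eq_iff[OF p(1)] q(2) by blast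
  have "p = (\<Sum>y\<in>Y. a y * h y) + (b + x) * f" using x(2) a(3) by (simp add: algebra_simps)
  also have "\<dots> \<in> combinations Y h" using a x by (intro combinationsI polys_in_add) auto
  finally show ?thesis .
qed

lemma poly_prime_vimage:
  assumes "primeideal P A"
  shows "poly_prime {..<n} {p \<in> Rn. cls p \<in> P}"
proof -
  interpret P: primeideal "{p \<in> Rn. cls p \<in> P}" PR
    using cls.primeideal_vimage[OF PR.is_cring assms] by simp
  show ?thesis unfolding poly_prime_def
  proof (intro conjI prime_in_subring.intro)
    show "1 \<notin> {p \<in> Rn. cls p \<in> P}" using P.one_imp_carrier P.I_notcarr by (auto simp only: PR_simps)
    show "0 \<in> {p \<in> Rn. cls p \<in> P}" using P.zero_closed by simp
    show "x + y \<in> {p \<in> Rn. cls p \<in> P}" if "x \<in> {p \<in> Rn. cls p \<in> P}" "y \<in> {p \<in> Rn. cls p \<in> P}" for x y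
      using P.a_closed[OF that] by simp
    show "x * y \<in> {p \<in> Rn. cls p \<in> P}" if "x \<in> Rn" "y \<in> {p \<in> Rn. cls p \<in> P}" for x y
      using P.I_l_closed[OF that(2), of x] that(1) by simp
    show "x \<in> {p \<in> Rn. cls p \<in> P} \<or> y \<in> {p \<in> Rn. cls p \<in> P}"
      if "x \<in> Rn" "y \<in> Rn" "x * y \<in> {p \<in> Rn. cls p \<in> P}" for x y
      using P.I_prime[of x y] that by simp
  qed (auto intro: polys_in_add polys_in_uminus polys_in_mult)
qed

text \<open>The result is kept as an identity of polynomials, sum g_j (d_j f) + b f = 1; the
  coefficient b reappears in \<open>tangent_f\<close>.\<close>

lemma unit_gradient:
  assumes reg: "regular_spec A" and f0: "f \<noteq> 0"
  shows "1 \<in> combinations {..<n} (\<lambda>j. pd j f)"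
proof (rule ccontr)
  let ?W = "combinations {..<n} (\<lambda>j. pd j f)"
  have pdf: "pd j f \<in> Rn" for j by (rule pd_polys_in[OF f_mem])
  assume not1: "1 \<notin> ?W"
  have "\<one>\<^bsub>A\<^esub> \<notin> cls ` ?W"
    using not1 cls_in_combinations[of 1 "{..<n}" "\<lambda>j. pd j f"] pdf by (auto simp: cls_one)
  \<comment> \<open>The maximal ideal is taken in A. Its preimage is the \<open>Q\<close> of
    \<open>jacobian_criterion\<close> and contains f together with all partial derivatives.\<close>
  then obtain m where m: "maximalideal m A" "cls ` ?W \<subseteq> m"
    using A.exists_maximalideal[OF cls_image_ideal[OF combinations_ideal[of "{..<n}" "\<lambda>j. pd j f"]]] pdf by blast
  have mp: "primeideal m A" by (rule A.maximalideal_prime[OF m(1)])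
  interpret m: primeideal m A by (rule mp)
  have regL: "regular_local_ring (localization A (carrier A - m))"
    using reg mp unfolding regular_spec_def by blast
  interpret loc: prime_localization A m "carrier A - m" "localization A (carrier A - m)"
    using regL A.is_cring mp
    by (intro prime_localization.intro prime_localization_axioms.intro) (simp_all add: regular_local_ring_def)
  obtain d P Y where P: "\<forall>i\<le>d. primeideal (P i) A \<and> P i \<subseteq> m" "\<forall>i<d. P i \<subset> P (Suc i)"
    and Y: "Y \<subseteq> m" "finite Y" "card Y \<le> (d::nat)" and gen: "\<forall>x\<in>m. \<exists>u\<in>carrier A - m. u \<otimes>\<^bsub>A\<^esub> x \<in> Idl\<^bsub>A\<^esub> Y"
    using loc.regular_chain_generators[OF regL] by blast
  define pre where "pre I = {p \<in> Rn. cls p \<in> I}" for I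
  have "\<forall>y\<in>Y. \<exists>p. p \<in> Rn \<and> cls p = y" using Y(1) m.Icarr by (auto simp: A_carrier)
  \<comment> \<open>Lifts of the local generators to polynomials; lifting is unique up to multiples
    of f, which \<open>combinations\<close> absorbs.\<close>
  from bchoice[OF this] obtain rep where rep: "\<forall>y\<in>Y. rep y \<in> Rn \<and> cls (rep y) = y" ..
  have YA: "Y \<subseteq> carrier A" using Y(1) m.Icarr by blast
  let ?Y = "rep ` Y"
  have YR: "y \<in> Rn" if "y \<in> ?Y" for y using rep that by blast
  have Wi: "ideal (cls ` combinations ?Y id) A"
    by (rule cls_image_ideal[OF combinations_ideal]) (use YR in simp)
  have "Y \<subseteq> cls ` combinations ?Y id"
  proof
    fix y assume y: "y \<in> Y"
    have "rep y \<in> combinations ?Y id" using combinations_gen[of ?Y "rep y" id] Y(2) y by simp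
    hence "cls (rep y) \<in> cls ` combinations ?Y id" by (rule imageI)
    moreover have "cls (rep y) = y" using rep y by blast
    ultimately show "y \<in> cls ` combinations ?Y id" by simp
  qed
  hence sub: "Idl\<^bsub>A\<^esub> Y \<subseteq> cls ` combinations ?Y id" by (rule A.genideal_minimal[OF Wi])
  show False
  proof (rule jacobian_criterion[of "{..<n}" "pre m" f "\<lambda>i. pre (P i)" d ?Y])
    show "poly_prime {..<n} (pre m)" unfolding pre_def by (rule poly_prime_vimage[OF mp])
    show "poly_prime {..<n} (pre (P i))" if "i \<le> d" for i
      unfolding pre_def using P(1) that by (intro poly_prime_vimage) blast
    show "f \<in> pre (P 0)"
    proof -
      have "ideal (P 0) A" using P(1) by (auto simp: primeideal_def)
      hence "\<zero>\<^bsub>A\<^esub> \<in> P 0" by (intro additive_subgroup.zero_closed ideal.axioms(1))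
      thus ?thesis using f_mem by (simp add: pre_def cls_f)
    qed
    show "pd j f \<in> pre m" if "j \<in> {..<n}" for j
    proof -
      have "pd j f \<in> ?W" by (rule combinations_gen) (use that in auto)
      thus ?thesis using m(2) pdf by (auto simp: pre_def)
    qed
    show "pre (P i) \<subset> pre (P (Suc i))" if i: "i < d" for i
    proof -
      have lt: "P i \<subset> P (Suc i)" using P(2) i by blast
      then obtain X where X: "X \<in> P (Suc i)" "X \<notin> P i" by blast
      have "ideal (P (Suc i)) A" using P(1) i by (auto simp: primeideal_def)
      hence "X \<in> carrier A" using X(1) by (rule ideal.Icarr)
      then obtain p where "p \<in> Rn" "X = cls p" by (auto simp: A_carrier)
      thus ?thesis using lt X by (auto simp: pre_def)
    qed
    show "pre (P d) \<subseteq> pre m" using P(1) by (auto simp: pre_def)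
    show "?Y \<subseteq> pre m" using rep Y(1) by (auto simp: pre_def)
    show "card ?Y \<le> d" using card_image_le[OF Y(2), of rep] Y(3) by simp
    fix p assume p: "p \<in> pre m"
    then obtain u where u: "u \<in> carrier A - m" "u \<otimes>\<^bsub>A\<^esub> cls p \<in> Idl\<^bsub>A\<^esub> Y" using gen by (auto simp: pre_def)
    then obtain u0 where u0: "u0 \<in> Rn" "u = cls u0" by (auto simp: A_carrier)
    have pR: "p \<in> Rn" using p by (simp add: pre_def)
    have "cls (u0 * p) \<in> cls ` combinations ?Y id" using u(2) sub u0 pR by (auto simp: cls_mult)
    hence "u0 * p \<in> combinations ?Y id"
      using cls_in_combinations[of "u0 * p" ?Y id] YR u0 pR by (simp add: polys_in_mult)
    moreover have "u0 \<in> Rn - pre m" using u u0 by (simp add: pre_def)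
    ultimately show "\<exists>u\<in>Rn - pre m. \<exists>a. (\<forall>y\<in>?Y. a y \<in> Rn) \<and> (\<exists>b\<in>Rn. u * p = (\<Sum>y\<in>?Y. a y * y) + b * f)"
      unfolding combinations_def id_def by blast
  qed (use f0 Y in auto)
qed

subsection \<open>Derivations\<close>

sublocale kalgebra A sc
proof
  show "sc c \<in> carrier A" for c by (simp add: sc_eq)
  have "mpoly_const (c + c') = mpoly_const c + (mpoly_const c' :: 'k mpoly)" for c c'
    by (simp add: mpoly_const_def single_add)
  thus "sc (c + c') = sc c \<oplus>\<^bsub>A\<^esub> sc c'" for c c' by (simp add: sc_eq cls_add)
  have "mpoly_const (c * c') = mpoly_const c * (mpoly_const c' :: 'k mpoly)" for c c'
    by (simp add: mpoly_const_def mult_single)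
  thus "sc (c * c') = sc c \<otimes>\<^bsub>A\<^esub> sc c'" for c c' by (simp add: sc_eq cls_mult)
  have "mpoly_const 1 = (1 :: 'k mpoly)" by (simp add: mpoly_const_def)
  thus "sc 1 = \<one>\<^bsub>A\<^esub>" by (simp add: sc_eq cls_one)
qed

text \<open>Stated for a derivation into any module, since it is applied to the universal derivation
  and to derivations of A. For the class of f it yields the relation sum (d_l f) dx_l = 0.\<close>

lemma chain_rule:
  assumes M: "module A M" and d: "\<And>a. a \<in> carrier A \<Longrightarrow> d a \<in> carrier M"
    and d_add: "\<And>a b. a \<in> carrier A \<Longrightarrow> b \<in> carrier A \<Longrightarrow> d (a \<oplus>\<^bsub>A\<^esub> b) = d a \<oplus>\<^bsub>M\<^esub> d b"
    and d_mult: "\<And>a b. a \<in> carrier A \<Longrightarrow> b \<in> carrier A \<Longrightarrow> d (a \<otimes>\<^bsub>A\<^esub> b) = a \<odot>\<^bsub>M\<^esub> d b \<oplus>\<^bsub>M\<^esub> b \<odot>\<^bsub>M\<^esub> d a"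
    and d_scalar: "\<And>c. d (sc c) = \<zero>\<^bsub>M\<^esub>"
    and p: "p \<in> Rn"
  shows "d (cls p) = (\<Oplus>\<^bsub>M\<^esub> l\<in>{..<n}. cls (pd l p) \<odot>\<^bsub>M\<^esub> d (cls (var l)))"
proof -
  interpret M: module A M by (rule M)
  have v: "var l \<in> Rn" if "l < n" for l using that by (simp add: polys_in_var)
  have dv: "d (cls (var l)) \<in> carrier M" if "l < n" for l using that v d by simp
  show ?thesis using p
  proof (induction p rule: polys_in_induct)
    case (const c)
    have "(\<Oplus>\<^bsub>M\<^esub> l\<in>{..<n}. cls (pd l (mpoly_const c)) \<odot>\<^bsub>M\<^esub> d (cls (var l))) = (\<Oplus>\<^bsub>M\<^esub> l\<in>{..<n}. \<zero>\<^bsub>M\<^esub>)"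
      using dv by (intro M.M.finsum_cong') (auto simp: cls_zero)
    thus ?case using d_scalar[of c] by (simp add: sc_eq)
  next
    case (var j q)
    have q: "cls q \<in> carrier A" "cls (pd l q) \<in> carrier A" for l using var pd_polys_in by auto
    have j: "j < n" using var by simp
    have t: "cls (pd l (var j * q)) \<odot>\<^bsub>M\<^esub> d (cls (var l)) = cls (var j) \<odot>\<^bsub>M\<^esub> (cls (pd l q) \<odot>\<^bsub>M\<^esub> d (cls (var l))) \<oplus>\<^bsub>M\<^esub>
        (if j = l then cls q \<odot>\<^bsub>M\<^esub> d (cls (var l)) else \<zero>\<^bsub>M\<^esub>)" if l: "l < n" for l
    proof -
      have "cls (pd l (var j * q)) = cls (var j) \<otimes>\<^bsub>A\<^esub> cls (pd l q) \<oplus>\<^bsub>A\<^esub> (if j = l then cls q else \<zero>\<^bsub>A\<^esub>)"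
        using v[OF j] var(2) pd_polys_in[OF var(2)]
        by (simp add: pd_mult pd_var cls_add cls_mult cls_zero cls_one polys_in_mult)
      thus ?thesis using v[OF j] q dv[OF l] by (simp add: M.smult_l_distr M.smult_assoc1)
    qed
    have "(\<Oplus>\<^bsub>M\<^esub> l\<in>{..<n}. cls (pd l (var j * q)) \<odot>\<^bsub>M\<^esub> d (cls (var l))) =
        (\<Oplus>\<^bsub>M\<^esub> l\<in>{..<n}. cls (var j) \<odot>\<^bsub>M\<^esub> (cls (pd l q) \<odot>\<^bsub>M\<^esub> d (cls (var l))) \<oplus>\<^bsub>M\<^esub>
          (if j = l then cls q \<odot>\<^bsub>M\<^esub> d (cls (var l)) else \<zero>\<^bsub>M\<^esub>))"
      using t v[OF j] q dv by (intro M.M.finsum_cong') auto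
    also have "\<dots> = (\<Oplus>\<^bsub>M\<^esub> l\<in>{..<n}. cls (var j) \<odot>\<^bsub>M\<^esub> (cls (pd l q) \<odot>\<^bsub>M\<^esub> d (cls (var l)))) \<oplus>\<^bsub>M\<^esub>
          (\<Oplus>\<^bsub>M\<^esub> l\<in>{..<n}. if j = l then cls q \<odot>\<^bsub>M\<^esub> d (cls (var l)) else \<zero>\<^bsub>M\<^esub>)"
      using v[OF j] q dv by (intro M.M.finsum_addf) auto
    also have "(\<Oplus>\<^bsub>M\<^esub> l\<in>{..<n}. if j = l then cls q \<odot>\<^bsub>M\<^esub> d (cls (var l)) else \<zero>\<^bsub>M\<^esub>) = cls q \<odot>\<^bsub>M\<^esub> d (cls (var j))"
      using j q dv by (intro M.M.finsum_singleton) auto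
    also have "(\<Oplus>\<^bsub>M\<^esub> l\<in>{..<n}. cls (var j) \<odot>\<^bsub>M\<^esub> (cls (pd l q) \<odot>\<^bsub>M\<^esub> d (cls (var l)))) = cls (var j) \<odot>\<^bsub>M\<^esub> d (cls q)"
      unfolding var(3) using v[OF j] q dv by (intro M.finsum_smult_ldistr[symmetric]) auto
    finally show ?case using v[OF j] var(2) by (simp add: cls_mult d_mult)
  next
    case (add q r)
    have c: "cls (pd l q) \<in> carrier A" "cls (pd l r) \<in> carrier A" for l using add pd_polys_in by auto
    have "(\<Oplus>\<^bsub>M\<^esub> l\<in>{..<n}. cls (pd l (q + r)) \<odot>\<^bsub>M\<^esub> d (cls (var l))) =
        (\<Oplus>\<^bsub>M\<^esub> l\<in>{..<n}. cls (pd l q) \<odot>\<^bsub>M\<^esub> d (cls (var l)) \<oplus>\<^bsub>M\<^esub> cls (pd l r) \<odot>\<^bsub>M\<^esub> d (cls (var l)))"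
      using c dv add(1,2)
      by (intro M.M.finsum_cong') (auto simp: pd_add cls_add pd_polys_in M.smult_l_distr)
    also have "\<dots> = d (cls q) \<oplus>\<^bsub>M\<^esub> d (cls r)"
      unfolding add(3,4) using c dv by (intro M.M.finsum_addf) auto
    finally show ?case using add(1,2) by (simp add: cls_add d_add)
  qed
qed

end

text \<open>
  The derivation \<open>tangent l\<close> is the projection of \<open>\<partial>\<^sub>l\<close> along \<open>\<Sum> g\<^sub>j \<partial>\<^sub>j\<close> onto the derivations which preserve
  the ideal \<open>(f)\<close>.
\<close>

locale hypersurface_gradient = hypersurface n f for n and f :: "'k::field_char_0 mpoly" +
  fixes g :: "nat \<Rightarrow> 'k mpoly" and b :: "'k mpoly"
  assumes g_mem: "j < n \<Longrightarrow> g j \<in> polys_in {..<n}" and b_mem: "b \<in> polys_in {..<n}"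
    and gradient: "(\<Sum>j<n. g j * pd j f) + b * f = 1"
begin

definition along :: "'k mpoly \<Rightarrow> 'k mpoly" where
  "along p = (\<Sum>j<n. g j * pd j p)"

definition tangent :: "nat \<Rightarrow> 'k mpoly \<Rightarrow> 'k mpoly" where
  "tangent l p = pd l p - along p * pd l f"

lemma along_closed: "p \<in> Rn \<Longrightarrow> along p \<in> Rn"
  unfolding along_def by (auto intro!: polys_in_sum polys_in_mult g_mem pd_polys_in)

lemma tangent_closed: "p \<in> Rn \<Longrightarrow> tangent l p \<in> Rn"
  unfolding tangent_def by (intro polys_in_diff polys_in_mult along_closed pd_polys_in f_mem)

lemma tangent_add: "tangent l (p + q) = tangent l p + tangent l q"
  by (simp add: tangent_def along_def pd_add algebra_simps sum.distrib)

lemma along_mult: "along (p * q) = p * along q + q * along p"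
  by (simp add: along_def pd_mult algebra_simps sum.distrib sum_distrib_left)

lemma tangent_mult: "tangent l (p * q) = p * tangent l q + q * tangent l p"
  by (simp add: tangent_def along_mult pd_mult algebra_simps)

text \<open>Modulo f the field \<open>along\<close> takes f to 1, so subtracting
  \<open>along f * pd l f\<close> leaves a multiple of f. This makes \<open>tangent l\<close>
  descend to the quotient.\<close>

lemma tangent_f: "tangent l f = (b * pd l f) * f"
proof -
  have "along f = 1 - b * f" using gradient by (simp add: along_def eq_diff_eq)
  thus ?thesis unfolding tangent_def by (simp only:) (simp add: algebra_simps)
qed

lemma tangent_cong:
  assumes "p \<in> Rn" "q \<in> Rn" "cls p = cls q"
  shows "cls (tangent l p) = cls (tangent l q)"
proof -
  obtain x where x: "x \<in> Rn" "p - q = x * f" using assms cls_eq_iff by blast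
  have "tangent l (p - q) = tangent l p - tangent l q"
    using tangent_add[of l "p - q" q] by (simp add: algebra_simps)
  hence "tangent l p - tangent l q = (x * (b * pd l f) + tangent l x) * f"
    unfolding x(2) by (simp add: tangent_mult tangent_f algebra_simps)
  moreover have "x * (b * pd l f) + tangent l x \<in> Rn"
    using x b_mem f_mem by (intro polys_in_add polys_in_mult tangent_closed pd_polys_in)
  ultimately show ?thesis using assms(1,2) by (subst cls_eq_iff) (auto intro: tangent_closed)
qed

text \<open>Computed on a chosen representative; \<open>tangent_cong\<close> makes the choice
  immaterial.\<close>

definition \<delta> :: "nat \<Rightarrow> 'k mpoly set \<Rightarrow> 'k mpoly set" where
  "\<delta> l X = cls (tangent l (SOME p. p \<in> Rn \<and> cls p = X))"

lemma \<delta>_cls: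
  assumes "p \<in> Rn"
  shows "\<delta> l (cls p) = cls (tangent l p)"
proof -
  have "(SOME q. q \<in> Rn \<and> cls q = cls p) \<in> Rn \<and> cls (SOME q. q \<in> Rn \<and> cls q = cls p) = cls p"
    by (rule someI[of _ p]) (simp add: assms)
  thus ?thesis unfolding \<delta>_def using assms by (intro tangent_cong) auto
qed

text \<open>Passing from partial derivatives to \<open>tangent l\<close> changes the chain rule by
  the class of \<open>along p\<close> times the differential of the class of f, which is
  zero.\<close>

lemma tangent_expand:
  assumes M: "module A M" and d: "\<And>a. a \<in> carrier A \<Longrightarrow> d a \<in> carrier M"
    and d_add: "\<And>a b. a \<in> carrier A \<Longrightarrow> b \<in> carrier A \<Longrightarrow> d (a \<oplus>\<^bsub>A\<^esub> b) = d a \<oplus>\<^bsub>M\<^esub> d b"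
    and d_mult: "\<And>a b. a \<in> carrier A \<Longrightarrow> b \<in> carrier A \<Longrightarrow> d (a \<otimes>\<^bsub>A\<^esub> b) = a \<odot>\<^bsub>M\<^esub> d b \<oplus>\<^bsub>M\<^esub> b \<odot>\<^bsub>M\<^esub> d a"
    and d_scalar: "\<And>c. d (sc c) = \<zero>\<^bsub>M\<^esub>"
    and a: "a \<in> carrier A"
  shows "d a = (\<Oplus>\<^bsub>M\<^esub> l\<in>{..<n}. \<delta> l a \<odot>\<^bsub>M\<^esub> d (cls (var l)))"
proof -
  interpret M: module A M by (rule M)
  have chain: "d (cls q) = (\<Oplus>\<^bsub>M\<^esub> l\<in>{..<n}. cls (pd l q) \<odot>\<^bsub>M\<^esub> d (cls (var l)))" if "q \<in> Rn" for q
    by (rule chain_rule[OF M]) (fact d d_add d_mult d_scalar that)+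
  obtain p where p: "p \<in> Rn" "a = cls p" using a by (auto simp: A_carrier)
  have dv: "d (cls (var l)) \<in> carrier M" if "l < n" for l using that d by (simp add: polys_in_var)
  have c: "cls (tangent l p) \<in> carrier A" "cls (along p) \<in> carrier A" "cls (pd l f) \<in> carrier A" for l
    using p f_mem by (auto intro: tangent_closed along_closed pd_polys_in)
  have "cls (pd l p) = cls (tangent l p) \<oplus>\<^bsub>A\<^esub> cls (along p) \<otimes>\<^bsub>A\<^esub> cls (pd l f)" for l
  proof -
    have "pd l p = tangent l p + along p * pd l f" by (simp add: tangent_def)
    thus ?thesis using tangent_closed[OF p(1)] along_closed[OF p(1)] pd_polys_in[OF f_mem]
      by (simp add: cls_add cls_mult polys_in_mult)
  qed
  hence t: "cls (pd l p) \<odot>\<^bsub>M\<^esub> d (cls (var l)) =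
      cls (tangent l p) \<odot>\<^bsub>M\<^esub> d (cls (var l)) \<oplus>\<^bsub>M\<^esub> cls (along p) \<odot>\<^bsub>M\<^esub> (cls (pd l f) \<odot>\<^bsub>M\<^esub> d (cls (var l)))"
    if "l < n" for l
    using that c dv by (simp add: M.smult_l_distr M.smult_assoc1)
  have "(\<Oplus>\<^bsub>M\<^esub> l\<in>{..<n}. cls (pd l f) \<odot>\<^bsub>M\<^esub> d (cls (var l))) = \<zero>\<^bsub>M\<^esub>"
    using chain[OF f_mem] d_scalar[of 0] by (simp add: cls_f sc_eq mpoly_const_def cls_zero)
  hence z: "(\<Oplus>\<^bsub>M\<^esub> l\<in>{..<n}. cls (along p) \<odot>\<^bsub>M\<^esub> (cls (pd l f) \<odot>\<^bsub>M\<^esub> d (cls (var l)))) = \<zero>\<^bsub>M\<^esub>"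
    using M.finsum_smult_ldistr[of "{..<n}" "cls (along p)" "\<lambda>l. cls (pd l f) \<odot>\<^bsub>M\<^esub> d (cls (var l))"] c dv by auto
  have "d a = (\<Oplus>\<^bsub>M\<^esub> l\<in>{..<n}. cls (tangent l p) \<odot>\<^bsub>M\<^esub> d (cls (var l)) \<oplus>\<^bsub>M\<^esub>
      cls (along p) \<odot>\<^bsub>M\<^esub> (cls (pd l f) \<odot>\<^bsub>M\<^esub> d (cls (var l))))"
    unfolding p(2) chain[OF p(1)] using t c dv by (intro M.M.finsum_cong') auto
  also have "\<dots> = (\<Oplus>\<^bsub>M\<^esub> l\<in>{..<n}. cls (tangent l p) \<odot>\<^bsub>M\<^esub> d (cls (var l))) \<oplus>\<^bsub>M\<^esub> \<zero>\<^bsub>M\<^esub>"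
    unfolding z[symmetric] using c dv by (intro M.M.finsum_addf) auto
  also have "\<dots> = (\<Oplus>\<^bsub>M\<^esub> l\<in>{..<n}. cls (tangent l p) \<odot>\<^bsub>M\<^esub> d (cls (var l)))"
    using c dv by (intro M.M.r_zero M.M.finsum_closed) auto
  finally show ?thesis unfolding p(2) \<delta>_cls[OF p(1)] .
qed

lemma frame:
  assumes n: "n > 0"
  shows "derivation_frame A sc n (\<lambda>l. cls (var l)) (\<lambda>l. cls (pd l f)) (\<lambda>l. cls (g l)) \<delta>"
proof (intro derivation_frame.intro derivation_frame_axioms.intro)
  have pdf: "pd l f \<in> Rn" for l by (rule pd_polys_in[OF f_mem])
  show "kalgebra A sc" by (rule kalgebra_axioms)
  show "(\<Oplus>\<^bsub>A\<^esub> l\<in>{..<n}. cls (pd l f) \<otimes>\<^bsub>A\<^esub> cls (g l)) = \<one>\<^bsub>A\<^esub>"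
  proof -
    have "(\<Oplus>\<^bsub>A\<^esub> l\<in>{..<n}. cls (pd l f) \<otimes>\<^bsub>A\<^esub> cls (g l)) = (\<Oplus>\<^bsub>A\<^esub> l\<in>{..<n}. cls (g l * pd l f))"
      using pdf g_mem by (intro A.finsum_cong') (auto simp: cls_mult A.m_comm)
    also have "\<dots> = cls (\<Sum>l<n. g l * pd l f)"
      using pdf g_mem by (intro cls_sum[symmetric]) (auto intro: polys_in_mult)
    also have "\<dots> = cls 1"
    proof (subst cls_eq_iff)
      show "(\<Sum>l<n. g l * pd l f) \<in> Rn" using pdf g_mem by (auto intro!: polys_in_sum polys_in_mult)
      show "\<exists>x\<in>Rn. (\<Sum>l<n. g l * pd l f) - 1 = x * f"
        using gradient b_mem by (intro bexI[of _ "- b"]) (auto simp: algebra_simps intro: polys_in_uminus)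
    qed simp
    finally show ?thesis by (simp add: cls_one)
  qed
  fix l assume l: "l < n"
  show "addmap A A (\<delta> l)"
  proof (rule addmapI)
    fix a a' assume a: "a \<in> carrier A" "a' \<in> carrier A"
    obtain p q where p: "p \<in> Rn" "a = cls p" "q \<in> Rn" "a' = cls q" using a by (auto simp: A_carrier)
    show "\<delta> l a \<in> carrier A" using p by (simp add: \<delta>_cls tangent_closed)
    have "\<delta> l (a \<oplus>\<^bsub>A\<^esub> a') = cls (tangent l p + tangent l q)"
      using p by (simp add: cls_add[symmetric] \<delta>_cls polys_in_add tangent_add)
    thus "\<delta> l (a \<oplus>\<^bsub>A\<^esub> a') = \<delta> l a \<oplus>\<^bsub>A\<^esub> \<delta> l a'" using p by (simp add: \<delta>_cls tangent_closed cls_add)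
  qed
  show "\<delta> l (sc c) = \<zero>\<^bsub>A\<^esub>" for c
    by (simp add: sc_eq \<delta>_cls tangent_def along_def cls_zero)
  show "\<delta> l (a \<otimes>\<^bsub>A\<^esub> a') = a \<otimes>\<^bsub>A\<^esub> \<delta> l a' \<oplus>\<^bsub>A\<^esub> a' \<otimes>\<^bsub>A\<^esub> \<delta> l a"
    if a: "a \<in> carrier A" "a' \<in> carrier A" for a a'
  proof -
    obtain p q where p: "p \<in> Rn" "a = cls p" "q \<in> Rn" "a' = cls q" using a by (auto simp: A_carrier)
    have "\<delta> l (a \<otimes>\<^bsub>A\<^esub> a') = cls (p * tangent l q + q * tangent l p)"
      using p by (simp add: cls_mult[symmetric] \<delta>_cls polys_in_mult tangent_mult)
    thus ?thesis using p by (simp add: \<delta>_cls tangent_closed cls_add cls_mult polys_in_mult)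
  qed
  show "\<delta> l (cls (var j)) = (if l = j then \<one>\<^bsub>A\<^esub> else \<zero>\<^bsub>A\<^esub>) \<ominus>\<^bsub>A\<^esub> cls (pd l f) \<otimes>\<^bsub>A\<^esub> cls (g j)" if j: "j < n" for j
  proof -
    \<comment> \<open>\<open>along\<close> takes x_j to g_j, and this produces the projection matrix
      with entries delta_lj - (d_l f) g_j.\<close>
    have "along (var j) = (\<Sum>i<n. if i = j then g i else 0)"
      unfolding along_def by (rule sum.cong) (auto simp: pd_var)
    hence "along (var j) = g j" using j by simp
    hence "tangent l (var j) = (if l = j then 1 else 0) - pd l f * g j"
      by (simp add: tangent_def pd_var mult.commute)
    thus ?thesis using pdf g_mem[OF j] j
      by (simp add: \<delta>_cls polys_in_var cls_diff cls_mult polys_in_mult cls_one cls_zero)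
  qed
next
  fix a assume a: "a \<in> carrier A"
  show "dK a = (\<Oplus>\<^bsub>\<Omega>\<^esub> l\<in>{..<n}. \<delta> l a \<odot>\<^bsub>\<Omega>\<^esub> dK (cls (var l)))"
    by (rule tangent_expand[OF \<Omega>.module_axioms]) (auto simp: dK_add dK_mult dK_scalar a)
  fix D assume D: "D \<in> carrier (derivations A sc)"
  \<comment> \<open>The product rule at 1 times 1 gives D 1 = D 1 + D 1; k-linearity then makes D
    vanish on all constants.\<close>
  have D1: "D \<one>\<^bsub>A\<^esub> = \<zero>\<^bsub>A\<^esub>"
  proof -
    have c: "D \<one>\<^bsub>A\<^esub> \<in> carrier A" by (rule TD(1)[OF D A.one_closed])
    hence "D \<one>\<^bsub>A\<^esub> \<oplus>\<^bsub>A\<^esub> D \<one>\<^bsub>A\<^esub> = D \<one>\<^bsub>A\<^esub>" using TD(4)[OF D A.one_closed A.one_closed] by simp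
    thus ?thesis using c by (metis A.add.l_cancel_one)
  qed
  have Ds: "D (sc c) = \<zero>\<^bsub>A\<^esub>" for c
  proof -
    have "D (sc c \<otimes>\<^bsub>A\<^esub> \<one>\<^bsub>A\<^esub>) = sc c \<otimes>\<^bsub>A\<^esub> D \<one>\<^bsub>A\<^esub>" by (rule TD(3)[OF D A.one_closed])
    thus ?thesis using D1 by simp
  qed
  obtain p where p: "p \<in> Rn" "a = cls p" using a by (auto simp: A_carrier)
  have \<delta>a: "\<delta> l a \<in> carrier A" for l using p by (simp add: \<delta>_cls tangent_closed)
  have Dv: "D (cls (var l)) \<in> carrier A" if "l < n" for l
    using that by (intro TD(1)[OF D]) (simp add: polys_in_var)
  have rm: "module A (ring_module A)"
    by (rule A.ring_module_module)
  have "D a = (\<Oplus>\<^bsub>ring_module A\<^esub> l\<in>{..<n}. \<delta> l a \<odot>\<^bsub>ring_module A\<^esub> D (cls (var l)))"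
    by (rule tangent_expand[OF rm]) (auto simp: ring_module_def TD(1,2)[OF D] TD(4)[OF D] Ds a)
  \<comment> \<open>Sums over the ring regarded as a module are turned into sums in the ring by the
    identity, viewed as an additive map.\<close>
  also have "\<dots> = (\<Oplus>\<^bsub>A\<^esub> l\<in>{..<n}. \<delta> l a \<odot>\<^bsub>ring_module A\<^esub> D (cls (var l)))"
  proof (rule addmap_finsum[where h = "\<lambda>x. x"])
    show "abelian_group (ring_module A)" using rm by (simp add: module_def)
    show "(\<lambda>l. \<delta> l a \<odot>\<^bsub>ring_module A\<^esub> D (cls (var l))) \<in> {..<n} \<rightarrow> carrier (ring_module A)"
      using \<delta>a Dv by (auto simp: ring_module_def)
  qed (auto simp: addmap_def ring_module_def A.abelian_group_axioms)
  also have "\<dots> = (\<Oplus>\<^bsub>A\<^esub> l\<in>{..<n}. D (cls (var l)) \<otimes>\<^bsub>A\<^esub> \<delta> l a)"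
    using \<delta>a Dv by (intro A.finsum_cong') (simp_all add: Pi_def ring_module_def A.m_comm)
  finally show "D a = (\<Oplus>\<^bsub>A\<^esub> l\<in>{..<n}. D (cls (var l)) \<otimes>\<^bsub>A\<^esub> \<delta> l a)" .
qed (use n g_mem f_mem in \<open>auto intro: polys_in_var pd_polys_in\<close>)

end

section \<open>Regular hypersurfaces over a field of characteristic zero\<close>

theorem hypersurface_chern_character_zero:
  fixes f :: "'k::field_char_0 mpoly"
  assumes f: "f \<in> carrier (poly_ring n)" "f \<notin> range mpoly_const"
    and reg: "regular_spec (hypersurface_ring n f)" and i: "i \<ge> 1"
  defines "A \<equiv> hypersurface_ring n f" and "s \<equiv> hypersurface_scalar n f"
  shows "chern_character A s (kahler A s) i = \<zero>\<^bsub>deRham_cohomology A s (2 * i)\<^esub>"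
    and "chern_character A s (derivations A s) i = \<zero>\<^bsub>deRham_cohomology A s (2 * i)\<^esub>"
proof -
  interpret H: hypersurface n f by unfold_locales (use f in \<open>simp add: poly_ring_def polys_in_def\<close>)
  \<comment> \<open>Without variables every polynomial is constant, so non-constancy provides the
    index 0 at which the complement is stored.\<close>
  have n: "n > 0"
  proof (rule ccontr)
    assume "\<not> n > 0"
    hence "f = mpoly_const (plookup f 0)" using polys_in_empty[of f] H.f_mem by simp
    thus False using f(2) by blast
  qed
  \<comment> \<open>Zero is a constant too; a nonzero f is what the Jacobian argument
    requires.\<close>
  have "f \<noteq> 0" using f(2) rangeI[of mpoly_const "0 :: 'k"] by (auto simp: mpoly_const_def)
  from H.unit_gradient[OF reg this] obtain g b where gb: "\<forall>j\<in>{..<n}. g j \<in> polys_in {..<n}" "b \<in> polys_in {..<n}"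
    "1 = (\<Sum>j<n. g j * pd j f) + b * f" unfolding H.combinations_def by blast
  interpret G: hypersurface_gradient n f g b by unfold_locales (use gb in auto)
  interpret F: derivation_frame A s n "\<lambda>l. H.cls (var l)" "\<lambda>l. H.cls (pd l f)" "\<lambda>l. H.cls (g l)" G.\<delta>
    unfolding A_def s_def by (rule G.frame[OF n])
  show "chern_character A s (kahler A s) i = \<zero>\<^bsub>deRham_cohomology A s (2 * i)\<^esub>"
    by (rule stably_trivial.chern_character_zero[OF F.kahler_stably_trivial i])
  show "chern_character A s (derivations A s) i = \<zero>\<^bsub>deRham_cohomology A s (2 * i)\<^esub>"
    by (rule stably_trivial.chern_character_zero[OF F.derivations_stably_trivial i])
qed

text \<open>The reals and the complex numbers both have characteristic zero, so the two halves are
  instances of the preceding theorem.\<close>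

theorem lemma4p4:
  fixes n :: nat and f :: "real mpoly" and g :: "complex mpoly"
  shows
    "(f \<in> carrier (poly_ring n) \<and> f \<notin> range mpoly_const \<and>
        regular_spec (hypersurface_ring n f) \<longrightarrow>
      (let A = hypersurface_ring n f; s = hypersurface_scalar n f in
        \<forall>i\<ge>1.
          chern_character A s (kahler A s) i = \<zero>\<^bsub>deRham_cohomology A s (2 * i)\<^esub> \<and>
          chern_character A s (derivations A s) i = \<zero>\<^bsub>deRham_cohomology A s (2 * i)\<^esub>)) \<and>
     (g \<in> carrier (poly_ring n) \<and> g \<notin> range mpoly_const \<and>
        regular_spec (hypersurface_ring n g) \<longrightarrow>
      (let A = hypersurface_ring n g; s = hypersurface_scalar n g in
        \<forall>i\<ge>1.
          chern_character A s (kahler A s) i = \<zero>\<^bsub>deRham_cohomology A s (2 * i)\<^esub> \<and>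
          chern_character A s (derivations A s) i = \<zero>\<^bsub>deRham_cohomology A s (2 * i)\<^esub>))"
  unfolding Let_def
  by (intro conjI impI allI) (elim conjE, erule (3) hypersurface_chern_character_zero)+

end
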